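(* Let $k$ be an algebraically closed field of characteristic zero, let $R=k[x_1,\ldots,x_n]$ with $n\ge3$, and let $J\subseteq R$ be a $d$-equigenerated strict almost complete intersection of height $2$ and homological dimension $2$. The following are equivalent: (a) $\deg(R/J)=d^2-d$; (b) $J$ has one of the following minimal graded free resolutions: $$0\to R(-2d-1)\to R(-d-1)\oplus R(-2d)^2\to R(-d)^3\to J\to0,$$ or $d=3$ and $$0\to R(-6)\to R(-5)^3\to R(-3)^3\to J\to0.$$ If either condition holds, then $\mathrm{Bour}(J)=1$.
   Context: A $d$-equigenerated strict almost complete intersection of height $2$ is an ideal $J=(f_1,f_2,f_3)$ with $\mathrm{ht}(J)=2$ minimally generated by three homogeneous forms of degree $d$ ($d\ge2$). Homological dimension $2$ means that $J$ has projective dimension $2$ as an $R$-module (equivalently $\mathrm{pd}_R(R/J)=3$); in particular $R/J$ is not Cohen--Macaulay. $\deg(R/J)$ is the multiplicity of $R/J$. Bourbaki degree: $\mathrm{Syz}(J)=\{(a_1,a_2,a_3)\in R^3:\sum a_if_i=0\}$ is graded as a submodule of $R^3$ (standard grading), $e=\mathrm{indeg}(\mathrm{Syz}(J))$ is the least degree of a nonzero homogeneous syzygy, and $\nu$ is a minimal generator of $\mathrm{Syz}(J)$ of degree $e$. Since $J$ is not perfect of height two, $\mathrm{Syz}(J)/R\nu$ is isomorphic, up to shift, to an unmixed homogeneous ideal $I_\nu\subseteq R$ of height $2$, and $\mathrm{Bour}(J)=\deg(R/I_\nu)$. This is independent of $\nu$, and $\mathrm{Bour}(J)=d^2-ed+e^2-\deg(R/J)$.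 *)

theory Defs
  imports
    "HOL-Library.Poly_Mapping"
    "HOL-Library.Extended_Nat"
    "HOL-Library.Cardinality"
    "HOL-Computational_Algebra.Polynomial"
begin

section \<open>Modules and polynomial rings\<close>

text \<open>
  For a commutative ring \<open>R\<close>, the type \<open>'i \<Rightarrow>\<^sub>0 R\<close> of finitely supported functions is the free
  \<open>R\<close>-module on \<open>'i\<close>.  It is used twice: for the \<open>k\<close>-vector space underlying
  \<open>k[x\<^sub>1,\<dots>,x\<^sub>n]\<close>, and for the free module \<open>nat \<Rightarrow>\<^sub>0 R\<close> of countable rank, which
  contains all modules considered below as submodules.
\<close>

definition pscale :: "'r::comm_ring_1 \<Rightarrow> ('i \<Rightarrow>\<^sub>0 'r) \<Rightarrow> ('i \<Rightarrow>\<^sub>0 'r)" where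
  "pscale c v = Poly_Mapping.map ((*) c) v"

lemma lookup_pscale: "Poly_Mapping.lookup (pscale c v) i = c * Poly_Mapping.lookup v i"
  unfolding pscale_def by transfer (simp add: when_def)

text \<open>The ring as a module over itself.  It is not globally interpreted, because the simp rule
  \<open>scale_scale\<close> would then undo \<open>mult.assoc\<close>.\<close>

lemma module_times: "module ((*) :: 'r::comm_ring_1 \<Rightarrow> 'r \<Rightarrow> 'r)"
  by (rule module.intro) (rule distrib_left distrib_right mult.assoc[symmetric] mult_1_left)+

abbreviation is_ideal :: "'r::comm_ring_1 set \<Rightarrow> bool" where
  "is_ideal I \<equiv> module.subspace (*) I"

abbreviation ideal_gen :: "'r::comm_ring_1 set \<Rightarrow> 'r set" where
  "ideal_gen S \<equiv> module.span (*) S"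

lemma pscale_module:
  shows "pscale a (x + y) = pscale a x + pscale a y"
    and "pscale (a + b) x = pscale a x + pscale b x"
    and "pscale a (pscale b x) = pscale (a * b) x"
    and "pscale 1 x = x"
  by (simp_all add: poly_mapping_eq_iff fun_eq_iff lookup_pscale lookup_add
      distrib_left distrib_right mult.assoc)

global_interpretation pmod: module "pscale :: 'r::comm_ring_1 \<Rightarrow> ('i \<Rightarrow>\<^sub>0 'r) \<Rightarrow> _"
  by unfold_locales (rule pscale_module)+

global_interpretation pvec: vector_space "pscale :: 'k::field \<Rightarrow> ('i \<Rightarrow>\<^sub>0 'k) \<Rightarrow> _"
  by unfold_locales (rule pscale_module)+

text \<open>\<open>k[x\<^sub>1,\<dots>,x\<^sub>n]\<close> is \<open>('n, 'k) mpol\<close> with \<open>n = CARD('n)\<close>.\<close>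

type_synonym ('n, 'k) mpol = "('n \<Rightarrow>\<^sub>0 nat) \<Rightarrow>\<^sub>0 'k"

definition mdeg :: "('n::finite \<Rightarrow>\<^sub>0 nat) \<Rightarrow> nat" where
  "mdeg m = (\<Sum>i\<in>UNIV. Poly_Mapping.lookup m i)"

text \<open>The degrees are integers so that shifted gradings can be formed freely;
  \<open>forms t = {0}\<close> for \<open>t < 0\<close>.\<close>

definition forms :: "int \<Rightarrow> ('n::finite, 'k::zero) mpol set" where
  "forms t = {p. \<forall>m\<in>Poly_Mapping.keys p. int (mdeg m) = t}"

definition irrelevant_ideal :: "('n::finite, 'k::zero) mpol set" where
  "irrelevant_ideal = {p. Poly_Mapping.lookup p 0 = 0}"

definition homogeneous_ideal :: "('n::finite, 'k::comm_ring_1) mpol set \<Rightarrow> bool" where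
  "homogeneous_ideal I \<longleftrightarrow> (\<exists>S. S \<subseteq> (\<Union>t. forms t) \<and> I = ideal_gen S)"


section \<open>Height and unmixedness\<close>

definition prime_ideal :: "'r::comm_ring_1 set \<Rightarrow> bool" where
  "prime_ideal P \<longleftrightarrow> is_ideal P \<and> 1 \<notin> P \<and> (\<forall>a b. a * b \<in> P \<longrightarrow> a \<in> P \<or> b \<in> P)"

definition prime_height :: "'r::comm_ring_1 set \<Rightarrow> enat" where
  "prime_height P = (SUP m \<in> {m. \<exists>Q. (\<forall>i\<le>m. prime_ideal (Q i)) \<and>
     (\<forall>i<m. Q i \<subset> Q (Suc i)) \<and> Q m = P}. enat m)"

text \<open>The unit ideal has height \<open>\<infinity>\<close>.\<close>

definition height :: "'r::comm_ring_1 set \<Rightarrow> enat" where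
  "height I = (INF P \<in> {P. prime_ideal P \<and> I \<subseteq> P}. prime_height P)"

text \<open>Associated primes of the module \<open>R/I\<close>.\<close>

definition associated_primes :: "'r::comm_ring_1 set \<Rightarrow> 'r set set" where
  "associated_primes I = {P. prime_ideal P \<and> (\<exists>a. P = {r. r * a \<in> I})}"

definition unmixed :: "'r::comm_ring_1 set \<Rightarrow> bool" where
  "unmixed I \<longleftrightarrow> (\<forall>P\<in>associated_primes I. prime_height P = height I)"


section \<open>Multiplicity\<close>

text \<open>The dimension of \<open>(R/I)\<^sub>t = R\<^sub>t / I\<^sub>t\<close> over \<open>k\<close>, for a homogeneous ideal \<open>I\<close>.\<close>

definition hilbert_function :: "('n::finite, 'k::field) mpol set \<Rightarrow> nat \<Rightarrow> nat" where
  "hilbert_function I t = pvec.dim (forms (int t) :: ('n, 'k) mpol set) - pvec.dim (forms (int t) \<inter> I)"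

definition hilbert_poly :: "('n::finite, 'k::field) mpol set \<Rightarrow> rat poly" where
  "hilbert_poly I = (THE p. \<exists>t0. \<forall>t\<ge>t0. of_nat (hilbert_function I t) = poly p (of_nat t))"

text \<open>\<open>deg(R/I)\<close>: with \<open>D = dim R/I\<close>, the Hilbert polynomial has degree \<open>D - 1\<close> and the multiplicity
  is \<open>(D - 1)!\<close> times its leading coefficient; for \<open>D \<le> 0\<close> it is the length of \<open>R/I\<close>.\<close>

definition multiplicity_quot :: "('n::finite, 'k::field) mpol set \<Rightarrow> rat" where
  "multiplicity_quot I =
     (if hilbert_poly I = 0 then of_nat (\<Sum>t | hilbert_function I t \<noteq> 0. hilbert_function I t)
      else fact (degree (hilbert_poly I)) * lead_coeff (hilbert_poly I))"


section \<open>Resolutions\<close>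

definition linear_on :: "(nat \<Rightarrow>\<^sub>0 'r::comm_ring_1) set \<Rightarrow> ((nat \<Rightarrow>\<^sub>0 'r) \<Rightarrow> (nat \<Rightarrow>\<^sub>0 'r)) \<Rightarrow> bool" where
  "linear_on M f \<longleftrightarrow> (\<forall>x\<in>M. \<forall>y\<in>M. f (x + y) = f x + f y) \<and> (\<forall>c. \<forall>x\<in>M. f (pscale c x) = pscale c (f x))"

text \<open>An ideal of \<open>R\<close> as a submodule of the first coordinate axis of \<open>nat \<Rightarrow>\<^sub>0 R\<close>.\<close>

definition ideal_module :: "'r::comm_ring_1 set \<Rightarrow> (nat \<Rightarrow>\<^sub>0 'r) set" where
  "ideal_module I = Poly_Mapping.single 0 ` I"

definition ideal_times :: "'r::comm_ring_1 set \<Rightarrow> (nat \<Rightarrow>\<^sub>0 'r) set \<Rightarrow> (nat \<Rightarrow>\<^sub>0 'r) set" where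
  "ideal_times I M = pmod.span {pscale c x | c x. c \<in> I \<and> x \<in> M}"

text \<open>Exactness of \<open>0 \<rightarrow> P\<^sub>m \<rightarrow> \<dots> \<rightarrow> P\<^sub>0 \<rightarrow> M \<rightarrow> 0\<close>, where \<open>\<phi> 0\<close> is the augmentation
  \<open>P\<^sub>0 \<rightarrow> M\<close> and \<open>\<phi> (i + 1)\<close> is the differential \<open>P\<^sub>i\<^sub>+\<^sub>1 \<rightarrow> P\<^sub>i\<close>.\<close>

definition exact_resolution ::
  "nat \<Rightarrow> (nat \<Rightarrow> (nat \<Rightarrow>\<^sub>0 'r::comm_ring_1) set) \<Rightarrow> (nat \<Rightarrow> (nat \<Rightarrow>\<^sub>0 'r) \<Rightarrow> (nat \<Rightarrow>\<^sub>0 'r)) \<Rightarrow>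
   (nat \<Rightarrow>\<^sub>0 'r) set \<Rightarrow> bool" where
  "exact_resolution m P \<phi> M \<longleftrightarrow>
     (\<forall>i\<le>m. linear_on (P i) (\<phi> i)) \<and>
     \<phi> 0 ` P 0 = M \<and>
     (\<forall>i<m. \<phi> (Suc i) ` P (Suc i) = {x \<in> P i. \<phi> i x = 0}) \<and>
     {x \<in> P m. \<phi> m x = 0} = {0}"

text \<open>Projective modules are direct summands of free modules; every countably generated projective
  module is, up to isomorphism, a direct summand of \<open>nat \<Rightarrow>\<^sub>0 R\<close>.  Over a Noetherian ring, the
  projective dimension of a finitely generated module is computed by such resolutions.\<close>

definition projective_module :: "(nat \<Rightarrow>\<^sub>0 'r::comm_ring_1) set \<Rightarrow> bool" where
  "projective_module P \<longleftrightarrow> pmod.subspace P \<and>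
     (\<exists>Q. pmod.subspace Q \<and> P \<inter> Q = {0} \<and> (\<forall>x. \<exists>p\<in>P. \<exists>q\<in>Q. x = p + q))"

definition projective_dimension :: "(nat \<Rightarrow>\<^sub>0 'r::comm_ring_1) set \<Rightarrow> enat" where
  "projective_dimension M =
     (INF m \<in> {m. \<exists>P \<phi>. (\<forall>i\<le>m. projective_module (P i)) \<and> exact_resolution m P \<phi> M}. enat m)"

definition free_module :: "nat \<Rightarrow> (nat \<Rightarrow>\<^sub>0 'r::comm_ring_1) set" where
  "free_module r = {v. Poly_Mapping.keys v \<subseteq> {..<r}}"

text \<open>The degree-\<open>t\<close> component of \<open>R(-b\<^sub>0) \<oplus> \<dots> \<oplus> R(-b\<^sub>r\<^sub>-\<^sub>1)\<close>.\<close>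

definition graded_piece :: "nat list \<Rightarrow> int \<Rightarrow> (nat \<Rightarrow>\<^sub>0 ('n::finite, 'k::comm_ring_1) mpol) set" where
  "graded_piece b t =
     {v \<in> free_module (length b). \<forall>i<length b. Poly_Mapping.lookup v i \<in> forms (t - int (b ! i))}"

text \<open>\<open>bs ! i\<close> lists the shifts \<open>b\<close> of the summands \<open>R(-b)\<close> of the \<open>i\<close>-th free module \<open>F\<^sub>i\<close>.  All maps are
  homogeneous of degree \<open>0\<close>, and minimality means that the image of \<open>F\<^sub>i\<^sub>+\<^sub>1 \<rightarrow> F\<^sub>i\<close> lies in
  \<open>(x\<^sub>1,\<dots>,x\<^sub>n) F\<^sub>i\<close>.\<close>

definition minimal_graded_free_resolution ::
  "nat list list \<Rightarrow> (nat \<Rightarrow> (nat \<Rightarrow>\<^sub>0 ('n::finite, 'k::comm_ring_1) mpol) \<Rightarrow> (nat \<Rightarrow>\<^sub>0 ('n, 'k) mpol)) \<Rightarrow>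
   ('n, 'k) mpol set \<Rightarrow> bool" where
  "minimal_graded_free_resolution bs \<phi> I \<longleftrightarrow>
     bs \<noteq> [] \<and>
     exact_resolution (length bs - 1) (\<lambda>i. free_module (length (bs ! i))) \<phi> (ideal_module I) \<and>
     (\<forall>t. \<phi> 0 ` graded_piece (bs ! 0) t \<subseteq> graded_piece [0] t) \<and>
     (\<forall>i. Suc i < length bs \<longrightarrow>
        (\<forall>t. \<phi> (Suc i) ` graded_piece (bs ! Suc i) t \<subseteq> graded_piece (bs ! i) t) \<and>
        \<phi> (Suc i) ` free_module (length (bs ! Suc i))
          \<subseteq> ideal_times irrelevant_ideal (free_module (length (bs ! i))))"

definition has_minimal_graded_free_resolution ::
  "('n::finite, 'k::comm_ring_1) mpol set \<Rightarrow> nat list list \<Rightarrow> bool" where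
  "has_minimal_graded_free_resolution I bs \<longleftrightarrow> (\<exists>\<phi>. minimal_graded_free_resolution bs \<phi> I)"


section \<open>Strict almost complete intersections and the Bourbaki degree\<close>

definition equigenerated_strict_aci_ht2 :: "nat \<Rightarrow> ('n::finite, 'k::comm_ring_1) mpol list \<Rightarrow> bool" where
  "equigenerated_strict_aci_ht2 d fs \<longleftrightarrow>
     d \<ge> 2 \<and> length fs = 3 \<and> distinct fs \<and> set fs \<subseteq> forms (int d) \<and>
     (\<forall>f\<in>set fs. f \<notin> ideal_gen (set fs - {f})) \<and>
     height (ideal_gen (set fs)) = 2"

definition syz :: "('n::finite, 'k::comm_ring_1) mpol list \<Rightarrow> (nat \<Rightarrow>\<^sub>0 ('n, 'k) mpol) set" where
  "syz fs = {a \<in> free_module (length fs). (\<Sum>i<length fs. Poly_Mapping.lookup a i * fs ! i) = 0}"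

text \<open>The degree-\<open>t\<close> component of \<open>syz fs\<close>, in the standard grading of the ambient free module.\<close>

definition syz_piece :: "('n::finite, 'k::comm_ring_1) mpol list \<Rightarrow> int \<Rightarrow> (nat \<Rightarrow>\<^sub>0 ('n, 'k) mpol) set" where
  "syz_piece fs t = syz fs \<inter> graded_piece (replicate (length fs) 0) t"

definition indeg_syz :: "('n::finite, 'k::comm_ring_1) mpol list \<Rightarrow> nat" where
  "indeg_syz fs = (LEAST e. \<exists>a\<in>syz_piece fs (int e). a \<noteq> 0)"

definition initial_syzygy ::
  "('n::finite, 'k::comm_ring_1) mpol list \<Rightarrow> (nat \<Rightarrow>\<^sub>0 ('n, 'k) mpol) \<Rightarrow> bool" where
  "initial_syzygy fs \<nu> \<longleftrightarrow>
     \<nu> \<in> syz_piece fs (int (indeg_syz fs)) \<and> \<nu> \<notin> ideal_times irrelevant_ideal (syz fs)"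

text \<open>\<open>\<psi>\<close> induces an isomorphism of \<open>syz fs / R\<nu>\<close> onto \<open>I\<close> that shifts degrees by \<open>s\<close>.\<close>

definition bourbaki_ideal ::
  "('n::finite, 'k::comm_ring_1) mpol list \<Rightarrow> (nat \<Rightarrow>\<^sub>0 ('n, 'k) mpol) \<Rightarrow> ('n, 'k) mpol set \<Rightarrow> bool" where
  "bourbaki_ideal fs \<nu> I \<longleftrightarrow>
     homogeneous_ideal I \<and> height I = 2 \<and> unmixed I \<and>
     (\<exists>\<psi> s. linear_on (syz fs) \<psi> \<and> \<psi> ` syz fs = ideal_module I \<and>
        {a \<in> syz fs. \<psi> a = 0} = pmod.span {\<nu>} \<and>
        (\<forall>t. \<psi> ` syz_piece fs t \<subseteq> graded_piece [0] (t + s)))"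

text \<open>The value is independent of the choice of \<open>\<nu>\<close> and of the ideal.\<close>

definition bourbaki_degree :: "('n::finite, 'k::field) mpol list \<Rightarrow> rat" where
  "bourbaki_degree fs =
     (THE b. \<exists>\<nu> I. initial_syzygy fs \<nu> \<and> bourbaki_ideal fs \<nu> I \<and> b = multiplicity_quot I)"

end

theory Submission
  imports Defs "HOL-Computational_Algebra.Factorial_Ring"
begin

text \<open>
  Let \<open>a\<^sub>1 \<le> a\<^sub>2 \<le> \<dots>\<close> and \<open>b\<^sub>1 \<le> b\<^sub>2 \<le> \<dots>\<close> be the shifts of the second and third module in the
  minimal resolution of \<open>J\<close>.  Since \<open>J\<close> has height \<open>2\<close>, the Hilbert polynomial of \<open>R/J\<close> has degree
  \<open>n - 3\<close>, and its leading coefficients express \<open>\<Sum>a - \<Sum>b = 3d\<close> and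
  \<open>2 deg(R/J) = \<Sum>a\<^sup>2 - \<Sum>b\<^sup>2 - 3d\<^sup>2\<close>.  By unique factorization a saturated submodule of rank one needs
  only one generator, so two minimal syzygies are independent and no \<open>j\<close> columns of the last matrix live
  on \<open>j + 1\<close> rows; hence \<open>a\<^sub>j\<^sub>+\<^sub>2 < b\<^sub>j\<close>.  The Koszul syzygies give \<open>a\<^sub>2 \<le> 2d\<close>.  For \<open>deg(R/J) = d\<^sup>2 - d\<close>
  these inequalities only leave the two shapes of (b).  In both, the relation among the three syzygies has
  linear coefficients at the last two generators, and these two linear forms generate a Bourbaki ideal;
  that every Bourbaki ideal has degree one follows from its Hilbert function, again by height \<open>2\<close>.
\<close>

text \<open>Height is defined by chains of primes and homological dimension by arbitrary projective
  resolutions, while the argument needs the numbers attached to one minimal free resolution; much of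
  the development bridges these two gaps. The degree n - 3 of the Hilbert polynomial is obtained
  without Krull's height theorem. An ideal of height 2 lies in no principal prime ideal, so each
  prime factor p of a generator comes with a member of the ideal not divisible by p, and the Koszul
  complex of two coprime forms bounds the Hilbert function from above. Monomials in n - 2 variables
  that are independent modulo a prime of height 2 over the ideal bound it from below. The letter w
  stands for n - 3 throughout. Since \<open>bourbaki_degree\<close> is a definite description over
  all pairs of an initial syzygy and a Bourbaki ideal, one pair has to be constructed and every pair
  has to be evaluated.\<close>

abbreviation lookup where "lookup \<equiv> Poly_Mapping.lookup"
abbreviation single where "single \<equiv> Poly_Mapping.single"
abbreviation keys where "keys \<equiv> Poly_Mapping.keys"

section \<open>Finitely supported functions as sums of single terms\<close>

lemma poly_mapping_eq_sum_single:
  "p = (\<Sum>m\<in>keys p. single m (lookup p m))"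
  by (rule poly_mapping_eqI)
    (auto simp: lookup_sum lookup_single when_def sum.delta in_keys_iff)

lemma poly_mapping_additive_induct:
  fixes p :: "'a \<Rightarrow>\<^sub>0 'b::comm_monoid_add"
  assumes "\<And>m c. P (single m c)" and add: "\<And>p q. P p \<Longrightarrow> P q \<Longrightarrow> P (p + q)"
  shows "P p"
proof -
  have "P (\<Sum>m\<in>A. single m (f m))" if "finite A" for A and f :: "'a \<Rightarrow> 'b"
    using that
  proof (induction A)
    case empty
    \<comment> \<open>\<open>P 0\<close> is the case of a single term with coefficient zero; its
      exponent is arbitrary.\<close>
    then show ?case using assms(1)[of undefined 0] by simp
  next
    case (insert x A)
    then show ?case using assms by simp
  qed
  then show ?thesis by (metis poly_mapping_eq_sum_single finite_keys)
qed

lemma times_eq_sum_single: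
  fixes f g :: "'a::comm_monoid_add \<Rightarrow>\<^sub>0 'r::comm_semiring_1"
  shows "f * g = (\<Sum>a\<in>keys f. \<Sum>b\<in>keys g.
    single (a + b) (lookup f a * lookup g b))"
proof -
  have "f * g = (\<Sum>m\<in>keys f. single m (lookup f m)) *
     (\<Sum>m\<in>keys g. single m (lookup g m))"
    by (simp flip: poly_mapping_eq_sum_single)
  then show ?thesis by (simp add: sum_product mult_single)
qed

lemma lookup_times_eq_sum:
  fixes f g :: "'a::comm_monoid_add \<Rightarrow>\<^sub>0 'r::comm_semiring_1"
  shows "lookup (f * g) k = (\<Sum>a\<in>keys f. \<Sum>b\<in>keys g.
    (lookup f a * lookup g b when a + b = k))"
  by (subst times_eq_sum_single) (simp add: lookup_sum lookup_single)

section \<open>Ideals\<close>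

lemma is_idealD:
  assumes "is_ideal I"
  shows "0 \<in> I" and "x \<in> I \<Longrightarrow> y \<in> I \<Longrightarrow> x + y \<in> I" and "x \<in> I \<Longrightarrow> c * x \<in> I"
    and "x \<in> I \<Longrightarrow> x * c \<in> I" and "x \<in> I \<Longrightarrow> - x \<in> I" and "x \<in> I \<Longrightarrow> y \<in> I \<Longrightarrow> x - y \<in> I"
proof -
  interpret module "(*) :: 'a \<Rightarrow> 'a \<Rightarrow> 'a" by (rule module_times)
  show "0 \<in> I" "x \<in> I \<Longrightarrow> y \<in> I \<Longrightarrow> x + y \<in> I" "x \<in> I \<Longrightarrow> c * x \<in> I" "x \<in> I \<Longrightarrow> - x \<in> I"
    "x \<in> I \<Longrightarrow> y \<in> I \<Longrightarrow> x - y \<in> I"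
    using subspace_0[OF assms] subspace_add[OF assms] subspace_scale[OF assms]
      subspace_neg[OF assms] subspace_diff[OF assms] by auto
  then show "x \<in> I \<Longrightarrow> x * c \<in> I"
    using assms subspace_scale by (metis mult.commute)
qed

lemma is_ideal_sum: "is_ideal I \<Longrightarrow> (\<And>i. i \<in> A \<Longrightarrow> f i \<in> I) \<Longrightarrow> sum f A \<in> I"
  by (induction A rule: infinite_finite_induct) (auto intro: is_idealD)

lemma is_idealI:
  assumes "0 \<in> I" "\<And>x y. x \<in> I \<Longrightarrow> y \<in> I \<Longrightarrow> x + y \<in> I" "\<And>c x. x \<in> I \<Longrightarrow> c * x \<in> I"
  shows "is_ideal I"
  using assms by (simp add: module.subspace_def[OF module_times])

lemma is_ideal_ideal_gen: "is_ideal (ideal_gen S)"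
  by (rule module.subspace_span[OF module_times])

lemma ideal_gen_superset: "S \<subseteq> ideal_gen S"
  by (rule module.span_superset[OF module_times])

lemma ideal_gen_minimal: "S \<subseteq> I \<Longrightarrow> is_ideal I \<Longrightarrow> ideal_gen S \<subseteq> I"
  by (rule module.span_minimal[OF module_times])

lemma prime_idealD:
  assumes "prime_ideal P"
  shows "is_ideal P" and "1 \<notin> P" and "a * b \<in> P \<Longrightarrow> a \<in> P \<or> b \<in> P"
  using assms by (auto simp: prime_ideal_def)

section \<open>Polynomials over a domain\<close>

text \<open>The variables carry no order, whereas exponent vectors indexed by \<open>nat\<close>
  have a linear order compatible with addition. Numbering the variables transports that order, so
  that least monomials can be chosen.\<close>

lemma monomial_order_embedding:
  obtains \<iota> :: "('n::finite \<Rightarrow>\<^sub>0 nat) \<Rightarrow> (nat \<Rightarrow>\<^sub>0 nat)"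
  where "inj \<iota>" "\<And>a b. \<iota> (a + b) = \<iota> a + \<iota> b"
proof -
  obtain ix :: "'n \<Rightarrow> nat" where ix: "inj ix"
    using finite_imp_inj_to_nat_seg[of "UNIV :: 'n set"] by auto
  define \<iota> :: "('n \<Rightarrow>\<^sub>0 nat) \<Rightarrow> (nat \<Rightarrow>\<^sub>0 nat)" where
    "\<iota> m = (\<Sum>i\<in>UNIV. single (ix i) (lookup m i))" for m
  have lk: "lookup (\<iota> m) (ix i) = lookup m i" for m i
  proof -
    have "lookup (\<iota> m) (ix i) = (\<Sum>j\<in>UNIV. if j = i then lookup m j else 0)"
      unfolding \<iota>_def lookup_sum
      by (intro sum.cong refl) (use ix in \<open>auto simp: lookup_single when_def inj_def\<close>)
    then show ?thesis by simp
  qed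
  have "inj \<iota>"
    by (rule injI, rule poly_mapping_eqI) (metis lk)
  moreover have "\<iota> (a + b) = \<iota> a + \<iota> b" for a b
    by (simp add: \<iota>_def lookup_add single_add sum.distrib)
  ultimately show ?thesis using that by blast
qed

text \<open>The terms of least degree outside \<open>P\<close> multiply to a term outside \<open>P\<close>.\<close>

lemma prime_ideal_coefficients:
  fixes f g :: "('n::finite \<Rightarrow>\<^sub>0 nat) \<Rightarrow>\<^sub>0 'r::comm_ring_1"
  assumes P: "prime_ideal P" and fg: "\<And>m. lookup (f * g) m \<in> P"
  shows "(\<forall>m. lookup f m \<in> P) \<or> (\<forall>m. lookup g m \<in> P)"
proof (rule ccontr)
  assume neg: "\<not> ?thesis"
  note I = is_idealD[OF prime_idealD(1)[OF P]]
  obtain \<iota> :: "('n \<Rightarrow>\<^sub>0 nat) \<Rightarrow> (nat \<Rightarrow>\<^sub>0 nat)" where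
    inj: "inj \<iota>" and add: "\<And>a b. \<iota> (a + b) = \<iota> a + \<iota> b"
    by (rule monomial_order_embedding) blast
  have ex: "\<exists>m. lookup h m \<notin> P \<and> (\<forall>m'. lookup h m' \<notin> P \<longrightarrow> \<iota> m \<le> \<iota> m')"
    if "\<not> (\<forall>m. lookup h m \<in> P)" for h :: "('n \<Rightarrow>\<^sub>0 nat) \<Rightarrow>\<^sub>0 'r"
  proof -
    let ?S = "{m. lookup h m \<notin> P}"
    have "?S \<subseteq> keys h"
      using I(1) by (auto simp: in_keys_iff)
    then have fin: "finite ?S" using finite_keys finite_subset by blast
    have ne: "?S \<noteq> {}" using that by auto
    have "Min (\<iota> ` ?S) \<in> \<iota> ` ?S" using fin ne by (intro Min_in) auto
    then obtain m where "m \<in> ?S" "\<iota> m = Min (\<iota> ` ?S)" by auto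
    then show ?thesis using fin by (intro exI[of _ m]) auto
  qed
  obtain a0 where a0: "lookup f a0 \<notin> P"
    and a0min: "\<And>m. lookup f m \<notin> P \<Longrightarrow> \<iota> a0 \<le> \<iota> m"
    using ex[of f] neg by auto
  obtain b0 where b0: "lookup g b0 \<notin> P"
    and b0min: "\<And>m. lookup g m \<notin> P \<Longrightarrow> \<iota> b0 \<le> \<iota> m"
    using ex[of g] neg by auto
  have keys: "a0 \<in> keys f" "b0 \<in> keys g"
    using a0 b0 I(1) by (auto simp: in_keys_iff)
  let ?t = "\<lambda>(a, b). (lookup f a * lookup g b when a + b = a0 + b0)"
  let ?K = "keys f \<times> keys g"
  have "lookup (f * g) (a0 + b0) = sum ?t ?K"
    by (simp add: lookup_times_eq_sum sum.cartesian_product)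
  also have "\<dots> = ?t (a0, b0) + sum ?t (?K - {(a0, b0)})"
    using keys by (subst sum.remove[of _ "(a0, b0)"]) auto
  finally have eq: "lookup f a0 * lookup g b0 =
     lookup (f * g) (a0 + b0) - sum ?t (?K - {(a0, b0)})"
    by simp
  have "?t ab \<in> P" if ab: "ab \<in> ?K - {(a0, b0)}" for ab
  proof (cases ab)
    case (Pair a b)
    have "lookup f a * lookup g b \<in> P" if e: "a + b = a0 + b0"
    proof (rule ccontr)
      assume "\<not> ?thesis"
      then have "lookup f a \<notin> P" "lookup g b \<notin> P"
        using I by auto
      then have le: "\<iota> a0 \<le> \<iota> a" "\<iota> b0 \<le> \<iota> b" using a0min b0min by auto
      have "\<iota> a + \<iota> b = \<iota> a0 + \<iota> b0" using add e by metis
      then have "\<iota> a = \<iota> a0"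
        using le by (metis add_less_le_mono antisym_conv2 order_less_irrefl)
      then have "a = a0" using inj by (simp add: inj_def)
      then have "b = b0" using e by simp
      then show False using ab Pair \<open>a = a0\<close> by simp
    qed
    then show ?thesis using Pair I(1) by (simp add: when_def)
  qed
  then have "sum ?t (?K - {(a0, b0)}) \<in> P"
    by (intro is_ideal_sum prime_idealD(1)[OF P]) auto
  then have "lookup f a0 * lookup g b0 \<in> P"
    using eq fg I(6) by simp
  then show False using prime_idealD(3)[OF P] a0 b0 by blast
qed

lemma prime_ideal_zero: "prime_ideal {0 :: 'r::idom}"
  unfolding prime_ideal_def by (auto intro: is_idealI)

text \<open>The zero ideal of a domain is prime, so the coefficient lemma with P = {0} shows that
  the polynomial ring is again a domain.\<close>

lemma mpol_mult_eq_0_iff [simp]: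
  fixes p q :: "('n::finite, 'k::idom) mpol"
  shows "p * q = 0 \<longleftrightarrow> p = 0 \<or> q = 0"
proof
  assume "p * q = 0"
  then have "(\<forall>m. lookup p m \<in> {0}) \<or> (\<forall>m. lookup q m \<in> {0})"
    by (intro prime_ideal_coefficients prime_ideal_zero) simp
  then show "p = 0 \<or> q = 0" by (auto intro: poly_mapping_eqI)
qed auto

lemma mpol_mult_cancel:
  fixes p q r :: "('n::finite, 'k::idom) mpol"
  assumes "r * p = r * q" "r \<noteq> 0"
  shows "p = q"
proof -
  have "r * (p - q) = 0" using assms by (simp add: algebra_simps)
  then show ?thesis using assms(2) by (subst (asm) mpol_mult_eq_0_iff) auto
qed

section \<open>Weights\<close>

text \<open>Total degree and degree in one variable are both additive weights on monomials, so
  components, degrees and leading components are treated once for both.\<close>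

definition additive_weight :: "('a::comm_monoid_add \<Rightarrow> nat) \<Rightarrow> bool" where
  "additive_weight w \<longleftrightarrow> w 0 = 0 \<and> (\<forall>a b. w (a + b) = w a + w b)"

definition wcomp :: "('a \<Rightarrow> nat) \<Rightarrow> nat \<Rightarrow> ('a \<Rightarrow>\<^sub>0 'r::zero) \<Rightarrow> ('a \<Rightarrow>\<^sub>0 'r)" where
  "wcomp w t p = Poly_Mapping.mapp (\<lambda>m c. c when w m = t) p"

definition wdeg :: "('a \<Rightarrow> nat) \<Rightarrow> ('a \<Rightarrow>\<^sub>0 'r::zero) \<Rightarrow> nat" where
  "wdeg w p = Max (insert 0 (w ` keys p))"

lemma lookup_wcomp: "lookup (wcomp w t p) m = (lookup p m when w m = t)"
  by (auto simp: wcomp_def lookup_mapp when_def in_keys_iff)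

lemma wcomp_0 [simp]: "wcomp w t 0 = 0"
  by (rule poly_mapping_eqI) (simp add: lookup_wcomp)

lemma wcomp_add: "wcomp w t (p + q) = wcomp w t p + wcomp w t (q :: 'a \<Rightarrow>\<^sub>0 'r::comm_monoid_add)"
  by (rule poly_mapping_eqI) (simp add: lookup_wcomp lookup_add when_add_distrib)

lemma wcomp_diff: "wcomp w t (p - q) = wcomp w t p - wcomp w t (q :: 'a \<Rightarrow>\<^sub>0 'r::ab_group_add)"
  by (rule poly_mapping_eqI) (simp add: lookup_wcomp lookup_minus when_def)

lemma wcomp_single: "wcomp w t (single m c) = (single m c when w m = t)"
  by (rule poly_mapping_eqI) (auto simp: lookup_wcomp lookup_single when_def)

lemma wcomp_wcomp: "wcomp w t (wcomp w s p) = (wcomp w s p when s = t)"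
  by (rule poly_mapping_eqI) (auto simp: lookup_wcomp when_def)

lemma wcomp_mult:
  fixes p q :: "'a::comm_monoid_add \<Rightarrow>\<^sub>0 'r::comm_semiring_1"
  assumes w: "additive_weight w"
  shows "wcomp w t (p * q) = (\<Sum>i\<le>t. wcomp w i p * wcomp w (t - i) q)"
proof (induction p rule: poly_mapping_additive_induct)
  case (1 a c)
  show ?case
  proof (induction q rule: poly_mapping_additive_induct)
    case (1 b d)
    have "(\<Sum>i\<le>t. wcomp w i (single a c) * wcomp w (t - i) (single b d))
       = (\<Sum>i\<le>t. if w a = i then (single (a + b) (c * d) when w b = t - i) else 0)"
      by (intro sum.cong refl) (auto simp: wcomp_single mult_single when_def)
    also have "\<dots> = (single (a + b) (c * d) when w (a + b) = t)"
      using w by (auto simp: sum.delta additive_weight_def when_def)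
    finally show ?case by (simp add: wcomp_single mult_single)
  next
    case (2 p q)
    then show ?case by (simp add: wcomp_add algebra_simps sum.distrib)
  qed
next
  case (2 p q)
  then show ?case by (simp add: wcomp_add algebra_simps sum.distrib)
qed

lemma wdeg_0 [simp]: "wdeg w 0 = 0"
  by (simp add: wdeg_def)

lemma wdeg_ge: "m \<in> keys p \<Longrightarrow> w m \<le> wdeg w p"
  by (simp add: wdeg_def)

lemma wdeg_leI: "(\<And>m. m \<in> keys p \<Longrightarrow> w m \<le> t) \<Longrightarrow> wdeg w p \<le> t"
  by (auto simp: wdeg_def)

lemma wcomp_beyond: "wdeg w p < t \<Longrightarrow> wcomp w t p = 0"
  using wdeg_ge[of _ p w] by (intro poly_mapping_eqI) (force simp: lookup_wcomp when_def in_keys_iff)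

lemma wdeg_attained: "p \<noteq> 0 \<Longrightarrow> \<exists>m\<in>keys p. w m = wdeg w p"
proof -
  assume "p \<noteq> 0"
  then have "keys p \<noteq> {}" by (metis ex_in_conv in_keys_iff lookup_zero poly_mapping_eqI)
  moreover have "wdeg w p \<in> insert 0 (w ` keys p)"
    unfolding wdeg_def by (rule Max_in) auto
  moreover have "\<exists>m\<in>keys p. w m = wdeg w p" if "wdeg w p = 0"
    using wdeg_ge[of _ p w] calculation(1) that by fastforce
  ultimately show ?thesis by auto
qed

lemma wcomp_wdeg_nonzero: "p \<noteq> 0 \<Longrightarrow> wcomp w (wdeg w p) p \<noteq> 0"
  using wdeg_attained[of p w] by (auto simp: poly_mapping_eq_iff fun_eq_iff lookup_wcomp when_def in_keys_iff)

lemma sum_wcomp: "wdeg w p \<le> T \<Longrightarrow> (\<Sum>t\<le>T. wcomp w t p) = p"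
proof (rule poly_mapping_eqI)
  fix m assume le: "wdeg w p \<le> T"
  show "lookup (\<Sum>t\<le>T. wcomp w t p) m = lookup p m"
  proof (cases "m \<in> keys p")
    case True
    then have "w m \<le> T" using le wdeg_ge[OF True, of w] by linarith
    then show ?thesis by (simp add: lookup_sum lookup_wcomp when_def sum.delta)
  qed (auto simp: lookup_sum lookup_wcomp in_keys_iff)
qed

lemma wdeg_add_le: "wdeg w (p + q) \<le> max (wdeg w p) (wdeg w q)"
  using keys_add[of p q] wdeg_ge[of _ p w] wdeg_ge[of _ q w]
  by (intro wdeg_leI) (force simp: le_max_iff_disj)

lemma keys_uminus_eq: "keys (- q) = keys (q :: 'a \<Rightarrow>\<^sub>0 'r::ab_group_add)"
  by (auto simp: in_keys_iff)

lemma wdeg_uminus [simp]: "wdeg w (- q) = wdeg w (q :: 'a \<Rightarrow>\<^sub>0 'r::ab_group_add)"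
  by (simp add: wdeg_def keys_uminus_eq)

lemma wdeg_diff_le: "wdeg w (p - q) \<le> max (wdeg w p) (wdeg w (q :: 'a \<Rightarrow>\<^sub>0 'r::ab_group_add))"
  using wdeg_add_le[of w p "- q"] by simp

text \<open>D and E need only bound the degrees, so the leading components may vanish. In every
  other summand of the product formula one factor lies beyond its degree.\<close>

lemma wcomp_mult_top:
  fixes p q :: "'a::comm_monoid_add \<Rightarrow>\<^sub>0 'r::comm_semiring_1"
  assumes "additive_weight w" "wdeg w p \<le> D" "wdeg w q \<le> E"
  shows "wcomp w (D + E) (p * q) = wcomp w D p * wcomp w E q"
proof -
  have "wcomp w (D + E) (p * q) = (\<Sum>i\<le>D + E. wcomp w i p * wcomp w (D + E - i) q)"
    by (rule wcomp_mult) fact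
  also have "\<dots> = (\<Sum>i\<le>D + E. if i = D then wcomp w D p * wcomp w E q else 0)"
  proof (intro sum.cong refl)
    fix i assume i: "i \<in> {..D + E}"
    consider "i < D" | "i = D" | "i > D" by linarith
    then show "wcomp w i p * wcomp w (D + E - i) q = (if i = D then wcomp w D p * wcomp w E q else 0)"
    proof cases
      case 1
      then have "wcomp w (D + E - i) q = 0" using assms by (intro wcomp_beyond) linarith
      then show ?thesis using 1 by simp
    next
      case 3
      then have "wcomp w i p = 0" using assms by (intro wcomp_beyond) linarith
      then show ?thesis using 3 by simp
    qed auto
  qed
  finally show ?thesis by simp
qed

lemma wdeg_mult_le:
  fixes p q :: "'a::comm_monoid_add \<Rightarrow>\<^sub>0 'r::comm_semiring_1"
  assumes "additive_weight w"
  shows "wdeg w (p * q) \<le> wdeg w p + wdeg w q"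
proof (rule wdeg_leI)
  fix m assume "m \<in> keys (p * q)"
  then obtain a b where "m = a + b" "a \<in> keys p" "b \<in> keys q"
    using keys_mult[of p q] by blast
  then show "w m \<le> wdeg w p + wdeg w q"
    using assms wdeg_ge[of a p w] wdeg_ge[of b q w] by (simp add: additive_weight_def)
qed

lemma wdeg_mult:
  fixes p q :: "('n::finite, 'k::idom) mpol"
  assumes w: "additive_weight w" and nz: "p \<noteq> 0" "q \<noteq> 0"
  shows "wdeg w (p * q) = wdeg w p + wdeg w q"
proof (rule antisym)
  show "wdeg w (p * q) \<le> wdeg w p + wdeg w q" by (rule wdeg_mult_le[OF w])
  have "wcomp w (wdeg w p + wdeg w q) (p * q) \<noteq> 0"
    using wcomp_mult_top[OF w order_refl order_refl, of p q] nz by (simp add: wcomp_wdeg_nonzero)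
  then show "wdeg w p + wdeg w q \<le> wdeg w (p * q)"
    using wcomp_beyond not_le by blast
qed

lemma additive_weight_mdeg [simp]: "additive_weight mdeg"
  by (simp add: additive_weight_def mdeg_def lookup_add sum.distrib)

lemma additive_weight_lookup [simp]: "additive_weight (\<lambda>m. lookup m x)"
  by (simp add: additive_weight_def lookup_add)

lemma mdeg_eq_0_iff: "mdeg m = 0 \<longleftrightarrow> m = 0"
  by (auto simp: mdeg_def intro: poly_mapping_eqI)

abbreviation const :: "'k \<Rightarrow> ('n::finite, 'k::comm_ring_1) mpol" where
  "const c \<equiv> single 0 c"

lemma tdeg_0_iff: "wdeg mdeg p = 0 \<longleftrightarrow> (\<exists>c. p = const c)"
proof
  assume d: "wdeg mdeg p = 0"
  have "p = const (lookup p 0)"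
  proof (rule poly_mapping_eqI)
    fix m
    have "m \<in> keys p \<Longrightarrow> m = 0" using d wdeg_ge[of m p mdeg] mdeg_eq_0_iff by force
    then show "lookup p m = lookup (const (lookup p 0)) m"
      by (auto simp: lookup_single when_def in_keys_iff)
  qed
  then show "\<exists>c. p = const c" by blast
next
  assume "\<exists>c. p = const c"
  then show "wdeg mdeg p = 0"
    by (auto simp: wdeg_def keys_single mdeg_eq_0_iff split: if_splits)
qed

lemma const_mult_inverse: "(c :: 'k::field) \<noteq> 0 \<Longrightarrow> const (inverse c) * const c = 1"
  by (simp add: mult_single)

section \<open>Unique factorization\<close>

text \<open>The subring k[V], kept as a subset of the full polynomial ring: an induction over the
  set of variables then stays within one type.\<close>

definition indets :: "'n set \<Rightarrow> ('n::finite, 'k::zero) mpol set" where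
  "indets V = {p. \<forall>m\<in>keys p. keys m \<subseteq> V}"

abbreviation xdeg :: "'n \<Rightarrow> ('n::finite, 'k::zero) mpol \<Rightarrow> nat" where
  "xdeg x \<equiv> wdeg (\<lambda>m. lookup m x)"

abbreviation xcomp :: "'n \<Rightarrow> nat \<Rightarrow> ('n::finite, 'k::zero) mpol \<Rightarrow> ('n::finite, 'k::zero) mpol" where
  "xcomp x \<equiv> wcomp (\<lambda>m. lookup m x)"

abbreviation xpow :: "'n \<Rightarrow> nat \<Rightarrow> ('n::finite, 'k::zero_neq_one) mpol" where
  "xpow x i \<equiv> single (single x i) 1"

lemma xpow_nonzero [simp]: "(xpow x i :: ('n::finite, 'k::zero_neq_one) mpol) \<noteq> 0"
  by (metis lookup_single_eq lookup_zero zero_neq_one)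

lemma indetsD: "p \<in> indets V \<Longrightarrow> m \<in> keys p \<Longrightarrow> y \<in> keys m \<Longrightarrow> y \<in> V"
  by (auto simp: indets_def)

lemma indets_mono: "V \<subseteq> W \<Longrightarrow> indets V \<subseteq> indets W"
  by (fastforce simp: indets_def)

lemma indets_UNIV [simp]: "indets UNIV = UNIV"
  by (simp add: indets_def)

lemma indets_const [simp]: "const c \<in> indets V"
  by (simp add: indets_def)

lemma indets_0 [simp]: "0 \<in> indets V"
  by (simp add: indets_def)

lemma indets_1 [simp]: "1 \<in> indets V"
  by (simp add: indets_def)

lemma indets_xpow [simp]: "x \<in> V \<Longrightarrow> xpow x i \<in> indets V"
  by (simp add: indets_def)

lemma indets_add: "p \<in> indets V \<Longrightarrow> q \<in> indets V \<Longrightarrow> p + q \<in> indets V"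
  using keys_add[of p q] by (auto simp: indets_def)

lemma indets_uminus: "p \<in> indets V \<Longrightarrow> - p \<in> indets V"
  for p :: "('n::finite, 'k::ab_group_add) mpol"
  by (simp add: indets_def keys_uminus_eq)

lemma indets_diff: "p \<in> indets V \<Longrightarrow> q \<in> indets V \<Longrightarrow> p - q \<in> indets V"
  for p :: "('n::finite, 'k::ab_group_add) mpol"
  using indets_add[of p V "- q"] indets_uminus[of q V] by simp

lemma indets_mult: "p \<in> indets V \<Longrightarrow> q \<in> indets V \<Longrightarrow> p * q \<in> indets V"
  for p :: "('n::finite, 'k::comm_ring_1) mpol"
proof -
  assume pq: "p \<in> indets V" "q \<in> indets V"
  have "keys m \<subseteq> V" if m: "m \<in> keys (p * q)" for m
  proof -
    obtain a b where "m = a + b" "a \<in> keys p" "b \<in> keys q"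
      using keys_mult[of p q] m by blast
    then show ?thesis using pq keys_add[of a b] unfolding indets_def by blast
  qed
  then show ?thesis by (simp add: indets_def)
qed

lemma indets_wcomp: "p \<in> indets V \<Longrightarrow> wcomp w t p \<in> indets V"
  by (auto simp: indets_def in_keys_iff lookup_wcomp)

lemma xdeg_0_iff: "xdeg x p = 0 \<longleftrightarrow> p \<in> indets (- {x})"
proof
  assume "xdeg x p = 0"
  then show "p \<in> indets (- {x})"
    using wdeg_ge[of _ p "\<lambda>m. lookup m x"] by (force simp: indets_def in_keys_iff)
next
  assume "p \<in> indets (- {x})"
  then have "xdeg x p \<le> 0"
    by (intro wdeg_leI) (force simp: indets_def in_keys_iff)
  then show "xdeg x p = 0" by simp
qed

lemma indets_iff_xdeg: "p \<in> indets V \<longleftrightarrow> (\<forall>x. x \<notin> V \<longrightarrow> xdeg x p = 0)"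
proof
  assume "\<forall>x. x \<notin> V \<longrightarrow> xdeg x p = 0"
  then have *: "x \<notin> V \<Longrightarrow> p \<in> indets (- {x})" for x by (simp add: xdeg_0_iff)
  show "p \<in> indets V"
    unfolding indets_def using indetsD[OF *] by blast
next
  assume "p \<in> indets V"
  then show "\<forall>x. x \<notin> V \<longrightarrow> xdeg x p = 0"
    using indets_mono[of V "- {x}" for x] by (auto simp: xdeg_0_iff)
qed

text \<open>k[V] is closed under factors because degrees in each variable outside V add up to zero.
  Hence divisibility, units and irreducibility mean the same in k[V] and in the full ring.\<close>

lemma indets_factor:
  fixes p q :: "('n::finite, 'k::idom) mpol"
  assumes "p * q \<in> indets V" "p * q \<noteq> 0"
  shows "p \<in> indets V" and "q \<in> indets V"
proof -
  have "xdeg x p + xdeg x q = 0" if "x \<notin> V" for x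
    using assms that wdeg_mult[of "\<lambda>m. lookup m x" p q] by (auto simp: indets_iff_xdeg)
  then show "p \<in> indets V" "q \<in> indets V" by (auto simp: indets_iff_xdeg)
qed

lemma mpol_unit_iff: "p dvd 1 \<longleftrightarrow> p \<noteq> 0 \<and> wdeg mdeg p = 0"
  for p :: "('n::finite, 'k::field) mpol"
proof
  assume "p dvd 1"
  then obtain q where q: "1 = p * q" by (auto simp: dvd_def)
  then have "p \<noteq> 0" "q \<noteq> 0" by auto
  then have "wdeg mdeg p + wdeg mdeg q = wdeg mdeg (1 :: ('n, 'k) mpol)"
    using q wdeg_mult[of mdeg p q] by simp
  also have "\<dots> = 0" using tdeg_0_iff[of "1 :: ('n, 'k) mpol"] by (metis single_one)
  finally show "p \<noteq> 0 \<and> wdeg mdeg p = 0" using \<open>p \<noteq> 0\<close> by simp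
next
  assume "p \<noteq> 0 \<and> wdeg mdeg p = 0"
  then obtain c where c: "p = const c" "c \<noteq> 0" by (metis single_zero tdeg_0_iff)
  then have "1 = p * const (inverse c)" by (metis const_mult_inverse mult.commute)
  then show "p dvd 1" by (rule dvdI)
qed

lemma mpol_unit_indets: "p dvd 1 \<Longrightarrow> p \<in> indets V" for p :: "('n::finite, 'k::field) mpol"
  using mpol_unit_iff tdeg_0_iff indets_const by metis

lemma tdeg_dvd_le: "p dvd q \<Longrightarrow> q \<noteq> 0 \<Longrightarrow> wdeg mdeg p \<le> wdeg mdeg q"
  for p q :: "('n::finite, 'k::field) mpol"
  by (auto simp: dvd_def wdeg_mult)

lemma exists_irreducible_factor:
  fixes c :: "('n::finite, 'k::field) mpol"
  assumes "c \<noteq> 0" "\<not> c dvd 1"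
  shows "\<exists>p. irreducible p \<and> p dvd c"
  using assms
proof (induction "wdeg mdeg c" arbitrary: c rule: less_induct)
  case less
  show ?case
  proof (cases "irreducible c")
    case False
    then obtain a b where ab: "c = a * b" "\<not> a dvd 1" "\<not> b dvd 1"
      using less.prems by (auto simp: irreducible_def)
    then have nz: "a \<noteq> 0" "b \<noteq> 0" using less.prems by auto
    then have "wdeg mdeg b > 0" using ab by (simp add: mpol_unit_iff)
    then have "wdeg mdeg a < wdeg mdeg c" using ab nz by (simp add: wdeg_mult)
    then obtain p where "irreducible p" "p dvd a" using less.hyps ab nz by blast
    then show ?thesis using ab by auto
  qed auto
qed

section \<open>Primes and contents in k[V][x]\<close>

lemma xhomogeneous_eq:
  fixes f :: "('n::finite, 'k::comm_ring_1) mpol"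
  assumes f: "f \<in> indets (insert x V)" and h: "\<And>m. m \<in> keys f \<Longrightarrow> lookup m x = D"
    and x: "x \<notin> V"
  shows "\<exists>c\<in>indets V. f = c * xpow x D"
proof
  let ?g = "\<lambda>m. m - single x D"
  let ?c = "\<Sum>m\<in>keys f. single (?g m) (lookup f m)"
  have g: "?g m + single x D = m" if "m \<in> keys f" for m
    by (rule poly_mapping_eqI) (use h[OF that] in \<open>auto simp: lookup_add lookup_minus lookup_single when_def\<close>)
  have "f = (\<Sum>m\<in>keys f. single m (lookup f m))"
    by (rule poly_mapping_eq_sum_single)
  also have "\<dots> = (\<Sum>m\<in>keys f. single (?g m) (lookup f m) * xpow x D)"
    by (intro sum.cong refl) (simp add: mult_single g)
  finally show "f = ?c * xpow x D" by (simp add: sum_distrib_right)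
  have "keys (?g m) \<subseteq> V" if m: "m \<in> keys f" for m
  proof
    fix y assume y: "y \<in> keys (?g m)"
    then have "y \<noteq> x" using h[OF m] by (auto simp: in_keys_iff lookup_minus lookup_single)
    moreover have "y \<in> keys m"
      using y by (auto simp: in_keys_iff lookup_minus lookup_single)
    ultimately show "y \<in> V" using indetsD[OF f m] by blast
  qed
  then have "single (?g m) (lookup f m) \<in> indets V"
    if "m \<in> keys f" for m
    using that by (auto simp: indets_def)
  then have "sum (\<lambda>m. single (?g m) (lookup f m)) A \<in> indets V"
    if "A \<subseteq> keys f" for A
    using that by (induction A rule: infinite_finite_induct) (auto intro: indets_add)
  then show "?c \<in> indets V" by blast
qed

text \<open>Plays the part of a coefficient of a univariate polynomial over k[V]: the pieces c x^D
  suffice, and no isomorphism with k[V][x] is set up.\<close>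

lemma xcomp_eq:
  fixes f :: "('n::finite, 'k::comm_ring_1) mpol"
  assumes "f \<in> indets (insert x V)" "x \<notin> V"
  shows "\<exists>c\<in>indets V. xcomp x D f = c * xpow x D"
  using assms by (intro xhomogeneous_eq indets_wcomp) (auto simp: in_keys_iff lookup_wcomp)

lemma wdeg_diff_top:
  fixes p q :: "'a \<Rightarrow>\<^sub>0 'r::ab_group_add"
  assumes "wdeg w p \<le> D" "wdeg w q \<le> D" "wcomp w D p = wcomp w D q" "p - q \<noteq> 0"
  shows "wdeg w (p - q) < D"
proof -
  have "wdeg w (p - q) \<le> D" using wdeg_diff_le[of w p q] assms by simp
  moreover have "wdeg w (p - q) \<noteq> D"
    using wcomp_wdeg_nonzero[OF assms(4), of w] assms(3) by (auto simp: wcomp_diff)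
  ultimately show ?thesis by simp
qed

lemma wdeg_wcomp_le: "wdeg w (wcomp w D p) \<le> D" for p :: "'a \<Rightarrow>\<^sub>0 'r::zero"
  by (rule wdeg_leI) (auto simp: in_keys_iff lookup_wcomp)

lemma wcomp_0_weight: "wdeg w p = 0 \<Longrightarrow> wcomp w 0 p = p" for p :: "'a \<Rightarrow>\<^sub>0 'r::comm_monoid_add"
  using sum_wcomp[of w p 0] by simp

text \<open>Divisibility is taken in the full ring; between members of k[V] it agrees with
  divisibility in k[V] by \<open>indets_factor\<close>.\<close>

definition prime_in :: "'n set \<Rightarrow> ('n::finite, 'k::comm_ring_1) mpol \<Rightarrow> bool" where
  "prime_in V p \<longleftrightarrow> p \<in> indets V \<and> p \<noteq> 0 \<and>
     (\<forall>g\<in>indets V. \<forall>h\<in>indets V. p dvd g * h \<longrightarrow> p dvd g \<or> p dvd h)"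

definition factorial_in :: "'n set \<Rightarrow> ('n::finite, 'k::comm_ring_1) mpol itself \<Rightarrow> bool" where
  "factorial_in V T \<longleftrightarrow> (\<forall>p :: ('n, 'k) mpol. p \<in> indets V \<longrightarrow> irreducible p \<longrightarrow> prime_in V p)"

text \<open>As p is free of x, the component of degree D in x of the quotient is again a quotient,
  and it contains the factor x^D, which cancels.\<close>

lemma dvd_xpow_cancel:
  fixes p :: "('n::finite, 'k::idom) mpol"
  assumes p: "p \<in> indets V" "p \<noteq> 0" and c: "c \<in> indets V" and x: "x \<notin> V"
    and dvd: "p dvd c * xpow x D"
  shows "p dvd c"
proof -
  obtain q where q: "c * xpow x D = p * q" using dvd by (auto simp: dvd_def)
  have d0: "xdeg x p = 0" "xdeg x c = 0" using p c x by (auto simp: indets_iff_xdeg)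
  have dx: "xdeg x (xpow x D :: ('n, 'k) mpol) = D" by (auto simp: wdeg_def)
  have "xdeg x q \<le> D"
  proof (cases "q = 0")
    case False
    then have "xdeg x q = xdeg x (c * xpow x D)" using q p d0 by (simp add: wdeg_mult)
    also have "\<dots> \<le> D" using wdeg_mult_le[of "\<lambda>m. lookup m x" c "xpow x D"] d0 dx by simp
    finally show ?thesis .
  qed simp
  then have "xcomp x (0 + D) (p * q) = xcomp x 0 p * xcomp x D q"
    using d0 by (intro wcomp_mult_top) auto
  moreover have "xcomp x (0 + D) (c * xpow x D) = xcomp x 0 c * xcomp x D (xpow x D)"
    using d0 dx by (intro wcomp_mult_top) auto
  ultimately have e: "c * xpow x D = p * xcomp x D q"
    using d0 q by (simp add: wcomp_0_weight wcomp_single)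
  obtain c' where "xcomp x D q = c' * xpow x D"
  proof -
    have "insert x (- {x}) = UNIV" by auto
    then show ?thesis using that xcomp_eq[of q x "- {x}" D] by auto
  qed
  then have "xpow x D * c = xpow x D * (p * c')" using e by (simp add: algebra_simps)
  then have "c = p * c'" by (rule mpol_mult_cancel) simp
  then show ?thesis by simp
qed

text \<open>Gauss's lemma: a prime of k[V] stays prime in k[V][x]. If p divides f g, it divides the
  product of the leading coefficients in x, hence one of them; removing that leading term lowers the
  sum of the two degrees in x.\<close>

lemma prime_in_insert:
  fixes p :: "('n::finite, 'k::idom) mpol"
  assumes p: "prime_in V p" and x: "x \<notin> V"
  shows "prime_in (insert x V) p"
proof -
  let ?V = "insert x V"
  have pV: "p \<in> indets V" and p0: "p \<noteq> 0" using p by (auto simp: prime_in_def)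
  have "p dvd f \<or> p dvd g" if "f \<in> indets ?V" "g \<in> indets ?V" "p dvd f * g" for f g
    using that
  proof (induction "xdeg x f + xdeg x g" arbitrary: f g rule: less_induct)
    case less
    show ?case
    proof (cases "f = 0 \<or> g = 0")
      case False
      then have nz: "f \<noteq> 0" "g \<noteq> 0" by auto
      let ?D = "xdeg x f" and ?E = "xdeg x g"
      obtain c where c: "c \<in> indets V" "xcomp x ?D f = c * xpow x ?D"
        using xcomp_eq less.prems x by metis
      obtain c' where c': "c' \<in> indets V" "xcomp x ?E g = c' * xpow x ?E"
        using xcomp_eq less.prems x by metis
      obtain q where q: "f * g = p * q" using less.prems by (auto simp: dvd_def)
      have "q \<noteq> 0" using q nz by auto
      have d0: "xdeg x p = 0" using pV x by (auto simp: indets_iff_xdeg)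
      have dq: "xdeg x q = ?D + ?E"
        using q nz p0 \<open>q \<noteq> 0\<close> d0 by (metis additive_weight_lookup add_0 wdeg_mult)
      have "xcomp x (0 + (?D + ?E)) (p * q) = xcomp x 0 p * xcomp x (?D + ?E) q"
        using d0 dq by (intro wcomp_mult_top) auto
      moreover have "xcomp x (?D + ?E) (f * g) = xcomp x ?D f * xcomp x ?E g"
        by (intro wcomp_mult_top) auto
      ultimately have "c * c' * xpow x (?D + ?E) = p * xcomp x (?D + ?E) q"
        using q c c' d0 by (simp add: wcomp_0_weight algebra_simps mult_single single_add[symmetric])
      then have "p dvd c * c'"
        using dvd_xpow_cancel[OF pV p0 indets_mult[OF c(1) c'(1)] x] by (metis dvd_triv_left)
      then consider "p dvd c" | "p dvd c'" using p c c' by (auto simp: prime_in_def)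
      then show ?thesis
      proof cases
        case 1
        then have pt: "p dvd xcomp x ?D f" using c by simp
        define f1 where "f1 = f - xcomp x ?D f"
        have "p dvd f1 * g" using pt less.prems(3) by (simp add: f1_def left_diff_distrib)
        have "f1 \<in> indets ?V" unfolding f1_def using less.prems by (intro indets_diff indets_wcomp)
        have "p dvd f1 \<or> p dvd g"
        proof (cases "f1 = 0")
          case False
          then have "xdeg x f1 < ?D"
            unfolding f1_def by (intro wdeg_diff_top) (auto simp: wdeg_wcomp_le wcomp_wcomp)
          then show ?thesis
            using less.hyps[of f1 g] \<open>p dvd f1 * g\<close> \<open>f1 \<in> indets ?V\<close> less.prems by simp
        qed simp
        moreover have "f = f1 + xcomp x ?D f" by (simp add: f1_def)
        ultimately show ?thesis using pt by (metis dvd_add)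
      next
        case 2
        then have pt: "p dvd xcomp x ?E g" using c' by simp
        define g1 where "g1 = g - xcomp x ?E g"
        have "p dvd f * g1" using pt less.prems(3) by (simp add: g1_def right_diff_distrib)
        have "g1 \<in> indets ?V" unfolding g1_def using less.prems by (intro indets_diff indets_wcomp)
        have "p dvd f \<or> p dvd g1"
        proof (cases "g1 = 0")
          case False
          then have "xdeg x g1 < ?E"
            unfolding g1_def by (intro wdeg_diff_top) (auto simp: wdeg_wcomp_le wcomp_wcomp)
          then show ?thesis
            using less.hyps[of f g1] \<open>p dvd f * g1\<close> \<open>g1 \<in> indets ?V\<close> less.prems by simp
        qed simp
        moreover have "g = g1 + xcomp x ?E g" by (simp add: g1_def)
        ultimately show ?thesis using pt by (metis dvd_add)
      qed
    qed auto
  qed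
  then show ?thesis
    using pV p0 indets_mono[of V ?V] by (auto simp: prime_in_def)
qed

text \<open>Each irreducible factor of c is prime in k[V], hence by Gauss's lemma prime in k[V][x],
  so it divides q or r and can be cancelled there. After all of c is used up, p itself is factored,
  with the removed factors collected in c1 and c2.\<close>

lemma strip_content:
  fixes p q r :: "('n::finite, 'k::field) mpol"
  assumes fac: "factorial_in V TYPE(('n, 'k) mpol)" and x: "x \<notin> V"
    and c: "c \<in> indets V" "c \<noteq> 0"
    and q: "q \<in> indets (insert x V)" and r: "r \<in> indets (insert x V)"
    and eq: "c * p = q * r"
  shows "\<exists>c1 c2 q' r'. c1 \<in> indets V \<and> c2 \<in> indets V \<and> c1 \<noteq> 0 \<and> c2 \<noteq> 0 \<and>
    q = c1 * q' \<and> r = c2 * r' \<and> p = q' * r'"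
  using c q r eq
proof (induction "wdeg mdeg c" arbitrary: c q r rule: less_induct)
  case less
  show ?case
  proof (cases "c dvd 1")
    case True
    then obtain d where d: "c * d = 1" by (metis dvd_def)
    have "p = d * (c * p)" by (metis d mult.commute mult.left_commute mult.right_neutral)
    also have "\<dots> = d * q * r" using less.prems by (simp add: mult.assoc)
    finally have "p = d * q * r" .
    moreover have "q = c * (d * q)" by (metis d mult.assoc mult_1)
    ultimately show ?thesis using less.prems
      by (intro exI[of _ c] exI[of _ 1] exI[of _ "d * q"] exI[of _ r]) auto
  next
    case False
    obtain s where s: "irreducible s" "s dvd c"
      using exists_irreducible_factor[OF less.prems(2) False] by blast
    then obtain c' where c': "c = s * c'" by (auto simp: dvd_def)
    have nz: "s \<noteq> 0" "c' \<noteq> 0" using c' less.prems by auto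
    have sV: "s \<in> indets V" "c' \<in> indets V"
      using indets_factor[of s c' V] c' less.prems by auto
    have "prime_in V s" using fac s sV by (auto simp: factorial_in_def)
    then have s_prime: "prime_in (insert x V) s" using x by (rule prime_in_insert)
    have "wdeg mdeg s > 0" using s nz by (auto simp: irreducible_def mpol_unit_iff)
    then have lt: "wdeg mdeg c' < wdeg mdeg c" using c' nz by (simp add: wdeg_mult)
    have "s dvd q * r" using less.prems(5) c' by (metis dvd_def mult.assoc)
    then consider "s dvd q" | "s dvd r" using s_prime less.prems by (auto simp: prime_in_def)
    then show ?thesis
    proof cases
      case 1
      then obtain q0 where q0: "q = s * q0" by (auto simp: dvd_def)
      have q0V: "q0 \<in> indets (insert x V)"
        using indets_factor(2)[of s q0 "insert x V"] q0 less.prems by (cases "q0 = 0") (auto simp: nz)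
      have "s * (c' * p) = s * (q0 * r)" using less.prems(5) c' q0 by (simp add: mult.assoc)
      then have "c' * p = q0 * r" by (rule mpol_mult_cancel) (rule nz)
      then obtain c1 c2 q' r' where "c1 \<in> indets V" "c2 \<in> indets V" "c1 \<noteq> 0" "c2 \<noteq> 0"
        "q0 = c1 * q'" "r = c2 * r'" "p = q' * r'"
        using less.hyps[OF lt sV(2) nz(2) q0V less.prems(4)] by blast
      then show ?thesis using q0 sV nz
        by (intro exI[of _ "s * c1"] exI[of _ c2] exI[of _ q'] exI[of _ r'])
          (auto intro: indets_mult simp: mult.assoc)
    next
      case 2
      then obtain r0 where r0: "r = s * r0" by (auto simp: dvd_def)
      have r0V: "r0 \<in> indets (insert x V)"
        using indets_factor(2)[of s r0 "insert x V"] r0 less.prems by (cases "r0 = 0") (auto simp: nz)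
      have "s * (c' * p) = s * (q * r0)" using less.prems(5) c' r0 by (simp add: algebra_simps)
      then have "c' * p = q * r0" by (rule mpol_mult_cancel) (rule nz)
      then obtain c1 c2 q' r' where "c1 \<in> indets V" "c2 \<in> indets V" "c1 \<noteq> 0" "c2 \<noteq> 0"
        "q = c1 * q'" "r0 = c2 * r'" "p = q' * r'"
        using less.hyps[OF lt sV(2) nz(2) less.prems(3) r0V] by blast
      then show ?thesis using r0 sV nz
        by (intro exI[of _ c1] exI[of _ "s * c2"] exI[of _ q'] exI[of _ r'])
          (auto intro: indets_mult simp: mult.assoc)
    qed
  qed
qed

text \<open>An irreducible p that involves x is primitive: in c g = p h the part of c absorbed by p
  must be a unit, since otherwise p would be an associate of a member of k[V].\<close>

lemma irreducible_dvd_content_mult: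
  fixes p g :: "('n::finite, 'k::field) mpol"
  assumes fac: "factorial_in V TYPE(('n, 'k) mpol)" and x: "x \<notin> V"
    and p: "irreducible p" "p \<in> indets (insert x V)" "xdeg x p > 0"
    and c: "c \<in> indets V" "c \<noteq> 0" and g: "g \<in> indets (insert x V)" and dvd: "p dvd c * g"
  shows "p dvd g"
proof (cases "g = 0")
  case False
  obtain h where h: "c * g = p * h" using dvd by (auto simp: dvd_def)
  have "c * g \<in> indets (insert x V)"
    using c g indets_mono[of V "insert x V"] by (intro indets_mult) auto
  then have hV: "h \<in> indets (insert x V)" using h False c by (metis indets_factor(2) mpol_mult_eq_0_iff)
  obtain c1 c2 p' h' where s: "c1 \<in> indets V" "c1 \<noteq> 0" "p = c1 * p'" "g = p' * h'"
    using strip_content[OF fac x c p(2) hV h] by blast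
  have "c1 dvd 1 \<or> p' dvd 1" using p(1) s(3) by (auto simp: irreducible_def)
  then show ?thesis
  proof
    assume "c1 dvd 1"
    then obtain d where "c1 * d = 1" by (metis dvd_def)
    then have "p' = p * d" using s(3) by (metis mult.commute mult.left_commute mult.right_neutral)
    then show ?thesis using s(4) by simp
  next
    assume "p' dvd 1"
    then have "p \<in> indets V" using s mpol_unit_indets indets_mult by blast
    then show ?thesis using p(3) x by (auto simp: indets_iff_xdeg)
  qed
qed simp

section \<open>Pseudo-division and the induction over the variables\<close>

text \<open>Division with remainder in k(V)[x] with denominators cleared. Multiplying f by the
  leading coefficient of r lets the leading term cancel; the new element is still in J, and the
  minimality of r keeps the reduction going until it reaches zero.\<close>

lemma pseudo_reduce:
  fixes J :: "('n::finite, 'k::field) mpol set"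
  assumes x: "x \<notin> V" and J: "J \<subseteq> indets (insert x V)"
    and diff: "\<And>f g. f \<in> J \<Longrightarrow> g \<in> J \<Longrightarrow> f - g \<in> J"
    and scale: "\<And>a f. a \<in> indets (insert x V) \<Longrightarrow> f \<in> J \<Longrightarrow> a * f \<in> J"
    and r: "r \<in> J" "r \<noteq> 0" and min: "\<And>f. f \<in> J \<Longrightarrow> f \<noteq> 0 \<Longrightarrow> xdeg x r \<le> xdeg x f"
    and f: "f \<in> J"
  shows "\<exists>c\<in>indets V. c \<noteq> 0 \<and> r dvd c * f"
  using f
proof (induction "xdeg x f" arbitrary: f rule: less_induct)
  case less
  let ?V = "insert x V"
  have sub: "indets V \<subseteq> (indets ?V :: ('n, 'k) mpol set)" by (rule indets_mono) auto
  show ?case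
  proof (cases "f = 0")
    case True
    then show ?thesis by (intro bexI[of _ 1]) auto
  next
    case False
    let ?D = "xdeg x f" and ?E = "xdeg x r"
    have le: "?E \<le> ?D" using min less.prems False by blast
    obtain c where c: "c \<in> indets V" "xcomp x ?E r = c * xpow x ?E" using xcomp_eq r J x by blast
    obtain c' where c': "c' \<in> indets V" "xcomp x ?D f = c' * xpow x ?D"
      using xcomp_eq[of f x V ?D] less.prems J x by blast
    have c0: "c \<noteq> 0" using c wcomp_wdeg_nonzero[OF r(2)] by (metis mult_zero_left)
    define a where "a = c' * xpow x (?D - ?E)"
    define f1 where "f1 = c * f - a * r"
    have aV: "a \<in> indets ?V" unfolding a_def using c' sub by (intro indets_mult) auto
    have f1J: "f1 \<in> J" unfolding f1_def using c sub aV less.prems r by (intro diff scale) auto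
    have dc: "xdeg x c = 0" "xdeg x c' = 0" using c c' x by (auto simp: indets_iff_xdeg)
    have dx: "xdeg x (xpow x i :: ('n, 'k) mpol) = i" for i by (auto simp: wdeg_def)
    have da: "xdeg x a \<le> ?D - ?E"
      unfolding a_def using wdeg_mult_le[of "\<lambda>m. lookup m x" c' "xpow x (?D - ?E)"] dc dx
      by simp
    have "\<exists>d\<in>indets V. d \<noteq> 0 \<and> r dvd d * f1"
    proof (cases "f1 = 0")
      case True
      then show ?thesis by (intro bexI[of _ 1]) auto
    next
      case f1: False
      have "xdeg x f1 < ?D" unfolding f1_def
      proof (rule wdeg_diff_top)
        show "xdeg x (c * f) \<le> ?D"
          using wdeg_mult_le[of "\<lambda>m. lookup m x" c f] dc by simp
        show "xdeg x (a * r) \<le> ?D"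
          using wdeg_mult_le[of "\<lambda>m. lookup m x" a r] da le by simp
        show "c * f - a * r \<noteq> 0" using f1 f1_def by simp
        have 1: "xcomp x (0 + ?D) (c * f) = xcomp x 0 c * xcomp x ?D f"
          using dc by (intro wcomp_mult_top) auto
        have 2: "xcomp x (?D - ?E + ?E) (a * r) = xcomp x (?D - ?E) a * xcomp x ?E r"
          using da by (intro wcomp_mult_top) auto
        have 3: "xcomp x (0 + (?D - ?E)) a = xcomp x 0 c' * xcomp x (?D - ?E) (xpow x (?D - ?E))"
          unfolding a_def using dc dx by (intro wcomp_mult_top) auto
        have 4: "xpow x (?D - ?E) * xpow x ?E = (xpow x ?D :: ('n, 'k) mpol)"
          using le by (simp add: mult_single flip: single_add)
        show "xcomp x ?D (c * f) = xcomp x ?D (a * r)"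
          using 1 2 3 le dc c c' 4[symmetric] by (simp add: wcomp_0_weight wcomp_single algebra_simps)
      qed
      then show ?thesis using less.hyps f1J by blast
    qed
    then obtain d where d: "d \<in> indets V" "d \<noteq> 0" "r dvd d * f1" by blast
    have "d * c * f = d * f1 + d * a * r" by (simp add: f1_def algebra_simps)
    then have "r dvd d * c * f" using d by simp
    then show ?thesis using d c c0 by (intro bexI[of _ "d * c"]) (auto intro: indets_mult)
  qed
qed

text \<open>Over the fraction field of k[V], p is irreducible and does not divide g, so some
  combination of p and g is a nonzero constant; clearing denominators puts it into k[V]. The
  constant appears here as an element r of least degree in x of the ideal generated by p and g,
  which divides both up to factors from k[V].\<close>

lemma eliminate_variable:
  fixes p g :: "('n::finite, 'k::field) mpol"
  assumes fac: "factorial_in V TYPE(('n, 'k) mpol)" and x: "x \<notin> V"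
    and p: "irreducible p" "p \<in> indets (insert x V)" "xdeg x p > 0"
    and g: "g \<in> indets (insert x V)" and ndvd: "\<not> p dvd g"
  shows "\<exists>\<alpha>\<in>indets (insert x V). \<exists>\<beta>\<in>indets (insert x V). \<alpha> * p + \<beta> * g \<in> indets V \<and> \<alpha> * p + \<beta> * g \<noteq> 0"
proof -
  let ?V = "insert x V"
  define J where "J = {\<alpha> * p + \<beta> * g | \<alpha> \<beta>. \<alpha> \<in> indets ?V \<and> \<beta> \<in> indets ?V}"
  have J: "J \<subseteq> indets ?V" using p g by (auto simp: J_def intro!: indets_add indets_mult)
  have p0: "p \<noteq> 0" using p by (simp add: irreducible_def)
  have pJ: "p \<in> J" unfolding J_def by (intro CollectI exI[of _ 1] exI[of _ 0]) auto
  have gJ: "g \<in> J" unfolding J_def by (intro CollectI exI[of _ 0] exI[of _ 1]) auto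
  have diff: "u - v \<in> J" if uv: "u \<in> J" "v \<in> J" for u v
  proof -
    obtain a b where "u = a * p + b * g" "a \<in> indets ?V" "b \<in> indets ?V" using uv J_def by blast
    moreover obtain a' b' where "v = a' * p + b' * g" "a' \<in> indets ?V" "b' \<in> indets ?V" using uv J_def by blast
    ultimately show ?thesis unfolding J_def
      by (intro CollectI exI[of _ "a - a'"] exI[of _ "b - b'"]) (auto simp: algebra_simps intro: indets_diff)
  qed
  have scale: "c * u \<in> J" if c: "c \<in> indets ?V" and u: "u \<in> J" for c u
  proof -
    obtain a b where "u = a * p + b * g" "a \<in> indets ?V" "b \<in> indets ?V" using u J_def by blast
    then show ?thesis unfolding J_def using c
      by (intro CollectI exI[of _ "c * a"] exI[of _ "c * b"]) (auto simp: algebra_simps intro: indets_mult)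
  qed
  obtain r where r: "r \<in> J" "r \<noteq> 0" and min: "\<And>f. f \<in> J \<Longrightarrow> f \<noteq> 0 \<Longrightarrow> xdeg x r \<le> xdeg x f"
    using ex_has_least_nat[of "\<lambda>f. f \<in> J \<and> f \<noteq> 0" p "xdeg x"] pJ p0 by blast
  obtain c where c: "c \<in> indets V" "c \<noteq> 0" "r dvd c * p"
    using pseudo_reduce[OF x J diff scale r min pJ] by blast
  obtain c' where c': "c' \<in> indets V" "c' \<noteq> 0" "r dvd c' * g"
    using pseudo_reduce[OF x J diff scale r min gJ] by blast
  obtain q where q: "c * p = q * r" using c(3) by (auto simp: dvd_def mult.commute)
  have "c * p \<in> indets ?V" using c p indets_mono[of V ?V] by (intro indets_mult) auto
  then have qV: "q \<in> indets ?V" using q c p0 by (metis indets_factor(1) mpol_mult_eq_0_iff)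
  obtain c1 c2 q' r' where s: "c2 \<in> indets V" "c2 \<noteq> 0" "r = c2 * r'" "p = q' * r'"
    using strip_content[OF fac x c(1,2) qV subsetD[OF J r(1)] q] by blast
  \<comment> \<open>If q' were a unit, p would be an associate of r' and would divide r, hence c' g,
    hence g.\<close>
  have "\<not> q' dvd 1"
  proof
    assume "q' dvd 1"
    then obtain d where "q' * d = 1" by (metis dvd_def)
    then have "r' = p * d" using s(4) by (metis mult.commute mult.left_commute mult.right_neutral)
    then have "p dvd c' * g" using s(3) c'(3) by (meson dvd_mult dvd_trans dvd_triv_left)
    then show False
      using irreducible_dvd_content_mult[OF fac x p c'(1,2) g] ndvd by blast
  qed
  then have "r' dvd 1" using p(1) s(4) by (auto simp: irreducible_def)
  then have "r \<in> indets V" using s mpol_unit_indets indets_mult by blast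
  then show ?thesis using r by (auto simp: J_def)
qed

lemma factorial_in_insert:
  fixes V :: "'n::finite set"
  assumes fac: "factorial_in V TYPE(('n, 'k::field) mpol)" and x: "x \<notin> V"
  shows "factorial_in (insert x V) TYPE(('n, 'k) mpol)"
  unfolding factorial_in_def
proof (intro allI impI)
  fix p :: "('n, 'k) mpol"
  assume p: "p \<in> indets (insert x V)" "irreducible p"
  show "prime_in (insert x V) p"
  proof (cases "xdeg x p = 0")
    case True
    have "p \<in> indets V"
      unfolding indets_iff_xdeg using p(1) True by (metis indets_iff_xdeg insertE)
    then show ?thesis using fac p x by (intro prime_in_insert) (auto simp: factorial_in_def)
  next
    case False
    have dv: "p dvd h" if gh: "g \<in> indets (insert x V)" "h \<in> indets (insert x V)" "p dvd g * h" "\<not> p dvd g" for g h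
    proof -
      obtain a b where ab: "a * p + b * g \<in> indets V" "a * p + b * g \<noteq> 0"
        using eliminate_variable[OF fac x p(2,1) _ gh(1,4)] False by blast
      have "(a * p + b * g) * h = p * (a * h) + b * (g * h)" by (simp add: algebra_simps)
      then have "p dvd (a * p + b * g) * h" using gh(3) by simp
      then show ?thesis
        using irreducible_dvd_content_mult[OF fac x p(2,1) _ ab gh(2)] False by blast
    qed
    have "p \<noteq> 0" using p by (simp add: irreducible_def)
    then show ?thesis unfolding prime_in_def using p(1) dv by blast
  qed
qed

lemma factorial_in: "factorial_in V TYPE(('n::finite, 'k::field) mpol)"
proof -
  have "finite V" by simp
  then show ?thesis
  proof (induction V)
    case empty
    have "p dvd 1" if p: "p \<in> indets {}" "p \<noteq> 0" for p :: "('n, 'k) mpol"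
    proof -
      have "wdeg mdeg p \<le> 0" using p by (intro wdeg_leI) (auto simp: indets_def mdeg_def)
      then show ?thesis using p by (simp add: mpol_unit_iff)
    qed
    then show ?case by (auto simp: factorial_in_def irreducible_def)
  next
    case (insert x V)
    then show ?case by (intro factorial_in_insert)
  qed
qed

theorem irreducible_imp_prime_elem_mpol:
  fixes p :: "('n::finite, 'k::field) mpol"
  assumes "irreducible p"
  shows "prime_elem p"
  using factorial_in[of UNIV] assms unfolding factorial_in_def prime_in_def
  by (auto simp: prime_elem_def irreducible_def)

lemma exists_prime_factor:
  fixes c :: "('n::finite, 'k::field) mpol"
  assumes "c \<noteq> 0" "\<not> c dvd 1"
  shows "\<exists>p. prime_elem p \<and> p dvd c"
  using exists_irreducible_factor[OF assms] irreducible_imp_prime_elem_mpol by blast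

lemma prime_elem_imp_irreducible_mpol:
  fixes p :: "('n::finite, 'k::field) mpol"
  assumes "prime_elem p"
  shows "irreducible p"
  unfolding irreducible_def
proof (intro conjI allI impI)
  show "p \<noteq> 0" "\<not> p dvd 1" using assms by (auto simp: prime_elem_def)
  fix a b assume ab: "p = a * b"
  then have "p dvd a \<or> p dvd b" using assms by (auto simp: prime_elem_def)
  moreover have nz: "a \<noteq> 0" "b \<noteq> 0" using ab \<open>p \<noteq> 0\<close> by auto
  moreover have "wdeg mdeg p = wdeg mdeg a + wdeg mdeg b" using ab nz by (simp add: wdeg_mult)
  ultimately show "a dvd 1 \<or> b dvd 1"
    using tdeg_dvd_le[of p a] tdeg_dvd_le[of p b] by (auto simp: mpol_unit_iff)
qed

section \<open>Ring homomorphisms out of the polynomial ring\<close>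

text \<open>The additive extension of a map \<phi> of coefficients and a map E of monomials. It is a
  ring homomorphism when both maps respect the structure, and covers both the regrouping of
  variables and substitution.\<close>

definition hom_ext :: "('k::zero \<Rightarrow> 's::comm_semiring_1) \<Rightarrow> ('a \<Rightarrow> 's) \<Rightarrow> ('a \<Rightarrow>\<^sub>0 'k) \<Rightarrow> 's" where
  "hom_ext \<phi> E p = (\<Sum>m\<in>keys p. \<phi> (lookup p m) * E m)"

lemma hom_ext_single: "\<phi> 0 = 0 \<Longrightarrow> hom_ext \<phi> E (single m c) = \<phi> c * E m"
  by (simp add: hom_ext_def)

lemma hom_ext_0 [simp]: "hom_ext \<phi> E 0 = 0"
  by (simp add: hom_ext_def)

lemma hom_ext_superset:
  assumes "finite A" "keys p \<subseteq> A" "\<phi> 0 = 0"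
  shows "hom_ext \<phi> E p = (\<Sum>m\<in>A. \<phi> (lookup p m) * E m)"
  unfolding hom_ext_def using assms by (intro sum.mono_neutral_left) (auto simp: in_keys_iff)

lemma hom_ext_add:
  assumes "\<phi> 0 = 0" "\<And>a b. \<phi> (a + b) = \<phi> a + \<phi> b"
  shows "hom_ext \<phi> E (p + q) = hom_ext \<phi> E p + hom_ext \<phi> E (q :: 'a \<Rightarrow>\<^sub>0 'k::comm_monoid_add)"
proof -
  let ?A = "keys p \<union> keys q"
  have "hom_ext \<phi> E (p + q) = (\<Sum>m\<in>?A. \<phi> (lookup (p + q) m) * E m)"
    using assms keys_add[of p q] by (intro hom_ext_superset) simp_all
  moreover have "hom_ext \<phi> E p = (\<Sum>m\<in>?A. \<phi> (lookup p m) * E m)"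
    using assms by (intro hom_ext_superset) auto
  moreover have "hom_ext \<phi> E q = (\<Sum>m\<in>?A. \<phi> (lookup q m) * E m)"
    using assms by (intro hom_ext_superset) auto
  ultimately show ?thesis by (simp add: lookup_add assms distrib_right sum.distrib)
qed

lemma hom_ext_mult:
  fixes p q :: "'a::comm_monoid_add \<Rightarrow>\<^sub>0 'k::comm_semiring_1"
  assumes \<phi>: "\<phi> 0 = 0" "\<And>a b. \<phi> (a + b) = \<phi> a + \<phi> b" "\<And>a b. \<phi> (a * b) = \<phi> a * \<phi> b"
    and E: "\<And>a b. E (a + b) = E a * E b"
  shows "hom_ext \<phi> E (p * q) = hom_ext \<phi> E p * hom_ext \<phi> E q"
proof (induction p rule: poly_mapping_additive_induct)
  case (1 a c)
  show ?case
  proof (induction q rule: poly_mapping_additive_induct)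
    case (1 b d)
    then show ?case by (simp add: mult_single hom_ext_single \<phi> E mult_ac)
  next
    case (2 p q)
    then show ?case by (simp add: hom_ext_add[OF \<phi>(1,2)] distrib_left)
  qed
qed (simp add: distrib_right hom_ext_add \<phi>)

lemma single_sum: "single a (sum f A) = (\<Sum>i\<in>A. single a (f i))"
  by (induction A rule: infinite_finite_induct) (auto simp: single_add)

section \<open>Height\<close>

definition mrestr :: "'n set \<Rightarrow> ('n \<Rightarrow>\<^sub>0 nat) \<Rightarrow> ('n \<Rightarrow>\<^sub>0 nat)" where
  "mrestr V m = Poly_Mapping.mapp (\<lambda>y c. c when y \<in> V) m"

lemma lookup_mrestr: "lookup (mrestr V m) y = (lookup m y when y \<in> V)"
  by (auto simp: mrestr_def lookup_mapp when_def in_keys_iff)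

lemma mrestr_add: "mrestr V (a + b) = mrestr V a + mrestr V b"
  by (rule poly_mapping_eqI) (simp add: lookup_mrestr lookup_add when_add_distrib)

lemma keys_mrestr: "keys (mrestr V m) = keys m \<inter> V"
  by (auto simp: in_keys_iff lookup_mrestr when_def split: if_splits)

lemma mrestr_split: "mrestr V m + mrestr (- V) m = m"
  by (rule poly_mapping_eqI) (simp add: lookup_mrestr lookup_add when_def)

lemma mrestr_id: "keys m \<subseteq> V \<Longrightarrow> mrestr V m = m"
  by (rule poly_mapping_eqI) (auto simp: lookup_mrestr when_def in_keys_iff)

lemma mrestr_0: "keys m \<subseteq> V \<Longrightarrow> mrestr (- V) m = 0"
  by (rule poly_mapping_eqI) (auto simp: lookup_mrestr when_def in_keys_iff)

text \<open>A polynomial as a polynomial in the variables outside \<open>V\<close> with coefficients in \<open>k[V]\<close>.\<close>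

definition collect_vars :: "'n set \<Rightarrow> ('n::finite, 'k::comm_ring_1) mpol \<Rightarrow> ('n \<Rightarrow>\<^sub>0 nat) \<Rightarrow>\<^sub>0 ('n, 'k) mpol" where
  "collect_vars V = hom_ext (\<lambda>c. single 0 (const c))
     (\<lambda>m. single (mrestr (- V) m) (single (mrestr V m) 1))"

lemma collect_vars_add: "collect_vars V (p + q) = collect_vars V p + collect_vars V q"
  unfolding collect_vars_def by (rule hom_ext_add) (auto simp: single_add)

lemma collect_vars_mult: "collect_vars V (p * q) = collect_vars V p * collect_vars V q"
  unfolding collect_vars_def by (rule hom_ext_mult) (auto simp: single_add mult_single mrestr_add)

lemma collect_vars_single:
  "collect_vars V (single m c) = single (mrestr (- V) m) (single (mrestr V m) c)"
  unfolding collect_vars_def by (simp add: hom_ext_single mult_single)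

lemma collect_vars_indets:
  assumes "p \<in> indets V"
  shows "collect_vars V p = single 0 p"
proof -
  have "collect_vars V p = (\<Sum>m\<in>keys p. single 0 (single m (lookup p m)))"
    unfolding collect_vars_def hom_ext_def using assms
    by (intro sum.cong refl) (auto simp: mult_single indets_def mrestr_id mrestr_0)
  then show ?thesis by (simp flip: single_sum poly_mapping_eq_sum_single)
qed

lemma collect_vars_coefficients:
  "p \<in> indets W \<Longrightarrow> lookup (collect_vars V p) \<mu> \<in> indets (W \<inter> V)"
proof -
  assume p: "p \<in> indets W"
  have "lookup (collect_vars V p) \<mu> = (\<Sum>m\<in>keys p.
     (single (mrestr V m) (lookup p m) when mrestr (- V) m = \<mu>))"
    by (simp add: collect_vars_def hom_ext_def lookup_sum mult_single lookup_single)
  moreover have "sum (\<lambda>m. single (mrestr V m) (lookup p m) when mrestr (- V) m = \<mu>) A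
       \<in> indets (W \<inter> V)" if "A \<subseteq> keys p" for A
    using that
  proof (induction A rule: infinite_finite_induct)
    case (insert x A)
    have "keys (mrestr V x) \<subseteq> W \<inter> V"
      using insert.prems p by (auto simp: keys_mrestr indets_def)
    then have "single (mrestr V x) (lookup p x) \<in> indets (W \<inter> V)"
      by (auto simp: indets_def)
    then have "(single (mrestr V x) (lookup p x) when mrestr (- V) x = \<mu>) \<in> indets (W \<inter> V)"
      by (simp add: when_def)
    then show ?case using insert by (simp add: indets_add)
  qed auto
  ultimately show ?thesis by simp
qed

lemma collect_vars_expand:
  "hom_ext (\<lambda>c. c) (\<lambda>\<mu>. single \<mu> 1) (collect_vars V p) = p"
proof (induction p rule: poly_mapping_additive_induct)
  case (1 m c)
  then show ?case by (simp add: collect_vars_single hom_ext_single mult_single mrestr_split)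
qed (simp add: collect_vars_add hom_ext_add)

text \<open>The extension to the full ring of the contraction of P to k[V], see
  \<open>extend_ideal_eq\<close>. The description by coefficients makes primality a case of
  \<open>prime_ideal_coefficients\<close>.\<close>

definition extend_ideal :: "'n set \<Rightarrow> ('n::finite, 'k::comm_ring_1) mpol set \<Rightarrow> ('n, 'k) mpol set" where
  "extend_ideal V P = {p. \<forall>\<mu>. lookup (collect_vars V p) \<mu> \<in> P}"

lemma prime_ideal_extend:
  assumes P: "prime_ideal P"
  shows "prime_ideal (extend_ideal V P)"
  unfolding prime_ideal_def
proof (intro conjI allI impI)
  note I = is_idealD[OF prime_idealD(1)[OF P]]
  show "is_ideal (extend_ideal V P)"
  proof (rule is_idealI)
    show "0 \<in> extend_ideal V P" using I(1) by (simp add: extend_ideal_def collect_vars_def)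
    show "x + y \<in> extend_ideal V P" if "x \<in> extend_ideal V P" "y \<in> extend_ideal V P" for x y
      using that I(2) by (simp add: extend_ideal_def collect_vars_add lookup_add)
    show "c * x \<in> extend_ideal V P" if "x \<in> extend_ideal V P" for c x
      using that I
      by (auto simp: extend_ideal_def collect_vars_mult lookup_times_eq_sum when_def
          intro!: is_ideal_sum prime_idealD(1)[OF P])
  qed
  have "collect_vars V (1 :: ('a, 'b) mpol) = single 0 1" by (rule collect_vars_indets) simp
  then have "lookup (collect_vars V (1 :: ('a, 'b) mpol)) 0 = 1" by (simp only: lookup_single_eq)
  then show "1 \<notin> extend_ideal V P" using prime_idealD(2)[OF P]
    by (auto simp: extend_ideal_def intro!: exI[of _ 0])
  fix a b assume "a * b \<in> extend_ideal V P"
  then show "a \<in> extend_ideal V P \<or> b \<in> extend_ideal V P"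
    using prime_ideal_coefficients[OF P, of "collect_vars V a" "collect_vars V b"]
    by (simp add: extend_ideal_def collect_vars_mult)
qed

lemma extend_ideal_eq:
  assumes P: "is_ideal P"
  shows "extend_ideal V P = ideal_gen (P \<inter> indets V)"
proof
  note I = is_idealD[OF is_ideal_ideal_gen[of "P \<inter> indets V"]]
  show "extend_ideal V P \<subseteq> ideal_gen (P \<inter> indets V)"
  proof
    fix p assume p: "p \<in> extend_ideal V P"
    have "lookup (collect_vars V p) \<mu> \<in> ideal_gen (P \<inter> indets V)" for \<mu>
      using p collect_vars_coefficients[of p UNIV V \<mu>] ideal_gen_superset[of "P \<inter> indets V"]
      by (auto simp: extend_ideal_def)
    then have "hom_ext (\<lambda>c. c) (\<lambda>\<mu>. single \<mu> 1) (collect_vars V p) \<in> ideal_gen (P \<inter> indets V)"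
      unfolding hom_ext_def using I by (intro is_ideal_sum is_ideal_ideal_gen) auto
    then show "p \<in> ideal_gen (P \<inter> indets V)" by (simp add: collect_vars_expand)
  qed
  have "P \<inter> indets V \<subseteq> extend_ideal V P"
    using is_idealD(1)[OF P] by (auto simp: extend_ideal_def collect_vars_indets lookup_single when_def)
  moreover have "is_ideal (extend_ideal V P)"
  proof (rule is_idealI)
    note I = is_idealD[OF P]
    show "0 \<in> extend_ideal V P" using I(1) by (simp add: extend_ideal_def collect_vars_def)
    show "x + y \<in> extend_ideal V P" if "x \<in> extend_ideal V P" "y \<in> extend_ideal V P" for x y
      using that I(2) by (simp add: extend_ideal_def collect_vars_add lookup_add)
    show "c * x \<in> extend_ideal V P" if "x \<in> extend_ideal V P" for c x
      using that I
      by (auto simp: extend_ideal_def collect_vars_mult lookup_times_eq_sum when_def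
          intro!: is_ideal_sum P)
  qed
  ultimately show "ideal_gen (P \<inter> indets V) \<subseteq> extend_ideal V P" by (rule ideal_gen_minimal)
qed

lemma extend_ideal_mono: "is_ideal P \<Longrightarrow> V \<subseteq> W \<Longrightarrow> extend_ideal V P \<subseteq> extend_ideal W P"
  unfolding extend_ideal_eq
  by (intro module.span_mono[OF module_times] Int_mono order_refl indets_mono)

lemma extend_ideal_UNIV: "is_ideal P \<Longrightarrow> extend_ideal UNIV P = P"
  unfolding extend_ideal_eq
  using ideal_gen_minimal[of P P] ideal_gen_superset[of P] by auto

text \<open>A nonzero f in P witnessing that z depends on Y lies in the larger extension. In the
  smaller one z counts as an outer variable, so the coefficients of f would be members of P in k[Y],
  hence zero.\<close>

lemma extend_ideal_strict:
  assumes P: "is_ideal P" and Y: "P \<inter> indets Y = {0}" and Z: "P \<inter> indets (insert z Y) \<noteq> {0}"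
    and V: "Y \<subseteq> V" "z \<notin> V" "V \<subseteq> W" "z \<in> W"
  shows "extend_ideal V P \<subset> extend_ideal W P"
proof -
  obtain f where f: "f \<in> P" "f \<in> indets (insert z Y)" "f \<noteq> 0"
  proof -
    have "0 \<in> P \<inter> indets (insert z Y)" using is_idealD(1)[OF P] by simp
    then show ?thesis using Z that by blast
  qed
  have "f \<in> ideal_gen (P \<inter> indets W)"
    using f V ideal_gen_superset[of "P \<inter> indets W"] indets_mono[of "insert z Y" W] by auto
  then have fW: "f \<in> extend_ideal W P" by (simp add: extend_ideal_eq P)
  have "f \<notin> extend_ideal V P"
  proof
    assume "f \<in> extend_ideal V P"
    then have "lookup (collect_vars V f) \<mu> \<in> P \<inter> indets Y" for \<mu>
      using collect_vars_coefficients[OF f(2), of V \<mu>] V indets_mono[of "insert z Y \<inter> V" Y]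
      by (auto simp: extend_ideal_def)
    then have "collect_vars V f = 0" using Y by (intro poly_mapping_eqI) auto
    then show False using collect_vars_expand[of V f] f(3) by simp
  qed
  then show ?thesis using extend_ideal_mono[OF P V(3)] fW by blast
qed

section \<open>Independent variables modulo a prime, and primes of small height\<close>

lemma prime_height_ge:
  assumes "\<And>i. i \<le> m \<Longrightarrow> prime_ideal (Q i)" "\<And>i. i < m \<Longrightarrow> Q i \<subset> Q (Suc i)" "Q m = P"
  shows "enat m \<le> prime_height P"
  unfolding prime_height_def using assms by (intro SUP_upper) blast

lemma prime_height_le:
  assumes "\<And>m Q. \<lbrakk>\<And>i. i \<le> m \<Longrightarrow> prime_ideal (Q i); \<And>i. i < m \<Longrightarrow> Q i \<subset> Q (Suc i); Q m = P\<rbrakk> \<Longrightarrow> m \<le> h"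
  shows "prime_height P \<le> enat h"
  unfolding prime_height_def using assms by (intro SUP_least) auto

text \<open>If every set of \<open>n - 2\<close> variables is algebraically dependent modulo \<open>P\<close>, then extending the
  contractions of \<open>P\<close> to growing sets of variables gives a chain of length \<open>3\<close>.\<close>

lemma independent_variables:
  fixes P :: "('n::finite, 'k::field) mpol set"
  assumes P: "prime_ideal P" and ht: "prime_height P \<le> 2"
  shows "\<exists>Y. CARD('n) \<le> card Y + 2 \<and> P \<inter> indets Y = {0}"
proof (rule ccontr)
  assume neg: "\<not> ?thesis"
  have I: "is_ideal P" using P by (rule prime_idealD)
  have "P \<inter> indets {} = {0}"
  proof -
    have "p = 0" if p: "p \<in> P" "p \<in> indets {}" for p
    proof (rule ccontr)
      assume "p \<noteq> 0"
      moreover have "wdeg mdeg p \<le> 0" using p by (intro wdeg_leI) (auto simp: indets_def mdeg_def)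
      ultimately have "p dvd 1" by (simp add: mpol_unit_iff)
      then have "1 \<in> P" using p is_idealD(4)[OF I] by (metis dvdE)
      then show False using prime_idealD(2)[OF P] by simp
    qed
    then show ?thesis using is_idealD(1)[OF I] by auto
  qed
  then obtain Y where Y: "P \<inter> indets Y = {0}"
    and max: "\<And>Y'. P \<inter> indets Y' = {0} \<Longrightarrow> card Y' \<le> card Y"
    using ex_has_greatest_nat[of "\<lambda>Y. P \<inter> indets Y = {0}" "{}" card "CARD('n) + 1"]
    by (metis card_mono finite less_Suc_eq_le subset_UNIV Suc_eq_plus1)
  have dep: "P \<inter> indets (insert z Y) \<noteq> {0}" if "z \<notin> Y" for z
    using max[of "insert z Y"] that by auto
  have "card Y + 2 < CARD('n)" using neg Y by force
  then have "3 \<le> card (- Y)" by (simp add: Compl_eq_Diff_UNIV card_Diff_subset)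
  then obtain T where T: "T \<subseteq> - Y" "card T = 3" by (meson obtain_subset_with_card_n)
  then obtain z1 z2 z3 where z: "T = {z1, z2, z3}" "z1 \<noteq> z2" "z1 \<noteq> z3" "z2 \<noteq> z3"
    by (auto simp: card_3_iff)
  then have zY: "z1 \<notin> Y" "z2 \<notin> Y" "z3 \<notin> Y" using T by auto
  \<comment> \<open>Each set adds a variable that depends on Y; the last one is everything, so that
    the chain ends in P itself.\<close>
  define V where "V i = (if i = 0 then Y else if i = 1 then insert z1 Y
     else if i = 2 then insert z1 (insert z2 Y) else UNIV)" for i :: nat
  have "enat 3 \<le> prime_height P"
  proof (rule prime_height_ge)
    show "prime_ideal (extend_ideal (V i) P)" for i by (rule prime_ideal_extend[OF P])
    show "extend_ideal (V 3) P = P" by (simp add: V_def extend_ideal_UNIV I)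
    fix i :: nat assume "i < 3"
    then consider "i = 0" | "i = 1" | "i = 2" by linarith
    then show "extend_ideal (V i) P \<subset> extend_ideal (V (Suc i)) P"
    proof cases
      case 1
      then show ?thesis using zY z by (intro extend_ideal_strict[OF I Y dep[OF zY(1)]]) (auto simp: V_def)
    next
      case 2
      then show ?thesis using zY z by (intro extend_ideal_strict[OF I Y dep[OF zY(2)]]) (auto simp: V_def)
    next
      case 3
      then show ?thesis using zY z by (intro extend_ideal_strict[OF I Y dep[OF zY(3)]]) (auto simp: V_def)
    qed
  qed
  then have "enat 3 \<le> 2" using ht by (rule order_trans)
  then show False by (simp add: numeral_eq_enat)
qed

lemma prime_ideal_multiples:
  fixes p :: "'r::comm_ring_1"
  shows "prime_elem p \<Longrightarrow> prime_ideal {q. p dvd q}"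
  unfolding prime_ideal_def prime_elem_def by (auto intro!: is_idealI)

lemma prime_ideal_contains_prime_elem:
  fixes f :: "('n::finite, 'k::field) mpol"
  assumes P: "prime_ideal P" and f: "f \<in> P" "f \<noteq> 0"
  shows "\<exists>p\<in>P. prime_elem p"
  using f
proof (induction "wdeg mdeg f" arbitrary: f rule: less_induct)
  case less
  have "\<not> f dvd 1"
    using less.prems prime_idealD(2)[OF P] is_idealD(4)[OF prime_idealD(1)[OF P]] by (metis dvdE)
  then obtain p where p: "prime_elem p" "p dvd f" using exists_prime_factor less.prems by blast
  then obtain g where g: "f = p * g" by (auto simp: dvd_def)
  have "p \<in> P \<or> g \<in> P" using prime_idealD(3)[OF P] less.prems g by auto
  then show ?case
  proof
    assume "g \<in> P"
    moreover have "g \<noteq> 0" using g less.prems by auto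
    moreover have "wdeg mdeg p > 0" using p(1) by (auto simp: prime_elem_def mpol_unit_iff)
    ultimately show ?thesis using less.hyps[of g] g less.prems by (auto simp: wdeg_mult)
  qed (use p in blast)
qed

lemma prime_elem_dvd_prime_elem:
  fixes p q :: "('n::finite, 'k::field) mpol"
  assumes "prime_elem p" "prime_elem q" "p dvd q"
  shows "q dvd p"
proof -
  obtain a where a: "q = p * a" using assms(3) by (auto simp: dvd_def)
  moreover have "\<not> p dvd 1" using assms(1) by (simp add: prime_elem_def)
  ultimately have "a dvd 1"
    using prime_elem_imp_irreducible_mpol[OF assms(2)] by (auto simp: irreducible_def)
  then obtain b where "a * b = 1" by (metis dvd_def)
  then have "p = q * b" using a by (simp add: mult.assoc)
  then show ?thesis by simp
qed

text \<open>A nonzero prime inside (p) contains a prime element q. It is a multiple of p, hence an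
  associate of p, so the two ideals coincide and nothing fits strictly between 0 and (p).\<close>

lemma prime_height_principal_le:
  fixes p :: "('n::finite, 'k::field) mpol"
  assumes p: "prime_elem p"
  shows "prime_height {q. p dvd q} \<le> 1"
  unfolding one_enat_def
proof (rule prime_height_le)
  fix m and Q :: "nat \<Rightarrow> ('n, 'k) mpol set"
  assume Q: "\<And>i. i \<le> m \<Longrightarrow> prime_ideal (Q i)" "\<And>i. i < m \<Longrightarrow> Q i \<subset> Q (Suc i)" "Q m = {q. p dvd q}"
  show "m \<le> 1"
  proof (rule ccontr)
    assume "\<not> ?thesis"
    then obtain j where j: "m = Suc (Suc j)" by (metis One_nat_def Suc_le_D not_less_eq_eq)
    obtain f where "f \<in> Q (Suc j)" "f \<notin> Q j" using Q(2)[of j] j by auto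
    moreover have "0 \<in> Q j" using Q(1)[of j] j is_idealD(1) prime_idealD(1) by auto
    ultimately obtain q where q: "q \<in> Q (Suc j)" "prime_elem q"
      using prime_ideal_contains_prime_elem[of "Q (Suc j)" f] Q(1)[of "Suc j"] j by auto
    have "q \<in> Q m" using q(1) Q(2)[of "Suc j"] j by auto
    then have "q dvd p" using Q(3) prime_elem_dvd_prime_elem p q(2) by auto
    have "Q m \<subseteq> Q (Suc j)"
    proof
      fix u assume "u \<in> Q m"
      then have "q dvd u" using Q(3) \<open>q dvd p\<close> dvd_trans by auto
      moreover have "is_ideal (Q (Suc j))" using Q(1)[of "Suc j"] j prime_idealD(1) by auto
      ultimately show "u \<in> Q (Suc j)" using q(1) is_idealD(4) by (metis dvdE)
    qed
    then show False using Q(2)[of "Suc j"] j by auto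
  qed
qed

lemma height_le: "prime_ideal P \<Longrightarrow> I \<subseteq> P \<Longrightarrow> height I \<le> prime_height P"
  unfolding height_def by (intro INF_lower) auto

lemma height_2_not_multiples:
  fixes I :: "('n::finite, 'k::field) mpol set"
  assumes "height I = 2" "prime_elem p"
  shows "\<exists>h\<in>I. \<not> p dvd h"
proof (rule ccontr)
  assume "\<not> ?thesis"
  then have "height I \<le> prime_height {q. p dvd q}"
    using assms(2) by (intro height_le prime_ideal_multiples) auto
  also have "\<dots> \<le> 1" by (rule prime_height_principal_le) fact
  finally show False using assms(1) by simp
qed

lemma height_2_nonzero:
  fixes I :: "('n::finite, 'k::field) mpol set"
  assumes "height I = 2"
  shows "\<exists>h\<in>I. h \<noteq> 0"
proof (rule ccontr)
  assume "\<not> ?thesis"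
  then have sub: "I \<subseteq> {0}" by auto
  have pr: "prime_ideal {0 :: ('n, 'k) mpol}"
    by (auto simp: prime_ideal_def intro!: is_idealI)
  have "prime_height {0 :: ('n, 'k) mpol} \<le> enat 0"
  proof (rule prime_height_le)
    fix m and Q :: "nat \<Rightarrow> ('n, 'k) mpol set"
    assume Q: "\<And>i. i \<le> m \<Longrightarrow> prime_ideal (Q i)" "\<And>i. i < m \<Longrightarrow> Q i \<subset> Q (Suc i)" "Q m = {0}"
    show "m \<le> 0"
    proof (rule ccontr)
      assume "\<not> m \<le> 0"
      then obtain j where j: "m = Suc j" by (cases m) auto
      then have "Q j \<subset> {0}" using Q(2)[of j] Q(3) by auto
      moreover have "0 \<in> Q j" using Q(1)[of j] j is_idealD(1) prime_idealD(1) by auto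
      ultimately show False by auto
    qed
  qed
  then have "height I \<le> 0" using height_le[OF pr sub] by (simp add: zero_enat_def)
  then show False using assms by simp
qed

lemma height_attained:
  assumes "height I = enat h"
  shows "\<exists>P. prime_ideal P \<and> I \<subseteq> P \<and> prime_height P = enat h"
proof -
  have "{P. prime_ideal P \<and> I \<subseteq> P} \<noteq> {}"
  proof
    assume "{P. prime_ideal P \<and> I \<subseteq> P} = {}"
    then have "height I = \<infinity>" unfolding height_def by (simp only: image_empty Inf_empty top_enat_def)
    then show False using assms by simp
  qed
  then have "height I \<in> prime_height ` {P. prime_ideal P \<and> I \<subseteq> P}"
    unfolding height_def Inf_enat_def
    by (auto intro: LeastI)
  then show ?thesis using assms by auto
qed

section \<open>Ideals of linear subspaces\<close>

definition subst :: "('n \<Rightarrow> ('n::finite, 'k::comm_ring_1) mpol) \<Rightarrow> ('n, 'k) mpol \<Rightarrow> ('n, 'k) mpol" where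
  "subst s = hom_ext const (\<lambda>m. \<Prod>x\<in>UNIV. s x ^ lookup m x)"

lemma subst_add: "subst s (p + q) = subst s p + subst s q"
  unfolding subst_def by (rule hom_ext_add) (auto simp: single_add)

lemma subst_mult: "subst s (p * q) = subst s p * subst s q"
  unfolding subst_def
  by (rule hom_ext_mult) (auto simp: single_add mult_single lookup_add power_add prod.distrib)

lemma subst_single: "subst s (single m c) = const c * (\<Prod>x\<in>UNIV. s x ^ lookup m x)"
  unfolding subst_def by (rule hom_ext_single) simp

lemma subst_0 [simp]: "subst s 0 = 0"
  by (simp add: subst_def)

lemma subst_const [simp]: "subst s (const c) = const c"
  by (simp add: subst_single)

lemma subst_uminus: "subst s (- p) = - subst s p"
  using subst_add[of s p "- p"] by (simp add: eq_neg_iff_add_eq_0 add.commute)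

lemma subst_diff: "subst s (p - q) = subst s p - subst s q"
  using subst_add[of s p "- q"] by (simp add: subst_uminus)

lemma subst_xpow [simp]: "subst s (xpow x 1) = s x"
proof -
  have "(\<Prod>y\<in>UNIV. s y ^ lookup (single x 1) y) = (\<Prod>y\<in>UNIV. if y = x then s x else 1)"
    by (intro prod.cong refl) (auto simp: lookup_single when_def)
  then show ?thesis by (simp add: subst_single)
qed

lemma xpow_power: "(xpow x 1 :: ('n::finite, 'k::comm_ring_1) mpol) ^ i = xpow x i"
  by (induction i) (auto simp: mult_single simp flip: single_add)

lemma prod_xpow: "(\<Prod>x\<in>UNIV. (xpow x 1 :: ('n::finite, 'k::comm_ring_1) mpol) ^ lookup m x) = single m 1"
proof -
  have "(\<Prod>x\<in>A. (xpow x 1 :: ('n::finite, 'k::comm_ring_1) mpol) ^ lookup m x) =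
      single (\<Sum>x\<in>A. single x (lookup m x)) 1" for A
    unfolding xpow_power by (induction A rule: infinite_finite_induct) (auto simp: mult_single)
  moreover have "(\<Sum>x\<in>UNIV. single x (lookup m x)) = m"
    by (rule poly_mapping_eqI) (simp add: lookup_sum lookup_single when_def)
  ultimately show ?thesis by simp
qed

lemma subst_cong:
  assumes "p \<in> indets V" "\<And>x. x \<in> V \<Longrightarrow> s x = s' x"
  shows "subst s p = subst s' p"
  unfolding subst_def hom_ext_def
proof (intro sum.cong refl arg_cong2[of _ _ _ _ "(*)"] prod.cong)
  fix m x assume m: "m \<in> keys p"
  show "s x ^ lookup m x = s' x ^ lookup m x"
  proof (cases "x \<in> V")
    case False
    then have "lookup m x = 0" using indetsD[OF assms(1) m, of x] by (auto simp: in_keys_iff)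
    then show ?thesis by simp
  qed (simp add: assms)
qed

lemma subst_xpow_id: "subst (\<lambda>x. xpow x 1) p = p"
  by (induction p rule: poly_mapping_additive_induct)
    (simp_all only: subst_single prod_xpow subst_add, simp add: mult_single)

lemma subst_indets_id:
  assumes "p \<in> indets V" "\<And>x. x \<in> V \<Longrightarrow> s x = xpow x 1"
  shows "subst s p = p"
  using subst_cong[OF assms(1), of s "\<lambda>x. xpow x 1"] assms(2) subst_xpow_id[of p] by simp

lemma is_ideal_prod_diff:
  assumes I: "is_ideal I" and d: "\<And>x. x \<in> A \<Longrightarrow> f x - g x \<in> I"
  shows "prod f A - prod g A \<in> (I :: 'r::comm_ring_1 set)"
  using d
proof (induction A rule: infinite_finite_induct)
  case (insert x A)
  have "prod f (insert x A) - prod g (insert x A) = f x * (prod f A - prod g A) + (f x - g x) * prod g A"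
    using insert by (simp add: algebra_simps)
  then show ?case using insert is_idealD(2,3,4)[OF I] by simp
qed (auto simp: is_idealD(1)[OF I])

lemma subst_congruent:
  assumes I: "is_ideal I" and d: "\<And>x. xpow x 1 - s x \<in> I"
  shows "p - subst s p \<in> I"
proof (induction p rule: poly_mapping_additive_induct)
  case (1 m c)
  have "xpow x 1 ^ i - s x ^ i \<in> I" for x i
    using is_ideal_prod_diff[OF I, of "{..<i}" "\<lambda>_. xpow x 1" "\<lambda>_. s x"] d by simp
  then have "(\<Prod>x\<in>UNIV. xpow x 1 ^ lookup m x) - (\<Prod>x\<in>UNIV. s x ^ lookup m x) \<in> I"
    by (intro is_ideal_prod_diff I)
  then have "const c * (single m 1 - (\<Prod>x\<in>UNIV. s x ^ lookup m x)) \<in> I"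
    unfolding prod_xpow using is_idealD(3)[OF I] by blast
  then show ?case by (simp add: subst_single right_diff_distrib mult_single)
next
  case (2 p q)
  then show ?case using is_idealD(2)[OF I, of "p - subst s p" "q - subst s q"]
    by (simp add: subst_add algebra_simps)
qed

text \<open>The ideal of the graph of a substitution is its kernel. The substitution fixes each
  \<open>s x\<close> because \<open>s x\<close> is free of W, so it kills the generators; conversely
  p and \<open>subst s p\<close> are congruent modulo the generators.\<close>

lemma graph_ideal_iff:
  fixes s :: "'n \<Rightarrow> ('n::finite, 'k::comm_ring_1) mpol"
  assumes s: "\<And>x. x \<notin> W \<Longrightarrow> s x = xpow x 1" "\<And>x. x \<in> W \<Longrightarrow> s x \<in> indets (- W)"
  shows "p \<in> ideal_gen ((\<lambda>x. xpow x 1 - s x) ` W) \<longleftrightarrow> subst s p = 0"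
proof
  let ?I = "ideal_gen ((\<lambda>x. xpow x 1 - s x) ` W)"
  note I = is_ideal_ideal_gen[of "(\<lambda>x. xpow x 1 - s x) ` W"]
  have ker: "is_ideal {p. subst s p = 0}" by (rule is_idealI) (auto simp: subst_add subst_mult)
  have "subst s (s x) = s x" if "x \<in> W" for x
    using s that by (intro subst_indets_id[of _ "- W"]) auto
  then have "(\<lambda>x. xpow x 1 - s x) ` W \<subseteq> {p. subst s p = 0}"
    by (auto simp: subst_diff simp del: One_nat_def)
  then show "p \<in> ?I \<Longrightarrow> subst s p = 0" using ideal_gen_minimal[OF _ ker] by blast
  have "xpow x 1 - s x \<in> ?I" for x
    using s(1)[of x] is_idealD(1)[OF I] ideal_gen_superset[of "(\<lambda>x. xpow x 1 - s x) ` W"]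
    by (cases "x \<in> W") auto
  then have "p - subst s p \<in> ?I" by (rule subst_congruent[OF I])
  then show "subst s p = 0 \<Longrightarrow> p \<in> ?I" by simp
qed

lemma prime_graph_ideal:
  fixes s :: "'n \<Rightarrow> ('n::finite, 'k::field) mpol"
  assumes s: "\<And>x. x \<notin> W \<Longrightarrow> s x = xpow x 1" "\<And>x. x \<in> W \<Longrightarrow> s x \<in> indets (- W)"
  shows "prime_ideal (ideal_gen ((\<lambda>x. xpow x 1 - s x) ` W))"
  unfolding prime_ideal_def
proof (intro conjI allI impI is_ideal_ideal_gen)
  note iff = graph_ideal_iff[OF s, simplified]
  show "1 \<notin> ideal_gen ((\<lambda>x. xpow x 1 - s x) ` W)"
    using subst_const[of s 1] iff[of 1] by simp
  show "a \<in> ideal_gen ((\<lambda>x. xpow x 1 - s x) ` W) \<or> b \<in> ideal_gen ((\<lambda>x. xpow x 1 - s x) ` W)"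
    if "a * b \<in> ideal_gen ((\<lambda>x. xpow x 1 - s x) ` W)" for a b
    using that by (simp add: iff subst_mult)
qed

lemma prime_height_mono:
  assumes PP': "prime_ideal P'" "P \<subseteq> P'"
  shows "prime_height P \<le> prime_height P'"
  unfolding prime_height_def[of P]
proof (rule SUP_least, clarsimp)
  fix m Q assume Q: "\<forall>i\<le>m. prime_ideal (Q i)" "\<forall>i<m. Q i \<subset> Q (Suc i)" "P = Q m"
  show "enat m \<le> prime_height P'"
  proof (cases "P = P'")
    case True
    then show ?thesis using Q by (intro prime_height_ge[of m Q]) auto
  next
    case False
    have "enat (Suc m) \<le> prime_height P'"
      using Q PP' False by (intro prime_height_ge[of _ "Q(Suc m := P')"]) (auto simp: le_Suc_eq less_Suc_eq)
    then show ?thesis by (meson enat_ord_simps(1) le_SucI order_refl order_trans)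
  qed
qed

lemma height_prime: "prime_ideal P \<Longrightarrow> height P = prime_height P"
  by (intro antisym height_le) (auto simp: height_def intro!: INF_greatest prime_height_mono)

lemma unmixed_prime: "prime_ideal P \<Longrightarrow> unmixed P"
proof -
  assume P: "prime_ideal P"
  have "Q = P" if Q: "Q \<in> associated_primes P" for Q
  proof -
    obtain a where a: "Q = {r. r * a \<in> P}" "prime_ideal Q" using Q by (auto simp: associated_primes_def)
    have "a \<notin> P" using a prime_idealD(2)[OF a(2)] by auto
    then show ?thesis using a(1) prime_idealD(3)[OF P] is_idealD(4)[OF prime_idealD(1)[OF P]] by auto
  qed
  then show ?thesis using height_prime[OF P] by (auto simp: unmixed_def)
qed

lemma mem_ideal_gen_singleton: "p \<in> ideal_gen {l} \<longleftrightarrow> l dvd p"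
  by (auto simp: module.span_singleton[OF module_times] dvd_def mult.commute)

lemma graph_form_nonunit:
  fixes c :: "('n::finite, 'k::field) mpol"
  assumes "c \<in> indets (- {x})"
  shows "xpow x 1 - c \<noteq> 0" and "wdeg mdeg (xpow x 1 - c) > 0"
proof -
  have "lookup c (single x 1) = 0"
    using indetsD[OF assms, of "single x 1" x] by (auto simp: in_keys_iff)
  then have k: "single x 1 \<in> keys (xpow x 1 - c)"
    by (simp add: in_keys_iff lookup_minus)
  then show "xpow x 1 - c \<noteq> 0" by auto
  have "mdeg (single x 1 :: 'n \<Rightarrow>\<^sub>0 nat) = 1"
    by (simp add: mdeg_def lookup_single when_def)
  then show "wdeg mdeg (xpow x 1 - c) > 0" using wdeg_ge[OF k, of mdeg] by simp
qed

text \<open>Call the two forms l1 and l2. Two members of Q without common factor yield, after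
  eliminating x_j, a nonzero member of Q free of x_j; let \<rho> be one of least degree. Modulo (l1,
  l2) such a polynomial can vanish only if l1 divides it. The quotient is again free of x_j and of
  smaller degree, so it is outside Q, and l1 must be in Q.\<close>

lemma graph_form_in_subprime:
  fixes Q :: "('n::finite, 'k::field) mpol set"
  assumes Q: "prime_ideal Q" and ij: "i \<noteq> j" and c: "c1 \<in> indets (- {i, j})" "c2 \<in> indets (- {i, j})"
    and sub: "Q \<subseteq> ideal_gen {xpow i 1 - c1, xpow j 1 - c2}"
    and p: "prime_elem p" "p \<in> Q" and g: "g \<in> Q" "\<not> p dvd g"
  shows "xpow i 1 - c1 \<in> Q"
proof -
  note I = is_idealD[OF prime_idealD(1)[OF Q]]
  let ?V = "- {j}"
  have UN: "insert j ?V = UNIV" by auto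
  have ex: "\<exists>\<rho>. \<rho> \<in> Q \<and> \<rho> \<in> indets ?V \<and> \<rho> \<noteq> 0"
  proof (cases "xdeg j p = 0")
    case True
    then show ?thesis using p by (intro exI[of _ p]) (auto simp: xdeg_0_iff prime_elem_def)
  next
    case False
    then obtain \<alpha> \<beta> where "\<alpha> * p + \<beta> * g \<in> indets ?V" "\<alpha> * p + \<beta> * g \<noteq> 0"
      using eliminate_variable[OF factorial_in, of j ?V p g] UN g prime_elem_imp_irreducible_mpol[OF p(1)]
      by auto
    moreover have "\<alpha> * p + \<beta> * g \<in> Q" using I p g by auto
    ultimately show ?thesis by blast
  qed
  obtain \<rho> where \<rho>: "\<rho> \<in> Q" "\<rho> \<in> indets ?V" "\<rho> \<noteq> 0"
    and min: "\<And>u. u \<in> Q \<Longrightarrow> u \<in> indets ?V \<Longrightarrow> u \<noteq> 0 \<Longrightarrow> wdeg mdeg \<rho> \<le> wdeg mdeg u"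
    using ex_has_least_nat[of "\<lambda>u. u \<in> Q \<and> u \<in> indets ?V \<and> u \<noteq> 0" _ "wdeg mdeg"] ex by metis
  let ?s = "\<lambda>x. if x = i then c1 else if x = j then c2 else xpow x 1"
  let ?t = "\<lambda>x. if x = i then c1 else xpow x 1"
  have "(\<lambda>x. xpow x 1 - ?s x) ` {i, j} = {xpow i 1 - c1, xpow j 1 - c2}" using ij by auto
  then have "\<rho> \<in> ideal_gen ((\<lambda>x. xpow x 1 - ?s x) ` {i, j})" using sub \<rho> by auto
  then have "subst ?s \<rho> = 0" using c by (subst (asm) graph_ideal_iff) auto
  \<comment> \<open>Since \<rho> is free of x_j, substituting for x_j has no effect, and membership
    in the ideal of two forms becomes divisibility by one.\<close>
  moreover have "subst ?s \<rho> = subst ?t \<rho>" by (rule subst_cong[OF \<rho>(2)]) auto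
  ultimately have "subst ?t \<rho> = 0" by simp
  then have "\<rho> \<in> ideal_gen ((\<lambda>x. xpow x 1 - ?t x) ` {i})"
    using c indets_mono[of "- {i, j}" "- {i}"] by (subst graph_ideal_iff) auto
  then have "xpow i 1 - c1 dvd \<rho>" by (simp add: mem_ideal_gen_singleton)
  then obtain \<rho>1 where r1: "\<rho> = (xpow i 1 - c1) * \<rho>1" by (auto simp: dvd_def)
  have c1i: "c1 \<in> indets (- {i})" using c indets_mono[of "- {i, j}" "- {i}"] by auto
  have nz: "\<rho>1 \<noteq> 0" using r1 \<rho> by auto
  have V1: "\<rho>1 \<in> indets ?V" using indets_factor(2) \<rho> r1 by blast
  have "wdeg mdeg \<rho>1 < wdeg mdeg \<rho>"
    using r1 nz graph_form_nonunit[OF c1i] by (simp add: wdeg_mult)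
  then have "\<rho>1 \<notin> Q" using min[OF _ V1 nz] by auto
  then show ?thesis using prime_idealD(3)[OF Q] r1 \<rho>(1) by blast
qed

text \<open>The chain 0, (l1), (l1, l2) gives height at least 2. In a longer chain the prime just
  below the top would contain a prime element and a further element not divisible by it; by
  \<open>graph_form_in_subprime\<close>, used for both orders of the variables, it would contain l1
  and l2 and equal the top.\<close>

lemma linear_codim_2:
  fixes c1 c2 :: "('n::finite, 'k::field) mpol"
  assumes ij: "i \<noteq> j" and c: "c1 \<in> indets (- {i, j})" "c2 \<in> indets (- {i, j})"
  shows "prime_ideal (ideal_gen {xpow i 1 - c1, xpow j 1 - c2})"
    and "prime_height (ideal_gen {xpow i 1 - c1, xpow j 1 - c2}) = 2"
proof -
  let ?P = "ideal_gen {xpow i 1 - c1, xpow j 1 - c2}"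
  let ?s = "\<lambda>x. if x = i then c1 else if x = j then c2 else xpow x 1"
  let ?t = "\<lambda>x. if x = i then c1 else xpow x 1"
  have Pim: "(\<lambda>x. xpow x 1 - ?s x) ` {i, j} = {xpow i 1 - c1, xpow j 1 - c2}" using ij by auto
  have "prime_ideal (ideal_gen ((\<lambda>x. xpow x 1 - ?s x) ` {i, j}))"
    using c by (intro prime_graph_ideal) auto
  then show P: "prime_ideal ?P" unfolding Pim .
  have c1i: "c1 \<in> indets (- {i})" and c2i: "c2 \<in> indets (- {i})" and c2j: "c2 \<in> indets (- {j})"
    using c indets_mono[of "- {i, j}" "- {i}"] indets_mono[of "- {i, j}" "- {j}"] by auto
  have Qim: "(\<lambda>x. xpow x 1 - ?t x) ` {i} = {xpow i 1 - c1}" by auto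
  have "prime_ideal (ideal_gen ((\<lambda>x. xpow x 1 - ?t x) ` {i}))"
    using c1i by (intro prime_graph_ideal) auto
  then have Q: "prime_ideal (ideal_gen {xpow i 1 - c1})" unfolding Qim .
  have pr0: "prime_ideal {0 :: ('n, 'k) mpol}"
    by (auto simp: prime_ideal_def intro!: is_idealI)
  define C where "C k = (if k = 0 then {0} else if k = 1 then ideal_gen {xpow i 1 - c1} else ?P)" for k :: nat
  have "enat 2 \<le> prime_height ?P"
  proof (rule prime_height_ge)
    show "prime_ideal (C k)" for k using P Q pr0 by (simp add: C_def)
    show "C 2 = ?P" by (simp add: C_def)
    fix k :: nat assume "k < 2"
    then consider "k = 0" | "k = 1" by linarith
    then show "C k \<subset> C (Suc k)"
    proof cases
      case 1
      have "xpow i 1 - c1 \<in> ideal_gen {xpow i 1 - c1}" by (simp add: mem_ideal_gen_singleton)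
      moreover have "xpow i 1 - c1 \<noteq> 0" by (rule graph_form_nonunit[OF c1i])
      ultimately have "{0} \<subset> ideal_gen {xpow i 1 - c1}"
        using is_idealD(1)[OF is_ideal_ideal_gen[of "{xpow i 1 - c1}"]] by (metis empty_iff empty_subsetI insert_iff insert_subset psubsetI)
      then show ?thesis using 1 by (simp add: C_def)
    next
      case 2
      have "xpow j 1 - c2 \<notin> ideal_gen ((\<lambda>x. xpow x 1 - ?t x) ` {i})"
      proof
        assume "xpow j 1 - c2 \<in> ideal_gen ((\<lambda>x. xpow x 1 - ?t x) ` {i})"
        then have "subst ?t (xpow j 1 - c2) = 0" using c1i by (subst (asm) graph_ideal_iff) auto
        moreover have "subst ?t c2 = c2" by (rule subst_indets_id[OF c2i]) auto
        ultimately show False using ij graph_form_nonunit(1)[OF c2j]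
          by (simp add: subst_diff del: One_nat_def)
      qed
      moreover have "ideal_gen {xpow i 1 - c1} \<subseteq> ?P" by (intro module.span_mono[OF module_times]) auto
      moreover have "xpow j 1 - c2 \<in> ?P" using ideal_gen_superset by blast
      ultimately show ?thesis using 2 unfolding Qim by (auto simp: C_def simp del: One_nat_def)
    qed
  qed
  moreover have "prime_height ?P \<le> enat 2"
  proof (rule prime_height_le)
    fix m and Q :: "nat \<Rightarrow> ('n, 'k) mpol set"
    assume Q: "\<And>i. i \<le> m \<Longrightarrow> prime_ideal (Q i)" "\<And>i. i < m \<Longrightarrow> Q i \<subset> Q (Suc i)" "Q m = ?P"
    show "m \<le> 2"
    proof (rule ccontr)
      assume "\<not> ?thesis"
      then have "m \<ge> 3" by simp
      then have k: "m = Suc (Suc (Suc (m - 3)))" by simp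
      define k where "k = m - 3"
      note k = k[folded k_def]
      have pk: "prime_ideal (Q k)" "prime_ideal (Q (Suc k))" "prime_ideal (Q (Suc (Suc k)))"
        using Q(1) k by auto
      obtain f where "f \<in> Q (Suc k)" "f \<notin> Q k" using Q(2)[of k] k by auto
      then obtain p where p: "p \<in> Q (Suc k)" "prime_elem p"
        using prime_ideal_contains_prime_elem[OF pk(2), of f] is_idealD(1)[OF prime_idealD(1)[OF pk(1)]] by auto
      obtain g where g: "g \<in> Q (Suc (Suc k))" "g \<notin> Q (Suc k)" using Q(2)[of "Suc k"] k by auto
      have ng: "\<not> p dvd g"
        using p(1) g(2) is_idealD(4)[OF prime_idealD(1)[OF pk(2)]] by (metis dvdE)
      have pQ: "p \<in> Q (Suc (Suc k))" using p Q(2)[of "Suc k"] k by auto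
      have strict: "Q (Suc (Suc k)) \<subset> ?P" using Q(2)[of "Suc (Suc k)"] Q(3) k by auto
      have "xpow i 1 - c1 \<in> Q (Suc (Suc k))"
        using strict by (intro graph_form_in_subprime[OF pk(3) ij c _ p(2) pQ g(1) ng]) auto
      moreover have "xpow j 1 - c2 \<in> Q (Suc (Suc k))"
        using strict ij c
        by (intro graph_form_in_subprime[OF pk(3) ij[symmetric], of c2 c1 p g])
          (auto simp: insert_commute p pQ g ng)
      ultimately have "?P \<subseteq> Q (Suc (Suc k))"
        using prime_idealD(1)[OF pk(3)] by (intro ideal_gen_minimal) auto
      then show False using strict by auto
    qed
  qed
  ultimately show "prime_height ?P = 2" by (simp add: numeral_eq_enat)
qed

section \<open>Graded submodules of free modules\<close>

text \<open>Degrees are integers here, unlike in \<open>wcomp\<close>, because shifting a grading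
  leads to negative degrees that must give zero instead of being truncated.\<close>

definition icomp :: "int \<Rightarrow> ('n::finite, 'k::zero) mpol \<Rightarrow> ('n, 'k) mpol" where
  "icomp t p = Poly_Mapping.mapp (\<lambda>m c. c when int (mdeg m) = t) p"

lemma lookup_icomp: "lookup (icomp t p) m = (lookup p m when int (mdeg m) = t)"
  by (auto simp: icomp_def lookup_mapp when_def in_keys_iff)

lemma icomp_0 [simp]: "icomp t 0 = 0"
  by (rule poly_mapping_eqI) (simp add: lookup_icomp)

lemma icomp_add: "icomp t (p + q) = icomp t p + icomp t (q :: ('n::finite, 'k::comm_monoid_add) mpol)"
  by (rule poly_mapping_eqI) (simp add: lookup_icomp lookup_add when_add_distrib)

lemma icomp_sum: "icomp t (sum f A) = (\<Sum>i\<in>A. icomp t (f i :: ('n::finite, 'k::comm_monoid_add) mpol))"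
  by (induction A rule: infinite_finite_induct) (auto simp: icomp_add)

lemma icomp_in_forms [simp]: "icomp t p \<in> forms t"
  by (auto simp: forms_def in_keys_iff lookup_icomp)

lemma icomp_forms: "p \<in> forms t \<Longrightarrow> icomp s p = (p when s = t)"
  by (rule poly_mapping_eqI) (auto simp: lookup_icomp forms_def when_def in_keys_iff)

lemma forms_0 [simp]: "0 \<in> forms t"
  by (simp add: forms_def)

lemma forms_add: "p \<in> forms t \<Longrightarrow> q \<in> forms t \<Longrightarrow> p + q \<in> forms t"
  using keys_add[of p q] by (auto simp: forms_def)

lemma forms_uminus: "p \<in> forms t \<Longrightarrow> - p \<in> forms t" for p :: "('n::finite, 'k::ab_group_add) mpol"
  by (simp add: forms_def keys_uminus_eq)

lemma forms_diff: "p \<in> forms t \<Longrightarrow> q \<in> forms t \<Longrightarrow> p - q \<in> forms t"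
  for p :: "('n::finite, 'k::ab_group_add) mpol"
  using forms_add[of p t "- q"] forms_uminus[of q t] by simp

lemma mdeg_add: "mdeg (a + b) = mdeg a + mdeg b"
  using additive_weight_mdeg by (auto simp: additive_weight_def)

lemma forms_mult: "p \<in> forms s \<Longrightarrow> q \<in> forms t \<Longrightarrow> p * q \<in> forms (s + t)"
  for p :: "('n::finite, 'k::comm_ring_1) mpol"
proof -
  assume pq: "p \<in> forms s" "q \<in> forms t"
  have "int (mdeg m) = s + t" if "m \<in> keys (p * q)" for m
  proof -
    obtain a b where "m = a + b" "a \<in> keys p" "b \<in> keys q"
      using keys_mult[of p q] \<open>m \<in> _\<close> by blast
    then show ?thesis using pq by (auto simp: forms_def mdeg_add)
  qed
  then show ?thesis by (simp add: forms_def)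
qed

lemma forms_neg: "t < 0 \<Longrightarrow> p \<in> forms t \<Longrightarrow> p = 0"
  by (rule poly_mapping_eqI) (auto simp: forms_def in_keys_iff)

lemma const_in_forms [simp]: "const c \<in> forms 0"
  by (simp add: forms_def mdeg_def)

lemma forms_0_const: "p \<in> forms 0 \<Longrightarrow> p = const (lookup p 0)"
  by (rule poly_mapping_eqI)
    (auto simp: forms_def in_keys_iff mdeg_eq_0_iff lookup_single when_def)

lemma icomp_mult_form:
  fixes p q :: "('n::finite, 'k::comm_ring_1) mpol"
  assumes q: "q \<in> forms s"
  shows "icomp t (p * q) = icomp (t - s) p * q"
proof (induction p rule: poly_mapping_additive_induct)
  case (1 m c)
  have 1: "single m c \<in> forms (int (mdeg m))" by (simp add: forms_def)
  have "icomp t (single m c * q) = (single m c * q when t = int (mdeg m) + s)"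
    using forms_mult[OF 1 q] by (rule icomp_forms)
  moreover have "icomp (t - s) (single m c) = (single m c when t - s = int (mdeg m))"
    using 1 by (rule icomp_forms)
  ultimately show ?case by (simp add: when_def)
qed (simp add: icomp_add distrib_right)

text \<open>Stated for all large bounds, so that finitely many coordinates of a vector can share one
  bound.\<close>

lemma sum_icomp: "\<exists>T. \<forall>T'\<ge>T. (\<Sum>t\<in>{0..T'}. icomp t p) = p"
proof (intro exI[of _ "int (wdeg mdeg p)"] allI impI poly_mapping_eqI)
  fix T' m assume T': "int (wdeg mdeg p) \<le> T'"
  show "lookup (\<Sum>t\<in>{0..T'}. icomp t p) m = lookup p m"
  proof (cases "m \<in> keys p")
    case True
    then have "int (mdeg m) \<in> {0..T'}" using T' wdeg_ge[OF True, of mdeg] by auto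
    then show ?thesis by (simp add: lookup_sum lookup_icomp when_def sum.delta)
  qed (auto simp: lookup_sum lookup_icomp in_keys_iff)
qed

definition vcomp :: "nat list \<Rightarrow> int \<Rightarrow> (nat \<Rightarrow>\<^sub>0 ('n::finite, 'k::zero) mpol) \<Rightarrow> (nat \<Rightarrow>\<^sub>0 ('n, 'k) mpol)" where
  "vcomp a t v = Poly_Mapping.mapp (\<lambda>i. icomp (t - int (a ! i))) v"

lemma lookup_vcomp: "lookup (vcomp a t v) i = icomp (t - int (a ! i)) (lookup v i)"
  by (auto simp: vcomp_def lookup_mapp when_def in_keys_iff)

lemma vcomp_0 [simp]: "vcomp a t 0 = 0"
  by (rule poly_mapping_eqI) (simp add: lookup_vcomp)

lemma vcomp_add: "vcomp a t (u + v) = vcomp a t u + vcomp a t (v :: nat \<Rightarrow>\<^sub>0 ('n::finite, 'k::comm_monoid_add) mpol)"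
  by (rule poly_mapping_eqI) (simp add: lookup_vcomp lookup_add icomp_add)

lemma vcomp_sum: "vcomp a t (sum f A) = (\<Sum>i\<in>A. vcomp a t (f i :: nat \<Rightarrow>\<^sub>0 ('n::finite, 'k::comm_monoid_add) mpol))"
  by (induction A rule: infinite_finite_induct) (auto simp: vcomp_add)

lemma free_module_iff: "v \<in> free_module r \<longleftrightarrow> (\<forall>i\<ge>r. lookup v i = 0)"
  by (auto simp: free_module_def in_keys_iff subset_iff) (meson not_le)

lemma subspace_free_module: "pmod.subspace (free_module r)"
  by (auto simp: pmod.subspace_def free_module_iff lookup_add lookup_pscale)

lemmas free_module_closed = pmod.subspace_0[OF subspace_free_module]
  pmod.subspace_add[OF subspace_free_module] pmod.subspace_scale[OF subspace_free_module]
  pmod.subspace_diff[OF subspace_free_module] pmod.subspace_sum[OF subspace_free_module]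

lemma vcomp_in_graded_piece:
  "v \<in> free_module (length a) \<Longrightarrow> vcomp a t v \<in> graded_piece a t"
  by (auto simp: graded_piece_def free_module_iff lookup_vcomp)

lemma vcomp_graded_piece:
  assumes "v \<in> graded_piece a t"
  shows "vcomp a s v = (v when s = t)"
proof (rule poly_mapping_eqI)
  fix i
  show "lookup (vcomp a s v) i = lookup (v when s = t) i"
  proof (cases "i < length a")
    case True
    then have "lookup v i \<in> forms (t - int (a ! i))" using assms by (simp add: graded_piece_def)
    then show ?thesis by (simp add: lookup_vcomp icomp_forms when_def)
  next
    case False
    then have "lookup v i = 0" using assms by (simp add: graded_piece_def free_module_iff)
    then show ?thesis by (simp add: lookup_vcomp when_def)
  qed
qed

lemma graded_piece_subset: "graded_piece a t \<subseteq> free_module (length a)"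
  by (auto simp: graded_piece_def)

lemma graded_piece_0 [simp]: "0 \<in> graded_piece a t"
  by (simp add: graded_piece_def free_module_iff)

lemma graded_piece_add: "u \<in> graded_piece a t \<Longrightarrow> v \<in> graded_piece a t \<Longrightarrow> u + v \<in> graded_piece a t"
  by (auto simp: graded_piece_def free_module_closed lookup_add intro: forms_add)

lemma graded_piece_diff: "u \<in> graded_piece a t \<Longrightarrow> v \<in> graded_piece a t \<Longrightarrow> u - v \<in> graded_piece a t"
  by (auto simp: graded_piece_def free_module_closed lookup_minus intro: forms_diff)

lemma graded_piece_scale: "p \<in> forms s \<Longrightarrow> v \<in> graded_piece a t \<Longrightarrow> pscale p v \<in> graded_piece a (s + t)"
  by (auto simp: graded_piece_def free_module_closed lookup_pscale dest!: forms_mult[of p s] simp: algebra_simps)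

lemma graded_piece_neg: "t < 0 \<Longrightarrow> v \<in> graded_piece a t \<Longrightarrow> v = 0"
proof (rule poly_mapping_eqI)
  fix i assume v: "t < 0" "v \<in> graded_piece a t"
  show "lookup v i = lookup 0 i"
  proof (cases "i < length a")
    case True
    then show ?thesis using v forms_neg[of "t - int (a ! i)"] by (auto simp: graded_piece_def)
  qed (use v in \<open>auto simp: graded_piece_def free_module_iff\<close>)
qed

lemma vcomp_neg: "t < 0 \<Longrightarrow> v \<in> free_module (length a) \<Longrightarrow> vcomp a t v = 0"
  using graded_piece_neg vcomp_in_graded_piece by blast

lemma icomp_neg: "t < 0 \<Longrightarrow> icomp t p = 0"
  using forms_neg icomp_in_forms by blast

lemma sum_vcomp:
  fixes v :: "nat \<Rightarrow>\<^sub>0 ('n::finite, 'k::comm_ring_1) mpol"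
  assumes v: "v \<in> free_module (length a)"
  shows "\<exists>T. \<forall>T'\<ge>T. (\<Sum>t\<in>{0..T'}. vcomp a t v) = v"
proof -
  have "\<exists>T. \<forall>T'\<ge>T. (\<Sum>t\<in>{0..T'}. icomp t (lookup v i)) = lookup v i" for i
    by (rule sum_icomp)
  then obtain T where T: "\<And>i T'. T' \<ge> T i \<Longrightarrow>
     (\<Sum>t\<in>{0..T'}. icomp t (lookup v i)) = lookup v i" by metis
  let ?T = "\<Sum>i<length a. \<bar>T i\<bar> + int (a ! i)"
  have "(\<Sum>t\<in>{0..T'}. vcomp a t v) = v" if T': "T' \<ge> ?T" for T'
  proof (rule poly_mapping_eqI)
    fix i
    show "lookup (\<Sum>t\<in>{0..T'}. vcomp a t v) i = lookup v i"
    proof (cases "i < length a")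
      case True
      have "\<bar>T i\<bar> + int (a ! i) \<le> ?T" using True by (intro member_le_sum) auto
      then have le: "T i \<le> T' - int (a ! i)" "0 \<le> T' - int (a ! i)" using T' by auto
      have "(\<Sum>t\<in>{0..T'}. icomp (t - int (a ! i)) (lookup v i)) =
            (\<Sum>t\<in>{- int (a ! i)..T' - int (a ! i)}. icomp t (lookup v i))"
        by (rule sum.reindex_bij_witness[of _ "\<lambda>t. t + int (a ! i)" "\<lambda>t. t - int (a ! i)"]) auto
      also have "\<dots> = (\<Sum>t\<in>{0..T' - int (a ! i)}. icomp t (lookup v i))"
        by (rule sum.mono_neutral_right) (auto simp: icomp_neg)
      also have "\<dots> = lookup v i" using T le by blast
      finally show ?thesis by (simp add: lookup_sum lookup_vcomp)
    next
      case False
      then have "lookup v i = 0" using v by (simp add: free_module_iff)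
      then show ?thesis by (simp add: lookup_sum lookup_vcomp)
    qed
  qed
  then show ?thesis by blast
qed

section \<open>Maps given by matrices, and graded submodules\<close>

text \<open>The map whose matrix has the vectors \<open>gs\<close> as columns. All differentials of
  the constructed resolution have this form.\<close>

definition lin :: "(nat \<Rightarrow>\<^sub>0 'r::comm_ring_1) list \<Rightarrow> (nat \<Rightarrow>\<^sub>0 'r) \<Rightarrow> (nat \<Rightarrow>\<^sub>0 'r)" where
  "lin gs v = (\<Sum>i<length gs. pscale (lookup v i) (gs ! i))"

lemma lookup_lin: "lookup (lin gs v) j = (\<Sum>i<length gs. lookup v i * lookup (gs ! i) j)"
  by (simp add: lin_def lookup_sum lookup_pscale)

lemma lin_add: "lin gs (u + v) = lin gs u + lin gs v"
  by (rule poly_mapping_eqI) (simp add: lookup_lin lookup_add distrib_right sum.distrib)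

lemma lin_diff: "lin gs (u - v) = lin gs u - lin gs v"
  by (rule poly_mapping_eqI) (simp add: lookup_lin lookup_minus left_diff_distrib sum_subtractf)

lemma lin_scale: "lin gs (pscale c v) = pscale c (lin gs v)"
  by (rule poly_mapping_eqI) (simp add: lookup_lin lookup_pscale sum_distrib_left mult.assoc)

lemma lin_0 [simp]: "lin gs 0 = 0"
  by (rule poly_mapping_eqI) (simp add: lookup_lin)

lemma lin_sum: "lin gs (sum f A) = (\<Sum>i\<in>A. lin gs (f i))"
  by (induction A rule: infinite_finite_induct) (auto simp: lin_add)

lemma lin_single: "i < length gs \<Longrightarrow> lin gs (single i 1) = gs ! i"
  by (rule poly_mapping_eqI)
    (simp add: lookup_lin lookup_single when_def if_distrib[of "\<lambda>x. x * _"] cong: if_cong)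

lemma linear_on_lin: "linear_on M (lin gs)"
  by (simp add: linear_on_def lin_add lin_scale)

lemma single_in_free_module [simp]: "i < r \<Longrightarrow> single i c \<in> free_module r"
  by (auto simp: free_module_iff lookup_single when_def)

lemma span_eq_lin_image: "pmod.span (set gs) = lin gs ` free_module (length gs)"
proof
  have "set gs \<subseteq> lin gs ` free_module (length gs)"
  proof
    fix g assume "g \<in> set gs"
    then obtain i where "i < length gs" "gs ! i = g" by (auto simp: in_set_conv_nth)
    then show "g \<in> lin gs ` free_module (length gs)"
      by (intro rev_image_eqI[of "single i 1"]) (auto simp: lin_single)
  qed
  moreover have "pmod.subspace (lin gs ` free_module (length gs))"
    unfolding pmod.subspace_def
    by (auto simp flip: lin_add lin_scale intro!: imageI free_module_closed
        rev_image_eqI[of 0] simp: free_module_closed)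
  ultimately show "pmod.span (set gs) \<subseteq> lin gs ` free_module (length gs)" by (rule pmod.span_minimal)
  show "lin gs ` free_module (length gs) \<subseteq> pmod.span (set gs)"
  proof
    fix x assume "x \<in> lin gs ` free_module (length gs)"
    then obtain v where "x = lin gs v" by auto
    then show "x \<in> pmod.span (set gs)" by (simp only: lin_def) (intro pmod.span_sum pmod.span_scale pmod.span_base, simp)
  qed
qed

lemma vcomp_lin:
  fixes gs :: "(nat \<Rightarrow>\<^sub>0 ('n::finite, 'k::comm_ring_1) mpol) list"
  assumes g: "\<And>i. i < length gs \<Longrightarrow> gs ! i \<in> graded_piece c (int (as ! i))"
  shows "vcomp c t (lin gs v) = lin gs (vcomp as t v)"
proof (rule poly_mapping_eqI)
  fix j
  show "lookup (vcomp c t (lin gs v)) j = lookup (lin gs (vcomp as t v)) j"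
  proof (cases "j < length c")
    case True
    have "icomp (t - int (c ! j)) (lookup v i * lookup (gs ! i) j)
        = icomp (t - int (as ! i)) (lookup v i) * lookup (gs ! i) j"
      if "i < length gs" for i
    proof -
      have "lookup (gs ! i) j \<in> forms (int (as ! i) - int (c ! j))"
        using g[OF that] True by (simp add: graded_piece_def)
      then show ?thesis by (subst icomp_mult_form) auto
    qed
    then show ?thesis by (simp add: lookup_vcomp lookup_lin icomp_sum)
  next
    case False
    then have "lookup (gs ! i) j = 0" if "i < length gs" for i
      using g[OF that] by (simp add: graded_piece_def free_module_iff)
    then show ?thesis by (simp add: lookup_vcomp lookup_lin)
  qed
qed

lemma lin_graded_piece:
  fixes gs :: "(nat \<Rightarrow>\<^sub>0 ('n::finite, 'k::comm_ring_1) mpol) list"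
  assumes g: "\<And>i. i < length gs \<Longrightarrow> gs ! i \<in> graded_piece c (int (as ! i))"
    and len: "length gs = length as" and v: "v \<in> graded_piece as t"
  shows "lin gs v \<in> graded_piece c t"
proof -
  have "lin gs v \<in> free_module (length c)"
    unfolding lin_def using g graded_piece_subset by (intro free_module_closed) blast
  then have "vcomp c t (lin gs v) \<in> graded_piece c t" by (rule vcomp_in_graded_piece)
  then show ?thesis using vcomp_lin[of gs c as t v] g vcomp_graded_piece[OF v, of t] by simp
qed

definition graded_submodule :: "nat list \<Rightarrow> (nat \<Rightarrow>\<^sub>0 ('n::finite, 'k::comm_ring_1) mpol) set \<Rightarrow> bool" where
  "graded_submodule c M \<longleftrightarrow> pmod.subspace M \<and> M \<subseteq> free_module (length c) \<and> (\<forall>v\<in>M. \<forall>t. vcomp c t v \<in> M)"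

lemma graded_submodule_kernel:
  fixes gs :: "(nat \<Rightarrow>\<^sub>0 ('n::finite, 'k::comm_ring_1) mpol) list"
  assumes g: "\<And>i. i < length gs \<Longrightarrow> gs ! i \<in> graded_piece c (int (as ! i))"
  shows "graded_submodule as {v \<in> free_module (length as). lin gs v = 0}"
  unfolding graded_submodule_def
proof (intro conjI ballI allI)
  show "pmod.subspace {v \<in> free_module (length as). lin gs v = 0}"
    unfolding pmod.subspace_def by (auto simp: lin_add lin_scale free_module_closed)
  fix v t assume v: "v \<in> {v \<in> free_module (length as). lin gs v = 0}"
  then have "lin gs (vcomp as t v) = 0" using vcomp_lin[of gs c as t v] g by simp
  then show "vcomp as t v \<in> {v \<in> free_module (length as). lin gs v = 0}"
    using v vcomp_in_graded_piece[of v as t] graded_piece_subset by blast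
qed auto

section \<open>Finite generation and minimal generators\<close>

text \<open>A finite set T0 suffices for the coordinates in V. Where the new coordinate is at least
  the bound N of its values on T0, T0 still suffices; the finitely many slices with a smaller value
  are covered by the induction hypothesis.\<close>

lemma dickson_on:
  fixes S :: "('n \<Rightarrow> nat) set"
  assumes "finite V"
  shows "\<exists>T\<subseteq>S. finite T \<and> (\<forall>m\<in>S. \<exists>m'\<in>T. \<forall>x\<in>V. m' x \<le> m x)"
  using assms
proof (induction V arbitrary: S)
  case empty
  show ?case
  proof (cases "S = {}")
    case False
    then obtain m where "m \<in> S" by blast
    then show ?thesis by (intro exI[of _ "{m}"]) auto
  qed auto
next
  case (insert x V)
  obtain T0 where T0: "T0 \<subseteq> S" "finite T0" "\<And>m. m \<in> S \<Longrightarrow> \<exists>m'\<in>T0. \<forall>y\<in>V. m' y \<le> m y"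
    using insert.IH[of S] by auto
  define N where "N = (\<Sum>m\<in>T0. m x)"
  have N: "m x \<le> N" if "m \<in> T0" for m unfolding N_def using T0 that by (intro member_le_sum) auto
  have "\<forall>k. \<exists>T. T \<subseteq> {m\<in>S. m x = k} \<and> finite T \<and> (\<forall>m\<in>{m\<in>S. m x = k}. \<exists>m'\<in>T. \<forall>y\<in>V. m' y \<le> m y)"
    by (intro allI insert.IH)
  from choice[OF this] obtain T where T': "\<forall>k. T k \<subseteq> {m\<in>S. m x = k} \<and> finite (T k) \<and>
     (\<forall>m\<in>{m\<in>S. m x = k}. \<exists>m'\<in>T k. \<forall>y\<in>V. m' y \<le> m y)" ..
  then have T: "\<And>k. T k \<subseteq> {m\<in>S. m x = k}" "\<And>k. finite (T k)"
    "\<And>k m. m \<in> S \<Longrightarrow> m x = k \<Longrightarrow> \<exists>m'\<in>T k. \<forall>y\<in>V. m' y \<le> m y" by auto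
  show ?case
  proof (intro exI[of _ "T0 \<union> (\<Union>k<N. T k)"] conjI ballI)
    fix m assume m: "m \<in> S"
    show "\<exists>m'\<in>T0 \<union> (\<Union>k<N. T k). \<forall>y\<in>insert x V. m' y \<le> m y"
    proof (cases "m x < N")
      case True
      obtain m' where m': "m' \<in> T (m x)" "\<forall>y\<in>V. m' y \<le> m y" using T(3)[OF m refl] by blast
      then have "m' x = m x" using T(1) by auto
      then show ?thesis using m' True by (intro bexI[of _ m']) auto
    next
      case False
      obtain m' where "m' \<in> T0" "\<forall>y\<in>V. m' y \<le> m y" using T0(3)[OF m] by blast
      then show ?thesis using N[of m'] False by (intro bexI[of _ m']) auto
    qed
  qed (use T0 T(1,2) in \<open>blast+\<close>)
qed

lemma dickson:
  fixes S :: "('n::finite \<Rightarrow>\<^sub>0 nat) set"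
  shows "\<exists>T\<subseteq>S. finite T \<and> (\<forall>m\<in>S. \<exists>m'\<in>T. \<exists>\<mu>. m = m' + \<mu>)"
proof -
  obtain T where T: "T \<subseteq> lookup ` S" "finite T"
    "\<And>f. f \<in> lookup ` S \<Longrightarrow> \<exists>f'\<in>T. \<forall>x. f' x \<le> f x"
    using dickson_on[of UNIV "lookup ` S"] by auto
  obtain T' where T': "T' \<subseteq> S" "finite T'" "T = lookup ` T'"
    using finite_subset_image[OF T(2,1)] by blast
  have "\<exists>m'\<in>T'. \<exists>\<mu>. m = m' + \<mu>" if m: "m \<in> S" for m
  proof -
    obtain m' where m': "m' \<in> T'" "\<And>x. lookup m' x \<le> lookup m x"
      using T(3) m T'(3) by blast
    have "m = m' + (m - m')" by (rule poly_mapping_eqI) (simp add: lookup_add lookup_minus m')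
    then show ?thesis using m' by blast
  qed
  then show ?thesis using T' by blast
qed

text \<open>A term order on a free module: the basis index is treated as the exponent of one extra
  variable \<open>None\<close>, so that terms of the module become monomials and multiplication by a
  monomial becomes addition.\<close>

lemma term_order_embedding:
  obtains \<kappa> :: "nat \<times> ('n::finite \<Rightarrow>\<^sub>0 nat) \<Rightarrow> (nat \<Rightarrow>\<^sub>0 nat)" and \<iota>
  where "inj \<kappa>" "\<And>i m \<mu>. \<kappa> (i, m + \<mu>) = \<kappa> (i, m) + \<iota> \<mu>"
proof -
  obtain \<iota> :: "('n option \<Rightarrow>\<^sub>0 nat) \<Rightarrow> (nat \<Rightarrow>\<^sub>0 nat)" where
    inj: "inj \<iota>" and add: "\<And>a b. \<iota> (a + b) = \<iota> a + \<iota> b"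
    by (rule monomial_order_embedding) blast
  define L where "L m = (\<Sum>x\<in>UNIV. single (Some x) (lookup m x))" for m :: "'n \<Rightarrow>\<^sub>0 nat"
  have L_add: "L (a + b) = L a + L b" for a b by (simp add: L_def lookup_add single_add sum.distrib)
  have L1: "lookup (L m) (Some x) = lookup m x" for m x
    by (simp add: L_def lookup_sum lookup_single when_def)
  have L2: "lookup (L m) None = 0" for m
    by (simp add: L_def lookup_sum lookup_single when_def)
  define \<kappa> where "\<kappa> = (\<lambda>(i, m). \<iota> (L m + single None i))"
  have "inj \<kappa>"
  proof (rule injI, clarsimp)
    fix i m j m' assume "\<kappa> (i, m) = \<kappa> (j, m')"
    then have eq: "L m + single None i = L m' + single None j"
      using inj by (simp add: \<kappa>_def inj_def)
    have "i = j" using arg_cong[OF eq, of "\<lambda>p. lookup p None"] by (simp add: lookup_add L2)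
    moreover have "lookup m x = lookup m' x" for x
      using arg_cong[OF eq, of "\<lambda>p. lookup p (Some x)"] by (simp add: lookup_add L1 lookup_single)
    ultimately show "i = j \<and> m = m'" by (auto intro: poly_mapping_eqI)
  qed
  moreover have "\<kappa> (i, m + \<mu>) = \<kappa> (i, m) + \<iota> (L \<mu>)" for i m \<mu>
    unfolding \<kappa>_def by (simp add: L_add ac_simps flip: add)
  ultimately show ?thesis by (rule that)
qed

lemma finite_monomials: "finite {m :: 'n::finite \<Rightarrow>\<^sub>0 nat. int (mdeg m) = t}"
proof (rule finite_imageD)
  have le: "lookup m x \<le> mdeg m" for m :: "'n \<Rightarrow>\<^sub>0 nat" and x
    unfolding mdeg_def by (intro member_le_sum) auto
  let ?F = "{f :: 'n \<Rightarrow> nat. \<forall>x. (x \<in> UNIV \<longrightarrow> f x \<in> {..nat t}) \<and> (x \<notin> UNIV \<longrightarrow> f x = 0)}"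
  have "finite ?F" by (rule finite_set_of_finite_funs) (rule finite, rule finite_atMost)
  moreover have "lookup ` {m :: 'n \<Rightarrow>\<^sub>0 nat. int (mdeg m) = t} \<subseteq> ?F"
  proof
    fix f assume "f \<in> lookup ` {m :: 'n \<Rightarrow>\<^sub>0 nat. int (mdeg m) = t}"
    then obtain m :: "'n \<Rightarrow>\<^sub>0 nat" where m: "f = lookup m" "nat t = mdeg m" by force
    show "f \<in> ?F" unfolding m using le[of m] by simp
  qed
  ultimately show "finite (lookup ` {m :: 'n \<Rightarrow>\<^sub>0 nat. int (mdeg m) = t})"
    by (rule finite_subset[rotated])
  show "inj_on lookup {m :: 'n \<Rightarrow>\<^sub>0 nat. int (mdeg m) = t}"
    by (rule inj_onI) (rule poly_mapping_eq_iff[THEN iffD2])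
qed

definition terms :: "(nat \<Rightarrow>\<^sub>0 ('a \<Rightarrow>\<^sub>0 'k::zero)) \<Rightarrow> (nat \<times> 'a) set" where
  "terms v = {(i, m). lookup (lookup v i) m \<noteq> 0}"

lemma terms_empty_iff: "terms v = {} \<longleftrightarrow> v = 0"
  by (auto simp: terms_def poly_mapping_eq_iff fun_eq_iff)

lemma finite_terms: "finite (terms v)"
proof (rule finite_subset)
  show "terms v \<subseteq> (SIGMA i:keys v. keys (lookup v i))"
    by (auto simp: terms_def in_keys_iff)
qed auto

lemma terms_graded_piece:
  "v \<in> graded_piece c t \<Longrightarrow> terms v \<subseteq> (SIGMA i:{..<length c}. {m. int (mdeg m) = t - int (c ! i)})"
proof
  fix x assume v: "v \<in> graded_piece c t" and x: "x \<in> terms v"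
  obtain i m where im: "x = (i, m)" by fastforce
  then have nz: "lookup (lookup v i) m \<noteq> 0" using x by (simp add: terms_def)
  then have i: "i < length c"
    using v by (metis (no_types, lifting) free_module_iff graded_piece_def lookup_zero mem_Collect_eq not_le)
  then have "lookup v i \<in> forms (t - int (c ! i))" using v by (simp add: graded_piece_def)
  then show "x \<in> (SIGMA i:{..<length c}. {m. int (mdeg m) = t - int (c ! i)})"
    using nz i im by (auto simp: forms_def in_keys_iff)
qed

text \<open>Hilbert's basis theorem in the graded case: homogeneous elements whose leading terms generate
  all leading terms generate the module, as there are finitely many terms in each degree.\<close>

lemma graded_submodule_finitely_generated:
  fixes M :: "(nat \<Rightarrow>\<^sub>0 ('n::finite, 'k::field) mpol) set"
  assumes M: "graded_submodule c M"
  shows "\<exists>G. finite G \<and> G \<subseteq> M \<and> (\<forall>g\<in>G. \<exists>t. g \<in> graded_piece c t) \<and> pmod.span G = M"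
proof -
  obtain \<kappa> :: "nat \<times> ('n \<Rightarrow>\<^sub>0 nat) \<Rightarrow> (nat \<Rightarrow>\<^sub>0 nat)" and \<iota>
    where \<kappa>: "inj \<kappa>" "\<And>i m \<mu>. \<kappa> (i, m + \<mu>) = \<kappa> (i, m) + \<iota> \<mu>"
    by (rule term_order_embedding) blast
  have sub: "pmod.subspace M" and MF: "M \<subseteq> free_module (length c)" using M by (auto simp: graded_submodule_def)
  define lt where "lt v x \<longleftrightarrow> x \<in> terms v \<and> (\<forall>y\<in>terms v. \<kappa> y \<le> \<kappa> x)"
    for v :: "nat \<Rightarrow>\<^sub>0 ('n, 'k) mpol" and x
  have lt_ex: "\<exists>x. lt v x" if "v \<noteq> 0" for v
  proof -
    have "Max (\<kappa> ` terms v) \<in> \<kappa> ` terms v"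
      using that finite_terms[of v] terms_empty_iff[of v] by (intro Max_in) auto
    then obtain x where "x \<in> terms v" "Max (\<kappa> ` terms v) = \<kappa> x" by auto
    then show ?thesis using finite_terms[of v] unfolding lt_def
      by (metis Max_ge finite_imageI imageI)
  qed
  define H where "H = {v \<in> M. v \<noteq> 0 \<and> (\<exists>t. v \<in> graded_piece c t)}"
  define S where "S i = {m. \<exists>v\<in>H. lt v (i, m)}" for i
  have "\<exists>T\<subseteq>S i. finite T \<and> (\<forall>m\<in>S i. \<exists>m'\<in>T. \<exists>\<mu>. m = m' + \<mu>)" for i by (rule dickson)
  then obtain T where T: "\<And>i. T i \<subseteq> S i" "\<And>i. finite (T i)" "\<And>i m. m \<in> S i \<Longrightarrow> \<exists>m'\<in>T i. \<exists>\<mu>. m = m' + \<mu>"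
    by metis
  have "\<exists>g. \<forall>i m. m \<in> T i \<longrightarrow> g i m \<in> H \<and> lt (g i m) (i, m)"
    using T(1) unfolding S_def by (intro choice allI) blast
  then obtain g where g: "\<And>i m. m \<in> T i \<Longrightarrow> g i m \<in> H" "\<And>i m. m \<in> T i \<Longrightarrow> lt (g i m) (i, m)" by blast
  define G where "G = (\<Union>i<length c. g i ` T i)"
  have fin: "finite G" using T(2) by (simp add: G_def)
  have GH: "G \<subseteq> H" using g by (auto simp: G_def)
  have spM: "pmod.span G \<subseteq> M" using GH sub by (intro pmod.span_minimal) (auto simp: H_def)
  have homog: "v \<in> pmod.span G" if v: "v \<in> M" "v \<in> graded_piece c t" for v t
  proof (rule ccontr)
    assume nv: "v \<notin> pmod.span G"
    define B where "B = {v \<in> M. v \<in> graded_piece c t \<and> v \<notin> pmod.span G}"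
    define D where "D = {\<kappa> x | x v. v \<in> B \<and> lt v x}"
    have "D \<subseteq> \<kappa> ` (SIGMA i:{..<length c}. {m. int (mdeg m) = t - int (c ! i)})"
      using terms_graded_piece by (fastforce simp: D_def B_def lt_def)
    then have finD: "finite D" by (rule finite_subset) (intro finite_imageI finite_SigmaI finite_lessThan finite_monomials)
    have B0: "u \<noteq> 0" if "u \<in> B" for u using that pmod.span_zero[of G] by (auto simp: B_def)
    have "D \<noteq> {}" using nv v lt_ex[of v] B0[of v] by (auto simp: D_def B_def)
    then have "Min D \<in> D" using finD by (rule Min_in[rotated])
    then obtain u x where u: "u \<in> B" "lt u x" "Min D = \<kappa> x" by (auto simp: D_def)
    have umin: "\<kappa> x \<le> \<kappa> y" if "w \<in> B" "lt w y" for w y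
    proof -
      have "\<kappa> y \<in> D" unfolding D_def using that by blast
      then show ?thesis using u(3) finD Min_le[of D "\<kappa> y"] by simp
    qed
    obtain i m where x: "x = (i, m)" by fastforce
    have uH: "u \<in> H" using u B0 by (auto simp: B_def H_def)
    have ut: "u \<in> graded_piece c t" using u by (simp add: B_def)
    have im: "i < length c" "int (mdeg m) = t - int (c ! i)"
      using terms_graded_piece[OF ut] u(2) x by (auto simp: lt_def)
    have "m \<in> S i" using uH u x by (auto simp: S_def)
    then obtain m' \<mu> where m': "m' \<in> T i" "m = m' + \<mu>" using T(3) by blast
    let ?g = "g i m'"
    have gG: "?g \<in> G" using m' im by (auto simp: G_def)
    have ltg: "lt ?g (i, m')" using g m' by blast
    obtain t' where gt: "?g \<in> graded_piece c t'" using GH gG by (auto simp: H_def)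
    have "int (mdeg m') = t' - int (c ! i)" using terms_graded_piece[OF gt] ltg by (auto simp: lt_def)
    then have \<mu>t: "int (mdeg \<mu>) = t - t'" using im m' by (simp add: mdeg_add)
    \<comment> \<open>Chosen so that the multiple of the generator cancels the leading term of
      u.\<close>
    define \<alpha> where "\<alpha> = lookup (lookup u i) m / lookup (lookup ?g i) m'"
    let ?s = "single \<mu> \<alpha>"
    define w where "w = u - pscale ?s ?g"
    have "?s \<in> forms (t - t')" using \<mu>t by (auto simp: forms_def)
    then have sgt: "pscale ?s ?g \<in> graded_piece c t" using graded_piece_scale[OF _ gt] by fastforce
    have wt: "w \<in> graded_piece c t" unfolding w_def using ut sgt by (rule graded_piece_diff)
    have sgs: "pscale ?s ?g \<in> pmod.span G" using gG by (intro pmod.span_scale pmod.span_base)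
    have wB: "w \<in> B"
    proof -
      have "w \<in> M" unfolding w_def using u sgs spM sub by (intro pmod.subspace_diff) (auto simp: B_def)
      moreover have "w \<notin> pmod.span G"
      proof
        assume "w \<in> pmod.span G"
        then have "w + pscale ?s ?g \<in> pmod.span G" using sgs by (rule pmod.span_add)
        then show False using u by (simp add: w_def B_def)
      qed
      ultimately show ?thesis using wt by (simp add: B_def)
    qed
    obtain y where y: "lt w y" using lt_ex B0 wB by blast
    have mult: "lookup (?s * q) k = (\<Sum>b\<in>keys q. (\<alpha> * lookup q b when \<mu> + b = k))"
      for q :: "('n, 'k) mpol" and k
      by (cases "\<alpha> = 0") (simp_all add: lookup_times_eq_sum)
    have lk: "lookup (?s * q) (\<mu> + b) = \<alpha> * lookup q b" for q :: "('n, 'k) mpol" and b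
      by (auto simp: mult when_def sum.delta in_keys_iff)
    have terms_sg: "terms (pscale ?s ?g) \<subseteq> (\<lambda>(j, b). (j, b + \<mu>)) ` terms ?g"
    proof
      fix z assume z: "z \<in> terms (pscale ?s ?g)"
      obtain j k where jk: "z = (j, k)" by fastforce
      have "lookup (?s * lookup ?g j) k \<noteq> 0" using z jk by (simp add: terms_def lookup_pscale)
      then obtain b where b: "b \<in> keys (lookup ?g j)" "\<mu> + b = k"
        unfolding mult by (meson sum.not_neutral_contains_not_neutral when_neq_zero)
      then have "(j, b) \<in> terms ?g" by (auto simp: terms_def in_keys_iff)
      then show "z \<in> (\<lambda>(j, b). (j, b + \<mu>)) ` terms ?g"
        using b jk by (intro rev_image_eqI[of "(j, b)"]) (auto simp: add.commute)
    qed
    have sg_le: "\<kappa> z \<le> \<kappa> x" if "z \<in> terms (pscale ?s ?g)" for z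
    proof -
      have "z \<in> (\<lambda>(j, b). (j, b + \<mu>)) ` terms ?g" using terms_sg that by blast
      then obtain j b where jb: "z = (j, b + \<mu>)" "(j, b) \<in> terms ?g" by auto
      then have "\<kappa> (j, b) \<le> \<kappa> (i, m')" using ltg by (auto simp: lt_def)
      then show ?thesis using jb x m' \<kappa>(2) by (simp add: add_right_mono)
    qed
    have "terms w \<subseteq> terms u \<union> terms (pscale ?s ?g)"
      by (auto simp: w_def terms_def lookup_minus)
    then have "\<kappa> y \<le> \<kappa> x" using y sg_le u(2) unfolding lt_def by blast
    moreover have "\<kappa> x \<le> \<kappa> y" using umin wB y by blast
    \<comment> \<open>The leading term of w is at most x because both parts are, and at least x by
      the choice of u. But the coefficient of w at x has been cancelled.\<close>
    ultimately have "y = x" using \<kappa>(1) by (metis antisym injD)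
    then have "x \<in> terms w" using y by (simp add: lt_def)
    moreover have "lookup (lookup w i) m = 0"
    proof -
      have "lookup (lookup ?g i) m' \<noteq> 0" using ltg by (auto simp: lt_def terms_def)
      moreover have "lookup (?s * lookup ?g i) m = \<alpha> * lookup (lookup ?g i) m'"
        using lk[of "lookup ?g i" m'] unfolding m'(2) by (simp only: add.commute)
      ultimately show ?thesis by (simp add: w_def lookup_minus lookup_pscale \<alpha>_def)
    qed
    ultimately show False by (simp add: x terms_def)
  qed
  have "M \<subseteq> pmod.span G"
  proof
    fix v assume v: "v \<in> M"
    then have vF: "v \<in> free_module (length c)" using MF by blast
    obtain T' where "(\<Sum>t\<in>{0..T'}. vcomp c t v) = v" using sum_vcomp[OF vF] by blast
    moreover have "vcomp c t v \<in> pmod.span G" for t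
      using homog[OF _ vcomp_in_graded_piece[OF vF]] M v by (auto simp: graded_submodule_def)
    ultimately show "v \<in> pmod.span G" by (metis pmod.span_sum)
  qed
  then show ?thesis using fin GH spM by (intro exI[of _ G]) (auto simp: H_def)
qed

lemma graded_piece_nonzero_nat:
  assumes "v \<in> graded_piece c t" "v \<noteq> 0"
  shows "0 \<le> t"
  using graded_piece_neg assms not_le by blast

text \<open>A list of homogeneous generators of least length. If a relation had a coefficient with
  nonzero constant term, the corresponding generator could be expressed by the others and
  dropped.\<close>

lemma minimal_generators:
  fixes M :: "(nat \<Rightarrow>\<^sub>0 ('n::finite, 'k::field) mpol) set"
  assumes M: "graded_submodule c M"
  shows "\<exists>gs as. length gs = length as \<and> sorted as \<and>
    (\<forall>i<length as. gs ! i \<in> M \<and> gs ! i \<in> graded_piece c (int (as ! i))) \<and> pmod.span (set gs) = M \<and>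
    (\<forall>v\<in>free_module (length as). lin gs v = 0 \<longrightarrow> (\<forall>i. lookup v i \<in> irrelevant_ideal))"
proof -
  define good where "good L \<longleftrightarrow> (\<forall>(a, g)\<in>set L. g \<in> M \<and> g \<in> graded_piece c (int a)) \<and> pmod.span (snd ` set L) = M"
    for L :: "(nat \<times> (nat \<Rightarrow>\<^sub>0 ('n, 'k) mpol)) list"
  obtain G where G: "finite G" "G \<subseteq> M" "\<And>g. g \<in> G \<Longrightarrow> \<exists>t. g \<in> graded_piece c t" "pmod.span G = M"
    using graded_submodule_finitely_generated[OF M] by blast
  have "\<exists>t::nat. g \<in> graded_piece c (int t)" if "g \<in> G" for g
  proof (cases "g = 0")
    case False
    then show ?thesis using G(3)[OF that] graded_piece_nonzero_nat by (metis nonneg_int_cases)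
  qed auto
  then obtain dg where dg: "\<And>g. g \<in> G \<Longrightarrow> g \<in> graded_piece c (int (dg g))" by metis
  obtain l where l: "set l = G" using G(1) finite_list by blast
  have "good (map (\<lambda>g. (dg g, g)) l)" using l G dg by (auto simp: good_def image_image)
  then obtain L0 where L0: "good L0" "\<And>L. good L \<Longrightarrow> length L0 \<le> length L"
    using ex_has_least_nat[of good "map (\<lambda>g. (dg g, g)) l" length] by blast
  \<comment> \<open>Sorting by degree changes neither the set of generators nor the length, so the
    least length is kept.\<close>
  define L where "L = sort_key fst L0"
  have L: "good L" "\<And>L'. good L' \<Longrightarrow> length L \<le> length L'" using L0 by (auto simp: L_def good_def)
  define gs where "gs = map snd L"
  define as where "as = map fst L"
  have len: "length gs = length as" by (simp add: gs_def as_def)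
  have srt: "sorted as" by (simp add: as_def L_def)
  have g: "gs ! i \<in> M \<and> gs ! i \<in> graded_piece c (int (as ! i))" if "i < length as" for i
  proof -
    have "L ! i \<in> set L" using that by (auto simp: as_def)
    then have "snd (L ! i) \<in> M \<and> snd (L ! i) \<in> graded_piece c (int (fst (L ! i)))"
      using L(1) unfolding good_def by (metis (no_types, lifting) case_prodD prod.collapse)
    then show ?thesis using that by (simp add: gs_def as_def)
  qed
  have sp: "pmod.span (set gs) = M" using L(1) by (simp add: good_def gs_def)
  have "lookup v i \<in> irrelevant_ideal"
    if v: "v \<in> free_module (length as)" "lin gs v = 0" for v i
  proof (rule ccontr)
    assume n: "lookup v i \<notin> irrelevant_ideal"
    define \<gamma> where "\<gamma> = lookup (lookup v i) 0"
    have \<gamma>: "\<gamma> \<noteq> 0" using n by (simp add: \<gamma>_def irrelevant_ideal_def)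
    have i: "i < length as" using \<gamma> v(1) by (metis \<gamma>_def free_module_iff lookup_zero not_le)
    \<comment> \<open>In degree \<open>as ! i\<close> the i-th coefficient of a homogeneous relation
      is a scalar, so this component of the relation can be solved for
      \<open>gs ! i\<close>.\<close>
    define w where "w = vcomp as (int (as ! i)) v"
    have w0: "lin gs w = 0" unfolding w_def using vcomp_lin[of gs c as "int (as ! i)" v] g len v by simp
    have wi: "lookup w i = const \<gamma>"
      using forms_0_const[of "icomp 0 (lookup v i)"]
      by (simp add: w_def lookup_vcomp lookup_icomp \<gamma>_def mdeg_def)
    define L' where "L' = take i L @ drop (Suc i) L"
    have iL: "i < length L" using i by (simp add: as_def)
    have others: "gs ! j \<in> snd ` set L'" if "j < length gs" "j \<noteq> i" for j
    proof -
      have "L ! j \<in> set L'"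
      proof (cases "j < i")
        case True
        then show ?thesis using iL by (auto simp: L'_def in_set_conv_nth intro!: exI[of _ j])
      next
        case False
        then have "L ! j = drop (Suc i) L ! (j - Suc i)" "j - Suc i < length (drop (Suc i) L)"
          using that by (auto simp: gs_def)
        then show ?thesis unfolding L'_def by (metis UnCI nth_mem set_append)
      qed
      then show ?thesis using that by (auto simp: gs_def)
    qed
    have "0 = (\<Sum>j<length gs. pscale (lookup w j) (gs ! j))" using w0 by (simp add: lin_def)
    also have "\<dots> = pscale (const \<gamma>) (gs ! i) + (\<Sum>j\<in>{..<length gs} - {i}. pscale (lookup w j) (gs ! j))"
      using i len wi by (subst sum.remove[of _ i]) auto
    finally have e: "pscale (const \<gamma>) (gs ! i) = - (\<Sum>j\<in>{..<length gs} - {i}. pscale (lookup w j) (gs ! j))"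
      by (simp add: eq_neg_iff_add_eq_0)
    have "(\<Sum>j\<in>{..<length gs} - {i}. pscale (lookup w j) (gs ! j)) \<in> pmod.span (snd ` set L')"
      using others by (intro pmod.span_sum pmod.span_scale pmod.span_base) auto
    then have "pscale (const \<gamma>) (gs ! i) \<in> pmod.span (snd ` set L')"
      unfolding e by (rule pmod.span_neg)
    then have "pscale (const (inverse \<gamma>)) (pscale (const \<gamma>) (gs ! i)) \<in> pmod.span (snd ` set L')"
      by (rule pmod.span_scale)
    then have "gs ! i \<in> pmod.span (snd ` set L')"
      unfolding pmod.scale_scale const_mult_inverse[OF \<gamma>] by simp
    then have "set gs \<subseteq> pmod.span (snd ` set L')"
      using others by (auto simp: in_set_conv_nth) (metis pmod.span_base)
    then have "M \<subseteq> pmod.span (snd ` set L')"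
      using pmod.span_minimal[OF _ pmod.subspace_span] sp by blast
    moreover have sL: "set L' \<subseteq> set L" unfolding L'_def by (auto dest: in_set_takeD in_set_dropD)
    moreover have "snd ` set L' \<subseteq> M" using L(1) sL by (force simp: good_def)
    then have "pmod.span (snd ` set L') \<subseteq> M" using M by (intro pmod.span_minimal) (auto simp: graded_submodule_def)
    ultimately have "good L'" using L(1) by (auto simp: good_def)
    then have "length L \<le> length L'" by (rule L(2))
    then show False using iL by (simp add: L'_def)
  qed
  then show ?thesis using len srt g sp by (intro exI[of _ gs] exI[of _ as]) auto
qed

section \<open>Projective dimension and minimal resolutions\<close>

lemma linear_on_0: "linear_on M f \<Longrightarrow> pmod.subspace M \<Longrightarrow> f 0 = 0"
  unfolding linear_on_def using pmod.subspace_0[of M] by (metis pmod.scale_zero_left)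

lemma linear_on_add: "linear_on M f \<Longrightarrow> x \<in> M \<Longrightarrow> y \<in> M \<Longrightarrow> f (x + y) = f x + f y"
  by (simp add: linear_on_def)

lemma linear_on_scale: "linear_on M f \<Longrightarrow> x \<in> M \<Longrightarrow> f (pscale c x) = pscale c (f x)"
  by (simp add: linear_on_def)

lemma linear_on_diff: "linear_on M f \<Longrightarrow> pmod.subspace M \<Longrightarrow> x \<in> M \<Longrightarrow> y \<in> M \<Longrightarrow> f (x - y) = f x - f y"
  using linear_on_add[of M f "x - y" y] pmod.subspace_diff[of M x y] by simp

lemma linear_on_sum:
  assumes "linear_on M f" "pmod.subspace M" "\<And>i. i \<in> A \<Longrightarrow> v i \<in> M"
  shows "f (\<Sum>i\<in>A. pscale (c i) (v i)) = (\<Sum>i\<in>A. pscale (c i) (f (v i)))"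
  using assms(3)
proof (induction A rule: infinite_finite_induct)
  case (insert x A)
  have "(\<Sum>i\<in>A. pscale (c i) (v i)) \<in> M"
    using insert.prems assms(2) by (intro pmod.subspace_sum pmod.subspace_scale) auto
  then show ?case using insert assms
    by (simp add: linear_on_add[OF assms(1)] linear_on_scale[OF assms(1)] pmod.subspace_scale)
qed (use linear_on_0 assms in auto)

lemma linear_on_compose:
  "linear_on M f \<Longrightarrow> f ` M \<subseteq> N \<Longrightarrow> linear_on N g \<Longrightarrow> linear_on M (\<lambda>x. g (f x))"
  unfolding linear_on_def by (auto simp: image_subset_iff)

lemma linear_on_id: "linear_on M (\<lambda>x. x)"
  by (simp add: linear_on_def)

lemma linear_on_minus: "linear_on M f \<Longrightarrow> linear_on M g \<Longrightarrow> linear_on M (\<lambda>x. f x - g x)"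
  by (auto simp: linear_on_def pmod.scale_right_diff_distrib)

text \<open>The basis vectors of the ambient free module split as p j + q j along P and Q; preimages
  of the f (p j) are chosen and extended linearly. For x in P the combination of the p j with the
  coordinates of x is x again, because the difference lies in both P and Q.\<close>

lemma projective_lift:
  fixes f d :: "(nat \<Rightarrow>\<^sub>0 'r::comm_ring_1) \<Rightarrow> (nat \<Rightarrow>\<^sub>0 'r)"
  assumes P: "projective_module P" and f: "linear_on P f"
    and X: "pmod.subspace X" and d: "linear_on X d" and sub: "f ` P \<subseteq> d ` X"
  shows "\<exists>\<beta>. linear_on P \<beta> \<and> \<beta> ` P \<subseteq> X \<and> (\<forall>x\<in>P. d (\<beta> x) = f x)"
proof -
  have sP: "pmod.subspace P" using P by (simp add: projective_module_def)
  obtain Q where Q: "pmod.subspace Q" "P \<inter> Q = {0}" "\<And>x. \<exists>p\<in>P. \<exists>q\<in>Q. x = p + q"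
    using P by (auto simp: projective_module_def)
  have "\<forall>j. \<exists>p q. p \<in> P \<and> q \<in> Q \<and> single j (1::'r) = p + q" for j :: nat
    using Q(3) by blast
  then obtain p q where pq: "\<And>j. p j \<in> P" "\<And>j. q j \<in> Q" "\<And>j::nat. single j (1::'r) = p j + q j"
    by metis
  have "\<exists>y. y \<in> X \<and> d y = f (p j)" for j
  proof -
    have "f (p j) \<in> d ` X" using pq(1) sub by (intro subsetD[OF sub] imageI)
    then show ?thesis by auto
  qed
  then obtain y where y: "\<And>j. y j \<in> X" "\<And>j. d (y j) = f (p j)" by metis
  define comb where "comb u x = (\<Sum>j\<in>keys x. pscale (lookup x j) (u j))"
    for u :: "nat \<Rightarrow> (nat \<Rightarrow>\<^sub>0 'r)" and x :: "nat \<Rightarrow>\<^sub>0 'r"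
  have comb_sup: "comb u x = (\<Sum>j\<in>A. pscale (lookup x j) (u j))"
    if "finite A" "keys x \<subseteq> A" for u x A
    unfolding comb_def using that by (intro sum.mono_neutral_left) (auto simp: in_keys_iff)
  have comb_add: "comb u (x + x') = comb u x + comb u x'" for u x x'
  proof -
    let ?A = "keys x \<union> keys x'"
    have "comb u (x + x') = (\<Sum>j\<in>?A. pscale (lookup (x + x') j) (u j))"
      using keys_add[of x x'] by (intro comb_sup) auto
    then show ?thesis
      using comb_sup[of ?A x u] comb_sup[of ?A x' u]
      by (simp add: lookup_add pmod.scale_left_distrib sum.distrib)
  qed
  have comb_scale: "comb u (pscale c x) = pscale c (comb u x)" for u c x
  proof -
    have "comb u (pscale c x) = (\<Sum>j\<in>keys x. pscale (lookup (pscale c x) j) (u j))"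
      by (intro comb_sup) (auto simp: in_keys_iff lookup_pscale)
    then show ?thesis by (simp add: lookup_pscale comb_def pmod.scale_sum_right)
  qed
  have comb_P: "comb p x = x" if x: "x \<in> P" for x
  proof -
    have "x = (\<Sum>j\<in>keys x. pscale (lookup x j) (p j + q j))"
    proof -
      have "(\<Sum>j\<in>keys x. pscale (lookup x j) (single j 1)) =
        (\<Sum>j\<in>keys x. single j (lookup x j))"
        by (intro sum.cong refl poly_mapping_eqI) (auto simp: lookup_pscale lookup_single when_def)
      then show ?thesis unfolding pq(3)[symmetric] by (simp flip: poly_mapping_eq_sum_single)
    qed
    then have "x - comb p x = comb q x" by (simp add: comb_def pmod.scale_right_distrib sum.distrib)
        (metis add_diff_cancel_left')
    moreover have "comb p x \<in> P" "comb q x \<in> Q"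
      using pq sP Q by (auto simp: comb_def intro!: pmod.subspace_sum pmod.subspace_scale)
    moreover have "x - comb p x \<in> P" using x sP \<open>comb p x \<in> P\<close> by (intro pmod.subspace_diff)
    ultimately have "x - comb p x \<in> P \<inter> Q" by simp
    then show ?thesis using Q(2) by simp
  qed
  show ?thesis
  proof (intro exI[of _ "comb y"] conjI ballI)
    show "linear_on P (comb y)" by (simp add: linear_on_def comb_add comb_scale)
    show "comb y ` P \<subseteq> X"
      using y X by (auto simp: comb_def intro!: pmod.subspace_sum pmod.subspace_scale)
    fix x assume x: "x \<in> P"
    have "d (comb y x) = (\<Sum>j\<in>keys x. pscale (lookup x j) (d (y j)))"
      unfolding comb_def using d X y by (intro linear_on_sum) auto
    also have "\<dots> = f (comb p x)"
      unfolding comb_def using f sP pq y by (subst linear_on_sum[OF f sP]) auto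
    finally show "d (comb y x) = f x" using comb_P[OF x] by simp
  qed
qed

lemma projective_free_module: "projective_module (free_module r)"
  unfolding projective_module_def
proof (intro conjI subspace_free_module exI[of _ "{v. \<forall>i<r. lookup v i = 0}"] allI)
  show "pmod.subspace {v. \<forall>i<r. lookup v i = 0}"
    by (auto simp: pmod.subspace_def lookup_add lookup_pscale)
  show "free_module r \<inter> {v. \<forall>i<r. lookup v i = 0} = {0}"
    by (auto simp: free_module_iff intro!: poly_mapping_eqI) (meson not_le)
  fix x :: "nat \<Rightarrow>\<^sub>0 'a"
  let ?p = "Poly_Mapping.mapp (\<lambda>i c. c when i < r) x" and ?q = "Poly_Mapping.mapp (\<lambda>i c. c when \<not> i < r) x"
  have p: "lookup ?p i = (lookup x i when i < r)"
    and q: "lookup ?q i = (lookup x i when \<not> i < r)" for i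
    by (auto simp: lookup_mapp when_def in_keys_iff)
  have "x = ?p + ?q" by (rule poly_mapping_eqI) (simp only: lookup_add p q, simp add: when_def)
  moreover have "?p \<in> free_module r" by (simp add: free_module_iff p)
  moreover have "?q \<in> {v. \<forall>i<r. lookup v i = 0}" by (simp add: q)
  ultimately show "\<exists>p\<in>free_module r. \<exists>q\<in>{v. \<forall>i<r. lookup v i = 0}. x = p + q" by blast
qed

text \<open>Comparing two resolutions of \<open>M\<close>: if \<open>\<alpha> : F \<rightarrow> P\<close> and \<open>\<beta> : P \<rightarrow> F\<close> lift the identity and \<open>h\<close> is a
  homotopy between \<open>\<beta> \<alpha>\<close> and the identity, then \<open>id - \<beta> \<alpha> - h d\<close> is a retraction of \<open>F\<^sub>2\<close> onto
  the kernel of \<open>F\<^sub>2 \<rightarrow> F\<^sub>1\<close>, as \<open>P\<^sub>2 \<rightarrow> P\<^sub>1\<close> is injective.\<close>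

lemma second_syzygy_retraction:
  assumes F: "projective_module F0" "projective_module F1" "projective_module F2"
    and d: "linear_on F0 d0" "linear_on F1 d1" "linear_on F2 d2"
    and ex: "d0 ` F0 = M" "d1 ` F1 = {x \<in> F0. d0 x = 0}" "d2 ` F2 = {x \<in> F1. d1 x = 0}"
    and PP: "projective_module P0" "projective_module P1" "projective_module P2"
    and \<psi>: "linear_on P0 \<psi>0" "linear_on P1 \<psi>1" "linear_on P2 \<psi>2"
    and exP: "\<psi>0 ` P0 = M" "\<psi>1 ` P1 = {x \<in> P0. \<psi>0 x = 0}" "\<psi>2 ` P2 = {x \<in> P1. \<psi>1 x = 0}"
      "{x \<in> P2. \<psi>2 x = 0} = {0}"
  shows "\<exists>r. linear_on F2 r \<and> r ` F2 \<subseteq> {x \<in> F2. d2 x = 0} \<and> (\<forall>x\<in>F2. d2 x = 0 \<longrightarrow> r x = x)"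
proof -
  have sF: "pmod.subspace F0" "pmod.subspace F1" "pmod.subspace F2"
    using F by (auto simp: projective_module_def)
  have sP: "pmod.subspace (P0)" "pmod.subspace (P1)" "pmod.subspace (P2)"
    using PP by (auto simp: projective_module_def)
  note lc = linear_on_compose and ld = linear_on_diff and lm = linear_on_minus
  have d1F: "d1 ` F1 \<subseteq> F0" and d2F: "d2 ` F2 \<subseteq> F1" using ex by auto
  have p1P: "\<psi>1 ` P1 \<subseteq> P0" and p2P: "\<psi>2 ` P2 \<subseteq> P1" using exP by auto
  have mem: "d1 x \<in> F0" if "x \<in> F1" for x using d1F that by auto
  have mem': "d2 x \<in> F1" if "x \<in> F2" for x using d2F that by auto
  have mp: "\<psi>1 x \<in> P0" if "x \<in> P1" for x using p1P that by auto
  have mp': "\<psi>2 x \<in> P1" if "x \<in> P2" for x using p2P that by auto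
  have dd: "d0 (d1 x) = 0" if "x \<in> F1" for x using ex that by blast
  have dd': "d1 (d2 x) = 0" if "x \<in> F2" for x using ex that by blast
  have pp: "\<psi>0 (\<psi>1 x) = 0" if "x \<in> P1" for x using exP that by blast
  have pp': "\<psi>1 (\<psi>2 x) = 0" if "x \<in> P2" for x using exP that by blast
  obtain \<alpha>0 where a0: "linear_on F0 \<alpha>0" "\<alpha>0 ` F0 \<subseteq> P0" "\<And>x. x \<in> F0 \<Longrightarrow> \<psi>0 (\<alpha>0 x) = d0 x"
    using projective_lift[OF F(1) d(1) sP(1) \<psi>(1)] ex exP by auto
  have l: "linear_on F1 (\<lambda>x. \<alpha>0 (d1 x))" by (rule lc[OF d(2) d1F a0(1)])
  have "(\<lambda>x. \<alpha>0 (d1 x)) ` F1 \<subseteq> \<psi>1 ` P1" 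
    unfolding exP using subsetD[OF a0(2) imageI] by (auto simp: a0(3) dd mem)
  then obtain \<alpha>1 where a1: "linear_on F1 \<alpha>1" "\<alpha>1 ` F1 \<subseteq> P1" "\<And>x. x \<in> F1 \<Longrightarrow> \<psi>1 (\<alpha>1 x) = \<alpha>0 (d1 x)"
    using projective_lift[OF F(2) l sP(2) \<psi>(2)] by auto
  have l: "linear_on F2 (\<lambda>x. \<alpha>1 (d2 x))" by (rule lc[OF d(3) d2F a1(1)])
  have "\<psi>1 (\<alpha>1 (d2 x)) = 0" if "x \<in> F2" for x
    using a1(3)[of "d2 x"] that d2F dd'[OF that] linear_on_0[OF a0(1) sF(1)] by auto
  then have "(\<lambda>x. \<alpha>1 (d2 x)) ` F2 \<subseteq> \<psi>2 ` P2" 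
    unfolding exP using subsetD[OF a1(2) imageI] by (auto simp: mem')
  then obtain \<alpha>2 where a2: "linear_on F2 \<alpha>2" "\<alpha>2 ` F2 \<subseteq> P2" "\<And>x. x \<in> F2 \<Longrightarrow> \<psi>2 (\<alpha>2 x) = \<alpha>1 (d2 x)"
    using projective_lift[OF F(3) l sP(3) \<psi>(3)] by auto
  obtain \<beta>0 where b0: "linear_on (P0) \<beta>0" "\<beta>0 ` P0 \<subseteq> F0" "\<And>x. x \<in> P0 \<Longrightarrow> d0 (\<beta>0 x) = \<psi>0 x"
    using projective_lift[OF PP(1) \<psi>(1) sF(1) d(1)] ex exP by auto
  have l: "linear_on (P1) (\<lambda>x. \<beta>0 (\<psi>1 x))" by (rule lc[OF \<psi>(2) p1P b0(1)])
  have "(\<lambda>x. \<beta>0 (\<psi>1 x)) ` P1 \<subseteq> d1 ` F1" 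
    unfolding ex using subsetD[OF b0(2) imageI] by (auto simp: b0(3) pp mp)
  then obtain \<beta>1 where b1: "linear_on (P1) \<beta>1" "\<beta>1 ` P1 \<subseteq> F1" "\<And>x. x \<in> P1 \<Longrightarrow> d1 (\<beta>1 x) = \<beta>0 (\<psi>1 x)"
    using projective_lift[OF PP(2) l sF(2) d(2)] by auto
  have l: "linear_on (P2) (\<lambda>x. \<beta>1 (\<psi>2 x))" by (rule lc[OF \<psi>(3) p2P b1(1)])
  have "d1 (\<beta>1 (\<psi>2 x)) = 0" if "x \<in> P2" for x
    using b1(3)[of "\<psi>2 x"] that p2P pp'[OF that] linear_on_0[OF b0(1) sP(1)] by auto
  then have "(\<lambda>x. \<beta>1 (\<psi>2 x)) ` P2 \<subseteq> d2 ` F2" 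
    unfolding ex using subsetD[OF b1(2) imageI] by (auto simp: mp')
  then obtain \<beta>2 where b2: "linear_on (P2) \<beta>2" "\<beta>2 ` P2 \<subseteq> F2" "\<And>x. x \<in> P2 \<Longrightarrow> d2 (\<beta>2 x) = \<beta>1 (\<psi>2 x)"
    using projective_lift[OF PP(3) l sF(3) d(3)] by auto
  have ba0: "\<beta>0 (\<alpha>0 x) \<in> F0" if "x \<in> F0" for x using that a0 b0 by blast
  have ba1: "\<beta>1 (\<alpha>1 x) \<in> F1" if "x \<in> F1" for x using that a1 b1 by blast
  have ba2: "\<beta>2 (\<alpha>2 x) \<in> F2" if "x \<in> F2" for x using that a2 b2 by blast
  have l: "linear_on F0 (\<lambda>x. x - \<beta>0 (\<alpha>0 x))" by (intro lm linear_on_id lc[OF a0(1,2) b0(1)])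
  have "d0 (x - \<beta>0 (\<alpha>0 x)) = 0" if "x \<in> F0" for x
    using ld[OF d(1) sF(1) that ba0[OF that]] a0 b0 that by (simp add: image_subset_iff)
  then have "(\<lambda>x. x - \<beta>0 (\<alpha>0 x)) ` F0 \<subseteq> d1 ` F1"
    unfolding ex using ba0 pmod.subspace_diff[OF sF(1)] by auto
  then obtain h0 where h0: "linear_on F0 h0" "h0 ` F0 \<subseteq> F1" "\<And>x. x \<in> F0 \<Longrightarrow> d1 (h0 x) = x - \<beta>0 (\<alpha>0 x)"
    using projective_lift[OF F(1) l sF(2) d(2)] by auto
  have hd0: "h0 (d1 x) \<in> F1" if "x \<in> F1" for x using that d1F h0 by blast
  have l: "linear_on F1 (\<lambda>x. x - \<beta>1 (\<alpha>1 x) - h0 (d1 x))"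
    by (intro lm linear_on_id lc[OF a1(1,2) b1(1)] lc[OF d(2) d1F h0(1)])
  have s1: "x - \<beta>1 (\<alpha>1 x) \<in> F1" if "x \<in> F1" for x using that ba1 pmod.subspace_diff[OF sF(2)] by auto
  have "d1 (x - \<beta>1 (\<alpha>1 x) - h0 (d1 x)) = 0" if x: "x \<in> F1" for x
  proof -
    have "d1 (x - \<beta>1 (\<alpha>1 x) - h0 (d1 x)) = d1 x - d1 (\<beta>1 (\<alpha>1 x)) - d1 (h0 (d1 x))"
      using ld[OF d(2) sF(2) s1[OF x] hd0[OF x]] ld[OF d(2) sF(2) x ba1[OF x]] by simp
    also have "\<dots> = d1 x - \<beta>0 (\<alpha>0 (d1 x)) - (d1 x - \<beta>0 (\<alpha>0 (d1 x)))"
      using b1(3)[OF subsetD[OF a1(2) imageI[OF x]]] a1(3)[OF x] h0(3)[OF mem[OF x]] by simp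
    finally show ?thesis by simp
  qed
  then have "(\<lambda>x. x - \<beta>1 (\<alpha>1 x) - h0 (d1 x)) ` F1 \<subseteq> d2 ` F2"
    unfolding ex using s1 hd0 pmod.subspace_diff[OF sF(2)] by auto
  then obtain h1 where h1: "linear_on F1 h1" "h1 ` F1 \<subseteq> F2"
    "\<And>x. x \<in> F1 \<Longrightarrow> d2 (h1 x) = x - \<beta>1 (\<alpha>1 x) - h0 (d1 x)"
    using projective_lift[OF F(2) l sF(3) d(3)] by auto
  have hd1: "h1 (d2 x) \<in> F2" if "x \<in> F2" for x using that d2F h1 by blast
  define r where "r x = x - \<beta>2 (\<alpha>2 x) - h1 (d2 x)" for x
  have l: "linear_on F2 r"
    unfolding r_def by (intro lm linear_on_id lc[OF a2(1,2) b2(1)] lc[OF d(3) d2F h1(1)])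
  have s2: "x - \<beta>2 (\<alpha>2 x) \<in> F2" if "x \<in> F2" for x using that ba2 pmod.subspace_diff[OF sF(3)] by auto
  have "d2 (r x) = 0" if x: "x \<in> F2" for x
  proof -
    have "d2 (r x) = d2 x - d2 (\<beta>2 (\<alpha>2 x)) - d2 (h1 (d2 x))"
      unfolding r_def using ld[OF d(3) sF(3) s2[OF x] hd1[OF x]] ld[OF d(3) sF(3) x ba2[OF x]] by simp
    also have "\<dots> = d2 x - \<beta>1 (\<alpha>1 (d2 x)) - (d2 x - \<beta>1 (\<alpha>1 (d2 x)) - h0 (d1 (d2 x)))"
      using b2(3)[OF subsetD[OF a2(2) imageI[OF x]]] a2(3)[OF x] h1(3)[OF mem'[OF x]] by simp
    finally show ?thesis using dd'[OF x] linear_on_0[OF h0(1) sF(1)] by simp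
  qed
  moreover have "r x \<in> F2" if "x \<in> F2" for x
    unfolding r_def using that s2 hd1 pmod.subspace_diff[OF sF(3)] by auto
  moreover have "r x = x" if x: "x \<in> F2" "d2 x = 0" for x
  proof -
    have "\<psi>2 (\<alpha>2 x) = 0" using a2(3)[OF x(1)] x(2) linear_on_0[OF a1(1) sF(2)] by simp
    then have "\<alpha>2 x = 0" using exP(4) a2(2) x(1) by auto
    then show ?thesis unfolding r_def
      using x linear_on_0[OF b2(1) sP(3)] linear_on_0[OF h1(1) sF(2)] by simp
  qed
  ultimately show ?thesis using l by blast
qed

lemma vcomp_scale_form:
  fixes v :: "nat \<Rightarrow>\<^sub>0 ('n::finite, 'k::comm_ring_1) mpol"
  assumes "p \<in> forms s"
  shows "vcomp a t (pscale p v) = pscale p (vcomp a (t - s) v)"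
proof (rule poly_mapping_eqI)
  fix i
  have "icomp (t - int (a ! i)) (lookup v i * p) = icomp (t - int (a ! i) - s) (lookup v i) * p"
    by (rule icomp_mult_form[OF assms])
  then show "lookup (vcomp a t (pscale p v)) i = lookup (pscale p (vcomp a (t - s) v)) i"
    by (simp add: lookup_vcomp lookup_pscale mult.commute algebra_simps)
qed

lemma free_module_expand:
  assumes "v \<in> free_module r"
  shows "v = (\<Sum>i<r. pscale (lookup v i) (single i 1))"
proof (rule poly_mapping_eqI)
  fix j
  have "(\<Sum>i<r. lookup v i * (1 when i = j)) = (\<Sum>i<r. if i = j then lookup v j else 0)"
    by (intro sum.cong refl) (simp add: when_def)
  also have "\<dots> = lookup v j" using assms by (simp add: free_module_iff)
  finally show "lookup v j =
      lookup (\<Sum>i<r. pscale (lookup v i) (single i 1)) j"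
    by (simp add: lookup_sum lookup_pscale lookup_single)
qed

text \<open>Graded Nakayama: a retract \<open>L\<close> of a free module \<open>F\<close> with \<open>L \<subseteq> (x\<^sub>1,\<dots>,x\<^sub>n) F\<close> satisfies
  \<open>L = (x\<^sub>1,\<dots>,x\<^sub>n) L\<close>.\<close>

lemma minimal_retract_zero:
  fixes L :: "(nat \<Rightarrow>\<^sub>0 ('n::finite, 'k::comm_ring_1) mpol) set"
  assumes L: "graded_submodule b L" and r: "linear_on (free_module (length b)) r" "r ` free_module (length b) \<subseteq> L"
    "\<And>x. x \<in> L \<Longrightarrow> r x = x" and m: "\<And>x i. x \<in> L \<Longrightarrow> lookup x i \<in> irrelevant_ideal"
  shows "L = {0}"
proof -
  let ?F = "free_module (length b)"
  have sL: "pmod.subspace L" "L \<subseteq> ?F" "\<And>v t. v \<in> L \<Longrightarrow> vcomp b t v \<in> L"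
    using L by (auto simp: graded_submodule_def)
  have homog: "x = 0" if "x \<in> L" "x \<in> graded_piece b (int t)" for x t
    using that
  proof (induction t arbitrary: x rule: less_induct)
    case (less t)
    let ?e = "\<lambda>i. single i 1 :: nat \<Rightarrow>\<^sub>0 ('n, 'k) mpol"
    have xF: "x \<in> ?F" using less.prems sL by blast
    have "x = r x" using r less.prems by simp
    also have "r x = r (\<Sum>i<length b. pscale (lookup x i) (?e i))"
      using free_module_expand[OF xF] by simp
    also have "\<dots> = (\<Sum>i<length b. pscale (lookup x i) (r (?e i)))"
      by (rule linear_on_sum[OF r(1) subspace_free_module]) auto
    finally have x: "x = (\<Sum>i<length b. pscale (lookup x i) (r (?e i)))" .
    have "x = vcomp b (int t) x" using vcomp_graded_piece[OF less.prems(2), of "int t"] by simp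
    also have "\<dots> = (\<Sum>i<length b. vcomp b (int t) (pscale (lookup x i) (r (?e i))))"
      by (subst x) (rule vcomp_sum)
    also have "\<dots> = (\<Sum>i<length b. 0)"
    proof (intro sum.cong refl)
      fix i assume i: "i \<in> {..<length b}"
      have xi: "lookup x i \<in> forms (int t - int (b ! i))"
        using less.prems(2) i by (simp add: graded_piece_def)
      have eq: "vcomp b (int t) (pscale (lookup x i) (r (?e i))) =
          pscale (lookup x i) (vcomp b (int (b ! i)) (r (?e i)))"
        using vcomp_scale_form[OF xi, of b "int t" "r (?e i)"] by simp
      have re: "r (?e i) \<in> L" using r(2) i by auto
      then have yL: "vcomp b (int (b ! i)) (r (?e i)) \<in> L" by (rule sL)
      have yg: "vcomp b (int (b ! i)) (r (?e i)) \<in> graded_piece b (int (b ! i))"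
        using re sL by (intro vcomp_in_graded_piece) auto
      \<comment> \<open>Below degree t the component of r (e_i) lies in L and is zero by induction;
        in degree t the coefficient of x is a scalar in the irrelevant ideal, hence zero; above t
        the coefficient is a form of negative degree.\<close>
      consider "b ! i < t" | "b ! i = t" | "t < b ! i" by linarith
      then show "vcomp b (int t) (pscale (lookup x i) (r (?e i))) = 0"
      proof cases
        case 1
        then show ?thesis using less.IH[OF 1 yL yg] eq by simp
      next
        case 2
        have "lookup x i = const (lookup (lookup x i) 0)"
          using xi 2 by (intro forms_0_const) simp
        moreover have "lookup (lookup x i) 0 = 0"
          using m[OF less.prems(1)] by (simp add: irrelevant_ideal_def)
        ultimately have "lookup x i = 0" by (metis single_zero)
        then show ?thesis by simp
      next
        case 3
        then have "lookup x i = 0" using xi forms_neg by force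
        then show ?thesis by simp
      qed
    qed
    finally show ?case by simp
  qed
  have "v = 0" if v: "v \<in> L" for v
  proof -
    have vF: "v \<in> ?F" using v sL by blast
    obtain T where "(\<Sum>t\<in>{0..T}. vcomp b t v) = v" using sum_vcomp[OF vF] by blast
    moreover have "vcomp b t v = 0" if "t \<ge> 0" for t
      using homog[of "vcomp b t v" "nat t"] sL(3)[OF v, of t] vcomp_in_graded_piece[OF vF, of t] that by simp
    ultimately show ?thesis by (metis (no_types, lifting) atLeastAtMost_iff sum.neutral)
  qed
  then show ?thesis using pmod.subspace_0[OF sL(1)] by auto
qed

section \<open>The minimal resolution of an ideal of projective dimension two\<close>

lemma projective_dimension_resolution:
  assumes "projective_dimension M = enat p"
  shows "\<exists>P \<phi>. (\<forall>i\<le>p. projective_module (P i)) \<and> exact_resolution p P \<phi> M"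
proof -
  let ?S = "{m. \<exists>P \<phi>. (\<forall>i\<le>m. projective_module (P i)) \<and> exact_resolution m P \<phi> M}"
  have "?S \<noteq> {}"
  proof
    assume "?S = {}"
    then have "projective_dimension M = \<infinity>"
      unfolding projective_dimension_def by (simp only: image_empty Inf_empty top_enat_def)
    then show False using assms by simp
  qed
  then obtain m where "m \<in> ?S" by blast
  then have m: "enat m \<in> enat ` ?S" by (rule imageI)
  have "projective_dimension M = (LEAST x. x \<in> enat ` ?S)"
    unfolding projective_dimension_def Inf_enat_def using m by (intro if_not_P) blast
  moreover have "(LEAST x. x \<in> enat ` ?S) \<in> enat ` ?S" using m by (rule LeastI)
  ultimately have "enat p \<in> enat ` ?S" using assms by simp
  then have "p \<in> ?S" by (simp only: inj_image_mem_iff[OF injI, OF enat.inject[THEN iffD1]])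
  then show ?thesis by blast
qed

lemma projective_dimension_le:
  "(\<And>i. i \<le> p \<Longrightarrow> projective_module (P i)) \<Longrightarrow> exact_resolution p P \<phi> M \<Longrightarrow> projective_dimension M \<le> enat p"
  unfolding projective_dimension_def by (intro INF_lower) blast

lemma single_eq_0_iff [simp]: "single i c = 0 \<longleftrightarrow> c = 0"
  using keys_single[of i c] by (metis keys_eq_empty insert_not_empty)

lemma lin_single_map:
  "lin (map (single 0) fs) v = single 0 (\<Sum>i<length fs. lookup v i * fs ! i)"
  by (rule poly_mapping_eqI) (auto simp: lookup_lin lookup_single when_def)

lemma syz_eq_kernel: "syz fs = {v \<in> free_module (length fs). lin (map (single 0) fs) v = 0}"
proof -
  have "lin (map (single 0) fs) v = 0 \<longleftrightarrow> (\<Sum>i<length fs. lookup v i * fs ! i) = 0" for v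
    by (simp add: lin_single_map)
  then show ?thesis by (simp add: syz_def)
qed

lemma lin_image_ideal_module:
  "lin (map (single 0) fs) ` free_module (length fs) = ideal_module (ideal_gen (set fs))"
proof -
  note l = lin_single_map[of fs]
  have "(\<Sum>i<length fs. lookup v i * fs ! i) \<in> ideal_gen (set fs)" for v
    using is_idealD(3)[OF is_ideal_ideal_gen[of "set fs"]] ideal_gen_superset[of "set fs"]
    by (intro is_ideal_sum is_ideal_ideal_gen) (auto simp: subset_iff)
  moreover have "ideal_gen (set fs) \<subseteq> {p. \<exists>v\<in>free_module (length fs). p = (\<Sum>i<length fs. lookup v i * fs ! i)}"
  proof (rule ideal_gen_minimal)
    show "set fs \<subseteq> {p. \<exists>v\<in>free_module (length fs). p = (\<Sum>i<length fs. lookup v i * fs ! i)}"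
    proof
      fix f assume "f \<in> set fs"
      then obtain j where j: "j < length fs" "fs ! j = f" by (auto simp: in_set_conv_nth)
      have "(\<Sum>i<length fs. lookup (single j 1) i * fs ! i) = (\<Sum>i<length fs. if i = j then f else 0)"
        using j by (intro sum.cong refl) (auto simp: lookup_single when_def)
      then show "f \<in> {p. \<exists>v\<in>free_module (length fs). p = (\<Sum>i<length fs. lookup v i * fs ! i)}"
        using j by (intro CollectI bexI[of _ "single j 1"]) auto
    qed
    show "is_ideal {p. \<exists>v\<in>free_module (length fs). p = (\<Sum>i<length fs. lookup v i * fs ! i)}"
    proof (rule is_idealI; clarsimp)
      show "\<exists>v\<in>free_module (length fs). (\<Sum>i<length fs. lookup v i * fs ! i) = 0"
        by (intro bexI[of _ 0]) (auto simp: free_module_closed)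
      show "\<exists>w\<in>free_module (length fs). (\<Sum>i<length fs. lookup u i * fs ! i) + (\<Sum>i<length fs. lookup v i * fs ! i)
           = (\<Sum>i<length fs. lookup w i * fs ! i)"
        if "u \<in> free_module (length fs)" "v \<in> free_module (length fs)" for u v
        using that by (intro bexI[of _ "u + v"])
          (auto simp: free_module_closed lookup_add distrib_right sum.distrib)
      show "\<exists>w\<in>free_module (length fs). c * (\<Sum>i<length fs. lookup u i * fs ! i)
           = (\<Sum>i<length fs. lookup w i * fs ! i)"
        if "u \<in> free_module (length fs)" for u c
        using that by (intro bexI[of _ "pscale c u"])
          (auto simp: free_module_closed lookup_pscale sum_distrib_left mult.assoc)
    qed
  qed
  ultimately show ?thesis unfolding ideal_module_def using l by (auto simp: image_iff)
qed

text \<open>Minimal generators are taken for the syzygies and then for the relations among them. A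
  projective resolution of length two makes the kernel of the last map a retract of its free module;
  minimality places this kernel in the irrelevant multiples, so graded Nakayama makes it
  zero.\<close>

lemma projective_dimension_2_resolution:
  fixes fs :: "('n::finite, 'k::field) mpol list"
  assumes fs: "set fs \<subseteq> forms (int d)"
    and pd: "projective_dimension (ideal_module (ideal_gen (set fs))) = 2"
  shows "\<exists>gs as ks bs.
    length gs = length as \<and> sorted as \<and>
    (\<forall>i<length as. gs ! i \<in> graded_piece (replicate (length fs) d) (int (as ! i))) \<and>
    lin gs ` free_module (length as) = syz fs \<and>
    (\<forall>v\<in>free_module (length as). lin gs v = 0 \<longrightarrow> (\<forall>i. lookup v i \<in> irrelevant_ideal)) \<and>
    length ks = length bs \<and> sorted bs \<and> bs \<noteq> [] \<and>
    (\<forall>j<length bs. ks ! j \<in> graded_piece as (int (bs ! j))) \<and>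
    lin ks ` free_module (length bs) = {v \<in> free_module (length as). lin gs v = 0} \<and>
    (\<forall>w\<in>free_module (length bs). lin ks w = 0 \<longrightarrow> w = 0)"
proof -
  let ?F = "map (single 0) fs :: (nat \<Rightarrow>\<^sub>0 ('n, 'k) mpol) list"
  let ?c = "replicate (length fs) d"
  let ?M = "ideal_module (ideal_gen (set fs))"
  have Fg: "?F ! i \<in> graded_piece [0] (int (?c ! i))" if "i < length ?F" for i
    using that fs by (auto simp: graded_piece_def subset_iff)
  have syz: "syz fs = {v \<in> free_module (length ?c). lin ?F v = 0}" by (simp add: syz_eq_kernel)
  have "graded_submodule ?c (syz fs)" unfolding syz by (rule graded_submodule_kernel[OF Fg])
  from minimal_generators[OF this] obtain gs as where
    g: "length gs = length as" "sorted as"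
      "\<And>i. i < length as \<Longrightarrow> gs ! i \<in> graded_piece ?c (int (as ! i))" "pmod.span (set gs) = syz fs"
      "\<And>v i. v \<in> free_module (length as) \<Longrightarrow> lin gs v = 0 \<Longrightarrow> lookup v i \<in> irrelevant_ideal"
    by blast
  have gim: "lin gs ` free_module (length as) = syz fs" using g(1,4) span_eq_lin_image[of gs] by simp
  let ?K = "{v \<in> free_module (length as). lin gs v = 0}"
  have "graded_submodule as ?K" using g by (intro graded_submodule_kernel) auto
  from minimal_generators[OF this] obtain ks bs where
    k: "length ks = length bs" "sorted bs"
      "\<And>i. i < length bs \<Longrightarrow> ks ! i \<in> graded_piece as (int (bs ! i))" "pmod.span (set ks) = ?K"
      "\<And>v i. v \<in> free_module (length bs) \<Longrightarrow> lin ks v = 0 \<Longrightarrow> lookup v i \<in> irrelevant_ideal"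
    by blast
  have kim: "lin ks ` free_module (length bs) = ?K" using k(1,4) span_eq_lin_image[of ks] by simp
  have Fim: "lin ?F ` free_module (length fs) = ?M" by (rule lin_image_ideal_module)
  have syz': "syz fs = {v \<in> free_module (length fs). lin ?F v = 0}" by (rule syz_eq_kernel)
  obtain P \<psi> where P: "\<And>i. i \<le> 2 \<Longrightarrow> projective_module (P i)" "exact_resolution 2 P \<psi> ?M"
    using projective_dimension_resolution[of ?M 2] pd by (auto simp: numeral_eq_enat)
  have exP: "\<psi> 0 ` P 0 = ?M" "\<psi> 1 ` P 1 = {x \<in> P 0. \<psi> 0 x = 0}" "\<psi> 2 ` P 2 = {x \<in> P 1. \<psi> 1 x = 0}"
    "{x \<in> P 2. \<psi> 2 x = 0} = {0}"
    and lP: "linear_on (P 0) (\<psi> 0)" "linear_on (P 1) (\<psi> 1)" "linear_on (P 2) (\<psi> 2)"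
    using P(2) unfolding exact_resolution_def by (auto simp: numeral_2_eq_2)
  have PP: "projective_module (P 0)" "projective_module (P 1)" "projective_module (P 2)" using P(1) by auto
  let ?L = "{w \<in> free_module (length bs). lin ks w = 0}"
  obtain r where r: "linear_on (free_module (length bs)) r" "r ` free_module (length bs) \<subseteq> ?L"
    "\<And>x. x \<in> ?L \<Longrightarrow> r x = x"
    using second_syzygy_retraction[OF projective_free_module projective_free_module projective_free_module
        linear_on_lin linear_on_lin linear_on_lin Fim _ kim PP lP exP] gim syz' by auto
  have "graded_submodule bs ?L" using k by (intro graded_submodule_kernel) auto
  then have "?L = {0}" by (rule minimal_retract_zero[OF _ r]) (use k in auto)
  then have inj: "w = 0" if "w \<in> free_module (length bs)" "lin ks w = 0" for w using that by blast
  \<comment> \<open>Without relations among the syzygies the resolution would stop one step earlier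
    and the projective dimension would be at most 1.\<close>
  have "bs \<noteq> []"
  proof
    assume "bs = []"
    then have "?K = {0}" using kim k(1) by (auto simp: lin_def free_module_iff image_iff)
    then have "exact_resolution 1 (\<lambda>i. if i = 0 then free_module (length fs) else free_module (length as))
       (\<lambda>i. if i = 0 then lin ?F else lin gs) ?M"
      using Fim gim syz' by (auto simp: exact_resolution_def linear_on_lin)
    then have "projective_dimension ?M \<le> enat 1"
      by (rule projective_dimension_le[rotated]) (auto simp: projective_free_module)
    then show False using pd by (simp add: numeral_eq_enat)
  qed
  then show ?thesis using g gim k kim inj by (intro exI[of _ gs] exI[of _ as] exI[of _ ks] exI[of _ bs]) auto
qed

section \<open>Dimensions of graded pieces\<close>

text \<open>The map f is known to be linear on S only. It is replaced by the linear map g that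
  agrees with f on a basis C of S, chosen to extend a basis A of the kernel.\<close>

lemma rank_nullity:
  fixes s1 :: "'k::field \<Rightarrow> 'a::ab_group_add \<Rightarrow> 'a" and s2 :: "'k \<Rightarrow> 'b::ab_group_add \<Rightarrow> 'b"
  assumes "vector_space s1" "vector_space s2"
    and S: "module.subspace s1 S" "finite T" "S \<subseteq> module.span s1 T"
    and add: "\<And>x y. x \<in> S \<Longrightarrow> y \<in> S \<Longrightarrow> f (x + y) = f x + f y"
    and scale: "\<And>c x. x \<in> S \<Longrightarrow> f (s1 c x) = s2 c (f x)"
  shows "vector_space.dim s1 S = vector_space.dim s2 (f ` S) + vector_space.dim s1 {x \<in> S. f x = 0}"
proof -
  interpret vector_space_pair s1 s2 using assms(1,2) by (simp add: vector_space_pair_def)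
  let ?K = "{x \<in> S. f x = 0}"
  have f0: "f 0 = 0" using scale[of 0 0] vs1.subspace_0[OF S(1)] by simp
  obtain A where A: "A \<subseteq> ?K" "vs1.independent A" "?K \<subseteq> vs1.span A"
    using vs1.maximal_independent_subset by blast
  have "A \<subseteq> S" using A by auto
  then obtain C where C: "A \<subseteq> C" "C \<subseteq> S" "vs1.independent C" "S \<subseteq> vs1.span C"
    by (rule vs1.maximal_independent_subset_extend[OF _ A(2)])
  have finC: "finite C" using vs1.independent_span_bound[OF S(2) C(3)] C(2) S(3) by blast
  have spC: "vs1.span C = S" using C S(1) vs1.span_minimal by blast
  have dK: "vs1.dim ?K = card A" using A by (intro vs1.basis_card_eq_dim[symmetric]) auto
  have dS: "vs1.dim S = card C" using C by (intro vs1.basis_card_eq_dim[symmetric]) auto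
  define g where "g = construct C f"
  have g: "Vector_Spaces.linear s1 s2 g" unfolding g_def by (rule linear_construct[OF C(3)])
  interpret g: Vector_Spaces.linear s1 s2 g by (rule g)
  have fg: "g x = f x" if "x \<in> S" for x
  proof -
    have "x \<in> vs1.span C" using that spC by simp
    then have "x \<in> S \<and> g x = f x"
    proof (induction rule: vs1.span_induct_alt)
      case base
      then show ?case using f0 g.zero vs1.subspace_0[OF S(1)] by simp
    next
      case (step c x y)
      have "g x = f x" unfolding g_def using step C(3) by (intro construct_basis)
      moreover have "x \<in> S" using step C by blast
      ultimately show ?case
        using step S(1) by (simp add: g.add g.scale add scale vs1.subspace_add vs1.subspace_scale)
    qed
    then show ?thesis by simp
  qed
  let ?D = "C - A"
  have indD: "vs1.independent ?D" using C(3) vs1.independent_mono by blast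
  have spD: "vs1.span ?D \<subseteq> S" using vs1.span_mono[of ?D C] spC by auto
  \<comment> \<open>A vector spanned by C - A and killed by g is also spanned by A. Its coordinates
    in C vanish outside both sets, hence everywhere.\<close>
  have "inj_on g (vs1.span ?D)"
    unfolding g.inj_on_iff_eq_0[OF vs1.subspace_span]
  proof (intro ballI impI)
    fix x assume x: "x \<in> vs1.span ?D" "g x = 0"
    then have "x \<in> ?K" using spD fg by auto
    then have xA: "x \<in> vs1.span A" using A by blast
    show "x = 0"
    proof (rule ccontr)
      assume nz: "x \<noteq> 0"
      have "vs1.representation C x = vs1.representation A x"
        using C A xA by (intro vs1.representation_extend) auto
      moreover have "vs1.representation C x = vs1.representation ?D x"
        using C x by (intro vs1.representation_extend) auto
      ultimately have z: "vs1.representation C x b = 0" for b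
        using vs1.representation_ne_zero[of A x b] vs1.representation_ne_zero[of ?D x b] by (metis DiffD2)
      have "x \<in> vs1.span C" using xA vs1.span_mono[OF C(1)] by blast
      then have "(\<Sum>b\<in>C. s1 (vs1.representation C x b) b) = x"
        using finC C by (intro vs1.sum_representation_eq) auto
      then show False using z nz by simp
    qed
  qed
  then have indg: "vs2.independent (g ` ?D)" "inj_on g ?D"
    using g.independent_injective_image[OF indD] inj_on_subset vs1.span_superset by blast+
  have "f ` S = g ` S" using fg by auto
  also have "\<dots> = vs2.span (g ` C)" using spC g.span_image by metis
  also have "\<dots> = vs2.span (g ` ?D)"
  proof (rule antisym)
    have "g x \<in> vs2.span (g ` ?D)" if "x \<in> C" for x
    proof (cases "x \<in> A")
      case True
      then have "g x = 0" using A fg by auto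
      then show ?thesis using vs2.span_zero by simp
    next
      case False
      then show ?thesis using that by (intro vs2.span_base) auto
    qed
    then show "vs2.span (g ` C) \<subseteq> vs2.span (g ` ?D)"
      by (intro vs2.span_minimal vs2.subspace_span) auto
    show "vs2.span (g ` ?D) \<subseteq> vs2.span (g ` C)" by (intro vs2.span_mono) auto
  qed
  finally have "vs2.dim (f ` S) = card (g ` ?D)"
    using vs2.dim_span_eq_card_independent[OF indg(1)] by simp
  also have "\<dots> = card ?D" using indg(2) by (rule card_image)
  also have "\<dots> = card C - card A" using C(1) finC by (intro card_Diff_subset finite_subset[OF C(1)]) auto
  finally show ?thesis using dS dK card_mono[OF finC C(1)] by simp
qed

text \<open>The free module regarded as a vector space over k, in which graded pieces have finite
  dimension.\<close>

definition fscale :: "'k::field \<Rightarrow> (nat \<Rightarrow>\<^sub>0 ('n::finite, 'k) mpol) \<Rightarrow> (nat \<Rightarrow>\<^sub>0 ('n, 'k) mpol)" where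
  "fscale c v = pscale (const c) v"

global_interpretation fvec: vector_space "fscale :: 'k::field \<Rightarrow> (nat \<Rightarrow>\<^sub>0 ('n::finite, 'k) mpol) \<Rightarrow> _"
  by unfold_locales (simp_all add: fscale_def pmod.scale_right_distrib pmod.scale_left_distrib single_add mult_single)

lemma pvec_vector_space: "vector_space (pscale :: 'k::field \<Rightarrow> ('i \<Rightarrow>\<^sub>0 'k) \<Rightarrow> _)" ..

lemma fvec_vector_space: "vector_space (fscale :: 'k::field \<Rightarrow> (nat \<Rightarrow>\<^sub>0 ('n::finite, 'k) mpol) \<Rightarrow> _)" ..

lemma pscale_eq_const_mult: "pscale c p = const c * p" for p :: "('n::finite, 'k::field) mpol"
  by (simp add: pscale_def mult_map_scale_conv_mult)

lemma subspace_forms: "pmod.subspace (forms t :: ('n::finite, 'k::field) mpol set)"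
  using forms_mult[OF const_in_forms, of _ t]
  by (auto simp: pmod.subspace_def forms_add pscale_eq_const_mult)

lemma subspace_ideal: "is_ideal I \<Longrightarrow> pmod.subspace I" for I :: "('n::finite, 'k::field) mpol set"
  using is_idealD[of I] by (auto simp: pmod.subspace_def pscale_eq_const_mult)

lemma subspace_graded_piece: "fvec.subspace (graded_piece a t)"
  using graded_piece_scale[OF const_in_forms, of _ a t]
  by (auto simp: fvec.subspace_def graded_piece_add fscale_def)

lemma subspace_pmod: "pmod.subspace M \<Longrightarrow> fvec.subspace M"
  by (auto simp: fvec.subspace_def pmod.subspace_def fscale_def)

definition monomials :: "int \<Rightarrow> ('n::finite \<Rightarrow>\<^sub>0 nat) set" where
  "monomials t = {m. int (mdeg m) = t}"

lemma finite_monomials' [simp]: "finite (monomials t)"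
  unfolding monomials_def by (rule finite_monomials)

lemma pscale_single: "pscale c (single m d) = single m (c * d)"
  by (rule poly_mapping_eqI) (auto simp: lookup_pscale lookup_single when_def)

lemma independent_monomials: "pmod.independent ((\<lambda>m. single m (1::'k::field)) ` A)" if "finite A"
proof (rule pvec.independent_if_scalars_zero)
  show "finite ((\<lambda>m. single m (1::'k)) ` A)" using that by simp
  fix f and x :: "'a \<Rightarrow>\<^sub>0 'k"
  assume s: "(\<Sum>x\<in>(\<lambda>m. single m (1::'k)) ` A. pscale (f x) x) = 0"
    and x: "x \<in> (\<lambda>m. single m 1) ` A"
  obtain m where m: "m \<in> A" "x = single m 1" using x by auto
  have inj: "inj_on (\<lambda>m. single m (1::'k)) A"
    by (rule inj_onI) (metis keys_single singleton_inject zero_neq_one)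
  have "0 = lookup (\<Sum>x\<in>(\<lambda>m. single m (1::'k)) ` A. pscale (f x) x) m"
    using s by simp
  also have "\<dots> = (\<Sum>k\<in>A. f (single k 1) * (1 when k = m))"
    by (subst sum.reindex[OF inj]) (simp add: lookup_sum lookup_pscale lookup_single)
  also have "\<dots> = (\<Sum>k\<in>A. if k = m then f x else 0)"
    by (intro sum.cong refl) (simp add: when_def m)
  also have "\<dots> = f x" using m that by simp
  finally show "f x = 0" by simp
qed

lemma subset_span_monomials:
  "keys p \<subseteq> A \<Longrightarrow> p \<in> pmod.span ((\<lambda>m. single m (1::'k::field)) ` A)"
proof -
  assume p: "keys p \<subseteq> A"
  have "p = (\<Sum>m\<in>keys p. pscale (lookup p m) (single m 1))"
    by (simp add: pscale_single flip: poly_mapping_eq_sum_single)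
  also have "\<dots> \<in> pmod.span ((\<lambda>m. single m (1::'k)) ` A)"
    using p by (intro pmod.span_sum pmod.span_scale pmod.span_base) auto
  finally show ?thesis .
qed

lemma forms_eq_span:
  "(forms t :: ('n::finite, 'k) mpol set) = pmod.span ((\<lambda>m. single m (1::'k::field)) ` monomials t)"
  (is "?L = ?R")
proof
  show "?L \<subseteq> ?R"
  proof
    fix p assume "p \<in> ?L"
    then show "p \<in> ?R"
      by (intro subset_span_monomials) (auto simp: forms_def monomials_def)
  qed
  show "?R \<subseteq> ?L"
    by (intro pmod.span_minimal subspace_forms) (auto simp: forms_def monomials_def)
qed

lemma card_single_image: "card ((\<lambda>m. single m (1::'k::field)) ` A) = card A"
  by (intro card_image inj_onI) (metis keys_single singleton_inject zero_neq_one)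

lemma dim_forms: "pvec.dim (forms t :: ('n::finite, 'k::field) mpol set) = card (monomials t :: ('n \<Rightarrow>\<^sub>0 nat) set)"
  unfolding forms_eq_span
  by (simp add: pvec.dim_eq_card_independent independent_monomials card_single_image)

lemma lin_fscale: "lin gs (fscale c v) = fscale c (lin gs v)"
  by (simp add: fscale_def lin_scale)

lemma linear_on_fscale: "linear_on M \<phi> \<Longrightarrow> x \<in> M \<Longrightarrow> \<phi> (fscale c x) = fscale c (\<phi> x)"
  by (simp add: fscale_def linear_on_scale)

lemma fscale_single: "fscale c (single i p) = single i (const c * p)"
  by (rule poly_mapping_eqI) (auto simp: fscale_def lookup_pscale lookup_single when_def)

definition shift_terms :: "nat list \<Rightarrow> int \<Rightarrow> (nat \<times> ('n::finite \<Rightarrow>\<^sub>0 nat)) set" where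
  "shift_terms b t = (SIGMA i:{..<length b}. monomials (t - int (b ! i)))"

lemma finite_shift_terms [simp]: "finite (shift_terms b t)"
  by (simp add: shift_terms_def)

lemma card_shift_terms:
  "card (shift_terms b t :: (nat \<times> ('n::finite \<Rightarrow>\<^sub>0 nat)) set) =
     (\<Sum>s\<leftarrow>b. card (monomials (t - int s) :: ('n \<Rightarrow>\<^sub>0 nat) set))"
  by (simp add: shift_terms_def sum_list_sum_nth atLeast0LessThan)

definition term_vec :: "nat \<times> ('n::finite \<Rightarrow>\<^sub>0 nat) \<Rightarrow> (nat \<Rightarrow>\<^sub>0 ('n, 'k::field) mpol)" where
  "term_vec = (\<lambda>(i, m). single i (single m 1))"

lemma inj_term_vec: "inj term_vec"
proof (rule injI, clarsimp simp: term_vec_def)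
  fix i j and m k :: "'a \<Rightarrow>\<^sub>0 nat"
  assume eq: "single i (single m (1::'b)) = single j (single k 1)"
  have "lookup (lookup (single i (single m (1::'b))) j) k = 1"
    unfolding eq by simp
  then show "i = j \<and> m = k" by (auto simp: lookup_single when_def split: if_splits)
qed

lemma independent_term_vec:
  assumes "finite A"
  shows "fvec.independent (term_vec ` A :: (nat \<Rightarrow>\<^sub>0 ('n::finite, 'k::field) mpol) set)"
proof (rule fvec.independent_if_scalars_zero)
  show "finite (term_vec ` A)" using assms by simp
  fix f :: "(nat \<Rightarrow>\<^sub>0 ('n, 'k) mpol) \<Rightarrow> 'k" and x :: "nat \<Rightarrow>\<^sub>0 ('n, 'k) mpol"
  assume s: "(\<Sum>x\<in>term_vec ` A. fscale (f x) x) = 0" and x: "x \<in> term_vec ` A"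
  obtain i m where m: "(i, m) \<in> A" "x = term_vec (i, m)" using x by auto
  have "0 = lookup (lookup (\<Sum>x\<in>term_vec ` A. fscale (f x) x) i) m"
    using s by simp
  also have "\<dots> = (\<Sum>k\<in>A. if k = (i, m) then f x else 0)"
    unfolding sum.reindex[OF inj_on_subset[OF inj_term_vec subset_UNIV]] lookup_sum o_def
    by (intro sum.cong refl)
      (auto simp: term_vec_def fscale_single mult_single lookup_single when_def m split: prod.splits)
  also have "\<dots> = f x" using m assms by simp
  finally show "f x = 0" by simp
qed

lemma graded_piece_eq_span:
  "(graded_piece b t :: (nat \<Rightarrow>\<^sub>0 ('n::finite, 'k::field) mpol) set) = fvec.span (term_vec ` shift_terms b t)"
  (is "?L = ?R")
proof
  show "?L \<subseteq> ?R"
  proof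
    fix v assume v: "v \<in> ?L"
    have "v \<in> free_module (length b)" using v graded_piece_subset by blast
    then have "v = (\<Sum>i<length b. pscale (lookup v i) (single i 1))"
      by (rule free_module_expand)
    also have "\<dots> \<in> ?R"
    proof (rule fvec.span_sum)
      fix i assume i: "i \<in> {..<length b}"
      have vi: "lookup v i \<in> forms (t - int (b ! i))" using v i by (simp add: graded_piece_def)
      let ?p = "lookup v i"
      have "pscale ?p (single i 1) = single i ?p" by (simp add: pscale_single)
      also have "\<dots> = (\<Sum>m\<in>keys ?p. single i (single m (lookup ?p m)))"
        by (simp flip: single_sum poly_mapping_eq_sum_single)
      also have "\<dots> = (\<Sum>m\<in>keys ?p. fscale (lookup ?p m) (term_vec (i, m)))"
        by (intro sum.cong refl) (simp add: term_vec_def fscale_single mult_single)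
      also have "\<dots> \<in> ?R"
        using vi i by (intro fvec.span_sum fvec.span_scale fvec.span_base imageI)
          (auto simp: shift_terms_def forms_def monomials_def)
      finally show "pscale ?p (single i 1) \<in> ?R" .
    qed
    finally show "v \<in> ?R" .
  qed
  show "?R \<subseteq> ?L"
    by (intro fvec.span_minimal subspace_graded_piece)
      (auto simp: term_vec_def shift_terms_def graded_piece_def lookup_single when_def forms_def monomials_def split: if_splits)
qed

lemma dim_graded_piece:
  "fvec.dim (graded_piece b t :: (nat \<Rightarrow>\<^sub>0 ('n::finite, 'k::field) mpol) set) =
     (\<Sum>s\<leftarrow>b. card (monomials (t - int s) :: ('n \<Rightarrow>\<^sub>0 nat) set))"
proof -
  have "card (term_vec ` shift_terms b t :: (nat \<Rightarrow>\<^sub>0 ('n, 'k) mpol) set) = card (shift_terms b t :: (nat \<times> ('n \<Rightarrow>\<^sub>0 nat)) set)"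
    by (intro card_image inj_on_subset[OF inj_term_vec]) auto
  then show ?thesis unfolding graded_piece_eq_span card_shift_terms[symmetric]
    by (simp add: fvec.dim_eq_card_independent independent_term_vec)
qed

lemma rank_nullity_graded:
  assumes "linear_on M \<phi>" "graded_piece b t \<subseteq> M"
    and S: "fvec.subspace S" "S \<subseteq> (graded_piece b t :: (nat \<Rightarrow>\<^sub>0 ('n::finite, 'k::field) mpol) set)"
  shows "fvec.dim S = fvec.dim (\<phi> ` S) + fvec.dim {x \<in> S. \<phi> x = 0}"
proof (rule rank_nullity[OF fvec_vector_space fvec_vector_space S(1), of "term_vec ` shift_terms b t"])
  show "finite (term_vec ` shift_terms b t)" by simp
  show "S \<subseteq> fvec.span (term_vec ` shift_terms b t)" using S by (simp add: graded_piece_eq_span)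
qed (use assms in \<open>auto intro: linear_on_add linear_on_fscale\<close>)

text \<open>A homogeneous member of the image has a homogeneous preimage: all components of a
  preimage other than the one in degree t are sent to other degrees and may be discarded.\<close>

lemma graded_image:
  fixes \<phi> :: "(nat \<Rightarrow>\<^sub>0 ('n::finite, 'k::field) mpol) \<Rightarrow> (nat \<Rightarrow>\<^sub>0 ('n, 'k) mpol)"
  assumes M: "graded_submodule b M" and lin: "linear_on M \<phi>"
    and gr: "\<And>t. \<phi> ` (M \<inter> graded_piece b t) \<subseteq> graded_piece c (t + s)"
  shows "\<phi> ` (M \<inter> graded_piece b t) = \<phi> ` M \<inter> graded_piece c (t + s)"
proof
  show "\<phi> ` (M \<inter> graded_piece b t) \<subseteq> \<phi> ` M \<inter> graded_piece c (t + s)" using gr by blast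
  have sM: "pmod.subspace M" "M \<subseteq> free_module (length b)" "\<And>v t. v \<in> M \<Longrightarrow> vcomp b t v \<in> M"
    using M by (auto simp: graded_submodule_def)
  show "\<phi> ` M \<inter> graded_piece c (t + s) \<subseteq> \<phi> ` (M \<inter> graded_piece b t)"
  proof
    fix y assume y: "y \<in> \<phi> ` M \<inter> graded_piece c (t + s)"
    then obtain v where v: "v \<in> M" "y = \<phi> v" by auto
    have vF: "v \<in> free_module (length b)" using v sM by blast
    obtain T where T: "\<And>T'. T' \<ge> T \<Longrightarrow> (\<Sum>u\<in>{0..T'}. vcomp b u v) = v" using sum_vcomp[OF vF] by blast
    let ?T = "max T t"
    have vc: "vcomp b u v \<in> M \<inter> graded_piece b u" for u
      using sM(3)[OF v(1)] vcomp_in_graded_piece[OF vF] by auto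
    \<comment> \<open>The trivial factor 1 gives the sum the shape that \<open>linear_on_sum\<close>
      expects.\<close>
    have "y = \<phi> (\<Sum>u\<in>{0..?T}. pscale 1 (vcomp b u v))" using T[of ?T] v by simp
    also have "\<dots> = (\<Sum>u\<in>{0..?T}. \<phi> (vcomp b u v))"
      using linear_on_sum[OF lin sM(1), of "{0..?T}" "\<lambda>u. vcomp b u v" "\<lambda>_. 1"] vc by auto
    finally have ysum: "y = (\<Sum>u\<in>{0..?T}. \<phi> (vcomp b u v))" .
    have "y = vcomp c (t + s) y" using y vcomp_graded_piece[of y c "t + s" "t + s"] by auto
    also have "\<dots> = (\<Sum>u\<in>{0..?T}. vcomp c (t + s) (\<phi> (vcomp b u v)))" by (subst ysum) (rule vcomp_sum)
    also have "\<dots> = (\<Sum>u\<in>{0..?T}. if u = t then \<phi> (vcomp b t v) else 0)"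
    proof (intro sum.cong refl)
      fix u
      have "\<phi> (vcomp b u v) \<in> graded_piece c (u + s)" using gr[of u] vc[of u] by blast
      then show "vcomp c (t + s) (\<phi> (vcomp b u v)) = (if u = t then \<phi> (vcomp b t v) else 0)"
        by (simp add: vcomp_graded_piece)
    qed
    also have "\<dots> = \<phi> (vcomp b t v)"
    \<comment> \<open>For negative t the index is outside the range of summation, but then the
      component vanishes as well.\<close>
    proof (cases "0 \<le> t")
      case False
      then have "vcomp b t v = 0" using vcomp_neg[OF _ vF] by simp
      then show ?thesis using False linear_on_0[OF lin sM(1)] by simp
    qed simp
    finally show "y \<in> \<phi> ` (M \<inter> graded_piece b t)" using vc[of t] by blast
  qed
qed

lemma graded_submodule_free: "graded_submodule b (free_module (length b))"
  using vcomp_in_graded_piece graded_piece_subset subspace_free_module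
  by (fastforce simp: graded_submodule_def)

lemma graded_image_free:
  fixes \<phi> :: "(nat \<Rightarrow>\<^sub>0 ('n::finite, 'k::field) mpol) \<Rightarrow> (nat \<Rightarrow>\<^sub>0 ('n, 'k) mpol)"
  assumes lin: "linear_on (free_module (length b)) \<phi>"
    and gr: "\<And>t. \<phi> ` graded_piece b t \<subseteq> graded_piece c t"
  shows "\<phi> ` graded_piece b t = \<phi> ` free_module (length b) \<inter> graded_piece c t"
proof -
  have "free_module (length b) \<inter> graded_piece b t = (graded_piece b t :: (nat \<Rightarrow>\<^sub>0 ('n, 'k) mpol) set)" for t
    using graded_piece_subset by blast
  then show ?thesis using graded_image[OF graded_submodule_free lin, of c 0 t] gr by simp
qed

lemma dim_ideal_module:
  fixes I :: "('n::finite, 'k::field) mpol set"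
  assumes "is_ideal I"
  shows "fvec.dim (ideal_module I \<inter> graded_piece [0] t) = pvec.dim (forms t \<inter> I)"
proof -
  have im: "ideal_module I \<inter> graded_piece [0] t = single 0 ` (forms t \<inter> I)"
    by (auto simp: ideal_module_def graded_piece_def)
  have "pvec.dim (forms t \<inter> I) = fvec.dim (single (0::nat) ` (forms t \<inter> I)) +
      pvec.dim {x \<in> forms t \<inter> I. single (0::nat) x = 0}"
  proof (rule rank_nullity[OF pvec_vector_space fvec_vector_space, of _ "(\<lambda>m. single m 1) ` monomials t"])
    show "pmod.subspace (forms t \<inter> I)"
      by (intro pmod.subspace_inter subspace_forms subspace_ideal assms)
    show "forms t \<inter> I \<subseteq> pmod.span ((\<lambda>m. single m 1) ` monomials t)"
      using forms_eq_span by blast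
  qed (auto simp: single_add fscale_single pscale_eq_const_mult)
  moreover have "{x \<in> forms t \<inter> I. single (0::nat) x = 0} = {0}"
    using is_idealD(1)[OF assms] by auto
  moreover have "pvec.dim {0 :: ('n, 'k) mpol} = 0"
    by (rule pvec.dim_unique[of "{}"]) (auto simp: pmod.span_zero pmod.independent_empty)
  ultimately show ?thesis using im by simp
qed

lemma fvec_dim_0 [simp]: "fvec.dim {0} = 0"
  by (rule fvec.dim_unique[of "{}"]) (auto simp: fvec.span_zero fvec.independent_empty)

abbreviation nmon :: "'n::finite itself \<Rightarrow> int \<Rightarrow> nat" where
  "nmon T t \<equiv> card (monomials t :: ('n \<Rightarrow>\<^sub>0 nat) set)"

text \<open>The Euler characteristic of the exact sequence in degree t, arranged without subtraction
  of natural numbers.\<close>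

lemma dim_resolution:
  fixes I :: "('n::finite, 'k::field) mpol set"
  assumes I: "is_ideal I" and res: "minimal_graded_free_resolution [b0, b1, b2] \<phi> I"
  shows "pvec.dim (forms t \<inter> I) + (\<Sum>s\<leftarrow>b1. nmon TYPE('n) (t - int s)) =
     (\<Sum>s\<leftarrow>b0. nmon TYPE('n) (t - int s)) + (\<Sum>s\<leftarrow>b2. nmon TYPE('n) (t - int s))"
proof -
  have ex: "exact_resolution 2 (\<lambda>i. free_module (length ([b0, b1, b2] ! i))) \<phi> (ideal_module I)"
    using res by (simp add: minimal_graded_free_resolution_def numeral_2_eq_2)
  have l: "linear_on (free_module (length b0)) (\<phi> 0)" "linear_on (free_module (length b1)) (\<phi> 1)"
    "linear_on (free_module (length b2)) (\<phi> 2)"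
  proof -
    have *: "linear_on (free_module (length ([b0, b1, b2] ! i))) (\<phi> i)" if "i \<le> 2" for i
      using ex that by (simp add: exact_resolution_def)
    show "linear_on (free_module (length b0)) (\<phi> 0)" "linear_on (free_module (length b1)) (\<phi> 1)"
      "linear_on (free_module (length b2)) (\<phi> 2)"
      using *[of 0] *[of 1] *[of 2] by simp_all
  qed
  have e: "\<phi> 0 ` free_module (length b0) = ideal_module I"
    "\<phi> 1 ` free_module (length b1) = {x \<in> free_module (length b0). \<phi> 0 x = 0}"
    "\<phi> 2 ` free_module (length b2) = {x \<in> free_module (length b1). \<phi> 1 x = 0}"
    "{x \<in> free_module (length b2). \<phi> 2 x = 0} = {0}"
  proof -
    have *: "\<phi> (Suc i) ` free_module (length ([b0, b1, b2] ! Suc i)) =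
        {x \<in> free_module (length ([b0, b1, b2] ! i)). \<phi> i x = 0}" if "i < 2" for i
      using ex that by (simp add: exact_resolution_def)
    show "\<phi> 1 ` free_module (length b1) = {x \<in> free_module (length b0). \<phi> 0 x = 0}"
      "\<phi> 2 ` free_module (length b2) = {x \<in> free_module (length b1). \<phi> 1 x = 0}"
      using *[of 0] *[of 1] by (simp_all add: numeral_2_eq_2)
    show "\<phi> 0 ` free_module (length b0) = ideal_module I" "{x \<in> free_module (length b2). \<phi> 2 x = 0} = {0}"
      using ex by (simp_all add: exact_resolution_def)
  qed
  have g: "\<phi> 0 ` graded_piece b0 t \<subseteq> graded_piece [0] t" "\<phi> 1 ` graded_piece b1 t \<subseteq> graded_piece b0 t"
    "\<phi> 2 ` graded_piece b2 t \<subseteq> graded_piece b1 t" for t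
  proof -
    have *: "\<phi> (Suc i) ` graded_piece ([b0, b1, b2] ! Suc i) t \<subseteq> graded_piece ([b0, b1, b2] ! i) t" if "i < 2" for i
      using res that unfolding minimal_graded_free_resolution_def by simp
    show "\<phi> 1 ` graded_piece b1 t \<subseteq> graded_piece b0 t" "\<phi> 2 ` graded_piece b2 t \<subseteq> graded_piece b1 t"
      using *[of 0] *[of 1] by (simp_all add: numeral_2_eq_2)
    show "\<phi> 0 ` graded_piece b0 t \<subseteq> graded_piece [0] t"
      using res unfolding minimal_graded_free_resolution_def by simp
  qed
  have i0: "\<phi> 0 ` graded_piece b0 t = ideal_module I \<inter> graded_piece [0] t"
    using graded_image_free[OF l(1) g(1)] e(1) by simp
  have i1: "\<phi> 1 ` graded_piece b1 t = {x \<in> graded_piece b0 t. \<phi> 0 x = 0}"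
    using graded_image_free[OF l(2) g(2)] e(2) graded_piece_subset[of b0 t] by auto
  have i2: "\<phi> 2 ` graded_piece b2 t = {x \<in> graded_piece b1 t. \<phi> 1 x = 0}"
    using graded_image_free[OF l(3) g(3)] e(3) graded_piece_subset[of b1 t] by auto
  have i3: "{x \<in> graded_piece b2 t. \<phi> 2 x = 0} = {0}"
    using e(4) graded_piece_subset[of b2 t] linear_on_0[OF l(3) subspace_free_module] by auto
  have "fvec.dim (graded_piece b0 t :: (nat \<Rightarrow>\<^sub>0 ('n, 'k) mpol) set) = pvec.dim (forms t \<inter> I) + fvec.dim {x \<in> graded_piece b0 t. \<phi> 0 x = 0}"
    using rank_nullity_graded[OF l(1) graded_piece_subset subspace_graded_piece order_refl, of t]
    by (simp only: i0 dim_ideal_module[OF I])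
  moreover have "fvec.dim (graded_piece b1 t :: (nat \<Rightarrow>\<^sub>0 ('n, 'k) mpol) set) = fvec.dim {x \<in> graded_piece b0 t. \<phi> 0 x = 0} + fvec.dim {x \<in> graded_piece b1 t. \<phi> 1 x = 0}"
    using rank_nullity_graded[OF l(2) graded_piece_subset subspace_graded_piece order_refl] by (simp only: i1)
  moreover have "fvec.dim (graded_piece b2 t :: (nat \<Rightarrow>\<^sub>0 ('n, 'k) mpol) set) = fvec.dim {x \<in> graded_piece b1 t. \<phi> 1 x = 0}"
    using rank_nullity_graded[OF l(3) graded_piece_subset subspace_graded_piece order_refl, of t]
    by (simp only: i2 i3 fvec_dim_0)
  ultimately show ?thesis by (simp add: dim_graded_piece)
qed

section \<open>Counting monomials\<close>

text \<open>The number of monomials of degree t in v variables. The truncated subtraction is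
  harmless for v = 0: the value is 1 in degree 0 and 0 in higher degrees.\<close>

definition mon_count :: "nat \<Rightarrow> int \<Rightarrow> nat" where
  "mon_count v t = (if t < 0 then 0 else (nat t + v - 1) choose nat t)"

text \<open>Listing the exponents along an enumeration of V turns the monomials into lists of given
  length and sum, which are counted by stars and bars.\<close>

lemma card_monomials_vars:
  "card {m \<in> monomials t. keys m \<subseteq> V} = mon_count (card V) t" for V :: "'n::finite set"
proof (cases "t < 0")
  case True
  then have "{m \<in> monomials t. keys m \<subseteq> V} = {}" by (auto simp: monomials_def)
  then show ?thesis using True by (simp only: mon_count_def card.empty if_True)
next
  case False
  obtain xs where xs: "set xs = V" "distinct xs" using finite_distinct_list[of V] by auto
  then have len: "length xs = card V" by (metis distinct_card)
  let ?M = "{m \<in> monomials t. keys m \<subseteq> V}"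
  let ?L = "{l :: nat list. length l = card V \<and> sum_list l = nat t}"
  have deg: "sum_list (map (lookup m) xs) = mdeg m" if "keys m \<subseteq> V" for m :: "'n \<Rightarrow>\<^sub>0 nat"
  proof -
    have "sum_list (map (lookup m) xs) = (\<Sum>x\<in>V. lookup m x)"
      using xs by (simp add: sum_list_distinct_conv_sum_set)
    also have "\<dots> = mdeg m" unfolding mdeg_def
      using that by (intro sum.mono_neutral_left) (auto simp: in_keys_iff)
    finally show ?thesis .
  qed
  have "bij_betw (\<lambda>m. map (lookup m) xs) ?M ?L"
    unfolding bij_betw_def
  proof
    show "inj_on (\<lambda>m. map (lookup m) xs) ?M"
    proof (rule inj_onI, rule poly_mapping_eqI)
      fix m m' :: "'n \<Rightarrow>\<^sub>0 nat" and x
      assume mm: "m \<in> ?M" "m' \<in> ?M" and eq: "map (lookup m) xs = map (lookup m') xs"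
      show "lookup m x = lookup m' x"
      proof (cases "x \<in> V")
        case False
        then have "x \<notin> keys m" "x \<notin> keys m'" using mm by auto
        then show ?thesis by (simp add: in_keys_iff)
      qed (use eq xs in auto)
    qed
    show "(\<lambda>m. map (lookup m) xs) ` ?M = ?L"
    proof
      show "(\<lambda>m. map (lookup m) xs) ` ?M \<subseteq> ?L"
      proof
        fix l assume "l \<in> (\<lambda>m. map (lookup m) xs) ` ?M"
        then obtain m where m: "m \<in> ?M" "l = map (lookup m) xs" by blast
        then have "sum_list l = mdeg m" using deg[of m] by simp
        moreover have "int (mdeg m) = t" using m by (simp add: monomials_def)
        ultimately have "sum_list l = nat t" by linarith
        then show "l \<in> ?L" using m len by simp
      qed
      show "?L \<subseteq> (\<lambda>m. map (lookup m) xs) ` ?M"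
      proof
        fix l assume l: "l \<in> ?L"
        define m where "m = (\<Sum>i<length xs. single (xs ! i) (l ! i))"
        have lk: "lookup m (xs ! j) = l ! j" if "j < length xs" for j
        proof -
          have "lookup m (xs ! j) = (\<Sum>i<length xs. if i = j then l ! i else 0)"
            unfolding m_def lookup_sum using that xs
            by (intro sum.cong refl) (auto simp: lookup_single when_def nth_eq_iff_index_eq)
          then show ?thesis using that by simp
        qed
        have eq: "map (lookup m) xs = l" using l len lk by (intro nth_equalityI) auto
        have keys: "keys m \<subseteq> V"
        proof
          fix x assume "x \<in> keys m"
          then have "lookup m x \<noteq> 0" by (simp add: in_keys_iff)
          then obtain i where "i < length xs" "xs ! i = x"
            unfolding m_def lookup_sum lookup_single
            by (meson lessThan_iff sum.not_neutral_contains_not_neutral when_neq_zero)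
          then show "x \<in> V" using xs by auto
        qed
        have "int (mdeg m) = t" using deg[OF keys] eq l False by simp
        then show "l \<in> (\<lambda>m. map (lookup m) xs) ` ?M"
          using eq keys by (intro rev_image_eqI[of m]) (auto simp: monomials_def)
      qed
    qed
  qed
  then have "card ?M = card ?L" by (rule bij_betw_same_card)
  then show ?thesis using False by (simp add: card_length_sum_list mon_count_def)
qed

lemma nmon_eq: "nmon TYPE('n::finite) t = mon_count CARD('n) t"
  using card_monomials_vars[of t "UNIV :: 'n set"] by simp

lemma mon_count_rec: "mon_count (Suc v) t = mon_count (Suc v) (t - 1) + mon_count v t"
proof -
  consider "t < 0" | "t = 0" | k where "t = int (Suc k)"
    by (metis int_cases not0_implies_Suc negative_zless of_nat_0 of_nat_less_0_iff)
  then show ?thesis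
  proof cases
    case 3
    then have "nat t = Suc k" "nat (t - 1) = k" "\<not> t < 0" "\<not> t - 1 < 0" by auto
    then show ?thesis by (simp only: mon_count_def if_False) simp
  qed (auto simp: mon_count_def)
qed

lemma mon_count_diff: "mon_count (Suc v) t = mon_count (Suc v) (t - int a) + (\<Sum>i<a. mon_count v (t - int i))"
proof (induction a)
  case (Suc a)
  have "mon_count (Suc v) (t - int a) = mon_count (Suc v) (t - int (Suc a)) + mon_count v (t - int a)"
    using mon_count_rec[of v "t - int a"] by (simp add: algebra_simps)
  then show ?case using Suc by simp
qed simp

lemma mon_count_mono: "mon_count (Suc v) (t - int a) \<le> mon_count (Suc v) t"
  using mon_count_diff[of v t a] by simp

lemma mon_count_bound: "mon_count (Suc w) t \<le> (nat t + 1) ^ w"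
proof (induction w)
  case (Suc w)
  show ?case
  proof (cases "t < 0")
    case False
    have "mon_count (Suc (Suc w)) t = (\<Sum>i<nat t + 1. mon_count (Suc w) (t - int i))"
      using mon_count_diff[of "Suc w" t "nat t + 1"] False by (simp add: mon_count_def)
    also have "\<dots> \<le> (\<Sum>i<nat t + 1. (nat t + 1) ^ w)"
      using mon_count_mono Suc.IH by (intro sum_mono) (meson order_trans)
    also have "\<dots> = (nat t + 1) ^ Suc w" by simp
    finally show ?thesis .
  qed (simp add: mon_count_def)
qed (simp add: mon_count_def)

text \<open>The second difference with steps a and e is the Hilbert function of two coprime forms of
  these degrees. It is a sum of a e values of \<open>mon_count (Suc w)\<close>, each at most (t +
  1)^w.\<close>

lemma mon_count_second_difference:
  "mon_count (w + 3) t + mon_count (w + 3) (t - int a - int e) \<le>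
     mon_count (w + 3) (t - int a) + mon_count (w + 3) (t - int e) + a * e * (nat t + 1) ^ w"
proof -
  have v: "w + 3 = Suc (Suc (Suc w))" by simp
  have "(\<Sum>i<a. mon_count (Suc (Suc w)) (t - int i)) =
     (\<Sum>i<a. mon_count (Suc (Suc w)) (t - int e - int i)) + (\<Sum>i<a. \<Sum>j<e. mon_count (Suc w) (t - int i - int j))"
    unfolding sum.distrib[symmetric]
  proof (intro sum.cong refl)
    fix i
    show "mon_count (Suc (Suc w)) (t - int i) = mon_count (Suc (Suc w)) (t - int e - int i) + (\<Sum>j<e. mon_count (Suc w) (t - int i - int j))"
      using mon_count_diff[of "Suc w" "t - int i" e] by (simp add: algebra_simps)
  qed
  moreover have "(\<Sum>i<a. \<Sum>j<e. mon_count (Suc w) (t - int i - int j)) \<le> (\<Sum>i<a. \<Sum>j<e. (nat t + 1) ^ w)"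
  proof (intro sum_mono)
    fix i j
    have "mon_count (Suc w) (t - int i - int j) \<le> mon_count (Suc w) t"
      using mon_count_mono order_trans by blast
    then show "mon_count (Suc w) (t - int i - int j) \<le> (nat t + 1) ^ w"
      using mon_count_bound order_trans by blast
  qed
  moreover have "(\<Sum>i<a. \<Sum>j<e. (nat t + 1) ^ w) = a * e * (nat t + 1) ^ w" by simp
  moreover have "mon_count (w + 3) t = mon_count (w + 3) (t - int a) + (\<Sum>i<a. mon_count (Suc (Suc w)) (t - int i))"
    unfolding v by (rule mon_count_diff)
  moreover have "mon_count (w + 3) (t - int e) = mon_count (w + 3) (t - int a - int e) + (\<Sum>i<a. mon_count (Suc (Suc w)) (t - int e - int i))"
    unfolding v using mon_count_diff[of "Suc (Suc w)" "t - int e" a] by (simp add: algebra_simps)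
  ultimately show ?thesis by linarith
qed

section \<open>Growth of the Hilbert function\<close>

text \<open>An upper bound on dim (R/I) in degree t that only asks for a spanning set modulo I. It
  avoids quotient spaces and admits negative degrees, which arise from shifts.\<close>

definition codim_le :: "('n::finite, 'k::field) mpol set \<Rightarrow> int \<Rightarrow> nat \<Rightarrow> bool" where
  "codim_le I t c \<longleftrightarrow> (\<exists>B. finite B \<and> card B \<le> c \<and> forms t \<subseteq> pmod.span ((I \<inter> forms t) \<union> B))"

lemma finite_independent_forms:
  fixes A :: "('n::finite, 'k::field) mpol set"
  assumes "A \<subseteq> forms t" "pmod.independent A"
  shows "finite A"
proof -
  have "A \<subseteq> pmod.span ((\<lambda>m. single m 1) ` monomials t)"
    using assms(1) by (simp add: forms_eq_span)
  then show ?thesis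
    using pvec.independent_span_bound[OF finite_imageI[OF finite_monomials'] assms(2)] by blast
qed

lemma forms_finite_basis:
  fixes U :: "('n::finite, 'k::field) mpol set"
  assumes "U \<subseteq> forms t"
  shows "\<exists>A. A \<subseteq> U \<and> finite A \<and> U \<subseteq> pmod.span A \<and> card A = pvec.dim U"
proof -
  obtain A where A: "A \<subseteq> U" "pmod.independent A" "U \<subseteq> pmod.span A" "card A = pvec.dim U"
    using pvec.basis_exists[of U] by blast
  have "finite A" using A(1,2) assms finite_independent_forms by blast
  then show ?thesis using A by blast
qed

lemma codim_le_of_dim:
  fixes U :: "('n::finite, 'k::field) mpol set"
  assumes U: "U \<subseteq> I \<inter> forms t" and le: "nmon TYPE('n) t \<le> pvec.dim U + c"
  shows "codim_le I t c"
proof -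
  obtain A where A: "A \<subseteq> U" "pmod.independent A" "U \<subseteq> pmod.span A" "card A = pvec.dim U"
    using pvec.basis_exists[of U] by blast
  have "A \<subseteq> forms t" using A U by blast
  then obtain B where B: "A \<subseteq> B" "B \<subseteq> forms t" "pmod.independent B" "forms t \<subseteq> pmod.span B"
    by (rule pvec.maximal_independent_subset_extend[OF _ A(2)])
  have fin: "finite B" using B(2,3) by (rule finite_independent_forms)
  have "card B = nmon TYPE('n) t" using pvec.basis_card_eq_dim[OF B(2,4,3)] dim_forms by metis
  then have "card (B - A) \<le> c" using le A(4) B(1) fin by (subst card_Diff_subset) (auto intro: finite_subset)
  moreover have "forms t \<subseteq> pmod.span ((I \<inter> forms t) \<union> (B - A))"
  proof -
    have "B \<subseteq> (I \<inter> forms t) \<union> (B - A)" using A(1) U by auto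
    then show ?thesis using B(4) pmod.span_mono by blast
  qed
  ultimately show ?thesis using fin unfolding codim_le_def by blast
qed

lemma hilbert_function_le_codim:
  fixes I :: "('n::finite, 'k::field) mpol set"
  assumes "codim_le I (int t) c"
  shows "hilbert_function I t \<le> c"
proof -
  obtain B where B: "finite B" "card B \<le> c" "forms (int t) \<subseteq> pmod.span ((I \<inter> forms (int t)) \<union> B)"
    using assms unfolding codim_le_def by blast
  obtain A where A: "A \<subseteq> I \<inter> forms (int t)" "finite A" "I \<inter> forms (int t) \<subseteq> pmod.span A" "card A = pvec.dim (I \<inter> forms (int t))"
    using forms_finite_basis[OF Int_lower2[of I "forms (int t)"]] that by metis
  have "(I \<inter> forms (int t)) \<union> B \<subseteq> pmod.span (A \<union> B)"
    using A(3) pmod.span_mono[of A "A \<union> B"] pmod.span_superset[of "A \<union> B"] by blast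
  then have "forms (int t) \<subseteq> pmod.span (A \<union> B)"
    using B(3) pmod.span_minimal[OF _ pmod.subspace_span] by blast
  then have "pvec.dim (forms (int t) :: ('n, 'k) mpol set) \<le> card (A \<union> B)"
    using A B by (intro pvec.dim_le_card) auto
  also have "\<dots> \<le> card A + card B" by (rule card_Un_le)
  finally show ?thesis using A(4) B(2) unfolding hilbert_function_def by (simp add: Int_commute)
qed

lemma homogeneous_ideal_icomp:
  fixes I :: "('n::finite, 'k::comm_ring_1) mpol set"
  assumes "homogeneous_ideal I" "p \<in> I"
  shows "icomp t p \<in> I"
proof -
  obtain S where S: "S \<subseteq> (\<Union>t. forms t)" "I = ideal_gen S" using assms by (auto simp: homogeneous_ideal_def)
  have I: "is_ideal I" by (simp add: S is_ideal_ideal_gen)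
  have "S \<subseteq> {p. \<forall>t. icomp t p \<in> I}"
  proof
    fix s assume s: "s \<in> S"
    then obtain u where "s \<in> forms u" using S by blast
    moreover have "s \<in> I" using s S ideal_gen_superset by blast
    ultimately show "s \<in> {p. \<forall>t. icomp t p \<in> I}" using is_idealD(1)[OF I] by (simp add: icomp_forms when_def)
  qed
  moreover have "is_ideal {p. \<forall>t. icomp t p \<in> I}"
  proof (rule is_idealI)
    show "0 \<in> {p. \<forall>t. icomp t p \<in> I}" using is_idealD(1)[OF I] by simp
    show "x + y \<in> {p. \<forall>t. icomp t p \<in> I}" if "x \<in> {p. \<forall>t. icomp t p \<in> I}" "y \<in> {p. \<forall>t. icomp t p \<in> I}" for x y
      using that is_idealD(2)[OF I] by (simp add: icomp_add)
    show "c * x \<in> {p. \<forall>t. icomp t p \<in> I}" if x: "x \<in> {p. \<forall>t. icomp t p \<in> I}" for c x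
    proof -
      obtain T where T: "(\<Sum>u\<in>{0..T}. icomp u x) = x" using sum_icomp[of x] by blast
      have "icomp t (c * x) \<in> I" for t
      proof -
        have "icomp t (c * x) = icomp t (c * (\<Sum>u\<in>{0..T}. icomp u x))" using T by simp
        also have "\<dots> = (\<Sum>u\<in>{0..T}. icomp (t - u) c * icomp u x)"
          by (simp add: sum_distrib_left icomp_sum icomp_mult_form[OF icomp_in_forms])
        also have "\<dots> \<in> I" using x is_idealD(3)[OF I] by (intro is_ideal_sum I) simp
        finally show ?thesis .
      qed
      then show ?thesis by simp
    qed
  qed
  ultimately have "I \<subseteq> {p. \<forall>t. icomp t p \<in> I}" using S ideal_gen_minimal by metis
  then show ?thesis using assms by blast
qed

text \<open>The lowest components of p and q multiply to a nonzero component of the product, and so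
  do the highest ones. In a form these have equal degree, so in each factor lowest and highest
  degree agree.\<close>

lemma forms_factor:
  fixes p q :: "('n::finite, 'k::idom) mpol"
  assumes f: "p * q \<in> forms t" and nz: "p * q \<noteq> 0"
  shows "\<exists>a b. p \<in> forms (int a) \<and> q \<in> forms (int b) \<and> t = int a + int b"
proof -
  have pq: "p \<noteq> 0" "q \<noteq> 0" using nz by auto
  have low: "\<exists>a. wcomp mdeg a p \<noteq> 0 \<and> (\<forall>i<a. wcomp mdeg i p = 0)" if "p \<noteq> 0" for p :: "('n, 'k) mpol"
    using exists_least_iff[of "\<lambda>a. wcomp mdeg a p \<noteq> 0"] wcomp_wdeg_nonzero[OF that, of mdeg] by blast
  obtain a where a: "wcomp mdeg a p \<noteq> 0" "\<And>i. i < a \<Longrightarrow> wcomp mdeg i p = 0" using low[OF pq(1)] by blast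
  obtain b where b: "wcomp mdeg b q \<noteq> 0" "\<And>i. i < b \<Longrightarrow> wcomp mdeg i q = 0" using low[OF pq(2)] by blast
  have "wcomp mdeg (a + b) (p * q) = (\<Sum>i\<le>a + b. wcomp mdeg i p * wcomp mdeg (a + b - i) q)"
    by (rule wcomp_mult) simp
  also have "\<dots> = (\<Sum>i\<le>a + b. if i = a then wcomp mdeg a p * wcomp mdeg b q else 0)"
  proof (intro sum.cong refl)
    fix i assume *: "i \<in> {..a + b}"
    consider "i < a" | "i = a" | "a < i" by linarith
    then show "wcomp mdeg i p * wcomp mdeg (a + b - i) q = (if i = a then wcomp mdeg a p * wcomp mdeg b q else 0)"
    proof cases
      case 3
      then have "a + b - i < b" using * by auto
      then show ?thesis using b 3 by simp
    qed (use a in auto)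
  qed
  finally have "wcomp mdeg (a + b) (p * q) \<noteq> 0" using a b by simp
  then obtain m where "lookup (wcomp mdeg (a + b) (p * q)) m \<noteq> 0"
    by (metis lookup_zero poly_mapping_eqI)
  then have "mdeg m = a + b" "m \<in> keys (p * q)"
    by (auto simp: lookup_wcomp in_keys_iff when_def split: if_splits)
  then have t1: "t = int (a + b)" using f by (auto simp: forms_def)
  have "wdeg mdeg (p * q) = wdeg mdeg p + wdeg mdeg q" using pq by (simp add: wdeg_mult)
  moreover have "wdeg mdeg (p * q) \<le> a + b" using f t1 by (intro wdeg_leI) (auto simp: forms_def)
  moreover have "a \<le> wdeg mdeg p" "b \<le> wdeg mdeg q" using a b wcomp_beyond by (meson not_le)+
  ultimately have d: "wdeg mdeg p = a" "wdeg mdeg q = b" by auto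
  have hom: "p \<in> forms (int a)" if "wdeg mdeg p = a" "\<And>i. i < a \<Longrightarrow> wcomp mdeg i p = 0" for p :: "('n, 'k) mpol" and a
  proof -
    have "mdeg m = a" if m: "m \<in> keys p" for m
    proof -
      have "mdeg m \<le> a" using wdeg_ge[OF m, of mdeg] \<open>wdeg mdeg p = a\<close> by simp
      moreover have "wcomp mdeg (mdeg m) p \<noteq> 0"
        using m by (auto simp: poly_mapping_eq_iff fun_eq_iff lookup_wcomp in_keys_iff)
      ultimately show ?thesis using \<open>\<And>i. i < a \<Longrightarrow> wcomp mdeg i p = 0\<close> by (meson le_neq_implies_less)
    qed
    then show ?thesis by (auto simp: forms_def)
  qed
  show ?thesis using hom[OF d(1) a(2)] hom[OF d(2) b(2)] t1 by (intro exI[of _ a] exI[of _ b]) auto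
qed

text \<open>As p is prime and does not divide h, all relations between p and h are multiples of (h,
  -p). The Koszul complex therefore computes the dimension of (p, h) in degree t, and the quotient
  is the second difference bounded by \<open>mon_count_second_difference\<close>.\<close>

lemma codim_two_forms:
  fixes p h :: "('n::finite, 'k::field) mpol"
  assumes w: "CARD('n) = w + 3" and p: "prime_elem p" "p \<in> forms (int a)" and h: "h \<in> forms (int e)" "\<not> p dvd h"
    and I: "is_ideal I" "p \<in> I" "h \<in> I"
  shows "codim_le I t (a * e * (nat t + 1) ^ w)"
proof -
  let ?gs = "[single 0 p, single 0 h]"
  let ?ks = "[single 0 h - single (Suc 0) p]"
  have p0: "p \<noteq> 0" using p by (simp add: prime_elem_def)
  have h0: "h \<noteq> 0" using h by auto
  have gl: "lin ?gs v = single 0 (lookup v 0 * p + lookup v (Suc 0) * h)" for v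
    by (rule poly_mapping_eqI) (auto simp: lookup_lin numeral_2_eq_2 lookup_single when_def)
  have kl: "lookup (lin ?ks v) i = (if i = 0 then lookup v 0 * h else if i = Suc 0 then - lookup v 0 * p else 0)" for v i
    by (auto simp: lookup_lin lookup_single lookup_minus when_def)
  have gg: "?gs ! i \<in> graded_piece [0] (int ([a, e] ! i))" if "i < length ?gs" for i
    using that p h by (auto simp: graded_piece_def less_Suc_eq numeral_2_eq_2)
  have kg: "?ks ! i \<in> graded_piece [a, e] (int ([a + e] ! i))" if "i < length ?ks" for i
    using that p h forms_uminus[OF p(2)]
    by (auto simp: graded_piece_def less_Suc_eq numeral_2_eq_2 lookup_minus lookup_single free_module_iff)
  have ggr: "lin ?gs ` graded_piece [a, e] t \<subseteq> graded_piece [0] t" for t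
    using lin_graded_piece[where gs = ?gs and c = "[0]" and as = "[a, e]", OF gg] by auto
  have kgr: "lin ?ks ` graded_piece [a + e] t \<subseteq> graded_piece [a, e] t" for t
    using lin_graded_piece[where gs = ?ks and c = "[a, e]" and as = "[a + e]", OF kg] by auto
  have ker: "{v \<in> free_module 2. lin ?gs v = 0} = lin ?ks ` free_module 1"
  proof
    show "lin ?ks ` free_module 1 \<subseteq> {v \<in> free_module 2. lin ?gs v = 0}"
      by (auto simp: free_module_iff gl kl)
    show "{v \<in> free_module 2. lin ?gs v = 0} \<subseteq> lin ?ks ` free_module 1"
    proof clarify
      fix v assume v: "v \<in> free_module 2" "lin ?gs v = 0"
      let ?v0 = "lookup v 0" and ?v1 = "lookup v (Suc 0)"
      have e: "?v0 * p + ?v1 * h = 0" using v(2) by (simp add: gl)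
      then have "p dvd ?v1 * h" by (metis add_eq_0_iff2 dvd_minus_iff dvd_triv_right)
      then have "p dvd ?v1" using p h by (auto simp: prime_elem_def)
      then obtain w where w: "?v1 = p * w" by (auto simp: dvd_def)
      have "p * (?v0 + w * h) = 0" using e w by (simp add: algebra_simps)
      then have v0: "?v0 = - w * h" using p0 by (simp add: eq_neg_iff_add_eq_0)
      have "v = lin ?ks (single 0 (- w))"
        using v(1) v0 w by (intro poly_mapping_eqI) (auto simp: kl free_module_iff mult.commute)
      then show "v \<in> lin ?ks ` free_module 1" by (intro image_eqI[of _ _ "single 0 (- w)"]) auto
    qed
  qed
  have i1: "lin ?ks ` graded_piece [a + e] t = {v \<in> graded_piece [a, e] t. lin ?gs v = 0}"
  proof -
    have "lin ?ks ` graded_piece [a + e] t = lin ?ks ` free_module 1 \<inter> graded_piece [a, e] t"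
      using graded_image_free[of "[a + e]" "lin ?ks", OF linear_on_lin kgr] by simp
    also have "\<dots> = {v \<in> free_module 2. lin ?gs v = 0} \<inter> graded_piece [a, e] t" unfolding ker ..
    also have "\<dots> = {v \<in> graded_piece [a, e] t. lin ?gs v = 0}" using graded_piece_subset[of "[a, e]" t] by (auto simp: numeral_2_eq_2)
    finally show ?thesis .
  qed
  have i2: "{v \<in> graded_piece [a + e] t. lin ?ks v = 0} = {0}"
  proof -
    have "v = 0" if "v \<in> graded_piece [a + e] t" "lin ?ks v = 0" for v
    proof (rule poly_mapping_eqI)
      fix i
      have "lookup v 0 * h = 0" using kl[of v 0] that(2) by simp
      then show "lookup v i = lookup 0 i"
        using h0 that(1) by (cases i) (auto simp: graded_piece_def free_module_iff)
    qed
    then show ?thesis by auto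
  qed
  let ?N = "mon_count (w + 3)"
  let ?G1 = "graded_piece [a, e] t :: (nat \<Rightarrow>\<^sub>0 ('n, 'k) mpol) set"
  let ?G2 = "graded_piece [a + e] t :: (nat \<Rightarrow>\<^sub>0 ('n, 'k) mpol) set"
  have d1: "fvec.dim ?G1 = fvec.dim (lin ?gs ` ?G1) + fvec.dim {v \<in> ?G1. lin ?gs v = 0}"
    by (rule rank_nullity_graded[OF linear_on_lin subset_UNIV subspace_graded_piece order_refl])
  have d2: "fvec.dim ?G2 = fvec.dim {v \<in> ?G1. lin ?gs v = 0}"
    using rank_nullity_graded[OF linear_on_lin[of UNIV ?ks] subset_UNIV subspace_graded_piece order_refl, of "[a + e]" t]
    by (simp only: i1 i2 fvec_dim_0)
  define U where "U = {p. single 0 p \<in> lin ?gs ` ?G1}"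
  have U1: "U \<subseteq> I \<inter> forms t"
  proof
    fix u assume "u \<in> U"
    then obtain v where v: "v \<in> ?G1" "single 0 u = lin ?gs v" by (auto simp: U_def)
    then have "single 0 u = single (0::nat) (lookup v 0 * p + lookup v (Suc 0) * h)"
      by (simp add: gl)
    then have "lookup (single (0::nat) u) 0 = lookup v 0 * p + lookup v (Suc 0) * h" by simp
    then have "u = lookup v 0 * p + lookup v (Suc 0) * h" by simp
    then have "u \<in> I" using is_idealD[OF I(1)] I by simp
    moreover have "lin ?gs v \<in> graded_piece [0] t" using ggr v(1) by blast
    then have "u \<in> forms t" using v(2)[symmetric] by (auto simp: graded_piece_def)
    ultimately show "u \<in> I \<inter> forms t" by simp
  qed
  have sU: "pmod.subspace U"
  proof -
    have s: "fvec.subspace (lin ?gs ` ?G1)"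
      unfolding fvec.subspace_def
      using fvec.subspace_add[OF subspace_graded_piece, of _ "[a, e]" t] fvec.subspace_scale[OF subspace_graded_piece, of _ "[a, e]" t]
      by (auto simp flip: lin_add lin_fscale intro!: imageI rev_image_eqI[of 0])
    show ?thesis unfolding pmod.subspace_def U_def
      using fvec.subspace_0[OF s] fvec.subspace_add[OF s] fvec.subspace_scale[OF s]
      by (auto simp: single_add pscale_eq_const_mult simp flip: fscale_single)
  qed
  have Uim: "single (0::nat) ` U = lin ?gs ` ?G1" by (auto simp: U_def gl)
  have "pvec.dim U = fvec.dim (single (0::nat) ` U) + pvec.dim {x \<in> U. single (0::nat) x = 0}"
  proof (rule rank_nullity[OF pvec_vector_space fvec_vector_space sU, of "(\<lambda>m. single m 1) ` monomials t"])
    show "U \<subseteq> pmod.span ((\<lambda>m. single m 1) ` monomials t)"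
      using U1 forms_eq_span by blast
  qed (auto simp: single_add fscale_single pscale_eq_const_mult)
  then have dU: "fvec.dim (lin ?gs ` ?G1) \<le> pvec.dim U" using Uim by simp
  have "fvec.dim ?G1 = ?N (t - int a) + ?N (t - int e)" by (simp add: dim_graded_piece nmon_eq w)
  moreover have "fvec.dim ?G2 = ?N (t - int a - int e)" by (simp add: dim_graded_piece nmon_eq w algebra_simps)
  ultimately have "nmon TYPE('n) t \<le> pvec.dim U + a * e * (nat t + 1) ^ w"
    using mon_count_second_difference[of w t a e] d1 d2 dU unfolding nmon_eq w by linarith
  then show ?thesis by (rule codim_le_of_dim[OF U1])
qed

text \<open>Multiplication by p maps R/(I, g), shifted by a, onto the kernel of R/(I, p g)
  \<rightarrow> R/(I, p); spanning sets of the two outer modules combine to one of the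
  middle.\<close>

lemma codim_filtration:
  fixes p g :: "('n::finite, 'k::field) mpol"
  assumes I: "homogeneous_ideal I" and p: "p \<in> forms (int a)"
    and c1: "codim_le (ideal_gen (insert p I)) t c" and c2: "codim_le (ideal_gen (insert g I)) (t - int a) c'"
  shows "codim_le (ideal_gen (insert (p * g) I)) t (c + c')"
proof -
  have iI: "is_ideal I" using I by (auto simp: homogeneous_ideal_def is_ideal_ideal_gen)
  let ?P = "ideal_gen (insert p I)" and ?G = "ideal_gen (insert g I)" and ?J = "ideal_gen (insert (p * g) I)"
  note J = is_idealD[OF is_ideal_ideal_gen[of "insert (p * g) I"]]
  have IJ: "I \<subseteq> ?J" "p * g \<in> ?J" using ideal_gen_superset by blast+
  have gen: "\<exists>i\<in>I. \<exists>u. y = i + q * u" if "y \<in> ideal_gen (insert q I)" for y q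
  proof -
    have "is_ideal {y. \<exists>i\<in>I. \<exists>u. y = i + q * u}"
    proof (rule is_idealI)
      show "0 \<in> {y. \<exists>i\<in>I. \<exists>u. y = i + q * u}"
        using is_idealD(1)[OF iI] by (intro CollectI bexI[of _ 0] exI[of _ 0]) auto
      fix x y assume "x \<in> {y. \<exists>i\<in>I. \<exists>u. y = i + q * u}"
      then obtain i u where x: "i \<in> I" "x = i + q * u" by blast
      show "c * x \<in> {y. \<exists>i\<in>I. \<exists>u. y = i + q * u}" for c
        using is_idealD(3)[OF iI x(1)] x(2)
        by (intro CollectI bexI[of _ "c * i"] exI[of _ "c * u"]) (auto simp: algebra_simps)
      assume "y \<in> {y. \<exists>i\<in>I. \<exists>u. y = i + q * u}"
      then obtain j v where y: "j \<in> I" "y = j + q * v" by blast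
      show "x + y \<in> {y. \<exists>i\<in>I. \<exists>u. y = i + q * u}"
        using is_idealD(2)[OF iI x(1) y(1)] x(2) y(2)
        by (intro CollectI bexI[of _ "i + j"] exI[of _ "u + v"]) (auto simp: algebra_simps)
    qed
    moreover have "insert q I \<subseteq> {y. \<exists>i\<in>I. \<exists>u. y = i + q * u}"
    proof
      fix y assume "y \<in> insert q I"
      then show "y \<in> {y. \<exists>i\<in>I. \<exists>u. y = i + q * u}"
      proof
        assume "y = q"
        then show ?thesis using is_idealD(1)[OF iI] by (intro CollectI bexI[of _ 0] exI[of _ 1]) auto
      next
        assume "y \<in> I"
        then show ?thesis by (intro CollectI bexI[of _ y] exI[of _ 0]) auto
      qed
    qed
    ultimately show ?thesis using ideal_gen_minimal that by blast
  qed
  obtain B where B: "finite B" "card B \<le> c" "forms t \<subseteq> pmod.span ((?P \<inter> forms t) \<union> B)"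
    using c1 unfolding codim_le_def by blast
  obtain B' where B': "finite B'" "card B' \<le> c'" "forms (t - int a) \<subseteq> pmod.span ((?G \<inter> forms (t - int a)) \<union> B')"
    using c2 unfolding codim_le_def by blast
  let ?S = "pmod.span ((?J \<inter> forms t) \<union> (B \<union> (*) p ` B'))"
  have base: "x \<in> ?S" if "x \<in> ?J \<inter> forms t" for x using that by (intro pmod.span_base) auto
  have mulp: "p * x \<in> ?S" if "x \<in> forms (t - int a)" for x
  proof -
    have "x \<in> pmod.span ((?G \<inter> forms (t - int a)) \<union> B')" using that B' by blast
    then show ?thesis
    proof (induction rule: pmod.span_induct_alt)
      case base
      then show ?case using pmod.span_zero by simp
    next
      case (step c x y)
      have "p * x \<in> ?S"
      proof (cases "x \<in> B'")
        case True
        then show ?thesis by (intro pmod.span_base) auto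
      next
        case False
        then have x: "x \<in> ?G" "x \<in> forms (t - int a)" using step by auto
        obtain i u where "i \<in> I" "x = i + g * u" using gen[OF x(1)] by blast
        then have "p * x = p * i + (p * g) * u" by (simp add: algebra_simps)
        moreover have "p * i \<in> ?J" using J(3) IJ(1) \<open>i \<in> I\<close> by blast
        moreover have "(p * g) * u \<in> ?J" using J(4)[OF IJ(2)] .
        ultimately have "p * x \<in> ?J" using J(2) by simp
        moreover have "p * x \<in> forms t" using forms_mult[OF p x(2)] by simp
        ultimately show ?thesis by (intro base) auto
      qed
      then have "pscale c (p * x) + p * y \<in> ?S" using step by (intro pmod.span_add pmod.span_scale)
      moreover have "p * (pscale c x + y) = pscale c (p * x) + p * y"
        unfolding pscale_eq_const_mult by (simp only: algebra_simps)
      ultimately show ?case by (simp only:)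
    qed
  qed
  have "(?P \<inter> forms t) \<union> B \<subseteq> ?S"
  proof
    fix y assume "y \<in> (?P \<inter> forms t) \<union> B"
    then consider "y \<in> B" | "y \<in> ?P" "y \<in> forms t" by blast
    then show "y \<in> ?S"
    proof cases
      case 1
      then show ?thesis by (intro pmod.span_base) auto
    next
      case 2
      obtain i u where iu: "i \<in> I" "y = i + p * u" using gen[OF 2(1)] by blast
      have "y = icomp t y" using icomp_forms[OF 2(2), of t] by simp
      also have "\<dots> = icomp t i + p * icomp (t - int a) u"
        using icomp_mult_form[OF p, of t u] by (simp add: iu icomp_add mult.commute)
      finally have y: "y = icomp t i + p * icomp (t - int a) u" .
      have "icomp t i \<in> ?J \<inter> forms t" using homogeneous_ideal_icomp[OF I iu(1)] IJ by auto
      then have "icomp t i + p * icomp (t - int a) u \<in> ?S" by (intro pmod.span_add base mulp) auto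
      then show ?thesis using y by simp
    qed
  qed
  then have "forms t \<subseteq> ?S" using B(3) pmod.span_minimal[OF _ pmod.subspace_span] by blast
  moreover have "card (B \<union> (*) p ` B') \<le> c + c'"
    using card_Un_le[of B "(*) p ` B'"] card_image_le[OF B'(1), of "(*) p"] B(2) B'(2) by linarith
  ultimately show ?thesis unfolding codim_le_def using B(1) B'(1)
    by (intro exI[of _ "B \<union> (*) p ` B'"]) auto
qed

text \<open>A nonzero homogeneous generator f of I is peeled off one prime factor p at a time. Each
  R/(I, p) is bounded through p and a member of I coprime to p, and the bounds add up along the
  filtration given by the factors.\<close>

lemma hilbert_function_growth:
  fixes I :: "('n::finite, 'k::field) mpol set"
  assumes w: "CARD('n) = w + 3" and I: "homogeneous_ideal I" and ht: "height I = 2"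
  shows "\<exists>C. \<forall>t. hilbert_function I t \<le> C * (t + 1) ^ w"
proof -
  obtain S where S: "S \<subseteq> (\<Union>t. forms t)" "I = ideal_gen S" using I by (auto simp: homogeneous_ideal_def)
  have iI: "is_ideal I" by (simp add: S is_ideal_ideal_gen)
  have SI: "S \<subseteq> I" using S ideal_gen_superset by blast
  have natdeg: "\<exists>e. h \<in> forms (int e)" if h: "h \<in> S" "h \<noteq> 0" for h
  proof -
    obtain u where u: "h \<in> forms u" using S h by blast
    then have "0 \<le> u" using forms_neg h(2) not_le by blast
    then show ?thesis using u by (metis nonneg_int_cases)
  qed
  have main: "\<exists>C. \<forall>t. codim_le (ideal_gen (insert g I)) t (C * (nat t + 1) ^ w)"
    if "g \<noteq> 0" "g \<in> forms (int b)" for g b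
    using that
  proof (induction "wdeg mdeg g" arbitrary: g b rule: less_induct)
    case less
    show ?case
    proof (cases "g dvd 1")
      case True
      then obtain r where "1 = g * r" by (auto simp: dvd_def)
      then have "1 \<in> ideal_gen (insert g I)"
        using is_idealD(4)[OF is_ideal_ideal_gen] ideal_gen_superset by (metis insertI1 subsetD)
      then have "x \<in> ideal_gen (insert g I)" for x
        using is_idealD(3)[OF is_ideal_ideal_gen, of 1 "insert g I" x] by simp
      then have "codim_le (ideal_gen (insert g I)) t (0 * (nat t + 1) ^ w)" for t
        unfolding codim_le_def using pmod.span_superset[of "ideal_gen (insert g I) \<inter> forms t"]
        by (intro exI[of _ "{}"]) auto
      then show ?thesis by blast
    next
      case False
      obtain p where p: "prime_elem p" "p dvd g" using exists_prime_factor less.prems(1) False by blast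
      then obtain g' where g': "g = p * g'" by (auto simp: dvd_def)
      have nz: "p \<noteq> 0" "g' \<noteq> 0" using g' less.prems by auto
      obtain a b' where ab: "p \<in> forms (int a)" "g' \<in> forms (int b')"
        using forms_factor[of p g' "int b"] g' less.prems by auto
      have "wdeg mdeg p > 0" using p(1) nz by (auto simp: prime_elem_def mpol_unit_iff)
      then have "wdeg mdeg g' < wdeg mdeg g" using g' nz by (simp add: wdeg_mult)
      then obtain C where C: "\<And>t. codim_le (ideal_gen (insert g' I)) t (C * (nat t + 1) ^ w)"
        using less.hyps[OF _ nz(2) ab(2)] by blast
      \<comment> \<open>Otherwise I would be contained in the principal prime ideal of p, which has
        height at most 1. Taking h among the generators makes it a form.\<close>
      have "\<exists>h\<in>S. \<not> p dvd h"
      proof (rule ccontr)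
        assume "\<not> ?thesis"
        then have "S \<subseteq> {q. p dvd q}" by auto
        then have "I \<subseteq> {q. p dvd q}"
          using S(2) ideal_gen_minimal prime_idealD(1)[OF prime_ideal_multiples[OF p(1)]] by metis
        then show False using height_2_not_multiples[OF ht p(1)] by blast
      qed
      then obtain h where h: "h \<in> S" "\<not> p dvd h" by blast
      then obtain e where e: "h \<in> forms (int e)" using natdeg[of h] by (cases "h = 0") auto
      have c1: "codim_le (ideal_gen (insert p I)) t (a * e * (nat t + 1) ^ w)" for t
        using h SI ideal_gen_superset[of "insert p I"]
        by (intro codim_two_forms[OF w p(1) ab(1) e h(2) is_ideal_ideal_gen]) auto
      have "codim_le (ideal_gen (insert g I)) t ((a * e + C) * (nat t + 1) ^ w)" for t
      proof -
        have "codim_le (ideal_gen (insert g I)) t (a * e * (nat t + 1) ^ w + C * (nat (t - int a) + 1) ^ w)"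
          unfolding g' by (rule codim_filtration[OF I ab(1) c1 C])
        moreover have "a * e * (nat t + 1) ^ w + C * (nat (t - int a) + 1) ^ w \<le> (a * e + C) * (nat t + 1) ^ w"
          by (simp add: distrib_right power_mono)
        ultimately show ?thesis unfolding codim_le_def by (meson order_trans)
      qed
      then show ?thesis by blast
    qed
  qed
  have "\<exists>f\<in>S. f \<noteq> 0"
  proof (rule ccontr)
    assume "\<not> ?thesis"
    then have "I \<subseteq> {0}" using S(2) by (metis ideal_gen_minimal insertCI is_idealI singletonD subsetI mult_zero_right add_0)
    then show False using height_2_nonzero[OF ht] by auto
  qed
  then obtain f where f: "f \<in> S" "f \<noteq> 0" by blast
  then obtain b where b: "f \<in> forms (int b)" using natdeg by blast
  \<comment> \<open>Adjoining f changes nothing because f is in I, so the bound applies to I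
    itself.\<close>
  have "ideal_gen (insert f I) = I"
    using f SI by (metis S(2) iI ideal_gen_minimal ideal_gen_superset insert_absorb order_refl subsetD subset_antisym)
  then obtain C where C: "\<And>t. codim_le I t (C * (nat t + 1) ^ w)" using main[OF f(2) b] by auto
  have "hilbert_function I t \<le> C * (t + 1) ^ w" for t
    using hilbert_function_le_codim[OF C[of "int t"]] by simp
  then show ?thesis by blast
qed

text \<open>Some prime P over I has height 2, and modulo P there are n - 2 = w + 1 algebraically
  independent variables. The monomials of degree t in these variables stay linearly independent
  modulo P, hence modulo I.\<close>

lemma hilbert_function_lower_bound:
  fixes I :: "('n::finite, 'k::field) mpol set"
  assumes w: "CARD('n) = w + 3" and I: "is_ideal I" and ht: "height I = 2"
  shows "mon_count (w + 1) (int t) \<le> hilbert_function I t"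
proof -
  obtain P where P: "prime_ideal P" "I \<subseteq> P" "prime_height P = 2"
    using height_attained[of I 2] ht by (auto simp: numeral_eq_enat)
  obtain Y where Y: "CARD('n) \<le> card Y + 2" "P \<inter> indets Y = {0}"
    using independent_variables[OF P(1)] P(3) by auto
  have "w + 1 \<le> card Y" using Y(1) w by simp
  then obtain Z where Z: "Z \<subseteq> Y" "card Z = w + 1" by (meson obtain_subset_with_card_n)
  let ?M = "{m \<in> monomials (int t). keys m \<subseteq> Z} :: ('n \<Rightarrow>\<^sub>0 nat) set"
  let ?A = "(\<lambda>m. single m (1::'k)) ` ?M"
  have finM: "finite ?M" by simp
  have spA: "pmod.span ?A \<subseteq> indets Y"
  proof (rule pmod.span_minimal)
    show "?A \<subseteq> indets Y" using Z by (auto simp: indets_def)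
    show "pmod.subspace (indets Y :: ('n, 'k) mpol set)"
      by (auto simp: pmod.subspace_def indets_add pscale_eq_const_mult intro: indets_mult)
  qed
  obtain B where B: "B \<subseteq> forms (int t) \<inter> I" "pmod.independent B" "forms (int t) \<inter> I \<subseteq> pmod.span B" "card B = pvec.dim (forms (int t) \<inter> I)"
    using pvec.basis_exists[of "forms (int t) \<inter> I"] by blast
  have spB: "pmod.span B \<subseteq> I" using B(1) by (intro pmod.span_minimal subspace_ideal I) auto
  have finB: "finite B" using B(1,2) finite_independent_forms by blast
  have finA: "finite ?A" by simp
  have AB: "pmod.span ?A \<inter> pmod.span B \<subseteq> {0}" using spA spB P(2) Y(2) by blast
  have dis: "?A \<inter> B = {}"
  proof -
    have "single m (1::'k) \<noteq> 0" for m :: "'n \<Rightarrow>\<^sub>0 nat" by simp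
    then show ?thesis using AB pmod.span_superset[of ?A] pmod.span_superset[of B] by fastforce
  qed
  have indA: "pmod.independent ?A" by (rule independent_monomials[OF finM])
  have "pmod.independent (?A \<union> B)"
  proof (rule pvec.independent_if_scalars_zero)
    show "finite (?A \<union> B)" using finA finB by simp
    fix u x assume s: "(\<Sum>x\<in>?A \<union> B. pscale (u x) x) = 0" and x: "x \<in> ?A \<union> B"
    have e: "(\<Sum>x\<in>?A. pscale (u x) x) + (\<Sum>x\<in>B. pscale (u x) x) = 0"
      using s by (simp only: sum.union_disjoint[OF finA finB dis])
    have insp: "(\<Sum>x\<in>C. pscale (u x) x) \<in> pmod.span C" for C
      by (intro pmod.span_sum pmod.span_scale pmod.span_base)
    note inB = insp[of B] and inA = insp[of ?A]
    have "(\<Sum>x\<in>?A. pscale (u x) x) = - (\<Sum>x\<in>B. pscale (u x) x)" using e by (simp add: eq_neg_iff_add_eq_0)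
    then have "(\<Sum>x\<in>?A. pscale (u x) x) \<in> pmod.span B" using pmod.span_neg[OF inB] by (simp only:)
    then have zA: "(\<Sum>x\<in>?A. pscale (u x) x) = 0" using inA AB by blast
    then have zB: "(\<Sum>x\<in>B. pscale (u x) x) = 0" using e by simp
    have zero: "u x = 0" if "pmod.independent C" "finite C" "(\<Sum>x\<in>C. pscale (u x) x) = 0" "x \<in> C" for C
      using pmod.independentD[OF that(1,2) order_refl that(3,4)] .
    show "u x = 0" using x zero[OF indA finA zA] zero[OF B(2) finB zB] by blast
  qed
  moreover have "?A \<union> B \<subseteq> pmod.span ((\<lambda>m. single m 1) ` monomials (int t))"
  proof -
    have "?A \<subseteq> forms (int t)" by (auto simp: forms_def monomials_def)
    then show ?thesis using B(1) forms_eq_span by blast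
  qed
  ultimately have "card (?A \<union> B) \<le> card ((\<lambda>m. single m (1::'k)) ` (monomials (int t) :: ('n \<Rightarrow>\<^sub>0 nat) set))"
    by (intro conjunct2[OF pvec.independent_span_bound]) auto
  also have "\<dots> = pvec.dim (forms (int t) :: ('n, 'k) mpol set)" by (simp add: card_single_image dim_forms)
  finally have "card ?A + card B \<le> pvec.dim (forms (int t) :: ('n, 'k) mpol set)"
    using card_Un_disjoint[OF finA finB dis] by simp
  moreover have "card ?A = mon_count (w + 1) (int t)"
    using card_single_image[of ?M] card_monomials_vars[of "int t" Z] Z(2) by simp
  ultimately show ?thesis unfolding hilbert_function_def using B(4) by linarith
qed

section \<open>Hilbert polynomials\<close>

lemma poly_eventually_positive:
  fixes p :: "rat poly"
  assumes "lead_coeff p > 0"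
  shows "\<exists>c>0. \<exists>T. \<forall>x\<ge>T. poly p x \<ge> c"
  using assms
proof (induction p)
  case (pCons a q)
  show ?case
  proof (cases "q = 0")
    case True
    then show ?thesis using pCons.prems by (intro exI[of _ a]) auto
  next
    case False
    then obtain c T where c: "c > 0" "\<And>x. x \<ge> T \<Longrightarrow> poly q x \<ge> c" using pCons by auto
    have "poly (pCons a q) x \<ge> 1" if x: "x \<ge> max T (max 0 ((1 - a) / c))" for x
    proof -
      have "x * poly q x \<ge> x * c" using x c(2)[of x] by (intro mult_left_mono) auto
      moreover have "x * c \<ge> 1 - a" using x c(1) by (simp add: pos_divide_le_eq)
      ultimately show ?thesis by simp
    qed
    then have "\<exists>T. \<forall>x\<ge>T. 1 \<le> poly (pCons a q) x" by blast
    then show ?thesis using zero_less_one by blast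
  qed
qed simp

lemma poly_eventually_positive_nat:
  fixes p :: "rat poly"
  assumes "lead_coeff p > 0"
  shows "\<exists>T::nat. \<forall>t\<ge>T. poly p (of_nat t) > 0"
proof -
  obtain c T where c: "c > 0" "\<And>x. x \<ge> T \<Longrightarrow> poly p x \<ge> c" using poly_eventually_positive[OF assms] by auto
  obtain N :: nat where N: "T \<le> of_nat N" using real_arch_simple[of T] by blast
  have "poly p (of_nat t) > 0" if "t \<ge> N" for t
  proof -
    have "T \<le> of_nat t" using N that by (meson of_nat_mono order_trans)
    then show ?thesis using c(1) c(2)[of "of_nat t"] by linarith
  qed
  then show ?thesis by blast
qed

lemma poly_eq_eventually:
  fixes p q :: "rat poly"
  assumes "\<And>t::nat. t \<ge> T \<Longrightarrow> poly p (of_nat t) = poly q (of_nat t)"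
  shows "p = q"
proof (rule ccontr)
  assume "p \<noteq> q"
  then have "finite {x. poly (p - q) x = 0}" by (intro poly_roots_finite) simp
  moreover have "(of_nat :: nat \<Rightarrow> rat) ` {T..} \<subseteq> {x. poly (p - q) x = 0}" using assms by auto
  ultimately have "finite ((of_nat :: nat \<Rightarrow> rat) ` {T..})" by (rule finite_subset[rotated])
  then have "finite {T..}" by (rule finite_imageD) (auto simp: inj_on_def)
  then show False using infinite_Ici by blast
qed

section \<open>Leading coefficients of Hilbert polynomials\<close>

text \<open>The polynomial binom(t + v, v), of degree v; it counts monomials in v + 1 variables, not
  in v.\<close>

definition mon_poly :: "nat \<Rightarrow> rat poly" where
  "mon_poly v = smult (inverse (fact v)) (\<Prod>i<v. [:of_nat (Suc i), 1:])"

lemma poly_mon_poly: "t \<ge> 0 \<Longrightarrow> poly (mon_poly v) (of_int t) = of_nat (mon_count (Suc v) t)"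
proof -
  assume "t \<ge> 0"
  then obtain k where k: "t = int k" by (metis nonneg_int_cases)
  have "(of_nat (mon_count (Suc v) t) :: rat) = of_nat ((k + v) choose v)"
    using k binomial_symmetric[of k "k + v"] by (simp add: mon_count_def)
  also have "\<dots> = (of_nat (k + v) gchoose v)" by (rule binomial_gbinomial)
  also have "\<dots> = pochhammer (of_nat (k + v) - of_nat v + 1) v / fact v" by (rule gbinomial_pochhammer')
  also have "\<dots> = (\<Prod>i<v. of_nat k + 1 + of_nat i) / fact v"
    by (simp add: pochhammer_prod atLeast0LessThan)
  also have "\<dots> = poly (mon_poly v) (of_int t)"
    by (simp add: mon_poly_def poly_prod k divide_inverse ac_simps)
  finally show ?thesis by simp
qed

lemma degree_prod_linear: "degree (\<Prod>i<v. [:a i, 1:] :: rat poly) = v"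
  by (subst degree_prod_eq_sum_degree) auto

lemma lead_coeff_mon_poly: "degree (mon_poly v) = v" "coeff (mon_poly v) v = inverse (fact v)"
proof -
  show d: "degree (mon_poly v) = v" by (simp add: mon_poly_def degree_prod_linear del: of_nat_Suc)
  have "lead_coeff (mon_poly v) = inverse (fact v)"
    by (simp add: mon_poly_def lead_coeff_smult lead_coeff_prod del: of_nat_Suc)
  then show "coeff (mon_poly v) v = inverse (fact v)" using d by simp
qed

lemma pcompose_monom: "pcompose (monom c i) r = smult c (r ^ i)" for r :: "rat poly"
  by (induction i) (simp_all add: monom_0 monom_Suc pcompose_pCons mult_ac)

lemma coeff_shift:
  fixes p :: "rat poly"
  assumes "degree p \<le> D"
  shows "coeff (pcompose p [:- s, 1:]) j = (\<Sum>i=j..D. coeff p i * of_nat (i choose j) * (- s) ^ (i - j))"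
proof -
  have "pcompose p [:- s, 1:] = pcompose (\<Sum>i\<le>D. monom (coeff p i) i) [:- s, 1:]"
    using assms by (simp add: poly_as_sum_of_monoms')
  also have "\<dots> = (\<Sum>i\<le>D. smult (coeff p i) ([:- s, 1:] ^ i))"
    by (simp add: pcompose_sum pcompose_monom)
  finally have "coeff (pcompose p [:- s, 1:]) j = (\<Sum>i\<le>D. coeff p i * coeff ([:- s, 1:] ^ i) j)"
    by (simp add: coeff_sum)
  also have "\<dots> = (\<Sum>i=j..D. coeff p i * coeff ([:- s, 1:] ^ i) j)"
  proof (rule sum.mono_neutral_right)
    show "\<forall>i\<in>{..D} - {j..D}. coeff p i * coeff ([:- s, 1:] ^ i) j = 0"
    proof
      fix i assume "i \<in> {..D} - {j..D}"
      then have "degree ([:- s, 1:] ^ i) < j" by (auto simp: degree_linear_power)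
      then show "coeff p i * coeff ([:- s, 1:] ^ i) j = 0" by (simp add: coeff_eq_0)
    qed
  qed auto
  also have "\<dots> = (\<Sum>i=j..D. coeff p i * of_nat (i choose j) * (- s) ^ (i - j))"
    by (intro sum.cong refl) (simp add: coeff_linear_poly_power)
  finally show ?thesis .
qed

text \<open>Taylor expansion of p (t - s), for the three top coefficients only: w + 2 = n - 1 is the
  degree for R itself, and w is the degree that remains for a quotient of codimension 2.\<close>

lemma coeff_shift_top:
  fixes p :: "rat poly"
  assumes "degree p \<le> w + 2"
  shows "coeff (pcompose p [:- s, 1:]) (w + 2) = coeff p (w + 2)"
    and "coeff (pcompose p [:- s, 1:]) (w + 1) = coeff p (w + 1) - of_nat (w + 2) * coeff p (w + 2) * s"
    and "coeff (pcompose p [:- s, 1:]) w = coeff p w - of_nat (w + 1) * coeff p (w + 1) * s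
      + of_nat ((w + 2) choose w) * coeff p (w + 2) * s\<^sup>2"
    and "w + 2 < j \<Longrightarrow> coeff (pcompose p [:- s, 1:]) j = 0"
proof -
  have e1: "{w + 1..w + 2} = {w + 1, w + 2}" and e2: "{w..w + 2} = {w, w + 1, w + 2}" by auto
  have c1: "(w + 2) choose (w + 1) = w + 2" using binomial_Suc_n[of "w + 1"] by simp
  have c2: "(w + 1) choose w = w + 1" using binomial_Suc_n[of w] by simp
  show "coeff (pcompose p [:- s, 1:]) (w + 2) = coeff p (w + 2)"
    unfolding coeff_shift[OF assms] by simp
  show "coeff (pcompose p [:- s, 1:]) (w + 1) = coeff p (w + 1) - of_nat (w + 2) * coeff p (w + 2) * s"
    unfolding coeff_shift[OF assms] e1 using c1 by (simp add: algebra_simps)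
  show "coeff (pcompose p [:- s, 1:]) w = coeff p w - of_nat (w + 1) * coeff p (w + 1) * s
      + of_nat ((w + 2) choose w) * coeff p (w + 2) * s\<^sup>2"
    unfolding coeff_shift[OF assms] e2 using c2 by (simp add: power2_eq_square algebra_simps)
  show "w + 2 < j \<Longrightarrow> coeff (pcompose p [:- s, 1:]) j = 0"
    unfolding coeff_shift[OF assms] by simp
qed

text \<open>With \<open>n = w + 3\<close>, the three leading coefficients of \<open>\<Sum> c binom(t - s + n - 1, n - 1)\<close> are determined by
  the moments \<open>\<Sum> c\<close>, \<open>\<Sum> c s\<close> and \<open>\<Sum> c s\<^sup>2\<close>.\<close>

lemma hilbert_function_moments:
  fixes I :: "('n::finite, 'k::field) mpol set" and L :: "(int \<times> int) list"
  assumes HF: "\<And>t. t \<ge> t0 \<Longrightarrow> int (hilbert_function I t) = (\<Sum>(c, s)\<leftarrow>L. c * int (mon_count (w + 3) (int t - s)))"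
    and bound: "\<And>t. hilbert_function I t \<le> C * (t + 1) ^ w"
  shows "(\<Sum>(c, s)\<leftarrow>L. c) = 0" and "(\<Sum>(c, s)\<leftarrow>L. c * s) = 0"
    and "(\<Sum>(c, s)\<leftarrow>L. c * s\<^sup>2) \<noteq> 0 \<Longrightarrow> 2 * multiplicity_quot I = of_int (\<Sum>(c, s)\<leftarrow>L. c * s\<^sup>2)"
    and "(\<And>t. mon_count (w + 1) (int t) \<le> hilbert_function I t) \<Longrightarrow> (\<Sum>(c, s)\<leftarrow>L. c * s\<^sup>2) \<noteq> 0"
proof -
  define p :: "rat poly" where
    "p = (\<Sum>(c, s)\<leftarrow>L. smult (of_int c) (pcompose (mon_poly (w + 2)) [:- of_int s, 1:]))"
  \<comment> \<open>Beyond T all arguments t - s are nonnegative, where counting monomials agrees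
    with the polynomial.\<close>
  define T where "T = max t0 (nat (\<Sum>(c, s)\<leftarrow>L. \<bar>s\<bar>))"
  have poly_p: "poly p (of_nat t) = of_nat (hilbert_function I t)" if t: "t \<ge> T" for t
  proof -
    have le: "s \<le> int t" if "(c, s) \<in> set L" for c s
    proof -
      have "s \<le> (\<Sum>(c, s)\<leftarrow>L. \<bar>s\<bar>)"
        using that
      proof (induction L)
        case (Cons x L)
        have "0 \<le> (\<Sum>(c, s)\<leftarrow>L. \<bar>s\<bar>)" by (rule sum_list_nonneg) auto
        then show ?case using Cons by (auto split: prod.splits)
      qed simp
      moreover have "nat (\<Sum>(c, s)\<leftarrow>L. \<bar>s\<bar>) \<le> t" using t unfolding T_def by simp
      ultimately show ?thesis by linarith
    qed
    have "poly p (of_nat t) = (\<Sum>(c, s)\<leftarrow>L. of_int c * poly (mon_poly (w + 2)) (of_int (int t - s)))"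
      unfolding p_def by (induction L) (auto simp: poly_pcompose algebra_simps)
    also have "\<dots> = (\<Sum>(c, s)\<leftarrow>L. of_int (c * int (mon_count (w + 3) (int t - s))))"
      using le poly_mon_poly[of _ "w + 2"]
      by (intro arg_cong[of _ _ sum_list] map_cong refl) (auto simp: numeral_3_eq_3 simp del: of_int_diff)
    also have "\<dots> = of_int (\<Sum>(c, s)\<leftarrow>L. c * int (mon_count (w + 3) (int t - s)))"
      by (induction L) auto
    also have "\<dots> = of_int (int (hilbert_function I t))" using HF[of t] t by (simp add: T_def)
    finally show ?thesis by simp
  qed
  let ?B = "mon_poly (w + 2)"
  have dB: "degree ?B \<le> w + 2" by (simp add: lead_coeff_mon_poly)
  have cB: "coeff ?B (w + 2) \<noteq> 0" by (simp add: lead_coeff_mon_poly(2)[of "w + 2", simplified])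
  note sh = coeff_shift_top[OF dB]
  let ?S0 = "\<Sum>(c, s)\<leftarrow>L. c" and ?S1 = "\<Sum>(c, s)\<leftarrow>L. c * s" and ?S2 = "\<Sum>(c, s)\<leftarrow>L. c * s\<^sup>2"
  have k0: "coeff p (w + 2) = of_int ?S0 * coeff ?B (w + 2)"
    unfolding p_def by (induction L) (auto simp: sh(1)[simplified] algebra_simps)
  have k1: "coeff p (w + 1) = of_int ?S0 * coeff ?B (w + 1) - of_nat (w + 2) * coeff ?B (w + 2) * of_int ?S1"
    unfolding p_def
  proof (induction L)
    case (Cons x L)
    then show ?case by (cases x) (simp only: list.map sum_list.Cons prod.case coeff_add coeff_smult sh(2), simp add: algebra_simps)
  qed simp
  have k2: "coeff p w = of_int ?S0 * coeff ?B w - of_nat (w + 1) * coeff ?B (w + 1) * of_int ?S1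
      + of_nat ((w + 2) choose w) * coeff ?B (w + 2) * of_int ?S2"
    unfolding p_def
  proof (induction L)
    case (Cons x L)
    then show ?case by (cases x) (simp only: list.map sum_list.Cons prod.case coeff_add coeff_smult sh(3), simp add: algebra_simps)
  qed simp
  have hp: "hilbert_poly I = p"
    unfolding hilbert_poly_def
  proof (rule the_equality)
    show "\<exists>t0. \<forall>t\<ge>t0. of_nat (hilbert_function I t) = poly p (of_nat t)" using poly_p by metis
    fix q :: "rat poly" assume "\<exists>t0. \<forall>t\<ge>t0. of_nat (hilbert_function I t) = poly q (of_nat t)"
    then obtain t1 where "\<And>t. t \<ge> t1 \<Longrightarrow> of_nat (hilbert_function I t) = poly q (of_nat t)" by auto
    then show "q = p" using poly_p by (intro poly_eq_eventually[of "max t1 T"]) auto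
  qed
  \<comment> \<open>A degree above w would make p exceed the growth bound, or become negative, for
    large t.\<close>
  have deg: "degree p \<le> w"
  proof (rule ccontr)
    assume "\<not> ?thesis"
    then have d: "w < degree p" by simp
    then have "p \<noteq> 0" by auto
    then consider "lead_coeff p > 0" | "lead_coeff (- p) > 0"
      by (metis lead_coeff_minus leading_coeff_0_iff linorder_neqE_linordered_idom neg_0_less_iff_less)
    then show False
    proof cases
      case 1
      let ?q = "smult (of_nat C) ([:1, 1:] ^ w) :: rat poly"
      have "degree (- ?q) < degree p"
        using d degree_smult_le[of "of_nat C" "[:1, 1:] ^ w :: rat poly"] by (simp add: degree_linear_power)
      then have "lead_coeff (- ?q + p) > 0" using lead_coeff_add_le[of "- ?q" p] 1 by simp
      then obtain T' where T': "\<And>t. t \<ge> T' \<Longrightarrow> poly (- ?q + p) (of_nat t) > 0"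
        using poly_eventually_positive_nat by blast
      let ?t = "max T T'"
      have "of_nat C * (of_nat ?t + 1) ^ w < (of_nat (hilbert_function I ?t) :: rat)"
        using T'[of ?t] poly_p[of ?t] by (simp add: add.commute)
      moreover have "(of_nat (hilbert_function I ?t) :: rat) \<le> of_nat (C * (?t + 1) ^ w)"
        using bound[of ?t] by (simp only: of_nat_le_iff)
      ultimately show False by (simp add: add.commute)
    next
      case 2
      then obtain T' where T': "\<And>t. t \<ge> T' \<Longrightarrow> poly (- p) (of_nat t) > 0"
        using poly_eventually_positive_nat by blast
      show False using T'[of "max T T'"] poly_p[of "max T T'"] by simp
    qed
  qed
  have z: "coeff p (w + 2) = 0" "coeff p (w + 1) = 0" using deg by (auto intro: coeff_eq_0)
  show S0: "?S0 = 0" using k0 z cB by simp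
  show S1: "?S1 = 0" using k1 z cB S0 by simp
  \<comment> \<open>The top coefficient of \<open>mon_poly (w + 2)\<close> is 1 / (w + 2)!, and
    binom(w + 2, w) = (w + 2)! / (2 w!). This is the source of the factor 2 in front of the
    multiplicity.\<close>
  have c: "2 * fact w * (of_nat ((w + 2) choose w) * coeff ?B (w + 2)) = (1 :: rat)"
  proof -
    have "of_nat ((w + 2) choose w) = (fact (w + 2) / (fact w * fact 2) :: rat)"
      by (subst binomial_fact) auto
    moreover have "2 * b * (a / (b * fact 2) * inverse a) = (1 :: rat)" if "a \<noteq> 0" "b \<noteq> 0" for a b
      using that by simp
    ultimately show ?thesis unfolding lead_coeff_mon_poly(2) by (metis fact_nonzero)
  qed
  have k2': "2 * fact w * coeff p w = of_int ?S2"
  proof -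
    have "2 * fact w * coeff p w = 2 * fact w * (of_nat ((w + 2) choose w) * coeff ?B (w + 2)) * of_int ?S2"
      using k2 S0 S1 by simp
    then show ?thesis using c by simp
  qed
  show "2 * multiplicity_quot I = of_int ?S2" if "?S2 \<noteq> 0"
  proof -
    have nz: "coeff p w \<noteq> 0"
    proof
      assume "coeff p w = 0"
      then have "(of_int ?S2 :: rat) = 0" using k2' by simp
      then show False using that by (simp only: of_int_eq_0_iff)
    qed
    then have "degree p = w" using deg le_degree by (metis antisym)
    moreover have "p \<noteq> 0" using nz by auto
    ultimately show ?thesis using k2' by (simp add: multiplicity_quot_def hp)
  qed
  show "?S2 \<noteq> 0" if lb: "\<And>t. mon_count (w + 1) (int t) \<le> hilbert_function I t"
  proof
    assume "?S2 = 0"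
    then have "coeff p w = 0" using k2' by simp
    \<comment> \<open>If the second moment vanished, p would have no term of degree w, while the
      lower bound grows like t^w / w!. The difference would be positive for large t.\<close>
    let ?q = "mon_poly w - p"
    have "coeff ?q w = inverse (fact w)" using \<open>coeff p w = 0\<close> by (simp add: lead_coeff_mon_poly)
    moreover have "degree ?q \<le> w" using deg by (intro degree_diff_le) (simp add: lead_coeff_mon_poly)
    ultimately have "lead_coeff ?q = inverse (fact w)"
      using le_degree[of ?q w] by (metis antisym fact_nonzero inverse_nonzero_iff_nonzero)
    then have "lead_coeff ?q > 0" by simp
    then obtain T' where T': "\<And>t. t \<ge> T' \<Longrightarrow> poly ?q (of_nat t) > 0"
      using poly_eventually_positive_nat by blast
    let ?t = "max T T'"
    have "poly (mon_poly w) (of_nat ?t) = of_nat (mon_count (w + 1) (int ?t))"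
      using poly_mon_poly[of "int ?t" w] by (simp del: of_nat_max)
    then have "(of_nat (hilbert_function I ?t) :: rat) < of_nat (mon_count (w + 1) (int ?t))"
      using T'[of ?t] poly_p[of ?t] by simp
    then have "hilbert_function I ?t < mon_count (w + 1) (int ?t)" by (simp only: of_nat_less_iff)
    then show False using lb[of ?t] by simp
  qed
qed

section \<open>Modules of rank one and shape of the resolution\<close>

lemma pscale_mpol_eq_0_iff: "pscale c x = 0 \<longleftrightarrow> c = 0 \<or> x = 0"
  for x :: "nat \<Rightarrow>\<^sub>0 ('n::finite, 'k::field) mpol"
  by (auto simp: poly_mapping_eq_iff[of "pscale c x"] poly_mapping_eq_iff[of x] fun_eq_iff lookup_pscale)

lemma pscale_mpol_cancel:
  fixes x y :: "nat \<Rightarrow>\<^sub>0 ('n::finite, 'k::field) mpol"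
  assumes "pscale c x = pscale c y" "c \<noteq> 0"
  shows "x = y"
proof -
  have "pscale c (x - y) = 0" using assms by (simp add: pmod.scale_right_diff_distrib)
  then show ?thesis using assms(2) by (simp add: pscale_mpol_eq_0_iff)
qed

lemma pscale_divide:
  fixes x :: "nat \<Rightarrow>\<^sub>0 ('n::finite, 'k::field) mpol"
  assumes "\<And>i. p dvd lookup x i"
  shows "\<exists>y. x = pscale p y"
proof -
  have "\<forall>i. \<exists>q. lookup x i = p * q" using assms by (auto simp: dvd_def)
  then obtain q where q: "\<And>i. lookup x i = p * q i" by metis
  have "x = pscale p (Poly_Mapping.mapp (\<lambda>i _. q i) x)"
    by (rule poly_mapping_eqI) (auto simp: lookup_pscale lookup_mapp q when_def in_keys_iff)
  then show ?thesis by blast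
qed

text \<open>The prime factors of b are removed one at a time: each divides a, and then cancels on
  both sides, or divides every coordinate of x, and then moves from x into the multiplier
  c1.\<close>

lemma common_multiple_imp_common_divisor:
  fixes x y :: "nat \<Rightarrow>\<^sub>0 ('n::finite, 'k::field) mpol"
  assumes "pscale a x = pscale b y" "b \<noteq> 0"
  shows "\<exists>u c1 c2. x = pscale c1 u \<and> y = pscale c2 u"
  using assms
proof (induction "wdeg mdeg b" arbitrary: a b x rule: less_induct)
  case less
  show ?case
  proof (cases "b dvd 1")
    case True
    then obtain r where r: "1 = b * r" by (auto simp: dvd_def)
    have "y = pscale (r * b) y" using r by (simp add: mult.commute)
    also have "\<dots> = pscale (r * a) x"
      using less.prems(1) by (metis pmod.scale_scale)
    finally have "y = pscale (r * a) x" .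
    then show ?thesis by (intro exI[of _ x] exI[of _ 1] exI[of _ "r * a"]) auto
  next
    case False
    obtain p where p: "prime_elem p" "p dvd b" using exists_prime_factor less.prems(2) False by blast
    then obtain b' where b': "b = p * b'" by (auto simp: dvd_def)
    have nz: "p \<noteq> 0" "b' \<noteq> 0" using b' less.prems by auto
    have "wdeg mdeg p > 0" using p(1) nz by (auto simp: prime_elem_def mpol_unit_iff)
    then have lt: "wdeg mdeg b' < wdeg mdeg b" using b' nz by (simp add: wdeg_mult)
    show ?thesis
    proof (cases "p dvd a")
      case True
      then obtain a' where "a = p * a'" by (auto simp: dvd_def)
      then have "pscale p (pscale a' x) = pscale p (pscale b' y)" using less.prems(1) b' by simp
      then have "pscale a' x = pscale b' y" using nz(1) by (rule pscale_mpol_cancel)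
      then show ?thesis using less.hyps[OF lt _ nz(2)] by blast
    next
      case False
      have "p dvd lookup x i" for i
      proof -
        have "a * lookup x i = p * (b' * lookup y i)"
          using arg_cong[OF less.prems(1), of "\<lambda>v. lookup v i"] b' by (simp add: lookup_pscale mult.assoc)
        then have "p dvd a * lookup x i" by simp
        then show ?thesis using p(1) False by (auto simp: prime_elem_def)
      qed
      then obtain x' where x': "x = pscale p x'" using pscale_divide by blast
      have "pscale p (pscale a x') = pscale p (pscale b' y)"
        using less.prems(1) b' x' by (simp add: mult.commute)
      then have "pscale a x' = pscale b' y" using nz(1) by (rule pscale_mpol_cancel)
      then obtain u c1 c2 where "x' = pscale c1 u" "y = pscale c2 u" using less.hyps[OF lt _ nz(2)] by blast
      then show ?thesis using x' by (intro exI[of _ u] exI[of _ "p * c1"] exI[of _ c2]) auto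
    qed
  qed
qed

lemma ideal_times_superset: "c \<in> I \<Longrightarrow> x \<in> M \<Longrightarrow> pscale c x \<in> ideal_times I M"
  unfolding ideal_times_def by (intro pmod.span_base) blast

lemma is_ideal_irrelevant: "is_ideal (irrelevant_ideal :: ('n::finite, 'k::comm_ring_1) mpol set)"
proof (rule is_idealI)
  fix c x :: "('n, 'k) mpol" assume x: "x \<in> irrelevant_ideal"
  have "(\<Sum>a\<in>keys c. \<Sum>b\<in>keys x. (lookup c a * lookup x b when a + b = 0)) = 0"
  proof (intro sum.neutral ballI)
    fix a b assume "a \<in> keys c" "b \<in> keys x"
    have "b = 0" if "a + b = 0"
    proof (rule poly_mapping_eqI)
      fix i
      show "lookup b i = lookup 0 i"
        using arg_cong[OF that, of "\<lambda>m. lookup m i"] by (simp add: lookup_add)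
    qed
    then show "(lookup c a * lookup x b when a + b = 0) = 0"
      using x by (auto simp: when_def irrelevant_ideal_def)
  qed
  then show "c * x \<in> irrelevant_ideal" by (simp add: irrelevant_ideal_def lookup_times_eq_sum)
qed (auto simp: irrelevant_ideal_def lookup_add)

lemma const_irrelevant_iff [simp]: "const c \<in> irrelevant_ideal \<longleftrightarrow> c = 0"
  by (simp add: irrelevant_ideal_def)

lemma form_irrelevant_nonpos: "p \<in> forms t \<Longrightarrow> t \<le> 0 \<Longrightarrow> p \<in> irrelevant_ideal \<Longrightarrow> p = 0"
  for p :: "('n::finite, 'k::comm_ring_1) mpol"
proof -
  assume p: "p \<in> forms t" "t \<le> 0" "p \<in> irrelevant_ideal"
  show "p = 0"
  proof (cases "t = 0")
    case True
    then have "p = const (lookup p 0)" using p(1) forms_0_const by blast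
    also have "lookup p 0 = 0" using p(3) by (simp add: irrelevant_ideal_def)
    finally show ?thesis by simp
  next
    case False
    then have "t < 0" using p(2) by simp
    then show ?thesis using p(1) by (rule forms_neg)
  qed
qed

definition minimal_gens :: "(nat \<Rightarrow>\<^sub>0 ('n::finite, 'k::comm_ring_1) mpol) list \<Rightarrow> bool" where
  "minimal_gens gs \<longleftrightarrow> (\<forall>v\<in>free_module (length gs). lin gs v = 0 \<longrightarrow>
     (\<forall>i. lookup v i \<in> irrelevant_ideal))"

text \<open>A member of the irrelevant multiples of the module also has a representation with
  irrelevant coefficients. The difference of two representations is a relation, whose coefficients
  are irrelevant by minimality.\<close>

lemma minimal_gens_ideal_times:
  fixes gs :: "(nat \<Rightarrow>\<^sub>0 ('n::finite, 'k::comm_ring_1) mpol) list"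
  assumes m: "minimal_gens gs" and w: "w \<in> free_module (length gs)"
    and mem: "lin gs w \<in> ideal_times irrelevant_ideal (lin gs ` free_module (length gs))"
  shows "lookup w i \<in> irrelevant_ideal"
proof -
  note I = is_idealD[OF is_ideal_irrelevant]
  have "\<exists>v\<in>free_module (length gs). x = lin gs v \<and> (\<forall>i. lookup v i \<in> irrelevant_ideal)"
    if "x \<in> ideal_times irrelevant_ideal (lin gs ` free_module (length gs))" for x
    using that unfolding ideal_times_def
  proof (induction rule: pmod.span_induct_alt)
    case base
    show ?case using I(1) by (intro bexI[of _ 0]) (auto simp: free_module_closed)
  next
    case (step c x y)
    obtain p u where "x = pscale p (lin gs u)" "p \<in> irrelevant_ideal" "u \<in> free_module (length gs)"
      using step(1) by auto
    moreover obtain v where "y = lin gs v" "v \<in> free_module (length gs)" "\<And>i. lookup v i \<in> irrelevant_ideal"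
      using step(2) by auto
    moreover have "c * (p * lookup u i) + lookup v i \<in> irrelevant_ideal" for i
      using calculation by (intro I(2,3,4)) auto
    ultimately show ?case
      by (intro bexI[of _ "pscale c (pscale p u) + v"])
        (auto simp: lin_add lin_scale free_module_closed lookup_add lookup_pscale mult.assoc)
  qed
  then obtain v where v: "v \<in> free_module (length gs)" "lin gs w = lin gs v" "\<And>i. lookup v i \<in> irrelevant_ideal"
    using mem by blast
  have "lin gs (w - v) = 0" using v(2) by (simp add: lin_diff)
  then have "lookup (w - v) i \<in> irrelevant_ideal"
    using m w v(1) by (auto simp: minimal_gens_def free_module_closed)
  then show ?thesis using I(2)[OF _ v(3)[of i], of "lookup (w - v) i"] by (simp add: lookup_minus)
qed

text \<open>In a torsion-free situation two dependent vectors are multiples of a common vector, so they cannot both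
  belong to a minimal system of generators.\<close>

lemma minimal_gens_independent:
  fixes gs :: "(nat \<Rightarrow>\<^sub>0 ('n::finite, 'k::field) mpol) list"
  assumes m: "minimal_gens gs" and v: "v \<in> free_module (length gs)" and w: "w \<in> free_module (length gs)"
    and ind: "\<And>\<alpha> \<beta>. (\<And>i. lookup (pscale (const \<alpha>) v + pscale (const \<beta>) w) i \<in> irrelevant_ideal) \<Longrightarrow> \<alpha> = 0 \<and> \<beta> = 0"
    and sat: "\<And>c u. c \<noteq> 0 \<Longrightarrow> pscale c u \<in> lin gs ` free_module (length gs) \<Longrightarrow> u \<in> lin gs ` free_module (length gs)"
    and rel: "pscale p (lin gs v) + pscale q (lin gs w) = 0"
  shows "p = 0 \<and> q = 0"
proof -
  let ?M = "lin gs ` free_module (length gs)"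
  have sM: "pmod.subspace ?M" using span_eq_lin_image[of gs] pmod.subspace_span by metis
  have notin: "\<alpha> = 0 \<and> \<beta> = 0"
    if "pscale (const \<alpha>) (lin gs v) + pscale (const \<beta>) (lin gs w) \<in> ideal_times irrelevant_ideal ?M" for \<alpha> \<beta>
  proof (rule ind)
    have "pscale (const \<alpha>) v + pscale (const \<beta>) w \<in> free_module (length gs)"
      using v w by (simp add: free_module_closed)
    then show "lookup (pscale (const \<alpha>) v + pscale (const \<beta>) w) i \<in> irrelevant_ideal" for i
      using minimal_gens_ideal_times[OF m, of "pscale (const \<alpha>) v + pscale (const \<beta>) w" i] that by (simp add: lin_add lin_scale)
  qed
  have zero: "0 \<in> ideal_times irrelevant_ideal ?M" unfolding ideal_times_def by (rule pmod.span_zero)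
  have nz: "lin gs v \<noteq> 0" "lin gs w \<noteq> 0" using notin[of 1 0] notin[of 0 1] zero by auto
  show ?thesis
  proof (cases "q = 0")
    case True
    then show ?thesis using rel nz by (simp add: pscale_mpol_eq_0_iff)
  next
    case False
    have "pscale p (lin gs v) = pscale (- q) (lin gs w)" using rel by (simp add: eq_neg_iff_add_eq_0)
    then obtain u c1 c2 where u: "lin gs v = pscale c1 u" "lin gs w = pscale c2 u"
      using common_multiple_imp_common_divisor False by (metis neg_equal_0_iff_equal)
    have c1: "c1 \<noteq> 0" using u nz by auto
    have "pscale c1 u \<in> ?M" using v u(1) by (metis imageI)
    then have uM: "u \<in> ?M" using sat c1 by blast
    \<comment> \<open>Crossing the constant terms of c1 and c2 gives a multiple of u by a
      coefficient without constant term, hence an irrelevant multiple. Independence modulo the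
      irrelevant ideal forces \<gamma>1 = 0, and then c1 u alone is an irrelevant multiple, a
      contradiction.\<close>
    let ?\<gamma>1 = "lookup c1 0" and ?\<gamma>2 = "lookup c2 0"
    have lc: "lookup (const a * c) 0 = a * lookup c 0" for a and c :: "('n, 'k) mpol"
      by (simp add: lookup_pscale flip: pscale_eq_const_mult)
    have "pscale (const ?\<gamma>2) (lin gs v) + pscale (const (- ?\<gamma>1)) (lin gs w) = pscale (const ?\<gamma>2 * c1 - const ?\<gamma>1 * c2) u"
      unfolding u by (simp add: single_uminus pmod.scale_left_diff_distrib)
    moreover have "const ?\<gamma>2 * c1 - const ?\<gamma>1 * c2 \<in> irrelevant_ideal"
      by (simp add: irrelevant_ideal_def lookup_minus lc)
    ultimately have "pscale (const ?\<gamma>2) (lin gs v) + pscale (const (- ?\<gamma>1)) (lin gs w) \<in> ideal_times irrelevant_ideal ?M"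
      using ideal_times_superset[OF _ uM] by metis
    then have "?\<gamma>1 = 0" using notin[of ?\<gamma>2 "- ?\<gamma>1"] by simp
    then have "lin gs v \<in> ideal_times irrelevant_ideal ?M"
      unfolding u(1) using uM by (intro ideal_times_superset) (auto simp: irrelevant_ideal_def)
    then show ?thesis using notin[of 1 0] by simp
  qed
qed

text \<open>Gaussian elimination without fractions: more than r vectors in a free module of rank r
  satisfy a nontrivial relation over the polynomial ring.\<close>

lemma dependent_vectors:
  fixes vs :: "'i \<Rightarrow> (nat \<Rightarrow>\<^sub>0 ('n::finite, 'k::field) mpol)"
  assumes "finite A" "r < card A" "\<And>i. i \<in> A \<Longrightarrow> vs i \<in> free_module r"
  shows "\<exists>c. (\<exists>i\<in>A. c i \<noteq> 0) \<and> (\<Sum>i\<in>A. pscale (c i) (vs i)) = 0"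
  using assms
proof (induction r arbitrary: A vs)
  case 0
  then have "vs i = 0" if "i \<in> A" for i using that by (auto simp: free_module_iff intro: poly_mapping_eqI)
  moreover have "A \<noteq> {}" using 0 by auto
  ultimately show ?case by (intro exI[of _ "\<lambda>_. 1"]) auto
next
  case (Suc r)
  show ?case
  proof (cases "\<forall>i\<in>A. lookup (vs i) r = 0")
    case True
    have "vs i \<in> free_module r" if "i \<in> A" for i
      using Suc.prems(3)[OF that] True that by (auto simp: free_module_iff) (metis Suc_leI le_neq_implies_less)
    then show ?thesis using Suc.IH[of A vs] Suc.prems by simp
  next
    case False
    then obtain k where k: "k \<in> A" "lookup (vs k) r \<noteq> 0" by blast
    let ?a = "lookup (vs k) r"
    let ?A = "A - {k}"
    define ws where "ws i = pscale ?a (vs i) - pscale (lookup (vs i) r) (vs k)" for i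
    have ws: "ws i \<in> free_module r" if i: "i \<in> ?A" for i
      unfolding free_module_iff
    proof (intro allI impI)
      fix j assume j: "r \<le> j"
      show "lookup (ws i) j = 0"
      proof (cases "j = r")
        case True
        then show ?thesis by (simp add: ws_def lookup_minus lookup_pscale)
      next
        case False
        then have "lookup (vs i) j = 0" "lookup (vs k) j = 0"
          using Suc.prems(3)[of i] Suc.prems(3)[of k] i k j by (auto simp: free_module_iff)
        then show ?thesis by (simp add: ws_def lookup_minus lookup_pscale)
      qed
    qed
    obtain c where c: "\<exists>i\<in>?A. c i \<noteq> 0" "(\<Sum>i\<in>?A. pscale (c i) (ws i)) = 0"
    proof -
      have "r < card ?A" using Suc.prems(1,2) k(1) by simp
      then show ?thesis using Suc.IH[of ?A ws] Suc.prems(1) ws that by blast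
    qed
    \<comment> \<open>The relation among the reduced vectors is lifted: its coefficients are
      multiplied by the pivot entry, and the pivot vector collects the subtracted multiples.\<close>
    define c' where "c' i = (if i = k then - (\<Sum>i\<in>?A. c i * lookup (vs i) r) else c i * ?a)" for i
    have "(\<Sum>i\<in>A. pscale (c' i) (vs i)) = pscale (c' k) (vs k) + (\<Sum>i\<in>?A. pscale (c' i) (vs i))"
      using Suc.prems(1) k by (simp add: sum.remove)
    also have "\<dots> = (\<Sum>i\<in>?A. pscale (c i) (ws i))"
      by (simp add: c'_def ws_def pmod.scale_right_diff_distrib sum_subtractf pmod.scale_sum_left)
    finally have "(\<Sum>i\<in>A. pscale (c' i) (vs i)) = 0" using c(2) by simp
    moreover have "\<exists>i\<in>A. c' i \<noteq> 0" using c(1) k by (auto simp: c'_def)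
    ultimately show ?thesis by blast
  qed
qed

text \<open>The quotient of the free module by the syzygies is an ideal of a domain, hence
  torsion-free.\<close>

lemma syz_saturated:
  fixes fs :: "('n::finite, 'k::field) mpol list"
  assumes "c \<noteq> 0" "pscale c u \<in> syz fs"
  shows "u \<in> syz fs"
proof -
  have "c * (\<Sum>i<length fs. lookup u i * fs ! i) = 0"
    using assms(2) by (simp add: syz_def lookup_pscale sum_distrib_left mult.assoc)
  then have "(\<Sum>i<length fs. lookup u i * fs ! i) = 0" using assms(1) by simp
  moreover have "u \<in> free_module (length fs)"
    using assms by (auto simp: syz_def free_module_iff lookup_pscale)
  ultimately show ?thesis by (simp add: syz_def)
qed

lemma irrelevant_coefficients:
  assumes "\<And>i. lookup v i \<in> irrelevant_ideal" "v \<in> free_module r"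
  shows "v \<in> ideal_times irrelevant_ideal (free_module r)"
proof -
  have "(\<Sum>i<r. pscale (lookup v i) (single i 1)) \<in> ideal_times irrelevant_ideal (free_module r)"
    using assms(1) unfolding ideal_times_def by (intro pmod.span_sum pmod.span_base) (blast intro: single_in_free_module)
  then show ?thesis using free_module_expand[OF assms(2)] by simp
qed

text \<open>A coefficient with nonzero constant term would, in degree d of the syzygy equation,
  express one of the forms by the others, against their minimality as generators.\<close>

lemma syz_coefficients_irrelevant:
  fixes fs :: "('n::finite, 'k::field) mpol list"
  assumes aci: "equigenerated_strict_aci_ht2 d fs" and v: "v \<in> syz fs"
  shows "lookup v i \<in> irrelevant_ideal"
proof (rule ccontr)
  assume n: "lookup v i \<notin> irrelevant_ideal"
  have fs: "distinct fs" "set fs \<subseteq> forms (int d)" "\<And>f. f \<in> set fs \<Longrightarrow> f \<notin> ideal_gen (set fs - {f})"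
    using aci by (auto simp: equigenerated_strict_aci_ht2_def)
  let ?\<gamma> = "lookup (lookup v i) 0"
  have \<gamma>: "?\<gamma> \<noteq> 0" using n by (simp add: irrelevant_ideal_def)
  have "i < length fs" using v \<gamma> by (auto simp: syz_def free_module_iff) (metis lookup_zero not_le)
  have g: "icomp 0 (lookup v i) = const ?\<gamma>"
    using forms_0_const[OF icomp_in_forms[of 0 "lookup v i"]] by (simp add: lookup_icomp mdeg_def)
  have "icomp (int d) (\<Sum>j<length fs. lookup v j * fs ! j) = 0" using v by (simp add: syz_def)
  moreover have "icomp (int d) (lookup v j * fs ! j) = icomp 0 (lookup v j) * fs ! j"
    if "j < length fs" for j
  proof -
    have "fs ! j \<in> forms (int d)" using that fs(2) by auto
    then show ?thesis by (subst icomp_mult_form) auto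
  qed
  ultimately have "0 = (\<Sum>j<length fs. icomp 0 (lookup v j) * fs ! j)" by (simp add: icomp_sum)
  also have "\<dots> = const ?\<gamma> * fs ! i + (\<Sum>j\<in>{..<length fs} - {i}. icomp 0 (lookup v j) * fs ! j)"
    using \<open>i < length fs\<close> g by (subst sum.remove[of _ i]) auto
  finally have e: "const ?\<gamma> * fs ! i = - (\<Sum>j\<in>{..<length fs} - {i}. icomp 0 (lookup v j) * fs ! j)"
    by (simp add: eq_neg_iff_add_eq_0)
  note J = is_idealD[OF is_ideal_ideal_gen[of "set fs - {fs ! i}"]]
  have "fs ! j \<in> ideal_gen (set fs - {fs ! i})" if "j \<in> {..<length fs} - {i}" for j
    using that fs(1) \<open>i < length fs\<close> ideal_gen_superset[of "set fs - {fs ! i}"]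
    by (auto simp: nth_eq_iff_index_eq)
  then have "(\<Sum>j\<in>{..<length fs} - {i}. icomp 0 (lookup v j) * fs ! j) \<in> ideal_gen (set fs - {fs ! i})"
    by (intro is_ideal_sum is_ideal_ideal_gen J(3))
  then have "const (inverse ?\<gamma>) * (const ?\<gamma> * fs ! i) \<in> ideal_gen (set fs - {fs ! i})"
    unfolding e by (intro J(3,5))
  then have "fs ! i \<in> ideal_gen (set fs - {fs ! i})"
    unfolding mult.assoc[symmetric] const_mult_inverse[OF \<gamma>] by simp
  then show False using fs(3) \<open>i < length fs\<close> by simp
qed

section \<open>Moments of the resolution\<close>

lemma sum_list_moments:
  "(\<Sum>(c, s)\<leftarrow>map (\<lambda>s. (e, int s)) b. c) = e * int (length b)"
  "(\<Sum>(c, s)\<leftarrow>map (\<lambda>s. (e, int s)) b. c * s) = e * (\<Sum>s\<leftarrow>b. int s)"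
  "(\<Sum>(c, s)\<leftarrow>map (\<lambda>s. (e, int s)) b. c * s\<^sup>2) = e * (\<Sum>s\<leftarrow>b. (int s)\<^sup>2)"
  "(\<Sum>(c, s)\<leftarrow>map (\<lambda>s. (e, int s)) b. c * int (mon_count v (t - s))) = e * int (\<Sum>s\<leftarrow>b. mon_count v (t - int s))"
  by (induction b) (auto simp: algebra_simps)

text \<open>The vanishing zeroth and first moments relate the ranks and the sums of the shifts; the
  second moment is twice the multiplicity, and the lower bound on the Hilbert function guarantees
  that it is not zero.\<close>

lemma resolution_moments:
  fixes J :: "('n::finite, 'k::field) mpol set"
  assumes w: "CARD('n) = w + 3" and J: "homogeneous_ideal J" "height J = 2"
    and res: "minimal_graded_free_resolution [b0, b1, b2] \<phi> J"
  shows "1 + int (length b1) = int (length b0) + int (length b2)"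
    and "(\<Sum>s\<leftarrow>b1. int s) = (\<Sum>s\<leftarrow>b0. int s) + (\<Sum>s\<leftarrow>b2. int s)"
    and "2 * multiplicity_quot J = of_int ((\<Sum>s\<leftarrow>b1. (int s)\<^sup>2) - (\<Sum>s\<leftarrow>b0. (int s)\<^sup>2) - (\<Sum>s\<leftarrow>b2. (int s)\<^sup>2))"
proof -
  have iJ: "is_ideal J" using J by (auto simp: homogeneous_ideal_def is_ideal_ideal_gen)
  \<comment> \<open>The signs are those of R - F_0 + F_1 - F_2, the alternating sum for R/J; the
    pair (1, 0) stands for R.\<close>
  let ?L = "(1, 0) # map (\<lambda>s. (- 1, int s)) b0 @ map (\<lambda>s. (1, int s)) b1 @ map (\<lambda>s. (- 1, int s)) b2"
  obtain C where C: "\<And>t. hilbert_function J t \<le> C * (t + 1) ^ w" using hilbert_function_growth[OF w J] by blast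
  have HF: "int (hilbert_function J t) = (\<Sum>(c, s)\<leftarrow>?L. c * int (mon_count (w + 3) (int t - s)))" for t
  proof -
    have le: "pvec.dim (forms (int t) \<inter> J) \<le> pvec.dim (forms (int t) :: ('n, 'k) mpol set)"
    proof -
      have "pvec.dim (forms (int t) \<inter> J) \<le> card ((\<lambda>m. single m (1::'k)) ` (monomials (int t) :: ('n \<Rightarrow>\<^sub>0 nat) set))"
        by (rule pvec.dim_le_card) (auto simp: forms_eq_span)
      then show ?thesis by (simp add: card_single_image dim_forms)
    qed
    have "pvec.dim (forms (int t) \<inter> J) + (\<Sum>s\<leftarrow>b1. mon_count (w + 3) (int t - int s)) =
        (\<Sum>s\<leftarrow>b0. mon_count (w + 3) (int t - int s)) + (\<Sum>s\<leftarrow>b2. mon_count (w + 3) (int t - int s))"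
      using dim_resolution[OF iJ res, of "int t"] by (simp add: nmon_eq w)
    moreover have "pvec.dim (forms (int t) :: ('n, 'k) mpol set) = mon_count (w + 3) (int t)"
      by (simp add: dim_forms nmon_eq w)
    ultimately have "int (hilbert_function J t) = int (mon_count (w + 3) (int t)) -
        int (\<Sum>s\<leftarrow>b0. mon_count (w + 3) (int t - int s)) + int (\<Sum>s\<leftarrow>b1. mon_count (w + 3) (int t - int s))
        - int (\<Sum>s\<leftarrow>b2. mon_count (w + 3) (int t - int s))"
      using le unfolding hilbert_function_def by linarith
    then show ?thesis by (simp only: list.map map_append sum_list.Cons sum_list.append sum_list_moments) simp
  qed
  note m = hilbert_function_moments[where ?t0.0 = 0 and I = J and L = ?L and w = w, OF HF C]
  have s2: "(\<Sum>(c, s)\<leftarrow>?L. c * s\<^sup>2) = (\<Sum>s\<leftarrow>b1. (int s)\<^sup>2) - (\<Sum>s\<leftarrow>b0. (int s)\<^sup>2) - (\<Sum>s\<leftarrow>b2. (int s)\<^sup>2)"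
    by (simp only: list.map map_append sum_list.Cons sum_list.append sum_list_moments) simp
  show "1 + int (length b1) = int (length b0) + int (length b2)"
    using m(1) by (simp only: list.map map_append sum_list.Cons sum_list.append sum_list_moments) simp
  show "(\<Sum>s\<leftarrow>b1. int s) = (\<Sum>s\<leftarrow>b0. int s) + (\<Sum>s\<leftarrow>b2. int s)"
    using m(2) by (simp only: list.map map_append sum_list.Cons sum_list.append sum_list_moments) simp
  show "2 * multiplicity_quot J = of_int ((\<Sum>s\<leftarrow>b1. (int s)\<^sup>2) - (\<Sum>s\<leftarrow>b0. (int s)\<^sup>2) - (\<Sum>s\<leftarrow>b2. (int s)\<^sup>2))"
    unfolding s2[symmetric] by (intro m(3) m(4) hilbert_function_lower_bound[OF w iJ J(2)])
qed

text \<open>Writing \<open>x = a\<^sub>1 - d\<close>, \<open>y = a\<^sub>2 - d\<close> and \<open>p = d - y\<close>, the two moment conditions and \<open>b\<^sub>j > a\<^sub>j\<^sub>+\<^sub>2\<close> give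
  \<open>2 p (y - 2) + (x - p - 1) (2 y - x - p) \<le> 0\<close>.\<close>

lemma shift_numerics:
  fixes as bs :: "nat list" and d :: nat
  assumes d: "d \<ge> 2" and srt: "sorted as" and len: "length as = length bs + 2" and ne: "bs \<noteq> []"
    and s1: "(\<Sum>s\<leftarrow>as. int s) = 3 * int d + (\<Sum>s\<leftarrow>bs. int s)"
    and s2: "(\<Sum>s\<leftarrow>as. (int s)\<^sup>2) = 5 * (int d)\<^sup>2 - 2 * int d + (\<Sum>s\<leftarrow>bs. (int s)\<^sup>2)"
    and a0: "d + 1 \<le> as ! 0" and a1: "as ! 1 \<le> 2 * d"
    and ab: "\<And>j. j < length bs \<Longrightarrow> as ! (j + 2) < bs ! j"
  shows "as = [d + 1, 2 * d, 2 * d] \<and> bs = [2 * d + 1] \<or> d = 3 \<and> as = [5, 5, 5] \<and> bs = [6]"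
proof -
  let ?l = "length bs"
  obtain u v cs where as: "as = u # v # cs" using len by (metis Suc_eq_plus1 Suc_length_conv add_2_eq_Suc')
  have lc: "length cs = ?l" using len as by simp
  have cs: "cs ! j = as ! (j + 2)" for j by (simp add: as)
  define x y where "x = int u - int d" and "y = int v - int d"
  have xy: "1 \<le> x" "x \<le> y" "y \<le> int d" using a0 a1 srt by (auto simp: as x_def y_def)
  let ?a = "\<lambda>j. int (cs ! j)" and ?b = "\<lambda>j. int (bs ! j)"
  have sc: "(\<Sum>s\<leftarrow>cs. f s) = (\<Sum>j<?l. f (cs ! j))" and sb: "(\<Sum>s\<leftarrow>bs. f s) = (\<Sum>j<?l. f (bs ! j))" for f :: "nat \<Rightarrow> int"
    using lc by (simp_all add: sum_list_sum_nth atLeast0LessThan)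
  have e1: "(\<Sum>j<?l. ?b j - ?a j) = x + y - int d"
    using s1 sc[of int] sb[of int] by (simp add: as sum_subtractf x_def y_def)
  \<comment> \<open>The constant is 5 d^2 - 2 d = 3 d^2 + 2 (d^2 - d): the three generators together
    with twice the multiplicity.\<close>
  have e2: "(\<Sum>j<?l. (?b j)\<^sup>2 - (?a j)\<^sup>2) = (x + int d)\<^sup>2 + (y + int d)\<^sup>2 - 5 * (int d)\<^sup>2 + 2 * int d"
    using s2 sc[of "\<lambda>s. (int s)\<^sup>2"] sb[of "\<lambda>s. (int s)\<^sup>2"] by (simp add: as sum_subtractf x_def y_def)
  have gt: "?b j \<ge> ?a j + 1" if "j < ?l" for j using ab[OF that] cs by simp
  have ge: "?a j \<ge> y + int d" if "j < ?l" for j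
    using srt that lc nth_mem[of j cs] by (simp add: as y_def)
  \<comment> \<open>Each b^2 - a^2 is (b - a) (b + a), and b + a \<ge> 2 a + 1 \<ge> 2 (y + d) + 1
    as the shifts are sorted.\<close>
  have "(\<Sum>j<?l. (?b j - ?a j) * (2 * (y + int d) + 1)) \<le> (\<Sum>j<?l. (?b j)\<^sup>2 - (?a j)\<^sup>2)"
  proof (intro sum_mono)
    fix j assume j: "j \<in> {..<?l}"
    have "(?b j - ?a j) * (2 * (y + int d) + 1) \<le> (?b j - ?a j) * (?b j + ?a j)"
      using gt[of j] ge[of j] j by (intro mult_left_mono) auto
    then show "(?b j - ?a j) * (2 * (y + int d) + 1) \<le> (?b j)\<^sup>2 - (?a j)\<^sup>2"
      by (simp add: power2_eq_square algebra_simps)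
  qed
  then have key: "(x + y - int d) * (2 * (y + int d) + 1) \<le> (x + int d)\<^sup>2 + (y + int d)\<^sup>2 - 5 * (int d)\<^sup>2 + 2 * int d"
    using e1 e2 by (simp flip: sum_distrib_right)
  have l1: "1 \<le> int ?l" using ne by (cases bs) auto
  have "(\<Sum>j<?l. 1) \<le> (\<Sum>j<?l. ?b j - ?a j)"
    by (intro sum_mono) (use gt in force)
  then have ls: "int ?l \<le> x + y - int d" using e1 by simp
  define p z where "p = int d - y" and "z = x - p - 1"
  have p: "0 \<le> p" "0 \<le> z" using xy ls l1 by (auto simp: p_def z_def)
  have dd: "int d = y + p" and xx: "x = z + p + 1" by (auto simp: p_def z_def)
  have "2 * p * (y - 2) + z * (2 * y - x - p) \<le> 0"
    using key unfolding dd xx by (simp add: power2_eq_square algebra_simps)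
  moreover have "z * (2 * y - x - p) \<ge> z"
  proof -
    have "2 * y - x - p \<ge> 0" using xy xx p by linarith
    moreover have "2 * y - x - p \<ge> 1 \<or> z = 0" using xy xx p by linarith
    ultimately show ?thesis using p(2) by (metis mult.right_neutral mult_left_mono mult_zero_left order_refl)
  qed
  moreover have "2 * p * (y - 2) \<ge> 0"
  proof (cases "p = 0")
    case False
    then have "y - 2 \<ge> 0" using xy xx p by linarith
    then show ?thesis using p by simp
  qed simp
  ultimately have z0: "z = 0" and "2 * p * (y - 2) = 0" using p by linarith+
  then have "p = 0 \<or> y = 2" by simp
  then have cases: "x = 1 \<and> y = int d \<or> x = 2 \<and> y = 2 \<and> int d = 3"
  proof
    assume "y = 2"
    \<comment> \<open>With z = 0 and y = 2 the inequality x \<le> y reads p + 1 \<le> 2.\<close>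
    then have "p = 0 \<or> p = 1" using xy xx z0 p by linarith
    then show ?thesis using \<open>y = 2\<close> dd xx z0 by auto
  qed (use dd xx z0 in auto)
  \<comment> \<open>In both cases the total excess x + y - d of the shifts b over the shifts a is 1,
    and each b contributes at least 1.\<close>
  then have "?l = 1" using ls l1 by auto
  then obtain b where b: "bs = [b]" by (metis One_nat_def length_0_conv length_Suc_conv)
  obtain c where c: "cs = [c]" using lc \<open>?l = 1\<close> by (metis One_nat_def length_0_conv length_Suc_conv)
  have bc: "int b = int c + 1" using e1 cases by (auto simp: b c)
  have q: "(int b)\<^sup>2 - (int c)\<^sup>2 = 2 * int c + 1" using bc by (simp add: power2_eq_square algebra_simps)
  have e2': "2 * int c + 1 = (x + int d)\<^sup>2 + (y + int d)\<^sup>2 - 5 * (int d)\<^sup>2 + 2 * int d"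
    using e2 q by (simp add: b c)
  from cases show ?thesis
  proof
    assume *: "x = 1 \<and> y = int d"
    then have "2 * int c + 1 = 4 * int d + 1" using e2' by (simp add: power2_eq_square algebra_simps)
    then show ?thesis using * bc by (auto simp: as b c x_def y_def)
  next
    assume *: "x = 2 \<and> y = 2 \<and> int d = 3"
    then have "2 * int c + 1 = 11" using e2' by (simp add: power2_eq_square)
    then show ?thesis using * bc by (auto simp: as b c x_def y_def)
  qed
qed

text \<open>Degrees are those of the resolution of \<open>J\<close>: a syzygy \<open>(a\<^sub>1, a\<^sub>2, a\<^sub>3)\<close> has the degree of the
  products \<open>a\<^sub>i f\<^sub>i\<close>, which exceeds its standard degree by \<open>d\<close>.\<close>

definition syz_resolution where
  "syz_resolution fs d gs as ks bs \<longleftrightarrow>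
    length gs = length as \<and> sorted as \<and>
    (\<forall>i<length as. gs ! i \<in> graded_piece (replicate (length fs) d) (int (as ! i))) \<and>
    lin gs ` free_module (length as) = syz fs \<and> minimal_gens gs \<and>
    length ks = length bs \<and> sorted bs \<and> bs \<noteq> [] \<and>
    (\<forall>j<length bs. ks ! j \<in> graded_piece as (int (bs ! j))) \<and>
    lin ks ` free_module (length bs) = {v \<in> free_module (length as). lin gs v = 0} \<and>
    (\<forall>w\<in>free_module (length bs). lin ks w = 0 \<longrightarrow> w = 0)"

lemma syz_resolution_exists:
  fixes fs :: "('n::finite, 'k::field) mpol list"
  assumes "set fs \<subseteq> forms (int d)" "projective_dimension (ideal_module (ideal_gen (set fs))) = 2"
  shows "\<exists>gs as ks bs. syz_resolution fs d gs as ks bs"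
proof -
  obtain gs as ks bs where *: "length gs = length as" "sorted as"
    "\<forall>i<length as. gs ! i \<in> graded_piece (replicate (length fs) d) (int (as ! i))"
    "lin gs ` free_module (length as) = syz fs"
    "\<forall>v\<in>free_module (length as). lin gs v = 0 \<longrightarrow> (\<forall>i. lookup v i \<in> irrelevant_ideal)"
    "length ks = length bs" "sorted bs" "bs \<noteq> []"
    "\<forall>j<length bs. ks ! j \<in> graded_piece as (int (bs ! j))"
    "lin ks ` free_module (length bs) = {v \<in> free_module (length as). lin gs v = 0}"
    "\<forall>w\<in>free_module (length bs). lin ks w = 0 \<longrightarrow> w = 0"
    using projective_dimension_2_resolution[OF assms] by (elim exE conjE) (rule that)
  then have "syz_resolution fs d gs as ks bs" by (simp add: syz_resolution_def minimal_gens_def)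
  then show ?thesis by blast
qed

section \<open>Consequences of a fixed minimal resolution\<close>

context
  fixes fs :: "('n::finite, 'k::field) mpol list" and d gs as ks bs
  assumes aci: "equigenerated_strict_aci_ht2 d fs" and res: "syz_resolution fs d gs as ks bs"
begin

lemma fs_facts: "length fs = 3" "set fs \<subseteq> forms (int d)" "d \<ge> 2" "height (ideal_gen (set fs)) = 2"
  using aci by (auto simp: equigenerated_strict_aci_ht2_def)

lemma res_facts:
  shows len_gs: "length gs = length as" and sorted_as: "sorted as"
    and gs_graded: "\<And>i. i < length gs \<Longrightarrow> gs ! i \<in> graded_piece (replicate 3 d) (int (as ! i))"
    and gs_image: "lin gs ` free_module (length as) = syz fs" and gs_min: "minimal_gens gs"
    and len_ks: "length ks = length bs" and sorted_bs: "sorted bs" and bs_ne: "bs \<noteq> []"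
    and ks_graded: "\<And>j. j < length ks \<Longrightarrow> ks ! j \<in> graded_piece as (int (bs ! j))"
    and ks_image: "lin ks ` free_module (length bs) = {v \<in> free_module (length as). lin gs v = 0}"
    and ks_inj: "\<And>w. w \<in> free_module (length bs) \<Longrightarrow> lin ks w = 0 \<Longrightarrow> w = 0"
  using res fs_facts(1) by (auto simp: syz_resolution_def)

lemma f_nonzero: "i < 3 \<Longrightarrow> fs ! i \<noteq> 0"
proof -
  assume "i < 3"
  then have "fs ! i \<notin> ideal_gen (set fs - {fs ! i})"
    using aci by (auto simp: equigenerated_strict_aci_ht2_def)
  then show ?thesis using is_idealD(1)[OF is_ideal_ideal_gen[of "set fs - {fs ! i}"]] by metis
qed

lemma gs_saturated:
  "c \<noteq> 0 \<Longrightarrow> pscale c u \<in> lin gs ` free_module (length gs) \<Longrightarrow> u \<in> lin gs ` free_module (length gs)"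
  using syz_saturated gs_image len_gs by metis

lemma lin_gs_irrelevant: "v \<in> free_module (length as) \<Longrightarrow> lin gs v = 0 \<Longrightarrow> lookup v i \<in> irrelevant_ideal"
  using gs_min len_gs by (simp add: minimal_gens_def)

lemma ks_kernel: "j < length bs \<Longrightarrow> ks ! j \<in> free_module (length as) \<and> lin gs (ks ! j) = 0"
proof -
  assume j: "j < length bs"
  then have "lin ks (single j 1) = ks ! j" using len_ks by (simp add: lin_single)
  then have "ks ! j \<in> lin ks ` free_module (length bs)" using j by (metis imageI single_in_free_module)
  then show ?thesis unfolding ks_image by simp
qed

lemma ks_entry:
  assumes "j < length bs" "i < length as"
  shows "lookup (ks ! j) i \<in> forms (int (bs ! j) - int (as ! i))"
    and "lookup (ks ! j) i \<in> irrelevant_ideal"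
  using ks_graded[of j] assms len_ks ks_kernel[OF assms(1)] lin_gs_irrelevant by (auto simp: graded_piece_def)

lemma minimal_resolution:
  "minimal_graded_free_resolution [[d, d, d], as, bs]
     (\<lambda>i. if i = 0 then lin (map (single 0) fs) else if i = 1 then lin gs else lin ks)
     (ideal_gen (set fs))"
proof -
  let ?F = "map (single 0) fs :: (nat \<Rightarrow>\<^sub>0 ('n, 'k) mpol) list"
  have rep: "replicate 3 d = [d, d, d]" by (simp add: numeral_3_eq_3)
  have Fg: "?F ! i \<in> graded_piece [0] (int ([d, d, d] ! i))" if "i < length ?F" for i
  proof -
    have "[d, d, d] ! i = d" using that fs_facts(1) by (auto simp: numeral_3_eq_3 less_Suc_eq)
    then show ?thesis using that fs_facts(2) by (auto simp: graded_piece_def subset_iff)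
  qed
  have g0: "lin ?F ` graded_piece [d, d, d] t \<subseteq> graded_piece [0] t" for t
    using lin_graded_piece[where gs = ?F and c = "[0]" and as = "[d, d, d]", OF Fg] fs_facts(1) by auto
  have g1: "lin gs ` graded_piece as t \<subseteq> graded_piece [d, d, d] t" for t
    using lin_graded_piece[where gs = gs and as = as, OF gs_graded len_gs] unfolding rep by auto
  have g2: "lin ks ` graded_piece bs t \<subseteq> graded_piece as t" for t
    using lin_graded_piece[where gs = ks and as = bs, OF ks_graded len_ks] by auto
  have i0: "lin ?F ` free_module 3 = ideal_module (ideal_gen (set fs))"
    using lin_image_ideal_module[of fs] fs_facts(1) by simp
  have i1: "lin gs ` free_module (length as) = {x \<in> free_module 3. lin ?F x = 0}"
    using gs_image syz_eq_kernel[of fs] fs_facts(1) by simp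
  have inj: "{x \<in> free_module (length bs). lin ks x = 0} = {0}"
    using ks_inj by (auto simp: free_module_closed)
  have m1: "lin gs ` free_module (length as) \<subseteq> ideal_times irrelevant_ideal (free_module 3)"
    unfolding gs_image
    using syz_coefficients_irrelevant[OF aci] fs_facts(1)
    by (auto intro!: irrelevant_coefficients simp: syz_def)
  have m2: "lin ks ` free_module (length bs) \<subseteq> ideal_times irrelevant_ideal (free_module (length as))"
    unfolding ks_image using lin_gs_irrelevant by (auto intro!: irrelevant_coefficients)
  have "i < 2 \<Longrightarrow> i = 0 \<or> i = 1" for i :: nat by linarith
  then show ?thesis
    unfolding minimal_graded_free_resolution_def exact_resolution_def
    using g0 g1 g2 i0 i1 ks_image inj m1 m2 
    by (auto simp: linear_on_lin numeral_3_eq_3 numeral_2_eq_2 less_Suc_eq)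
qed

lemma gen_nonzero: "i < length as \<Longrightarrow> gs ! i \<noteq> 0"
proof
  assume i: "i < length as" and "gs ! i = 0"
  then have "lin gs (single i 1) = 0" using len_gs by (simp add: lin_single)
  then have "lookup (single i 1) i \<in> (irrelevant_ideal :: ('n, 'k) mpol set)"
    using i by (intro lin_gs_irrelevant) auto
  then show False by (simp add: irrelevant_ideal_def)
qed

text \<open>A nonzero coefficient of the i-th generator is a form of degree
  \<open>as ! i - d\<close>, and it lies in the irrelevant ideal, so this degree is
  positive.\<close>

lemma gen_degree_gt: "i < length as \<Longrightarrow> d + 1 \<le> as ! i"
proof -
  assume i: "i < length as"
  have g: "gs ! i \<in> graded_piece (replicate 3 d) (int (as ! i))" using gs_graded i len_gs by simp
  have "gs ! i \<in> syz fs"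
    using gs_image i len_gs lin_single[of i gs] by (metis imageI single_in_free_module)
  then have irr: "lookup (gs ! i) l \<in> irrelevant_ideal" for l
    using syz_coefficients_irrelevant[OF aci] by blast
  obtain l where l: "lookup (gs ! i) l \<noteq> 0"
    using gen_nonzero[OF i] by (metis lookup_zero poly_mapping_eqI)
  then have "l < 3" using g by (auto simp: graded_piece_def free_module_iff) (meson not_le)
  then have "lookup (gs ! i) l \<in> forms (int (as ! i) - int d)"
    using g by (auto simp: graded_piece_def)
  then have "\<not> int (as ! i) - int d \<le> 0" using form_irrelevant_nonpos irr l by blast
  then show ?thesis by simp
qed

lemma lin_gs_graded: "lin gs ` graded_piece as t = syz fs \<inter> graded_piece (replicate 3 d) t"
  using graded_image_free[of as "lin gs" "replicate 3 d" t, OF linear_on_lin]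
    lin_graded_piece[where gs = gs and as = as, OF gs_graded len_gs] gs_image
  by (auto simp: image_subset_iff)

text \<open>The Koszul relations \<open>(f\<^sub>2, - f\<^sub>1, 0)\<close> and \<open>(f\<^sub>3, 0, - f\<^sub>1)\<close> are not multiples of one vector.\<close>

lemma second_generator: "2 \<le> length as" "as ! 1 \<le> 2 * d"
proof -
  have "2 \<le> length as \<and> as ! 1 \<le> 2 * d"
  proof (rule ccontr)
    assume neg: "\<not> ?thesis"
    \<comment> \<open>If there is no second generator, or if its shift exceeds 2 d, every syzygy in
      degree 2 d is a multiple of the first generator (or zero).\<close>
    have mult: "\<exists>p. x = pscale p (gs ! 0)" if x: "x \<in> syz fs \<inter> graded_piece (replicate 3 d) (int (2 * d))" for x
    proof -
      obtain v where v: "v \<in> graded_piece as (int (2 * d))" "x = lin gs v"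
        using x unfolding lin_gs_graded[symmetric] by auto
      have z: "lookup v i = 0" if i: "i \<noteq> 0" "i < length as" for i
      proof -
        have "2 * d < as ! 1" using neg i by auto
        also have "as ! 1 \<le> as ! i" using sorted_as i by (intro sorted_nth_mono) auto
        finally have "int (2 * d) - int (as ! i) < 0" by simp
        moreover have "lookup v i \<in> forms (int (2 * d) - int (as ! i))"
          using v i by (simp add: graded_piece_def)
        ultimately show ?thesis by (rule forms_neg)
      qed
      show ?thesis
      proof (cases "length as = 0")
        case True
        then have "x = pscale 0 (gs ! 0)" using v(2) len_gs by (simp add: lin_def)
        then show ?thesis by blast
      next
        case False
        then have "{..<length gs} = insert 0 {1..<length gs}" using len_gs by auto
        then have "x = pscale (lookup v 0) (gs ! 0) +
            (\<Sum>i\<in>{1..<length gs}. pscale (lookup v i) (gs ! i))"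
          using v(2) by (simp add: lin_def)
        also have "(\<Sum>i\<in>{1..<length gs}. pscale (lookup v i) (gs ! i)) = 0"
          using z len_gs by (intro sum.neutral) auto
        finally show ?thesis by auto
      qed
    qed
    define \<kappa> where "\<kappa> i = single 0 (fs ! i) - single i (fs ! 0)" for i :: nat
    have f: "fs ! i \<in> forms (int d)" if "i < 3" for i using fs_facts that by (simp add: subset_iff)
    have \<kappa>l: "lookup (\<kappa> i) l = (if l = 0 then fs ! i else if l = i then - (fs ! 0) else 0)"
      if "i \<noteq> 0" for i l using that by (auto simp: \<kappa>_def lookup_minus lookup_single)
    have \<kappa>: "\<kappa> i \<in> syz fs \<inter> graded_piece (replicate 3 d) (int (2 * d))" if i: "i = 1 \<or> i = 2" for i
    proof -
      have "i \<noteq> 0" "i < 3" using i by auto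
      have F: "\<kappa> i \<in> free_module 3" using i by (auto simp: free_module_iff \<kappa>l)
      have s: "{..<3} = {0, 1, 2 :: nat}" by auto
      have "(\<Sum>l<length fs. lookup (\<kappa> i) l * fs ! l) = 0"
        unfolding fs_facts(1) s using i by (auto simp: \<kappa>l mult.commute)
      then have "\<kappa> i \<in> syz fs" using F fs_facts(1) by (simp add: syz_def)
      moreover have "\<kappa> i \<in> graded_piece (replicate 3 d) (int (2 * d))"
        using F f[OF \<open>i < 3\<close>] forms_uminus[OF f[of 0]] \<open>i \<noteq> 0\<close> by (auto simp: graded_piece_def \<kappa>l)
      ultimately show ?thesis by blast
    qed
    obtain p where p: "\<kappa> 1 = pscale p (gs ! 0)" using mult[OF \<kappa>[of 1]] by auto
    obtain q where q: "\<kappa> 2 = pscale q (gs ! 0)" using mult[OF \<kappa>[of 2]] by auto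
    have f0: "fs ! 0 \<noteq> 0" by (rule f_nonzero) simp
    \<comment> \<open>Coordinate 2 is zero in the first Koszul relation, hence in the generator; in
      the second Koszul relation it is minus the nonzero form \<open>fs ! 0\<close>.\<close>
    have "p * lookup (gs ! 0) 1 = - (fs ! 0)" "p * lookup (gs ! 0) 2 = 0"
      using \<kappa>l[of 1 1] \<kappa>l[of 1 2] unfolding p by (simp_all add: lookup_pscale)
    then have "lookup (gs ! 0) 2 = 0" using f0 by auto
    moreover have "q * lookup (gs ! 0) 2 = - (fs ! 0)"
      using \<kappa>l[of 2 2] unfolding q by (simp add: lookup_pscale)
    ultimately show False using f0 by simp
  qed
  then show "2 \<le> length as" "as ! 1 \<le> 2 * d" by auto
qed

lemma positive_length: "0 < length as" "1 < length as"
  using second_generator by linarith+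

lemma lin_gs_single: "i < length as \<Longrightarrow> lin gs (single i 1) = gs ! i"
  using lin_single[of i gs] len_gs by simp

lemma gens_independent:
  assumes "v \<in> free_module (length as)" "w \<in> free_module (length as)"
    and "\<And>\<alpha> \<beta>. (\<And>i. lookup (pscale (const \<alpha>) v + pscale (const \<beta>) w) i \<in> irrelevant_ideal) \<Longrightarrow> \<alpha> = 0 \<and> \<beta> = 0"
    and "pscale p (lin gs v) + pscale q (lin gs w) = 0"
  shows "p = 0 \<and> q = 0"
  by (rule minimal_gens_independent[OF gs_min _ _ assms(3) gs_saturated assms(4)])
    (use assms(1,2) len_gs in auto)

lemma gens_01_independent:
  assumes "pscale p (gs ! 0) + pscale q (gs ! 1) = 0"
  shows "p = 0 \<and> q = 0"
proof (rule gens_independent)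
  let ?e0 = "single 0 1 :: nat \<Rightarrow>\<^sub>0 ('n, 'k) mpol" and ?e1 = "single 1 1 :: nat \<Rightarrow>\<^sub>0 ('n, 'k) mpol"
  show "?e0 \<in> free_module (length as)" "?e1 \<in> free_module (length as)"
    by (rule single_in_free_module positive_length)+
  show "pscale p (lin gs ?e0) + pscale q (lin gs ?e1) = 0"
    unfolding lin_gs_single[OF positive_length(1)] lin_gs_single[OF positive_length(2)] by (rule assms)
  fix \<alpha> \<beta>
  assume *: "\<And>i. lookup (pscale (const \<alpha>) ?e0 + pscale (const \<beta>) ?e1) i \<in> irrelevant_ideal"
  show "\<alpha> = 0 \<and> \<beta> = 0"
    using *[of 0] *[of 1] by (simp add: lookup_add lookup_pscale lookup_single)
qed

text \<open>If the first \<open>j + 1\<close> relations only involved the first \<open>j + 2\<close> generators, these generators would span a module of rank one.\<close>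

lemma shift_inequality:
  assumes j: "j < length bs"
  shows "j + 2 < length as \<and> as ! (j + 2) < bs ! j"
proof (rule ccontr)
  assume neg: "\<not> ?thesis"
  \<comment> \<open>An entry of these columns in a row from j + 2 on would be a form of degree at
    most 0 in the irrelevant ideal.\<close>
  have small: "ks ! l \<in> free_module (j + 2)" if l: "l \<le> j" for l
    unfolding free_module_iff
  proof (intro allI impI)
    fix i assume i: "j + 2 \<le> i"
    have lb: "l < length bs" using l j by simp
    show "lookup (ks ! l) i = 0"
    proof (cases "i < length as")
      case True
      have "bs ! l \<le> bs ! j" using sorted_bs l j by (intro sorted_nth_mono) auto
      also have "bs ! j \<le> as ! (j + 2)" using neg i True by auto
      also have "as ! (j + 2) \<le> as ! i" using sorted_as i True by (intro sorted_nth_mono) auto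
      finally have "int (bs ! l) - int (as ! i) \<le> 0" by simp
      then show ?thesis using form_irrelevant_nonpos ks_entry[OF lb True] by blast
    next
      case False
      then show ?thesis using ks_kernel[OF lb] by (simp add: free_module_iff)
    qed
  qed
  \<comment> \<open>The j + 1 columns together with the first two unit vectors are j + 3 vectors in
    rank j + 2, so they are dependent.\<close>
  define vs where "vs i = (if i \<le> j then ks ! i else single (i - (j + 1)) 1)" for i
  have "vs i \<in> free_module (j + 2)" if "i < j + 3" for i
    using that small by (auto simp: vs_def)
  then obtain c where c: "\<exists>i<j + 3. c i \<noteq> 0" "(\<Sum>i<j + 3. pscale (c i) (vs i)) = 0"
    using dependent_vectors[of "{..<j + 3}" "j + 2" vs] by auto
  have "{..<j + 3} = {..j} \<union> {j + 1, j + 2}" by auto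
  then have "(\<Sum>i<j + 3. pscale (c i) (vs i)) = (\<Sum>i\<le>j. pscale (c i) (vs i)) + (\<Sum>i\<in>{j + 1, j + 2}. pscale (c i) (vs i))"
    by (simp only:) (rule sum.union_disjoint; auto)
  also have "(\<Sum>i\<le>j. pscale (c i) (vs i)) = (\<Sum>i\<le>j. pscale (c i) (ks ! i))"
    by (intro sum.cong refl) (simp add: vs_def)
  finally have e: "(\<Sum>i\<le>j. pscale (c i) (ks ! i)) + (pscale (c (j + 1)) (single 0 1)
      + pscale (c (j + 2)) (single 1 1)) = 0"
    using c(2) by (simp add: vs_def)
  \<comment> \<open>Applying \<open>lin gs\<close> kills the columns and leaves a relation between
    the first two generators, whose coefficients must vanish.\<close>
  have k0: "lin gs (\<Sum>i\<le>j. pscale (c i) (ks ! i)) = 0"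
    unfolding lin_sum lin_scale using ks_kernel j by (intro sum.neutral) auto
  have "lin gs ((\<Sum>i\<le>j. pscale (c i) (ks ! i)) + (pscale (c (j + 1)) (single 0 1)
      + pscale (c (j + 2)) (single 1 1))) = 0"
    unfolding e by simp
  then have "pscale (c (j + 1)) (gs ! 0) + pscale (c (j + 2)) (gs ! 1) = 0"
    unfolding lin_add k0 lin_scale lin_gs_single[OF positive_length(1)] lin_gs_single[OF positive_length(2)] by simp
  then have c12: "c (j + 1) = 0" "c (j + 2) = 0" using gens_01_independent by blast+
  \<comment> \<open>What remains is a relation among the columns alone, excluded by the injectivity
    of the last map.\<close>
  define w where "w = (\<Sum>i\<le>j. single i (c i))"
  have wl: "lookup w i = c i" if "i \<le> j" for i
    using that by (simp add: w_def lookup_sum lookup_single when_def)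
  have wF: "w \<in> free_module (length bs)"
    unfolding w_def using j by (intro free_module_closed(5)) auto
  have "lin ks w = (\<Sum>i\<le>j. lin ks (pscale (c i) (single i 1)))"
    by (simp add: w_def lin_sum pscale_single)
  also have "\<dots> = (\<Sum>i\<le>j. pscale (c i) (ks ! i))"
    using j len_ks by (intro sum.cong refl) (simp add: lin_scale lin_single)
  also have "\<dots> = 0" using e c12 by simp
  finally have "w = 0" using ks_inj wF by blast
  then have "c i = 0" if "i \<le> j" for i using wl[OF that] by simp
  moreover have "i \<le> j \<or> i = j + 1 \<or> i = j + 2" if "i < j + 3" for i using that by linarith
  ultimately show False using c(1) c12 by blast
qed

section \<open>Hilbert function of the syzygies and of a Bourbaki ideal\<close>

lemma graded_piece_shift: "graded_piece (replicate 3 0) t = graded_piece (replicate 3 d) (t + int d)"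
  by (auto simp: graded_piece_def)

lemma syz_piece_eq: "syz_piece fs t = lin gs ` graded_piece as (t + int d)"
  using lin_gs_graded[of "t + int d"] fs_facts(1) by (simp add: syz_piece_def graded_piece_shift)

lemma dim_syz_piece:
  "fvec.dim (syz_piece fs t) + (\<Sum>s\<leftarrow>bs. nmon TYPE('n) (t + int d - int s)) = (\<Sum>s\<leftarrow>as. nmon TYPE('n) (t + int d - int s))"
proof -
  let ?G1 = "graded_piece as (t + int d) :: (nat \<Rightarrow>\<^sub>0 ('n, 'k) mpol) set"
  let ?G2 = "graded_piece bs (t + int d) :: (nat \<Rightarrow>\<^sub>0 ('n, 'k) mpol) set"
  have "lin ks ` ?G2 = lin ks ` free_module (length bs) \<inter> ?G1"
    using lin_graded_piece[where gs = ks and as = bs, OF ks_graded len_ks]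
    by (intro graded_image_free linear_on_lin) auto
  then have i2: "lin ks ` ?G2 = {x \<in> ?G1. lin gs x = 0}"
    unfolding ks_image using graded_piece_subset[of as "t + int d"] by auto
  have i3: "{x \<in> ?G2. lin ks x = 0} = {0}"
    using ks_inj graded_piece_subset[of bs "t + int d"] by auto
  have "fvec.dim ?G1 = fvec.dim (syz_piece fs t) + fvec.dim {x \<in> ?G1. lin gs x = 0}"
    unfolding syz_piece_eq by (rule rank_nullity_graded[OF linear_on_lin subset_UNIV subspace_graded_piece order_refl])
  moreover have "fvec.dim ?G2 = fvec.dim {x \<in> ?G1. lin gs x = 0}"
    using rank_nullity_graded[OF linear_on_lin[of UNIV ks] subset_UNIV subspace_graded_piece order_refl, of bs "t + int d"]
    by (simp only: i2 i3 fvec_dim_0)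
  ultimately show ?thesis by (simp add: dim_graded_piece)
qed

lemma graded_submodule_syz: "graded_submodule (replicate 3 0) (syz fs)"
proof -
  let ?F = "map (single 0) fs :: (nat \<Rightarrow>\<^sub>0 ('n, 'k) mpol) list"
  have "?F ! i \<in> graded_piece [0] (int (replicate 3 d ! i))" if "i < length ?F" for i
    using that fs_facts by (auto simp: graded_piece_def subset_iff)
  then have "graded_submodule (replicate 3 d) {v \<in> free_module (length (replicate 3 d)). lin ?F v = 0}"
    by (rule graded_submodule_kernel)
  then have g: "graded_submodule (replicate 3 d) (syz fs)" using syz_eq_kernel[of fs] fs_facts(1) by simp
  have "vcomp (replicate 3 0) t v = vcomp (replicate 3 d) (t + int d) v" if "v \<in> syz fs" for v t
  proof (rule poly_mapping_eqI)
    fix i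
    show "lookup (vcomp (replicate 3 0) t v) i = lookup (vcomp (replicate 3 d) (t + int d) v) i"
    proof (cases "i < 3")
      case False
      then have "lookup v i = 0" using that fs_facts(1) by (simp add: syz_def free_module_iff)
      then show ?thesis by (simp add: lookup_vcomp)
    qed (simp add: lookup_vcomp)
  qed
  then show ?thesis using g by (simp add: graded_submodule_def)
qed

lemma indeg_eq: "0 < length as \<Longrightarrow> indeg_syz fs = as ! 0 - d"
proof -
  assume ne: "0 < length as"
  have a0: "d \<le> as ! 0" using gen_degree_gt[OF ne] by simp
  have g0: "gs ! 0 \<in> syz_piece fs (int (as ! 0 - d))"
  proof -
    have "gs ! 0 \<in> syz fs" using gs_image ne len_gs lin_single[of 0 gs] by (metis imageI single_in_free_module)
    then show ?thesis using gs_graded[of 0] ne len_gs a0 fs_facts(1)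
      by (simp add: syz_piece_def graded_piece_shift)
  qed
  have low: "as ! 0 - d \<le> e" if e: "a \<in> syz_piece fs (int e)" "a \<noteq> 0" for a e
  proof (rule ccontr)
    assume neg: "\<not> ?thesis"
    obtain v where v: "v \<in> graded_piece as (int e + int d)" "a = lin gs v" using e(1) syz_piece_eq by auto
    have "v = 0"
    proof (rule poly_mapping_eqI)
      fix i
      show "lookup v i = lookup 0 i"
      proof (cases "i < length as")
        case True
        have "as ! 0 \<le> as ! i" using sorted_as True by (intro sorted_nth_mono) auto
        then have "int e + int d - int (as ! i) < 0" using neg by linarith
        moreover have "lookup v i \<in> forms (int e + int d - int (as ! i))" using v True by (simp add: graded_piece_def)
        ultimately show ?thesis using forms_neg by (metis lookup_zero)
      qed (use v in \<open>auto simp: graded_piece_def free_module_iff\<close>)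
    qed
    then show False using e(2) v(2) by simp
  qed
  show ?thesis unfolding indeg_syz_def
    using g0 gen_nonzero[OF ne] low by (intro Least_equality) auto
qed

lemma g0_initial: "0 < length as \<Longrightarrow> initial_syzygy fs (gs ! 0)"
proof -
  assume ne: "0 < length as"
  have a0: "d \<le> as ! 0" using gen_degree_gt[OF ne] by simp
  have l: "lin gs (single 0 1) = gs ! 0" by (rule lin_gs_single[OF ne])
  have "gs ! 0 \<in> syz fs" using gs_image ne l by (metis imageI single_in_free_module)
  then have "gs ! 0 \<in> syz_piece fs (int (as ! 0 - d))"
    using gs_graded[of 0] ne len_gs a0 fs_facts(1)
    by (simp add: syz_piece_def graded_piece_shift)
  moreover have "gs ! 0 \<notin> ideal_times irrelevant_ideal (syz fs)"
  proof
    assume "gs ! 0 \<in> ideal_times irrelevant_ideal (syz fs)"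
    then have "lin gs (single 0 1) \<in> ideal_times irrelevant_ideal (lin gs ` free_module (length gs))"
      unfolding l len_gs gs_image .
    moreover have "0 < length gs" using ne len_gs by simp
    ultimately have "lookup (single (0::nat) (1 :: ('n, 'k) mpol)) 0 \<in> irrelevant_ideal"
      by (intro minimal_gens_ideal_times[OF gs_min] single_in_free_module)
    then show False by (simp add: irrelevant_ideal_def)
  qed
  ultimately show ?thesis using indeg_eq[OF ne] by (simp add: initial_syzygy_def)
qed

text \<open>In each degree dim I is the dimension of the syzygies minus that of R\<nu>. Here \<nu>
  has degree a1 - d, so the summand with shift a1 cancels, and up to the unknown shift s the Hilbert
  function of I is fixed, whatever \<nu> and I are.\<close>

lemma bourbaki_multiplicity:
  assumes w: "CARD('n) = w + 3" and as: "as = [a1, a, a]" and bs: "bs = [a + 1]"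
    and \<nu>: "initial_syzygy fs \<nu>" and I: "bourbaki_ideal fs \<nu> I"
  shows "multiplicity_quot I = 1"
proof -
  obtain \<psi> s where \<psi>: "homogeneous_ideal I" "height I = 2" "linear_on (syz fs) \<psi>" "\<psi> ` syz fs = ideal_module I"
    "{a \<in> syz fs. \<psi> a = 0} = pmod.span {\<nu>}" "\<And>t. \<psi> ` syz_piece fs t \<subseteq> graded_piece [0] (t + s)"
    using I by (auto simp: bourbaki_ideal_def)
  have iI: "is_ideal I" using \<psi>(1) by (auto simp: homogeneous_ideal_def is_ideal_ideal_gen)
  let ?z = "replicate 3 0 :: nat list"
  have ne: "0 < length as" by (simp add: as)
  have a1: "d \<le> a1" using gen_degree_gt[OF ne] by (simp add: as)
  let ?e = "a1 - d"
  have ind: "indeg_syz fs = ?e" using indeg_eq[OF ne] by (simp add: as)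
  have sp: "syz_piece fs t = syz fs \<inter> graded_piece ?z t" for t by (simp add: syz_piece_def fs_facts(1))
  have \<nu>g: "\<nu> \<in> graded_piece ?z (int ?e)" using \<nu> ind by (simp add: initial_syzygy_def sp)
  have \<nu>0: "\<nu> \<noteq> 0"
    using \<nu> pmod.span_zero by (auto simp: initial_syzygy_def ideal_times_def)
  let ?N = "mon_count (w + 3)"
  have dimI: "pvec.dim (forms u \<inter> I) + ?N (u - s + int d - int (a + 1)) = 2 * ?N (u - s + int d - int a)" for u
  proof -
    define t where "t = u - s"
    have "\<psi> ` (syz fs \<inter> graded_piece ?z t) = \<psi> ` syz fs \<inter> graded_piece [0] (t + s)"
      using \<psi>(6) by (intro graded_image[OF graded_submodule_syz \<psi>(3)]) (simp add: sp)
    then have im: "\<psi> ` syz_piece fs t = ideal_module I \<inter> graded_piece [0] u" using \<psi>(4) by (simp add: sp t_def)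
    have sub: "pmod.subspace (syz fs)" using graded_submodule_syz by (simp add: graded_submodule_def)
    have "fvec.dim (syz_piece fs t) = fvec.dim (\<psi> ` syz_piece fs t) + fvec.dim {x \<in> syz_piece fs t. \<psi> x = 0}"
    proof (rule rank_nullity[OF fvec_vector_space fvec_vector_space, of _ "term_vec ` shift_terms ?z t"])
      show "fvec.subspace (syz_piece fs t)"
        unfolding sp by (intro fvec.subspace_inter subspace_pmod[OF sub] subspace_graded_piece)
      show "syz_piece fs t \<subseteq> fvec.span (term_vec ` shift_terms ?z t)"
        unfolding sp graded_piece_eq_span[symmetric] by blast
    qed (use \<psi>(3) in \<open>auto simp: sp intro: linear_on_add linear_on_fscale\<close>)
    then have r1: "fvec.dim (syz_piece fs t) = pvec.dim (forms u \<inter> I) + fvec.dim {x \<in> syz_piece fs t. \<psi> x = 0}"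
      unfolding im dim_ideal_module[OF iI] .
    let ?G = "graded_piece [?e] t :: (nat \<Rightarrow>\<^sub>0 ('n, 'k) mpol) set"
    have \<nu>l: "[\<nu>] ! i \<in> graded_piece ?z (int ([?e] ! i))" if "i < length [\<nu>]" for i using that \<nu>g by simp
    have "lin [\<nu>] ` ?G = lin [\<nu>] ` free_module (length [?e]) \<inter> graded_piece ?z t"
      using lin_graded_piece[where gs = "[\<nu>]" and c = ?z and as = "[?e]", OF \<nu>l]
      by (intro graded_image_free linear_on_lin) auto
    also have "lin [\<nu>] ` free_module (length [?e]) = {x \<in> syz fs. \<psi> x = 0}"
      using span_eq_lin_image[of "[\<nu>]"] \<psi>(5) by simp
    finally have k: "lin [\<nu>] ` ?G = {x \<in> syz_piece fs t. \<psi> x = 0}" by (auto simp: sp)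
    have k0: "{x \<in> ?G. lin [\<nu>] x = 0} = {0}"
    proof -
      have "v = 0" if v: "v \<in> ?G" "lin [\<nu>] v = 0" for v
      proof (rule poly_mapping_eqI)
        fix i
        have "lookup v 0 = 0" using v(2) \<nu>0 by (simp add: lin_def pscale_mpol_eq_0_iff)
        then show "lookup v i = lookup 0 i"
          using v(1) by (cases i) (auto simp: graded_piece_def free_module_iff)
      qed
      then show ?thesis by auto
    qed
    have "fvec.dim ?G = fvec.dim {x \<in> syz_piece fs t. \<psi> x = 0}"
      using rank_nullity_graded[OF linear_on_lin[of UNIV "[\<nu>]"] subset_UNIV subspace_graded_piece order_refl, of "[?e]" t]
      by (simp only: k k0 fvec_dim_0)
    then have "fvec.dim {x \<in> syz_piece fs t. \<psi> x = 0} = ?N (t - int ?e)" by (simp add: dim_graded_piece nmon_eq w)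
    moreover have e: "t - int ?e = t + int d - int a1" using a1 by simp
    ultimately have r2: "fvec.dim {x \<in> syz_piece fs t. \<psi> x = 0} = ?N (t + int d - int a1)" by (simp only:)
    have "fvec.dim (syz_piece fs t) + ?N (t + int d - int (a + 1)) =
        ?N (t + int d - int a1) + (?N (t + int d - int a) + ?N (t + int d - int a))"
      using dim_syz_piece[of t] by (simp add: as bs nmon_eq w)
    then show ?thesis using r1 r2 unfolding t_def[symmetric] by linarith
  qed
  \<comment> \<open>The degree in which the two remaining generators of the syzygies land in I; the
    alternating sum for R/I is then that of 0, \<sigma>, \<sigma> and \<sigma> + 1.\<close>
  define \<sigma> where "\<sigma> = s - int d + int a"
  let ?L = "[(1, 0), (- 2, \<sigma>), (1, \<sigma> + 1)] :: (int \<times> int) list"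
  have HF: "int (hilbert_function I t) = (\<Sum>(c, s)\<leftarrow>?L. c * int (?N (int t - s)))" for t
  proof -
    have "pvec.dim (forms (int t) \<inter> I) \<le> card ((\<lambda>m. single m (1::'k)) ` (monomials (int t) :: ('n \<Rightarrow>\<^sub>0 nat) set))"
      by (rule pvec.dim_le_card) (auto simp: forms_eq_span)
    then have "pvec.dim (forms (int t) \<inter> I) \<le> ?N (int t)" by (simp add: card_single_image nmon_eq w)
    moreover have "pvec.dim (forms (int t) :: ('n, 'k) mpol set) = ?N (int t)" by (simp add: dim_forms nmon_eq w)
    moreover have "int t - s + int d - int (a + 1) = int t - (\<sigma> + 1)" "int t - s + int d - int a = int t - \<sigma>"
      by (simp_all add: \<sigma>_def)
    moreover have "(\<Sum>(c, s)\<leftarrow>?L. c * int (?N (int t - s))) = int (?N (int t)) - 2 * int (?N (int t - \<sigma>)) + int (?N (int t - (\<sigma> + 1)))"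
      by simp
    ultimately show ?thesis using dimI[of "int t"] unfolding hilbert_function_def by presburger
  qed
  obtain C where C: "\<And>t. hilbert_function I t \<le> C * (t + 1) ^ w" using hilbert_function_growth[OF w \<psi>(1,2)] by blast
  note m = hilbert_function_moments[where ?t0.0 = 0 and I = I and L = ?L and w = w, OF HF C]
  \<comment> \<open>The vanishing first moment -2 \<sigma> + (\<sigma> + 1) fixes the shift; the
    second moment is then -2 + 4 = 2.\<close>
  have "\<sigma> = 1" using m(2) by simp
  then have "2 * multiplicity_quot I = 2" using m(3) by simp
  then show ?thesis by simp
qed

end

section \<open>The Bourbaki ideal\<close>

lemma lookup_const_mult: "lookup (const c * p) m = c * lookup p m"
  for p :: "('n::finite, 'k::field) mpol"
  by (simp add: lookup_pscale flip: pscale_eq_const_mult)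

lemma mdeg_1_eq_single:
  assumes "mdeg m = 1"
  shows "\<exists>x. m = single x 1"
proof -
  have "m \<noteq> 0" using assms by (auto simp: mdeg_def)
  then obtain x where x: "lookup m x \<noteq> 0" by (metis lookup_zero poly_mapping_eqI)
  have e: "m = single x 1 + (m - single x 1)"
    by (rule poly_mapping_eqI) (use x in \<open>auto simp: lookup_add lookup_minus lookup_single when_def\<close>)
  have "mdeg (single x 1) = 1" by (simp add: mdeg_def lookup_single when_def)
  then have "mdeg (m - single x 1) = 0" using assms e mdeg_add by (metis add_left_cancel add.right_neutral)
  then have "m - single x 1 = 0" by (simp add: mdeg_eq_0_iff)
  then have "m = single x 1" using e by (metis add.right_neutral)
  then show ?thesis by blast
qed

lemma linear_form_keys:
  assumes "h \<in> forms 1" "m \<in> keys h"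
  shows "\<exists>x. m = single x 1"
  using assms by (intro mdeg_1_eq_single) (force simp: forms_def)

lemma linear_form_nonzero:
  assumes "h \<in> forms 1" "h \<noteq> 0"
  shows "\<exists>x. lookup h (single x 1) \<noteq> 0"
proof -
  obtain m where "lookup h m \<noteq> 0" using assms(2) by (metis lookup_zero poly_mapping_eqI)
  then show ?thesis using linear_form_keys[OF assms(1), of m] by (auto simp: in_keys_iff)
qed

lemma linear_form_indets:
  assumes "h \<in> forms 1" "\<And>x. x \<in> W \<Longrightarrow> lookup h (single x 1) = 0"
  shows "h \<in> indets (- W)"
  unfolding indets_def
proof (intro CollectI ballI)
  fix m assume m: "m \<in> keys h"
  obtain x where "m = single x 1" using linear_form_keys[OF assms(1) m] by blast
  then show "keys m \<subseteq> - W" using m assms(2)[of x] by (auto simp: in_keys_iff)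
qed

lemma xpow_1_form: "xpow x 1 \<in> forms 1"
proof -
  have "mdeg (single x 1) = 1" by (simp add: mdeg_def lookup_single when_def)
  then show ?thesis by (simp add: forms_def del: One_nat_def)
qed

lemma const_mult_form: "p \<in> forms t \<Longrightarrow> const c * p \<in> forms t" for p :: "('n::finite, 'k::comm_ring_1) mpol"
  using forms_mult[OF const_in_forms, of p t c] by simp

lemma linear_form_prime:
  fixes h :: "('n::finite, 'k::field) mpol"
  assumes "h \<in> forms 1" "h \<noteq> 0"
  shows "prime_elem h"
proof -
  have le: "wdeg mdeg h \<le> 1" using assms by (intro wdeg_leI) (auto simp: forms_def)
  obtain m where "m \<in> keys h" "mdeg m = wdeg mdeg h" using wdeg_attained[OF assms(2), of mdeg] by blast
  then have d: "wdeg mdeg h = 1" using assms(1) by (auto simp: forms_def)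
  have "irreducible h"
    unfolding irreducible_def
  proof (intro conjI allI impI)
    show "h \<noteq> 0" "\<not> h dvd 1" using assms d by (auto simp: mpol_unit_iff)
    fix a b assume ab: "h = a * b"
    then have nz: "a \<noteq> 0" "b \<noteq> 0" using assms by auto
    then have "wdeg mdeg a + wdeg mdeg b = 1" using ab d by (simp add: wdeg_mult)
    then show "a dvd 1 \<or> b dvd 1" using nz by (auto simp: mpol_unit_iff)
  qed
  then show ?thesis by (rule irreducible_imp_prime_elem_mpol)
qed

text \<open>Row reduction of two independent linear forms to the graph form whose primality and
  height are known from \<open>linear_codim_2\<close>.\<close>

lemma linear_forms_ideal:
  fixes h1 h2 :: "('n::finite, 'k::field) mpol"
  assumes h: "h1 \<in> forms 1" "h2 \<in> forms 1"
    and ind: "\<And>\<alpha> \<beta>. const \<alpha> * h1 + const \<beta> * h2 = 0 \<Longrightarrow> \<alpha> = 0 \<and> \<beta> = 0"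
  shows "\<exists>i j c1 c2. i \<noteq> j \<and> c1 \<in> indets (- {i, j}) \<and> c2 \<in> indets (- {i, j}) \<and>
    ideal_gen {h1, h2} = ideal_gen {xpow i 1 - c1, xpow j 1 - c2}"
proof -
  let ?c = "\<lambda>h x. lookup h (single x 1)"
  have "h1 \<noteq> 0" using ind[of 1 0] by auto
  then obtain i where i: "?c h1 i \<noteq> 0" using linear_form_nonzero[OF h(1)] by blast
  \<comment> \<open>Eliminates x_i from h2; independence keeps the result nonzero, so it has a pivot
    x_j with j different from i.\<close>
  define h' where "h' = const (- ?c h2 i) * h1 + const (?c h1 i) * h2"
  have h'f: "h' \<in> forms 1" unfolding h'_def using h by (intro forms_add const_mult_form)
  have h'i: "?c h' i = 0" by (simp add: h'_def lookup_add lookup_const_mult)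
  have "h' \<noteq> 0" using ind[of "- ?c h2 i" "?c h1 i"] i unfolding h'_def by blast
  then obtain j where j: "?c h' j \<noteq> 0" using linear_form_nonzero[OF h'f] by blast
  have ij: "i \<noteq> j" using h'i j by auto
  define l2 where "l2 = const (inverse (?c h' j)) * h'"
  define l1 where "l1 = const (inverse (?c h1 i)) * h1 - const (?c h1 j * inverse (?c h1 i)) * l2"
  define c1 where "c1 = xpow i 1 - l1"
  define c2 where "c2 = xpow j 1 - l2"
  have lf: "l1 \<in> forms 1" "l2 \<in> forms 1"
    unfolding l1_def l2_def using h h'f by (intro forms_diff const_mult_form; simp)+
  have cf: "c1 \<in> forms 1" "c2 \<in> forms 1" unfolding c1_def c2_def using lf by (intro forms_diff xpow_1_form; simp)+
  have l2c: "?c l2 j = 1" "?c l2 i = 0" using j h'i by (simp_all add: l2_def lookup_const_mult)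
  have l1c: "?c l1 i = 1" "?c l1 j = 0" using i l2c by (simp_all add: l1_def lookup_minus lookup_const_mult)
  have sx: "?c (xpow x 1 :: ('n, 'k) mpol) y = (if x = y then 1 else 0)" for x y
  proof -
    have "single x (1::nat) = single y 1 \<longleftrightarrow> x = y"
      by (metis keys_single singleton_inject zero_neq_one)
    then show ?thesis by (simp add: lookup_single when_def)
  qed
  have "?c c1 x = 0" "?c c2 x = 0" if "x \<in> {i, j}" for x
    using that l1c l2c ij by (auto simp: c1_def c2_def lookup_minus sx simp del: One_nat_def)
  then have "c1 \<in> indets (- {i, j})" "c2 \<in> indets (- {i, j})"
    by (blast intro: linear_form_indets[OF cf(1)] linear_form_indets[OF cf(2)])+
  moreover have "ideal_gen {h1, h2} = ideal_gen {l1, l2}"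
  proof
    note H = is_idealD[OF is_ideal_ideal_gen[of "{h1, h2}"]] and L = is_idealD[OF is_ideal_ideal_gen[of "{l1, l2}"]]
    have hm: "h1 \<in> ideal_gen {h1, h2}" "h2 \<in> ideal_gen {h1, h2}" using ideal_gen_superset[of "{h1, h2}"] by auto
    have lm: "l1 \<in> ideal_gen {l1, l2}" "l2 \<in> ideal_gen {l1, l2}" using ideal_gen_superset[of "{l1, l2}"] by auto
    have "l2 \<in> ideal_gen {h1, h2}" unfolding l2_def h'_def by (intro H(2,3) hm)
    moreover have "l1 \<in> ideal_gen {h1, h2}" unfolding l1_def by (intro H(3,6) hm calculation)
    ultimately show "ideal_gen {l1, l2} \<subseteq> ideal_gen {h1, h2}"
      by (intro ideal_gen_minimal is_ideal_ideal_gen) auto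
    have inv: "const c * (const (inverse c) * p) = p" if "c \<noteq> 0" for c and p :: "('n, 'k) mpol"
      using that by (simp add: mult_single flip: mult.assoc)
    have "const (?c h1 i) * (l1 + const (?c h1 j * inverse (?c h1 i)) * l2) = h1"
      unfolding l1_def using inv[OF i] by simp
    moreover have "const (?c h1 i) * (l1 + const (?c h1 j * inverse (?c h1 i)) * l2) \<in> ideal_gen {l1, l2}"
      by (intro L(2,3) lm)
    ultimately have h1L: "h1 \<in> ideal_gen {l1, l2}" by simp
    have "const (?c h' j) * l2 = h'" unfolding l2_def by (rule inv[OF j])
    then have h'L: "h' \<in> ideal_gen {l1, l2}" using L(3)[OF lm(2), of "const (?c h' j)"] by simp
    have "const (?c h1 i) * h2 = h' - const (- ?c h2 i) * h1" by (simp add: h'_def)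
    then have "const (?c h1 i) * h2 \<in> ideal_gen {l1, l2}" using L(6)[OF h'L L(3)[OF h1L, of "const (- ?c h2 i)"]] by simp
    then have "const (inverse (?c h1 i)) * (const (?c h1 i) * h2) \<in> ideal_gen {l1, l2}" by (rule L(3))
    then have "h2 \<in> ideal_gen {l1, l2}"
      unfolding mult.assoc[symmetric] const_mult_inverse[OF i] by simp
    then show "ideal_gen {h1, h2} \<subseteq> ideal_gen {l1, l2}"
      using h1L by (intro ideal_gen_minimal is_ideal_ideal_gen) auto
  qed
  moreover have "l1 = xpow i 1 - c1" "l2 = xpow j 1 - c2" by (simp_all add: c1_def c2_def)
  ultimately show ?thesis using ij by (intro exI[of _ i] exI[of _ j] exI[of _ c1] exI[of _ c2]) simp
qed

text \<open>Let (h 0, h 1, h 2) be the only relation among the generators; h 1 and h 2 are linear. A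
  syzygy with coordinates v goes to the minor v 1 h 2 - v 2 h 1, which vanishes on the relation and
  on the first generator. Its image is (h 1, h 2), and coprimality of h 1 and h 2 makes the kernel
  no larger than the multiples of the first generator.\<close>

lemma bourbaki_ideal_exists:
  fixes fs :: "('n::finite, 'k::field) mpol list"
  assumes aci: "equigenerated_strict_aci_ht2 d fs" and res: "syz_resolution fs d gs as ks bs"
    and as: "as = [a1, a, a]" and bs: "bs = [a + 1]"
  shows "\<exists>I. bourbaki_ideal fs (gs ! 0) I"
proof -
  note R = res_facts[OF aci res]
  have lg: "length gs = 3" and lk: "length ks = 1" using R(1,6) by (auto simp: as bs)
  have la: "length as = 3" and lb: "length bs = 1" by (simp_all add: as bs)
  define k where "k = ks ! 0"
  define h where "h i = lookup k i" for i
  have ks: "ks = [k]" using lk by (auto simp: k_def length_Suc_conv)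
  have kF: "k \<in> free_module 3" "lin gs k = 0" using ks_kernel[OF aci res, of 0] by (simp_all add: k_def as bs numeral_3_eq_3)
  have lin3: "lin gs v = pscale (lookup v 0) (gs ! 0) + (pscale (lookup v 1) (gs ! 1)
      + pscale (lookup v 2) (gs ! 2))" for v
  proof -
    have "{..<3} = {0, 1, 2 :: nat}" by auto
    then show ?thesis unfolding lin_def lg by simp
  qed
  have hf: "h 1 \<in> forms 1" "h 2 \<in> forms 1"
    using ks_entry(1)[OF aci res, of 0 1] ks_entry(1)[OF aci res, of 0 2] by (simp_all add: h_def k_def as bs)
  have k_nz: "k \<noteq> 0"
  proof
    assume "k = 0"
    then have "lin ks (single 0 1) = 0" using ks by (simp add: lin_def)
    then have "single (0::nat) (1 :: ('n, 'k) mpol) = 0" using R(11)[of "single 0 1"] lb by (simp del: single_one)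
    then show False by (simp del: single_one)
  qed
  have ker: "\<exists>r. v = pscale r k" if "v \<in> free_module 3" "lin gs v = 0" for v
  proof -
    have "v \<in> lin ks ` free_module (length bs)" unfolding R(10) using that la by simp
    then show ?thesis using ks by (auto simp: lin_def)
  qed
  have s: "single i (1 :: ('n, 'k) mpol) \<in> free_module (length as)" if "i < 3" for i
    using that la by (intro single_in_free_module) simp
  have lgs: "lin gs (single i 1) = gs ! i" if "i < 3" for i using lin_single[of i gs] that lg by simp
  have rel: "pscale (h 0) (gs ! 0) + (pscale (h 1) (gs ! 1) + pscale (h 2) (gs ! 2)) = 0"
    using kF(2) by (simp add: lin3 h_def)
  \<comment> \<open>If h 1 and h 2 were proportional over k, the relation would involve only the
    first generator and one scalar combination of the other two. Such a pair is independent by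
    minimality.\<close>
  have no_rel: "p = 0 \<and> q = 0"
    if pq: "pscale p (gs ! 0) + pscale q (pscale (const \<gamma>) (gs ! 1) + pscale (const \<delta>) (gs ! 2)) = 0"
      and gd: "\<gamma> = 1 \<or> \<delta> = 1" for p q \<gamma> \<delta>
  proof (rule gens_independent[OF aci res])
    let ?e = "\<lambda>i. single i 1 :: nat \<Rightarrow>\<^sub>0 ('n, 'k) mpol"
    let ?w = "pscale (const \<gamma>) (?e 1) + pscale (const \<delta>) (?e 2)"
    show "?e 0 \<in> free_module (length as)" by (rule s) simp
    have "?e 1 \<in> free_module (length as)" "?e 2 \<in> free_module (length as)" by (rule s; simp)+
    then show "?w \<in> free_module (length as)" by (intro free_module_closed)
    show "pscale p (lin gs (?e 0)) + pscale q (lin gs ?w) = 0"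
      unfolding lin_add lin_scale using pq lgs[of 0] lgs[of 1] lgs[of 2] by (simp del: single_one)
    fix \<alpha> \<beta> assume *: "\<And>i. lookup (pscale (const \<alpha>) (?e 0) + pscale (const \<beta>) ?w) i \<in> irrelevant_ideal"
    have "\<alpha> = 0" using *[of 0] by (simp add: lookup_add lookup_pscale lookup_single)
    moreover have "\<beta> * \<gamma> = 0" "\<beta> * \<delta> = 0"
      using *[of 1] *[of 2] by (simp_all add: lookup_add lookup_pscale lookup_single mult_single del: single_one)
    ultimately show "\<alpha> = 0 \<and> \<beta> = 0" using gd by auto
  qed
  have k0: False if "h 0 = 0" "h 1 = 0" "h 2 = 0"
  proof -
    have "lookup k i = 0" for i
    proof (cases "i < 3")
      case True
      then have "i = 0 \<or> i = 1 \<or> i = 2" by linarith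
      then show ?thesis using that by (auto simp: h_def)
    qed (use kF in \<open>auto simp: free_module_iff\<close>)
    then show False using k_nz by (auto intro: poly_mapping_eqI)
  qed
  have ind: "\<alpha> = 0 \<and> \<beta> = 0" if e: "const \<alpha> * h 1 + const \<beta> * h 2 = 0" for \<alpha> \<beta>
  proof (rule ccontr)
    assume neg: "\<not> ?thesis"
    have solve: "x = const (- v / u) * y" if "const u * x + const v * y = 0" "u \<noteq> 0" for u v and x y :: "('n, 'k) mpol"
    proof -
      have "const u * x = - (const v * y)" using that(1) by (simp add: eq_neg_iff_add_eq_0)
      then have "const (inverse u) * (const u * x) = const (inverse u) * (- (const v * y))" by (simp only:)
      then have "x = const (inverse u) * (- (const v * y))"
        unfolding mult.assoc[symmetric] const_mult_inverse[OF that(2)] by simp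
      also have "\<dots> = const (- v / u) * y"
      proof -
        have "(const (- v / u) :: ('n, 'k) mpol) = - (const (inverse u) * const v)"
          by (simp add: mult_single divide_inverse mult.commute flip: single_uminus)
        then show ?thesis by (simp only: mult_minus_left mult_minus_right mult.assoc)
      qed
      finally show ?thesis .
    qed
    show False
    proof (cases "\<beta> = 0")
      case False
      have h2: "h 2 = const (- \<alpha> / \<beta>) * h 1" using e False by (intro solve) (simp_all add: add.commute)
      have "pscale (h 0) (gs ! 0) + pscale (h 1) (pscale (const 1) (gs ! 1) + pscale (const (- \<alpha> / \<beta>)) (gs ! 2)) = 0"
        using rel unfolding h2 by (simp add: pmod.scale_right_distrib mult.commute)
      then have "h 0 = 0 \<and> h 1 = 0" by (rule no_rel) simp
      then show False using k0 h2 by simp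
    next
      case True
      then have "\<alpha> \<noteq> 0" using neg by simp
      then have h1: "h 1 = const (- \<beta> / \<alpha>) * h 2" using e by (intro solve)
      have "pscale (h 0) (gs ! 0) + pscale (h 2) (pscale (const (- \<beta> / \<alpha>)) (gs ! 1) + pscale (const 1) (gs ! 2)) = 0"
        using rel unfolding h1 by (simp add: pmod.scale_right_distrib mult.commute)
      then have "h 0 = 0 \<and> h 2 = 0" by (rule no_rel) simp
      then show False using k0 h1 by simp
    qed
  qed
  let ?I = "ideal_gen {h 1, h 2}"
  note II = is_idealD[OF is_ideal_ideal_gen[of "{h 1, h 2}"]]
  have hI: "h 1 \<in> ?I" "h 2 \<in> ?I" using ideal_gen_superset[of "{h 1, h 2}"] by auto
  obtain i j c1 c2 where c: "i \<noteq> j" "c1 \<in> indets (- {i, j})" "c2 \<in> indets (- {i, j})"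
    "?I = ideal_gen {xpow i 1 - c1, xpow j 1 - c2}"
    using linear_forms_ideal[OF hf ind] by blast
  have PI: "prime_ideal ?I" "prime_height ?I = 2" unfolding c(4) by (rule linear_codim_2[OF c(1,2,3)])+
  have hom: "homogeneous_ideal ?I" unfolding homogeneous_ideal_def using hf by (intro exI[of _ "{h 1, h 2}"]) auto
  \<comment> \<open>The 2 by 2 minor of v and the relation in coordinates 1 and 2; these have the
    same degree, so the minor is homogeneous for homogeneous v.\<close>
  define \<delta> where "\<delta> v = lookup v 1 * h 2 - lookup v 2 * h 1"
    for v :: "nat \<Rightarrow>\<^sub>0 ('n, 'k) mpol"
  have d_add: "\<delta> (v + w) = \<delta> v + \<delta> w" for v w by (simp add: \<delta>_def lookup_add algebra_simps)
  have d_diff: "\<delta> (v - w) = \<delta> v - \<delta> w" for v w by (simp add: \<delta>_def lookup_minus algebra_simps)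
  have d_scale: "\<delta> (pscale c v) = c * \<delta> v" for c v by (simp add: \<delta>_def lookup_pscale algebra_simps)
  have d_k: "\<delta> k = 0" by (simp add: \<delta>_def h_def mult.commute)
  \<comment> \<open>The choice of a representation of x is immaterial: two representations differ by
    a multiple of k, on which \<delta> vanishes.\<close>
  define \<psi> where "\<psi> x = single (0::nat) (\<delta> (SOME v. v \<in> free_module 3 \<and> lin gs v = x))" for x
  have \<psi>: "\<psi> (lin gs v) = single 0 (\<delta> v)" if v: "v \<in> free_module 3" for v
  proof -
    let ?v = "SOME u. u \<in> free_module 3 \<and> lin gs u = lin gs v"
    have *: "?v \<in> free_module 3 \<and> lin gs ?v = lin gs v" by (rule someI[of _ v]) (simp add: v)
    then have "v - ?v \<in> free_module 3" "lin gs (v - ?v) = 0" using v by (simp_all add: free_module_closed lin_diff)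
    then obtain r where "v - ?v = pscale r k" using ker by blast
    then have "\<delta> v - \<delta> ?v = 0" using d_diff[of v ?v] d_scale[of r k] d_k by simp
    then show ?thesis by (simp add: \<psi>_def)
  qed
  have syz: "syz fs = lin gs ` free_module 3" using R(4) la by simp
  have lin: "linear_on (syz fs) \<psi>"
    unfolding linear_on_def
  proof (intro conjI ballI allI)
    fix x assume "x \<in> syz fs"
    then obtain v where v: "v \<in> free_module 3" "x = lin gs v" by (auto simp: syz)
    show "\<psi> (pscale c x) = pscale c (\<psi> x)" for c
      using \<psi>[OF v(1)] \<psi>[OF free_module_closed(3)[OF v(1)], of c] by (simp add: v(2) lin_scale d_scale pscale_single)
    fix y assume "y \<in> syz fs"
    then obtain w where w: "w \<in> free_module 3" "y = lin gs w" by (auto simp: syz)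
    show "\<psi> (x + y) = \<psi> x + \<psi> y"
      using \<psi>[OF v(1)] \<psi>[OF w(1)] \<psi>[OF free_module_closed(2)[OF v(1) w(1)]] by (simp add: v(2) w(2) lin_add d_add single_add)
  qed
  have im: "\<psi> ` syz fs = ideal_module ?I"
  proof
    show "\<psi> ` syz fs \<subseteq> ideal_module ?I"
    proof
      fix y assume "y \<in> \<psi> ` syz fs"
      then obtain v where "v \<in> free_module 3" "y = single 0 (\<delta> v)" using \<psi> by (auto simp: syz)
      moreover have "\<delta> v \<in> ?I" unfolding \<delta>_def by (intro II(3,6) hI)
      ultimately show "y \<in> ideal_module ?I" by (simp add: ideal_module_def)
    qed
    have "?I \<subseteq> \<delta> ` free_module 3"
    proof (rule ideal_gen_minimal)
      have "h 1 = \<delta> (single 2 (- 1))" "h 2 = \<delta> (single 1 1)"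
        by (simp_all add: \<delta>_def lookup_single del: single_one)
      then show "{h 1, h 2} \<subseteq> \<delta> ` free_module 3"
        using single_in_free_module[of 2 3 "- 1 :: ('n, 'k) mpol"] single_in_free_module[of 1 3 "1 :: ('n, 'k) mpol"] by auto
      show "is_ideal (\<delta> ` free_module 3)"
      proof (rule is_idealI)
        show "0 \<in> \<delta> ` free_module 3" by (intro rev_image_eqI[of 0]) (auto simp: free_module_closed \<delta>_def)
        show "x + y \<in> \<delta> ` free_module 3" if "x \<in> \<delta> ` free_module 3" "y \<in> \<delta> ` free_module 3" for x y
          using that by (auto simp: free_module_closed simp flip: d_add)
        show "c * x \<in> \<delta> ` free_module 3" if "x \<in> \<delta> ` free_module 3" for c x
          using that by (auto simp: free_module_closed simp flip: d_scale)
      qed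
    qed
    then show "ideal_module ?I \<subseteq> \<psi> ` syz fs"
      unfolding ideal_module_def syz image_image using \<psi> by force
  qed
  have h1_nz: "h 1 \<noteq> 0" using ind[of 1 0] by auto
  \<comment> \<open>By degrees the quotient of two linear forms is a scalar, which their linear
    independence excludes.\<close>
  have h12: "\<not> h 1 dvd h 2"
  proof
    assume "h 1 dvd h 2"
    then obtain r where r: "h 2 = h 1 * r" by (auto simp: dvd_def)
    have h2_nz: "h 2 \<noteq> 0" using ind[of 0 1] by auto
    obtain a' b' where "h 1 \<in> forms (int a')" "r \<in> forms (int b')" "1 = int a' + int b'"
      using forms_factor[of "h 1" r 1] hf(2) h2_nz r by auto
    moreover have "a' = 1"
    proof -
      have "h 1 = icomp (int a') (h 1)" using icomp_forms[OF \<open>h 1 \<in> forms (int a')\<close>, of "int a'"] by simp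
      also have "\<dots> = (h 1 when int a' = 1)" using icomp_forms[OF hf(1)] by simp
      finally show ?thesis using h1_nz by (auto simp: when_def split: if_splits)
    qed
    ultimately have "r \<in> forms 0" by simp
    then obtain \<rho> where "r = const \<rho>" using forms_0_const by blast
    then have "const \<rho> * h 1 + const (- 1) * h 2 = 0" using r by (simp add: single_uminus)
    then show False using ind[of \<rho> "- 1"] by simp
  qed
  have kern: "{x \<in> syz fs. \<psi> x = 0} = pmod.span {gs ! 0}"
  proof
    show "{x \<in> syz fs. \<psi> x = 0} \<subseteq> pmod.span {gs ! 0}"
    proof clarify
      fix x assume "x \<in> syz fs" "\<psi> x = 0"
      then obtain v where v: "v \<in> free_module 3" "x = lin gs v" "\<delta> v = 0" using \<psi> by (auto simp: syz)
      have e: "lookup v 1 * h 2 = lookup v 2 * h 1" using v(3) by (simp add: \<delta>_def)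
      then have "h 1 dvd lookup v 1 * h 2" by simp
      then have "h 1 dvd lookup v 1"
        using linear_form_prime[OF hf(1) h1_nz] h12 by (auto simp: prime_elem_def)
      then obtain r where r: "lookup v 1 = h 1 * r" by (auto simp: dvd_def)
      have "h 1 * (r * h 2) = h 1 * lookup v 2" using e r by (simp add: algebra_simps)
      then have r2: "r * h 2 = lookup v 2" by (rule mpol_mult_cancel) (rule h1_nz)
      have "lin gs (v - pscale r k) = pscale (lookup v 0 - r * h 0) (gs ! 0)"
        unfolding lin3 using r r2 by (simp add: lookup_minus lookup_pscale h_def mult.commute)
      then have "x = pscale (lookup v 0 - r * h 0) (gs ! 0)"
        using v(2) kF(2) by (simp add: lin_diff lin_scale)
      then show "x \<in> pmod.span {gs ! 0}" by (simp add: pmod.span_scale pmod.span_base)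
    qed
    show "pmod.span {gs ! 0} \<subseteq> {x \<in> syz fs. \<psi> x = 0}"
    proof
      fix x assume "x \<in> pmod.span {gs ! 0}"
      then obtain c where "x = pscale c (gs ! 0)" by (auto simp: pmod.span_singleton)
      then have x: "x = lin gs (pscale c (single 0 1))" using lgs[of 0] by (simp add: lin_scale del: single_one)
      have F: "pscale c (single 0 1) \<in> free_module 3" by (intro free_module_closed single_in_free_module) simp
      have "\<delta> (pscale c (single 0 1)) = 0" by (simp add: \<delta>_def lookup_pscale lookup_single del: single_one)
      then show "x \<in> {x \<in> syz fs. \<psi> x = 0}" using x F \<psi>[OF F] by (auto simp: syz)
    qed
  qed
  have gr: "\<psi> ` syz_piece fs t \<subseteq> graded_piece [0] (t + (int d - int a + 1))" for t
  proof
    fix y assume "y \<in> \<psi> ` syz_piece fs t"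
    then obtain v where v: "v \<in> graded_piece as (t + int d)" "y = \<psi> (lin gs v)"
      unfolding syz_piece_eq[OF aci res] by auto
    have vF: "v \<in> free_module 3" using v(1) graded_piece_subset la by fastforce
    have vi: "lookup v i \<in> forms (t + int d - int (as ! i))" if "i < 3" for i
      using v(1) that la by (simp add: graded_piece_def)
    have "lookup v 1 \<in> forms (t + int d - int a)" "lookup v 2 \<in> forms (t + int d - int a)"
      using vi[of 1] vi[of 2] by (simp_all add: as)
    then have "\<delta> v \<in> forms (t + int d - int a + 1)" unfolding \<delta>_def using hf by (intro forms_diff forms_mult)
    then show "y \<in> graded_piece [0] (t + (int d - int a + 1))"
      unfolding v(2) \<psi>[OF vF] by (simp add: graded_piece_def algebra_simps)
  qed
  have "bourbaki_ideal fs (gs ! 0) ?I"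
    unfolding bourbaki_ideal_def
    using hom PI height_prime[OF PI(1)] unmixed_prime[OF PI(1)] lin im kern gr by auto
  then show ?thesis by blast
qed

lemma bourbaki_degree_eq_1:
  fixes fs :: "('n::finite, 'k::field) mpol list"
  assumes w: "CARD('n) = w + 3" and aci: "equigenerated_strict_aci_ht2 d fs" and res: "syz_resolution fs d gs as ks bs"
    and as: "as = [a1, a, a]" and bs: "bs = [a + 1]"
  shows "bourbaki_degree fs = 1"
  unfolding bourbaki_degree_def
proof (rule the_equality)
  obtain I where I: "bourbaki_ideal fs (gs ! 0) I" using bourbaki_ideal_exists[OF aci res as bs] by blast
  have "initial_syzygy fs (gs ! 0)" by (rule g0_initial[OF aci res]) (simp add: as)
  then show "\<exists>\<nu> I. initial_syzygy fs \<nu> \<and> bourbaki_ideal fs \<nu> I \<and> 1 = multiplicity_quot I"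
    using I bourbaki_multiplicity[OF aci res w as bs] by metis
  show "b = 1" if "\<exists>\<nu> I. initial_syzygy fs \<nu> \<and> bourbaki_ideal fs \<nu> I \<and> b = multiplicity_quot I" for b
    using that bourbaki_multiplicity[OF aci res w as bs] by blast
qed

theorem theorem3p10:
  fixes fs :: "('n::finite, 'k::{alg_closed_field, field_char_0}) mpol list"
    and J :: "('n, 'k) mpol set"
    and d :: nat
  assumes n: "CARD('n) \<ge> 3"
    and aci: "equigenerated_strict_aci_ht2 d fs"
    and J: "J = ideal_gen (set fs)"
    and hd: "projective_dimension (ideal_module J) = 2"
  shows "(multiplicity_quot J = (of_nat d)^2 - of_nat d \<longleftrightarrow>
            has_minimal_graded_free_resolution J [[d, d, d], [d + 1, 2 * d, 2 * d], [2 * d + 1]] \<or>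
            (d = 3 \<and> has_minimal_graded_free_resolution J [[3, 3, 3], [5, 5, 5], [6]])) \<and>
         (multiplicity_quot J = (of_nat d)^2 - of_nat d \<or>
            has_minimal_graded_free_resolution J [[d, d, d], [d + 1, 2 * d, 2 * d], [2 * d + 1]] \<or>
            (d = 3 \<and> has_minimal_graded_free_resolution J [[3, 3, 3], [5, 5, 5], [6]])
          \<longrightarrow> bourbaki_degree fs = 1)"
proof -
  define w where "w = CARD('n) - 3"
  have w: "CARD('n) = w + 3" using n by (simp add: w_def)
  have fs: "set fs \<subseteq> forms (int d)" "d \<ge> 2" "height J = 2"
    using aci J by (auto simp: equigenerated_strict_aci_ht2_def)
  have hJ: "homogeneous_ideal J" unfolding J homogeneous_ideal_def using fs(1) by blast
  obtain gs as ks bs where res: "syz_resolution fs d gs as ks bs"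
    using syz_resolution_exists[OF fs(1)] hd J by blast
  note R = res_facts[OF aci res]
  define \<phi> where "\<phi> = (\<lambda>i::nat. if i = 0 then lin (map (single 0) fs) else if i = 1 then lin gs else lin ks)"
  have mres: "minimal_graded_free_resolution [[d, d, d], as, bs] \<phi> J"
    unfolding J \<phi>_def by (rule minimal_resolution[OF aci res])
  have shape: "as = [d + 1, 2 * d, 2 * d] \<and> bs = [2 * d + 1] \<or> d = 3 \<and> as = [5, 5, 5] \<and> bs = [6]"
    if m: "multiplicity_quot J = (of_nat d)^2 - of_nat d"
  proof (rule shift_numerics[OF fs(2) R(2) _ R(8)])
    note M = resolution_moments[OF w hJ fs(3) mres]
    show "length as = length bs + 2" using M(1) by simp
    show "(\<Sum>s\<leftarrow>as. int s) = 3 * int d + (\<Sum>s\<leftarrow>bs. int s)" using M(2) by simp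
    have "(of_int (2 * (int d)\<^sup>2 - 2 * int d) :: rat) =
        of_int ((\<Sum>s\<leftarrow>as. (int s)\<^sup>2) - (\<Sum>s\<leftarrow>[d, d, d]. (int s)\<^sup>2) - (\<Sum>s\<leftarrow>bs. (int s)\<^sup>2))"
      using M(3) m by simp
    then have "2 * (int d)\<^sup>2 - 2 * int d = (\<Sum>s\<leftarrow>as. (int s)\<^sup>2) - (\<Sum>s\<leftarrow>[d, d, d]. (int s)\<^sup>2) - (\<Sum>s\<leftarrow>bs. (int s)\<^sup>2)"
      by (simp only: of_int_eq_iff)
    then show "(\<Sum>s\<leftarrow>as. (int s)\<^sup>2) = 5 * (int d)\<^sup>2 - 2 * int d + (\<Sum>s\<leftarrow>bs. (int s)\<^sup>2)" by simp
    show "d + 1 \<le> as ! 0" using gen_degree_gt[OF aci res positive_length(1)[OF aci res]] .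
    show "as ! 1 \<le> 2 * d" by (rule second_generator(2)[OF aci res])
    show "as ! (j + 2) < bs ! j" if "j < length bs" for j using shift_inequality[OF aci res that] by simp
  qed
  \<comment> \<open>Any resolution with these shifts determines the multiplicity by its second
    moment: (d + 1)^2 + 2 (2 d)^2 - 3 d^2 - (2 d + 1)^2 = 2 (d^2 - d), and 75 - 27 - 36 = 12 for d =
    3.\<close>
  have b: "multiplicity_quot J = (of_nat d)^2 - of_nat d"
    if "has_minimal_graded_free_resolution J [[d, d, d], [d + 1, 2 * d, 2 * d], [2 * d + 1]] \<or>
      d = 3 \<and> has_minimal_graded_free_resolution J [[3, 3, 3], [5, 5, 5], [6]]"
    using that
  proof
    assume "has_minimal_graded_free_resolution J [[d, d, d], [d + 1, 2 * d, 2 * d], [2 * d + 1]]"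
    then obtain \<phi>' where "minimal_graded_free_resolution [[d, d, d], [d + 1, 2 * d, 2 * d], [2 * d + 1]] \<phi>' J"
      unfolding has_minimal_graded_free_resolution_def by blast
    from resolution_moments(3)[OF w hJ fs(3) this] show ?thesis
      by (simp add: power2_eq_square algebra_simps)
  next
    assume *: "d = 3 \<and> has_minimal_graded_free_resolution J [[3, 3, 3], [5, 5, 5], [6]]"
    then obtain \<phi>' where "minimal_graded_free_resolution [[3, 3, 3], [5, 5, 5], [6]] \<phi>' J"
      unfolding has_minimal_graded_free_resolution_def by blast
    from resolution_moments(3)[OF w hJ fs(3) this] show ?thesis
      using * by (simp add: power2_eq_square)
  qed
  have a: "has_minimal_graded_free_resolution J [[d, d, d], [d + 1, 2 * d, 2 * d], [2 * d + 1]] \<or>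
      d = 3 \<and> has_minimal_graded_free_resolution J [[3, 3, 3], [5, 5, 5], [6]]"
    if "multiplicity_quot J = (of_nat d)^2 - of_nat d"
    using shape[OF that] mres unfolding has_minimal_graded_free_resolution_def by auto
  have "bourbaki_degree fs = 1" if "multiplicity_quot J = (of_nat d)^2 - of_nat d"
    using shape[OF that]
  proof
    assume *: "as = [d + 1, 2 * d, 2 * d] \<and> bs = [2 * d + 1]"
    show ?thesis by (rule bourbaki_degree_eq_1[OF w aci res]) (use * in auto)
  next
    assume *: "d = 3 \<and> as = [5, 5, 5] \<and> bs = [6]"
    show ?thesis by (rule bourbaki_degree_eq_1[OF w aci res, of 5 5]) (use * in auto)
  qed
  then show ?thesis using a b by blast
qed

end
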